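(* Let $\mathrm{M}$ be a loopless matroid on a finite set $E$. Let $\mathscr{C}=\mathscr{C}(\mathrm{M})$ be the set of all nonempty proper flats of $\mathrm{M}$, and let $\underline{\mathscr{C}}=\underline{\mathscr{C}}(\mathrm{M})$ be the set of all proper flats of $\mathrm{M}$ with rank at least two. (1) If $E$ is nonempty, we have a decomposition of $\underline{\mathrm{H}}_{\underline{\alpha}}(\mathrm{M})$-modules $$\underline{\mathrm{CH}}(\mathrm{M})=\underline{\mathrm{H}}_{\underline{\alpha}}(\mathrm{M})\oplus\bigoplus_{F\in\underline{\mathscr{C}}}\underline{\psi}^F_\mathrm{M}\big(\underline{\mathrm{CH}}(\mathrm{M}_F)\otimes\underline{\mathrm{J}}_{\underline{\alpha}}(\mathrm{M}^F)\big),$$ and all pairs of distinct summands are orthogonal for the Poincaré pairing of $\underline{\mathrm{CH}}(\mathrm{M})$. (2) We have a decomposition of $\mathrm{H}_\alpha(\mathrm{M})$-modules $$\mathrm{CH}(\mathrm{M})=\mathrm{H}_\alpha(\mathrm{M})\oplus\bigoplus_{F\in\mathscr{C}}\psi^F_\mathrm{M}\big(\underline{\mathrm{CH}}(\mathrm{M}_F)\otimes\mathrm{J}_\alpha(\mathrm{M}^F)\big),$$ and all pairs of distinct summands are orthogonal for the Poincaré pairing of $\mathrm{CH}(\mathrm{M})$.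
   Context: Matroids. A matroid $\mathrm{M}$ on a finite set $E$ is a nonempty collection of subsets of $E$, called flats, such that (1) the intersection of any two flats is a flat; (2) for any flat $F$, any element of $E\setminus F$ is contained in exactly one flat that is minimal among the flats strictly containing $F$. It is loopless if $\varnothing$ is a flat. A flat is proper if it is not $E$. Every maximal flag (chain) of proper flats has the same cardinality $d$, the rank of $\mathrm{M}$. For a flat $F$, the localization $\mathrm{M}^F$ is the loopless matroid on $F$ whose flats are the flats of $\mathrm{M}$ contained in $F$ (its rank is the rank $\mathrm{rk}_\mathrm{M}(F)$ of $F$); the contraction $\mathrm{M}_F$ is the loopless matroid on $E\setminus F$ whose flats are the sets $G\setminus F$ for flats $G\supseteq F$ of $\mathrm{M}$ (its rank is $d-\mathrm{rk}_\mathrm{M}(F)$). Chow ring. $\underline{\mathrm{CH}}(\mathrm{M})$ is the quotient of $\mathbb{Q}[x_F\mid F\text{ a nonempty proper flat}]$ by the linear forms $\sum_{i_1\in F}x_F-\sum_{i_2\in F}x_F$ (distinct $i_1,i_2\in E$) and the monomials $x_{F_1}x_{F_2}$ ($F_1,F_2$ incomparable nonempty proper flats). When $E$ is nonempty, the degree map $\underline{\deg}_\mathrm{M}:\underline{\mathrm{CH}}^{d-1}(\mathrm{M})\to\mathbb{Q}$ is the well-defined linear isomorphism with $\prod_{F\in\mathscr{F}}x_F\mapsto1$ for every complete flag $\mathscr{F}$ of nonempty proper flats; the Poincaré pairing is $(\eta_1,\eta_2)\mapsto\underline{\deg}_\mathrm{M}(\eta_1\eta_2)$ on $\underline{\mathrm{CH}}^k(\mathrm{M})\times\underline{\mathrm{CH}}^{d-k-1}(\mathrm{M})$.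 Augmented Chow ring. $\mathrm{CH}(\mathrm{M})$ is the quotient of $\mathbb{Q}[y_i\mid i\in E]\otimes\mathbb{Q}[x_F\mid F\text{ a proper flat}]$ by the linear forms $y_i-\sum_{i\notin F}x_F$ ($i\in E$), the monomials $x_{F_1}x_{F_2}$ ($F_1,F_2$ incomparable proper flats) and the monomials $y_ix_F$ ($i\in E$, $F$ a proper flat not containing $i$). The degree map $\deg_\mathrm{M}:\mathrm{CH}^d(\mathrm{M})\to\mathbb{Q}$ is the well-defined linear isomorphism with $\prod_{F\in\mathscr{F}}x_F\mapsto1$ for every complete flag $\mathscr{F}$ of proper flats; the Poincaré pairing is $(\eta_1,\eta_2)\mapsto\deg_\mathrm{M}(\eta_1\eta_2)$ on $\mathrm{CH}^k(\mathrm{M})\times\mathrm{CH}^{d-k}(\mathrm{M})$. All variables have degree 1. Orthogonality of graded subspaces means that the pairing vanishes on their elements of complementary degrees. Alpha classes. For $E$ nonempty, $\underline{\alpha}_\mathrm{M}=\sum_{i\in G}x_G\in\underline{\mathrm{CH}}^1(\mathrm{M})$, the sum over nonempty proper flats $G$ containing a given $i\in E$ (independent of $i$); $\alpha_\mathrm{M}=\sum_Gx_G\in\mathrm{CH}^1(\mathrm{M})$, the sum over all proper flats $G$. $\underline{\mathrm{H}}_{\underline{\alpha}}(\mathrm{M})\subseteq\underline{\mathrm{CH}}(\mathrm{M})$ is the subalgebra generated by $\underline{\alpha}_\mathrm{M}$, and $\mathrm{H}_\alpha(\mathrm{M})\subseteq\mathrm{CH}(\mathrm{M})$ is the subalgebra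 generated by $\alpha_\mathrm{M}$. For $\mathrm{M}$ of rank $d$, graded subspaces are defined by $\underline{\mathrm{J}}^k_{\underline{\alpha}}(\mathrm{M})=\underline{\mathrm{H}}^k_{\underline{\alpha}}(\mathrm{M})$ if $k\ne d-1$ and $0$ if $k=d-1$; $\mathrm{J}^k_\alpha(\mathrm{M})=\mathrm{H}^k_\alpha(\mathrm{M})$ if $k\neq d$ and $0$ if $k=d$ (for $\mathrm{M}^F$, replace $d$ by $\mathrm{rk}_\mathrm{M}(F)$). Pushforwards. For a nonempty proper flat $F$, $\underline{\psi}^F_\mathrm{M}:\underline{\mathrm{CH}}(\mathrm{M}_F)\otimes\underline{\mathrm{CH}}(\mathrm{M}^F)\to\underline{\mathrm{CH}}(\mathrm{M})$ is the well-defined linear map $\prod_{F'}x_{F'\setminus F}\otimes\prod_{F''}x_{F''}\mapsto x_F\prod_{F'}x_{F'}\prod_{F''}x_{F''}$, where $F'$ runs over any finite collection of proper flats strictly containing $F$ and $F''$ over any finite collection of nonempty proper flats strictly contained in $F$. For a proper flat $F$, $\psi^F_\mathrm{M}:\underline{\mathrm{CH}}(\mathrm{M}_F)\otimes\mathrm{CH}(\mathrm{M}^F)\to\mathrm{CH}(\mathrm{M})$ is the well-defined linear map given by the same formula, where now $F''$ runs over any finite collection of proper flats (possibly empty) strictly contained in $F$. The summands in the claim are the images of the indicated subspaces. *)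

theory Defs
  imports
    "HOL-Algebra.Module"
    "HOL-Algebra.Subrings"
    "HOL-Algebra.QuotRing"
    "HOL-Library.Poly_Mapping"
    "HOL-Library.Multiset"
    "HOL-Library.FuncSet"
    "HOL.Hull"
    "HOL.Zorn"
begin

hide_const (open) Multiset.mult

section \<open>Matroids given by their flats\<close>

record 'a matroid =
  ground :: "'a set"
  flats :: "'a set set"

definition covering_flat :: "'a matroid \<Rightarrow> 'a set \<Rightarrow> 'a set \<Rightarrow> bool" where
  "covering_flat M F G \<longleftrightarrow> G \<in> flats M \<and> F \<subset> G \<and> \<not> (\<exists>G'\<in>flats M. F \<subset> G' \<and> G' \<subset> G)"

definition is_matroid :: "'a matroid \<Rightarrow> bool" where
  "is_matroid M \<longleftrightarrow>
     finite (ground M) \<and> flats M \<subseteq> Pow (ground M) \<and> flats M \<noteq> {} \<and>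
     (\<forall>F\<in>flats M. \<forall>G\<in>flats M. F \<inter> G \<in> flats M) \<and>
     (\<forall>F\<in>flats M. \<forall>i\<in>ground M - F. \<exists>!G. covering_flat M F G \<and> i \<in> G)"

definition loopless :: "'a matroid \<Rightarrow> bool" where
  "loopless M \<longleftrightarrow> {} \<in> flats M"

definition proper_flats :: "'a matroid \<Rightarrow> 'a set set" where
  "proper_flats M = flats M - {ground M}"

definition nonempty_proper_flats :: "'a matroid \<Rightarrow> 'a set set" where
  "nonempty_proper_flats M = proper_flats M - {{}}"

text \<open>The common cardinality of all maximal flags of proper flats.\<close>

definition matroid_rank :: "'a matroid \<Rightarrow> nat" where
  "matroid_rank M = (THE d. \<forall>C. subset.maxchain (proper_flats M) C \<longrightarrow> card C = d)"

definition localization :: "'a matroid \<Rightarrow> 'a set \<Rightarrow> 'a matroid" where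
  "localization M F = \<lparr>ground = F, flats = {G \<in> flats M. G \<subseteq> F}\<rparr>"

definition contraction :: "'a matroid \<Rightarrow> 'a set \<Rightarrow> 'a matroid" where
  "contraction M F = \<lparr>ground = ground M - F, flats = {G - F | G. G \<in> flats M \<and> F \<subseteq> G}\<rparr>"

definition flat_rank :: "'a matroid \<Rightarrow> 'a set \<Rightarrow> nat" where
  "flat_rank M F = matroid_rank (localization M F)"


section \<open>Linear algebra over the rationals\<close>

text \<open>Vector spaces and algebras over the rational numbers are \<^term>\<open>QQ\<close>-modules and
  \<^term>\<open>QQ\<close>-algebras in the sense of \<^theory>\<open>HOL-Algebra.Module\<close>;
  \<^term>\<open>QQ\<close> serves both as the ground ring and as a one-dimensional space.\<close>

definition QQ :: "(rat, rat) module" where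
  "QQ = \<lparr>carrier = UNIV, mult = (*), one = 1, zero = 0, add = (+), smult = (*)\<rparr>"

definition linear_maps :: "(rat, 'b) module \<Rightarrow> (rat, 'c) module \<Rightarrow> ('b \<Rightarrow> 'c) set" where
  "linear_maps A B = {f \<in> hom (add_monoid A) (add_monoid B).
     \<forall>c. \<forall>a\<in>carrier A. f (c \<odot>\<^bsub>A\<^esub> a) = c \<odot>\<^bsub>B\<^esub> f a}"

definition lin_span :: "(rat, 'b) module \<Rightarrow> 'b set \<Rightarrow> 'b set" where
  "lin_span A X = (\<lambda>S. submodule S QQ A) hull X"

definition generated_subalgebra :: "(rat, 'b) module \<Rightarrow> 'b set \<Rightarrow> 'b set" where
  "generated_subalgebra A X = (\<lambda>S. subring S A \<and> submodule S QQ A) hull X"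

text \<open>Quotient by a subspace, or by an ideal if \<open>A\<close> is an algebra. If \<open>A\<close> is only
  a vector space (so that its fields \<^const>\<open>mult\<close> and \<^const>\<open>one\<close> are meaningless),
  the same fields of the quotient are meaningless too.\<close>

definition quot_module :: "(rat, 'b) module \<Rightarrow> 'b set \<Rightarrow> (rat, 'b set) module" where
  "quot_module A I =
     \<lparr>carrier = carrier (A Quot I), mult = mult (A Quot I), one = one (A Quot I),
      zero = zero (A Quot I), add = add (A Quot I),
      smult = (\<lambda>c X. \<Union>a\<in>X. I +>\<^bsub>A\<^esub> (c \<odot>\<^bsub>A\<^esub> a))\<rparr>"

text \<open>The vector space with basis \<open>S\<close>.\<close>

definition free_module :: "'s set \<Rightarrow> (rat, 's \<Rightarrow>\<^sub>0 rat) module" where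
  "free_module S =
     \<lparr>carrier = {z. Poly_Mapping.keys z \<subseteq> S}, mult = undefined, one = undefined,
      zero = 0, add = (+), smult = (\<lambda>c. Poly_Mapping.map ((*) c))\<rparr>"

definition bilinear_relations ::
  "(rat, 'b) module \<Rightarrow> (rat, 'c) module \<Rightarrow> ('b \<times> 'c \<Rightarrow>\<^sub>0 rat) set" where
  "bilinear_relations A B =
     {Poly_Mapping.single (a \<oplus>\<^bsub>A\<^esub> a', b) 1 - Poly_Mapping.single (a, b) 1 - Poly_Mapping.single (a', b) 1
        | a a' b. a \<in> carrier A \<and> a' \<in> carrier A \<and> b \<in> carrier B} \<union>
     {Poly_Mapping.single (a, b \<oplus>\<^bsub>B\<^esub> b') 1 - Poly_Mapping.single (a, b) 1 - Poly_Mapping.single (a, b') 1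
        | a b b'. a \<in> carrier A \<and> b \<in> carrier B \<and> b' \<in> carrier B} \<union>
     {Poly_Mapping.single (c \<odot>\<^bsub>A\<^esub> a, b) 1 - Poly_Mapping.single (a, b) c
        | c a b. a \<in> carrier A \<and> b \<in> carrier B} \<union>
     {Poly_Mapping.single (a, c \<odot>\<^bsub>B\<^esub> b) 1 - Poly_Mapping.single (a, b) c
        | c a b. a \<in> carrier A \<and> b \<in> carrier B}"

definition tensor_relations ::
  "(rat, 'b) module \<Rightarrow> (rat, 'c) module \<Rightarrow> ('b \<times> 'c \<Rightarrow>\<^sub>0 rat) set" where
  "tensor_relations A B = lin_span (free_module (carrier A \<times> carrier B)) (bilinear_relations A B)"

definition tensor_product ::
  "(rat, 'b) module \<Rightarrow> (rat, 'c) module \<Rightarrow> (rat, ('b \<times> 'c \<Rightarrow>\<^sub>0 rat) set) module" where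
  "tensor_product A B = quot_module (free_module (carrier A \<times> carrier B)) (tensor_relations A B)"

definition pure_tensor ::
  "(rat, 'b) module \<Rightarrow> (rat, 'c) module \<Rightarrow> 'b \<Rightarrow> 'c \<Rightarrow> ('b \<times> 'c \<Rightarrow>\<^sub>0 rat) set" where
  "pure_tensor A B a b =
     tensor_relations A B +>\<^bsub>free_module (carrier A \<times> carrier B)\<^esub> Poly_Mapping.single (a, b) 1"

text \<open>For subspaces \<open>S\<close> of \<open>A\<close> and \<open>T\<close> of \<open>B\<close>, their tensor product regarded as a
  subspace of the tensor product of \<open>A\<close> and \<open>B\<close>.\<close>

definition tensor_subspace ::
  "(rat, 'b) module \<Rightarrow> (rat, 'c) module \<Rightarrow> 'b set \<Rightarrow> 'c set \<Rightarrow> ('b \<times> 'c \<Rightarrow>\<^sub>0 rat) set set" where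
  "tensor_subspace A B S T =
     lin_span (tensor_product A B) {pure_tensor A B a b | a b. a \<in> S \<and> b \<in> T}"

definition regular_module :: "(rat, 'b) module \<Rightarrow> ('b, 'b) module" where
  "regular_module A =
     \<lparr>carrier = carrier A, mult = mult A, one = one A, zero = zero A, add = add A, smult = mult A\<rparr>"

text \<open>For a subalgebra \<open>H\<close> of \<open>A\<close> and a finite index set \<open>I\<close>: as an \<open>H\<close>-module,
  \<open>A\<close> is the internal direct sum of the \<open>H\<close>-submodules \<open>S i\<close>.\<close>

definition module_decomposition ::
  "'b set \<Rightarrow> (rat, 'b) module \<Rightarrow> 'i set \<Rightarrow> ('i \<Rightarrow> 'b set) \<Rightarrow> bool" where
  "module_decomposition H A I S \<longleftrightarrow>
     (\<forall>i\<in>I. submodule (S i) (A\<lparr>carrier := H\<rparr>) (regular_module A)) \<and>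
     (\<forall>a\<in>carrier A. \<exists>!f. f \<in> Pi\<^sub>E I S \<and> finsum A f I = a)"


section \<open>Polynomial algebras\<close>

type_synonym 'v mpoly = "('v \<Rightarrow>\<^sub>0 nat) \<Rightarrow>\<^sub>0 rat"

definition poly_algebra :: "'v set \<Rightarrow> (rat, 'v mpoly) module" where
  "poly_algebra V =
     \<lparr>carrier = {p. \<forall>m\<in>Poly_Mapping.keys p. Poly_Mapping.keys m \<subseteq> V},
      mult = (*), one = 1, zero = 0, add = (+), smult = (\<lambda>c. Poly_Mapping.map ((*) c))\<rparr>"

definition var :: "'v \<Rightarrow> 'v mpoly" where
  "var v = Poly_Mapping.single (Poly_Mapping.single v 1) 1"

definition homogeneous :: "nat \<Rightarrow> 'v mpoly \<Rightarrow> bool" where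
  "homogeneous k p \<longleftrightarrow>
     (\<forall>m\<in>Poly_Mapping.keys p. (\<Sum>v\<in>Poly_Mapping.keys m. Poly_Mapping.lookup m v) = k)"


section \<open>The Chow ring\<close>

definition chow_poly :: "'a matroid \<Rightarrow> (rat, 'a set mpoly) module" where
  "chow_poly M = poly_algebra (nonempty_proper_flats M)"

definition chow_ideal :: "'a matroid \<Rightarrow> 'a set mpoly set" where
  "chow_ideal M = Idl\<^bsub>chow_poly M\<^esub>
     ({(\<Sum>F\<in>{F \<in> nonempty_proper_flats M. i \<in> F}. var F) -
       (\<Sum>F\<in>{F \<in> nonempty_proper_flats M. j \<in> F}. var F)
         | i j. i \<in> ground M \<and> j \<in> ground M \<and> i \<noteq> j} \<union>
      {var F * var G
         | F G. F \<in> nonempty_proper_flats M \<and> G \<in> nonempty_proper_flats M \<and>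
                \<not> F \<subseteq> G \<and> \<not> G \<subseteq> F})"

definition chow :: "'a matroid \<Rightarrow> (rat, 'a set mpoly set) module" where
  "chow M = quot_module (chow_poly M) (chow_ideal M)"

definition chow_class :: "'a matroid \<Rightarrow> 'a set mpoly \<Rightarrow> 'a set mpoly set" where
  "chow_class M p = chow_ideal M +>\<^bsub>chow_poly M\<^esub> p"

definition chow_degree_part :: "'a matroid \<Rightarrow> nat \<Rightarrow> 'a set mpoly set set" where
  "chow_degree_part M k = chow_class M ` {p \<in> carrier (chow_poly M). homogeneous k p}"

text \<open>Only for matroids on a nonempty ground set, so that \<^term>\<open>matroid_rank M - 1\<close> is
  an honest difference. The condition \<^const>\<open>extensional\<close> fixes the values outside the domain.\<close>

definition chow_deg :: "'a matroid \<Rightarrow> 'a set mpoly set \<Rightarrow> rat" where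
  "chow_deg M = (THE f.
     f \<in> extensional (chow_degree_part M (matroid_rank M - 1)) \<and>
     f \<in> linear_maps (chow M\<lparr>carrier := chow_degree_part M (matroid_rank M - 1)\<rparr>) QQ \<and>
     bij_betw f (chow_degree_part M (matroid_rank M - 1)) UNIV \<and>
     (\<forall>C. subset.maxchain (nonempty_proper_flats M) C \<longrightarrow>
        f (chow_class M (\<Prod>F\<in>C. var F)) = 1))"

definition chow_orthogonal ::
  "'a matroid \<Rightarrow> 'a set mpoly set set \<Rightarrow> 'a set mpoly set set \<Rightarrow> bool" where
  "chow_orthogonal M S T \<longleftrightarrow>
     (\<forall>k\<le>matroid_rank M - 1.
        \<forall>\<eta>\<in>S \<inter> chow_degree_part M k. \<forall>\<xi>\<in>T \<inter> chow_degree_part M (matroid_rank M - 1 - k).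
          chow_deg M (\<eta> \<otimes>\<^bsub>chow M\<^esub> \<xi>) = 0)"

text \<open>The class does not depend on the chosen element of the nonempty ground set.\<close>

definition chow_alpha :: "'a matroid \<Rightarrow> 'a set mpoly set" where
  "chow_alpha M = chow_class M
     (\<Sum>G\<in>{G \<in> nonempty_proper_flats M. (SOME i. i \<in> ground M) \<in> G}. var G)"

definition chow_H :: "'a matroid \<Rightarrow> 'a set mpoly set set" where
  "chow_H M = generated_subalgebra (chow M) {chow_alpha M}"

definition chow_J_part :: "'a matroid \<Rightarrow> nat \<Rightarrow> 'a set mpoly set set" where
  "chow_J_part M k =
     (if k + 1 = matroid_rank M then {\<zero>\<^bsub>chow M\<^esub>} else chow_H M \<inter> chow_degree_part M k)"

definition chow_J :: "'a matroid \<Rightarrow> 'a set mpoly set set" where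
  "chow_J M = lin_span (chow M) (\<Union>k. chow_J_part M k)"


section \<open>The augmented Chow ring\<close>

text \<open>The tensor product of the polynomial rings in the \<open>y\<close> and the \<open>x\<close> variables is the
  polynomial ring in both kinds of variables.\<close>

datatype 'a aug_var = YVar 'a | XVar "'a set"

definition aug_chow_poly :: "'a matroid \<Rightarrow> (rat, 'a aug_var mpoly) module" where
  "aug_chow_poly M = poly_algebra (YVar ` ground M \<union> XVar ` proper_flats M)"

definition aug_chow_ideal :: "'a matroid \<Rightarrow> 'a aug_var mpoly set" where
  "aug_chow_ideal M = Idl\<^bsub>aug_chow_poly M\<^esub>
     ({var (YVar i) - (\<Sum>F\<in>{F \<in> proper_flats M. i \<notin> F}. var (XVar F)) | i. i \<in> ground M} \<union>
      {var (XVar F) * var (XVar G)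
         | F G. F \<in> proper_flats M \<and> G \<in> proper_flats M \<and> \<not> F \<subseteq> G \<and> \<not> G \<subseteq> F} \<union>
      {var (YVar i) * var (XVar F) | i F. i \<in> ground M \<and> F \<in> proper_flats M \<and> i \<notin> F})"

definition aug_chow :: "'a matroid \<Rightarrow> (rat, 'a aug_var mpoly set) module" where
  "aug_chow M = quot_module (aug_chow_poly M) (aug_chow_ideal M)"

definition aug_chow_class :: "'a matroid \<Rightarrow> 'a aug_var mpoly \<Rightarrow> 'a aug_var mpoly set" where
  "aug_chow_class M p = aug_chow_ideal M +>\<^bsub>aug_chow_poly M\<^esub> p"

definition aug_chow_degree_part :: "'a matroid \<Rightarrow> nat \<Rightarrow> 'a aug_var mpoly set set" where
  "aug_chow_degree_part M k = aug_chow_class M ` {p \<in> carrier (aug_chow_poly M). homogeneous k p}"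

definition aug_chow_deg :: "'a matroid \<Rightarrow> 'a aug_var mpoly set \<Rightarrow> rat" where
  "aug_chow_deg M = (THE f.
     f \<in> extensional (aug_chow_degree_part M (matroid_rank M)) \<and>
     f \<in> linear_maps (aug_chow M\<lparr>carrier := aug_chow_degree_part M (matroid_rank M)\<rparr>) QQ \<and>
     bij_betw f (aug_chow_degree_part M (matroid_rank M)) UNIV \<and>
     (\<forall>C. subset.maxchain (proper_flats M) C \<longrightarrow>
        f (aug_chow_class M (\<Prod>F\<in>C. var (XVar F))) = 1))"

definition aug_chow_orthogonal ::
  "'a matroid \<Rightarrow> 'a aug_var mpoly set set \<Rightarrow> 'a aug_var mpoly set set \<Rightarrow> bool" where
  "aug_chow_orthogonal M S T \<longleftrightarrow>
     (\<forall>k\<le>matroid_rank M.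
        \<forall>\<eta>\<in>S \<inter> aug_chow_degree_part M k. \<forall>\<xi>\<in>T \<inter> aug_chow_degree_part M (matroid_rank M - k).
          aug_chow_deg M (\<eta> \<otimes>\<^bsub>aug_chow M\<^esub> \<xi>) = 0)"

definition aug_chow_alpha :: "'a matroid \<Rightarrow> 'a aug_var mpoly set" where
  "aug_chow_alpha M = aug_chow_class M (\<Sum>G\<in>proper_flats M. var (XVar G))"

definition aug_chow_H :: "'a matroid \<Rightarrow> 'a aug_var mpoly set set" where
  "aug_chow_H M = generated_subalgebra (aug_chow M) {aug_chow_alpha M}"

definition aug_chow_J_part :: "'a matroid \<Rightarrow> nat \<Rightarrow> 'a aug_var mpoly set set" where
  "aug_chow_J_part M k =
     (if k = matroid_rank M then {\<zero>\<^bsub>aug_chow M\<^esub>} else aug_chow_H M \<inter> aug_chow_degree_part M k)"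

definition aug_chow_J :: "'a matroid \<Rightarrow> 'a aug_var mpoly set set" where
  "aug_chow_J M = lin_span (aug_chow M) (\<Union>k. aug_chow_J_part M k)"


section \<open>Pushforwards\<close>

text \<open>Collections of flats are multisets, so that the formulas describe the images of
  all monomials in the variables indexed by flats; these span the source.\<close>

definition chow_psi ::
  "'a matroid \<Rightarrow> 'a set \<Rightarrow> ('a set mpoly set \<times> 'a set mpoly set \<Rightarrow>\<^sub>0 rat) set \<Rightarrow> 'a set mpoly set" where
  "chow_psi M F =
     (let A = chow (contraction M F); B = chow (localization M F); T = tensor_product A B in
      THE f. f \<in> extensional (carrier T) \<and> f \<in> linear_maps T (chow M) \<and>
        (\<forall>\<F>' \<F>''.
           set_mset \<F>' \<subseteq> {G \<in> proper_flats M. F \<subset> G} \<and>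
           set_mset \<F>'' \<subseteq> {G \<in> nonempty_proper_flats M. G \<subset> F} \<longrightarrow>
           f (pure_tensor A B
               (chow_class (contraction M F) (\<Prod>G\<in>#\<F>'. var (G - F)))
               (chow_class (localization M F) (\<Prod>G\<in>#\<F>''. var G)))
           = chow_class M (var F * (\<Prod>G\<in>#\<F>'. var G) * (\<Prod>G\<in>#\<F>''. var G))))"

definition aug_chow_psi ::
  "'a matroid \<Rightarrow> 'a set \<Rightarrow> ('a set mpoly set \<times> 'a aug_var mpoly set \<Rightarrow>\<^sub>0 rat) set
     \<Rightarrow> 'a aug_var mpoly set" where
  "aug_chow_psi M F =
     (let A = chow (contraction M F); B = aug_chow (localization M F); T = tensor_product A B in
      THE f. f \<in> extensional (carrier T) \<and> f \<in> linear_maps T (aug_chow M) \<and>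
        (\<forall>\<F>' \<F>''.
           set_mset \<F>' \<subseteq> {G \<in> proper_flats M. F \<subset> G} \<and>
           set_mset \<F>'' \<subseteq> {G \<in> proper_flats M. G \<subset> F} \<longrightarrow>
           f (pure_tensor A B
               (chow_class (contraction M F) (\<Prod>G\<in>#\<F>'. var (G - F)))
               (aug_chow_class (localization M F) (\<Prod>G\<in>#\<F>''. var (XVar G))))
           = aug_chow_class M
               (var (XVar F) * (\<Prod>G\<in>#\<F>'. var (XVar G)) * (\<Prod>G\<in>#\<F>''. var (XVar G)))))"


section \<open>The summands\<close>

definition flats_C :: "'a matroid \<Rightarrow> 'a set set" where
  "flats_C M = nonempty_proper_flats M"

definition flats_uC :: "'a matroid \<Rightarrow> 'a set set" where
  "flats_uC M = {F \<in> proper_flats M. 2 \<le> flat_rank M F}"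

text \<open>The index \<^const>\<open>None\<close> stands for the subalgebra generated by the alpha class.\<close>

fun chow_summand :: "'a matroid \<Rightarrow> 'a set option \<Rightarrow> 'a set mpoly set set" where
  "chow_summand M None = chow_H M"
| "chow_summand M (Some F) = chow_psi M F `
     tensor_subspace (chow (contraction M F)) (chow (localization M F))
       (carrier (chow (contraction M F))) (chow_J (localization M F))"

fun aug_chow_summand :: "'a matroid \<Rightarrow> 'a set option \<Rightarrow> 'a aug_var mpoly set set" where
  "aug_chow_summand M None = aug_chow_H M"
| "aug_chow_summand M (Some F) = aug_chow_psi M F `
     tensor_subspace (chow (contraction M F)) (aug_chow (localization M F))
       (carrier (chow (contraction M F))) (aug_chow_J (localization M F))"

end

theory Submission
  imports Defs
begin

text \<open>Use one variable \<open>x\<^sub>G\<close> for every flat \<open>G\<close>, with \<open>x\<^sub>E\<close> standing for minus the alpha class, and put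
  \<open>h\<^sub>F\<close> for minus the sum of the \<open>x\<^sub>G\<close> with \<open>F \<subseteq> G\<close>. For a flat \<open>B\<close> and \<open>\<delta> \<in> {0, 1}\<close>, the flats \<open>G \<supseteq> B\<close> of
  rank at least \<open>rk B + \<delta>\<close> carry a ring which is the augmented Chow ring for \<open>B = \<emptyset>, \<delta> = 0\<close>, the Chow
  ring for \<open>B = \<emptyset>, \<delta> = 1\<close>, and the Chow ring of the contraction by \<open>F\<close> for \<open>B = F, \<delta> = 1\<close>. Let \<open>r\<close>
  and \<open>d\<close> be the ranks of \<open>F\<close> and \<open>E\<close> over \<open>B\<close>.

  Multiplied by \<open>x\<^sub>F\<close>, the alpha class of the localization at \<open>F\<close> becomes \<open>h\<^sub>F\<close>. So the summand of \<open>F\<close> is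
  spanned by the \<open>x\<^sub>F h\<^sub>F\<^sup>k p\<close> with \<open>k < r - \<delta>\<close> and \<open>p\<close> a polynomial in the variables of the flats strictly
  above \<open>F\<close>, and \<open>h\<^sub>F\<close> to the power \<open>r - \<delta> + 1\<close> vanishes, which rewrites all monomials into the sum of
  the summands.

  In terms of the \<open>h\<^sub>F\<close>, the quadratic relations become \<open>(h\<^sub>F - h\<^sub>H) (h\<^sub>G - h\<^sub>H) = 0\<close> for the join \<open>H\<close> of \<open>F\<close>
  and \<open>G\<close>. Hence the degree map exists: it sends a monomial of degree \<open>d - \<delta>\<close> in the \<open>h\<^sub>F\<close> to 1 if the join
  of every nonempty subfamily \<open>J\<close> of its factors has rank at least \<open>card J + \<delta>\<close> over \<open>B\<close> (the dragon
  Hall-Rado condition), and to 0 otherwise.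

  A polynomial above \<open>F\<close> whose degree exceeds the top degree of the contraction by \<open>F\<close> is killed by
  \<open>x\<^sub>F\<close>; this gives orthogonality. Moreover \<open>x\<^sub>F h\<^sub>F\<^sup>k p\<close> with \<open>k = r - \<delta>\<close> has the degree of \<open>p\<close> in the
  contraction by \<open>F\<close>, and \<open>x\<^sub>F\<^sup>2 = - x\<^sub>F h\<^sub>F - x\<^sub>F u\<close> with \<open>u\<close> the sum of the variables above \<open>F\<close>, so the pairing on a
  summand is triangular in \<open>k\<close> over the Poincare pairing of the contraction. By induction it is
  nondegenerate on every summand, and therefore the sum is direct.\<close>

section \<open>Polynomials\<close>

text \<open>The degree maps and the pushforwards are definite descriptions, so nothing is known
  about them before existence and uniqueness are proved. The obstacle is that the top degree of the
  quotient might collapse to 0. The \<open>h\<close>-variables remove it: a functional can be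
  written down on monomials by a formula, and its compatibility with the quadratic relations becomes
  an uncrossing argument for the rank function. The general bottom \<open>B\<close> and the number
  \<open>\<delta>\<close> serve the inductions. Multiplying by the variable of \<open>F\<close>
  leads from any of these rings to the contraction by \<open>F\<close>, that is to
  \<open>B = F\<close> and \<open>\<delta> = 1\<close>; contracting further stays in this family and
  lowers the corank. Vanishing above the top degree and Poincare duality are both proved along this
  descent. The additional variable of \<open>E\<close> frees the linear relations from the choice of
  an element: they say that \<open>h\<close> vanishes on the flats of least rank. For
  \<open>B = {}\<close> and \<open>\<delta> = 0\<close> the variable \<open>y_i\<close> is then
  recovered as \<open>hvar M {i}\<close>.\<close>

lemma poly_mapping_add_induct [case_names zero single add]:
  assumes "P 0"
    and "\<And>k c. c \<noteq> 0 \<Longrightarrow> P (Poly_Mapping.single k c)"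
    and "\<And>p q. P p \<Longrightarrow> P q \<Longrightarrow> Poly_Mapping.keys p \<subseteq> Poly_Mapping.keys (p + q) \<Longrightarrow>
        Poly_Mapping.keys q \<subseteq> Poly_Mapping.keys (p + q) \<Longrightarrow> P (p + q)"
  shows "P (p :: 'k \<Rightarrow>\<^sub>0 'c :: comm_monoid_add)"
proof (induction p rule: Poly_Mapping.update_induct)
  case const
  then show ?case using assms(1) .
next
  case (update p k c)
  have eq: "Poly_Mapping.update k c p = p + Poly_Mapping.single k c"
    using update(1)
    by (intro poly_mapping_eqI) (auto simp: lookup_update lookup_add lookup_single in_keys_iff when_def)
  have "Poly_Mapping.lookup p k = 0"
    using update(1) by (simp add: in_keys_iff)
  then show ?case
    unfolding eq using update
    by (intro assms(3) assms(2)) (auto simp: in_keys_iff lookup_add lookup_single when_def)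
qed

text \<open>The coefficient map \<open>c\<close> is \<open>cst\<close> for polynomial values and the identity for rational values.\<close>

definition lin_ext :: "('c \<Rightarrow> 'r) \<Rightarrow> ('k \<Rightarrow> 'r) \<Rightarrow> ('k \<Rightarrow>\<^sub>0 'c::zero) \<Rightarrow> 'r::comm_ring_1" where
  "lin_ext c g z = (\<Sum>k\<in>Poly_Mapping.keys z. c (Poly_Mapping.lookup z k) * g k)"

lemma lin_ext_zero [simp]: "lin_ext c g 0 = 0"
  by (simp add: lin_ext_def)

lemma lin_ext_add:
  fixes z :: "'k \<Rightarrow>\<^sub>0 'c::comm_monoid_add"
  assumes "c 0 = 0" "\<And>x y. c (x + y) = c x + c y"
  shows "lin_ext c g (z + w) = lin_ext c g z + lin_ext c g w"
  unfolding lin_ext_def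
  by (rule setsum_keys_plus_distrib) (auto simp: assms algebra_simps)

lemma lin_ext_single:
  assumes "c 0 = 0"
  shows "lin_ext c g (Poly_Mapping.single k a) = c a * g k"
  using assms by (simp add: lin_ext_def)

definition cst :: "rat \<Rightarrow> 'v mpoly" where
  "cst c = Poly_Mapping.single 0 c"

lemma cst_simps [simp]: "cst 0 = 0" "cst 1 = 1"
  "cst (a + b) = cst a + cst b" "cst (- a) = - cst a" "cst (a - b) = cst a - cst b"
  "cst (a * b) = cst a * cst b"
  by (simp_all add: cst_def single_add single_uminus single_diff mult_single)

lemma smult_conv: "Poly_Mapping.map ((*) c) p = cst c * p"
  by (simp add: cst_def mult_map_scale_conv_mult)

definition mono_eval :: "('v \<Rightarrow> 'r) \<Rightarrow> ('v \<Rightarrow>\<^sub>0 nat) \<Rightarrow> 'r::comm_ring_1" where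
  "mono_eval f m = (\<Prod>v\<in>Poly_Mapping.keys m. f v ^ Poly_Mapping.lookup m v)"

lemma mono_eval_superset:
  assumes "finite S" "Poly_Mapping.keys m \<subseteq> S"
  shows "mono_eval f m = (\<Prod>v\<in>S. f v ^ Poly_Mapping.lookup m v)"
  unfolding mono_eval_def using assms
  by (intro prod.mono_neutral_left) (auto simp: in_keys_iff)

lemma mono_eval_zero [simp]: "mono_eval f 0 = 1"
  by (simp add: mono_eval_def)

lemma mono_eval_single [simp]: "mono_eval f (Poly_Mapping.single v n) = f v ^ n"
  by (simp add: mono_eval_def)

lemma mono_eval_add: "mono_eval f (m + n) = mono_eval f m * mono_eval f n"
proof -
  let ?S = "Poly_Mapping.keys m \<union> Poly_Mapping.keys n"
  have "mono_eval f (m + n) = (\<Prod>v\<in>?S. f v ^ Poly_Mapping.lookup (m + n) v)"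
    by (intro mono_eval_superset) (use Poly_Mapping.keys_add[of m n] in auto)
  also have "\<dots> = (\<Prod>v\<in>?S. f v ^ Poly_Mapping.lookup m v) * (\<Prod>v\<in>?S. f v ^ Poly_Mapping.lookup n v)"
    by (simp add: lookup_add power_add prod.distrib)
  also have "\<dots> = mono_eval f m * mono_eval f n"
    by (subst (1 2) mono_eval_superset[of ?S]) auto
  finally show ?thesis .
qed

definition subst :: "('v \<Rightarrow> 'w mpoly) \<Rightarrow> 'v mpoly \<Rightarrow> 'w mpoly" where
  "subst f = lin_ext cst (mono_eval f)"

lemma subst_zero [simp]: "subst f 0 = 0"
  by (simp add: subst_def)

lemma subst_add: "subst f (p + q) = subst f p + subst f q"
  by (simp add: subst_def lin_ext_add)

lemma subst_single: "subst f (Poly_Mapping.single m c) = cst c * mono_eval f m"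
  by (simp add: subst_def lin_ext_single)

lemma subst_cst [simp]: "subst f (cst c) = cst c"
  by (simp add: cst_def[of c] subst_single)

lemma subst_one [simp]: "subst f 1 = 1"
  using subst_cst[of f 1] by (simp only: cst_simps)

lemma subst_var [simp]: "subst f (var v) = f v"
  by (simp add: var_def subst_single)

lemma subst_mult: "subst f (p * q) = subst f p * subst f q"
proof (induction p rule: poly_mapping_add_induct)
  case (single m c)
  show ?case
  proof (induction q rule: poly_mapping_add_induct)
    case (single m' c')
    show ?case by (simp add: mult_single subst_single mono_eval_add algebra_simps)
  qed (simp_all add: subst_add algebra_simps)
qed (simp_all add: subst_add algebra_simps)

lemma subst_uminus: "subst f (- p) = - subst f p"
  using subst_add[of f p "- p"] by (simp add: eq_neg_iff_add_eq_0 add.commute)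

lemma subst_diff: "subst f (p - q) = subst f p - subst f q"
  using subst_add[of f p "- q"] by (simp add: subst_uminus)

lemma subst_sum: "subst f (sum g S) = (\<Sum>x\<in>S. subst f (g x))"
  by (induction S rule: infinite_finite_induct) (simp_all add: subst_add)

lemma subst_prod: "subst f (prod g S) = (\<Prod>x\<in>S. subst f (g x))"
  by (induction S rule: infinite_finite_induct) (simp_all add: subst_mult)

lemma subst_power: "subst f (p ^ n) = subst f p ^ n"
  by (induction n) (simp_all add: subst_mult)

lemmas subst_simps = subst_add subst_mult subst_uminus subst_diff subst_sum subst_prod subst_power

section \<open>Monomials, homogeneous polynomials and polynomials in a given set of
  variables\<close>

lemma mpoly_var_decomp:
  "Poly_Mapping.single (Poly_Mapping.single v 1 + m) c = var v * Poly_Mapping.single m c"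
  by (simp add: var_def mult_single)

definition mdeg :: "('v \<Rightarrow>\<^sub>0 nat) \<Rightarrow> nat" where
  "mdeg m = (\<Sum>v\<in>Poly_Mapping.keys m. Poly_Mapping.lookup m v)"

lemma mdeg_add: "mdeg (m + n) = mdeg m + mdeg n"
  unfolding mdeg_def by (rule setsum_keys_plus_distrib) auto

lemma mdeg_zero [simp]: "mdeg 0 = 0" and mdeg_single [simp]: "mdeg (Poly_Mapping.single v k) = k"
  by (simp_all add: mdeg_def)

lemma mdeg_eq_0_iff: "mdeg m = 0 \<longleftrightarrow> m = 0"
  unfolding mdeg_def by (auto simp: in_keys_iff intro!: poly_mapping_eqI)

lemma homogeneous_mdeg: "homogeneous n p \<longleftrightarrow> (\<forall>m\<in>Poly_Mapping.keys p. mdeg m = n)"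
  by (simp add: homogeneous_def mdeg_def)

lemma mono_pop:
  fixes m :: "'v \<Rightarrow>\<^sub>0 nat"
  assumes "v \<in> Poly_Mapping.keys m"
  shows "\<exists>m'. m = Poly_Mapping.single v 1 + m' \<and> Poly_Mapping.keys m' \<subseteq> Poly_Mapping.keys m"
proof -
  have "m = Poly_Mapping.single v 1 + (m - Poly_Mapping.single v 1)"
    using assms by (intro poly_mapping_eqI) (auto simp: lookup_add lookup_minus lookup_single when_def in_keys_iff)
  moreover have "Poly_Mapping.keys (m - Poly_Mapping.single v 1) \<subseteq> Poly_Mapping.keys m"
    by (auto simp: in_keys_iff lookup_minus)
  ultimately show ?thesis by blast
qed

text \<open>All polynomials live in one type with all sets as variables; this is the membership test
  for fewer variables. Passing between a matroid, its localizations and its contractions then needs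
  no change of type.\<close>

definition poly_in :: "'v set \<Rightarrow> 'v mpoly set" where
  "poly_in V = carrier (poly_algebra V)"

lemma poly_in_iff: "p \<in> poly_in V \<longleftrightarrow> (\<forall>m\<in>Poly_Mapping.keys p. Poly_Mapping.keys m \<subseteq> V)"
  by (simp add: poly_in_def poly_algebra_def)

lemma poly_in_UNIV [simp]: "p \<in> poly_in UNIV"
  by (simp add: poly_in_iff)

lemma poly_in_zero [simp, intro]: "0 \<in> poly_in V"
  and poly_in_one [simp, intro]: "1 \<in> poly_in V"
  and poly_in_cst [simp, intro]: "cst c \<in> poly_in V"
  by (simp_all add: poly_in_iff cst_def)

lemma poly_in_var [simp, intro]: "v \<in> V \<Longrightarrow> var v \<in> poly_in V"
  by (simp add: poly_in_iff var_def)

lemma poly_in_add [intro]: "p \<in> poly_in V \<Longrightarrow> q \<in> poly_in V \<Longrightarrow> p + q \<in> poly_in V"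
  unfolding poly_in_iff using Poly_Mapping.keys_add[of p q] by blast

lemma poly_in_mult [intro]:
  assumes "p \<in> poly_in V" "q \<in> poly_in V"
  shows "p * q \<in> poly_in V"
  unfolding poly_in_iff
proof
  fix m assume "m \<in> Poly_Mapping.keys (p * q)"
  then obtain a b where "m = a + b" "a \<in> Poly_Mapping.keys p" "b \<in> Poly_Mapping.keys q"
    using Poly_Mapping.keys_mult[of p q] by blast
  then show "Poly_Mapping.keys m \<subseteq> V"
    using assms Poly_Mapping.keys_add[of a b] unfolding poly_in_iff by blast
qed

lemma poly_in_uminus [intro]: "p \<in> poly_in V \<Longrightarrow> - p \<in> poly_in V"
  using poly_in_mult[OF poly_in_cst[of "- 1"], of p V] by simp

lemma poly_in_diff [intro]: "p \<in> poly_in V \<Longrightarrow> q \<in> poly_in V \<Longrightarrow> p - q \<in> poly_in V"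
  using poly_in_add[of p V "- q"] by auto

lemma poly_in_sum [intro]: "(\<And>x. x \<in> S \<Longrightarrow> f x \<in> poly_in V) \<Longrightarrow> sum f S \<in> poly_in V"
  by (induction S rule: infinite_finite_induct) auto

lemma poly_in_prod [intro]: "(\<And>x. x \<in> S \<Longrightarrow> f x \<in> poly_in V) \<Longrightarrow> prod f S \<in> poly_in V"
  by (induction S rule: infinite_finite_induct) auto

lemma poly_in_power [intro]: "p \<in> poly_in V \<Longrightarrow> p ^ n \<in> poly_in V"
  by (induction n) auto

lemma poly_in_mono: "V \<subseteq> W \<Longrightarrow> p \<in> poly_in V \<Longrightarrow> p \<in> poly_in W"
  unfolding poly_in_iff by blast

lemma homogeneous_zero [simp, intro]: "homogeneous n 0"
  by (simp add: homogeneous_def)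

lemma homogeneous_cst [simp, intro]: "homogeneous 0 (cst c)"
  and homogeneous_one [simp, intro]: "homogeneous 0 1"
  by (simp_all add: homogeneous_mdeg cst_def)

lemma homogeneous_var [simp, intro]: "homogeneous 1 (var v)"
  "homogeneous (Suc 0) (var v)"
  by (simp_all add: homogeneous_mdeg var_def)

lemma homogeneous_add [intro]: "homogeneous n p \<Longrightarrow> homogeneous n q \<Longrightarrow> homogeneous n (p + q)"
  unfolding homogeneous_mdeg using Poly_Mapping.keys_add[of p q] by blast

lemma homogeneous_mult:
  assumes "homogeneous n p" "homogeneous k q"
  shows "homogeneous (n + k) (p * q)"
  unfolding homogeneous_mdeg
proof
  fix m assume "m \<in> Poly_Mapping.keys (p * q)"
  then obtain a b where "m = a + b" "a \<in> Poly_Mapping.keys p" "b \<in> Poly_Mapping.keys q"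
    using Poly_Mapping.keys_mult[of p q] by blast
  then show "mdeg m = n + k"
    using assms unfolding homogeneous_mdeg by (simp add: mdeg_add)
qed

lemma homogeneous_mult_eq: "homogeneous n p \<Longrightarrow> homogeneous k q \<Longrightarrow> l = n + k \<Longrightarrow> homogeneous l (p * q)"
  using homogeneous_mult by blast

lemma homogeneous_cst_mult [intro]: "homogeneous n p \<Longrightarrow> homogeneous n (cst c * p)"
  using homogeneous_mult[of 0 "cst c" n p] by simp

lemma homogeneous_uminus [intro]: "homogeneous n p \<Longrightarrow> homogeneous n (- p)"
  using homogeneous_cst_mult[of n p "- 1"] by simp

lemma homogeneous_diff [intro]: "homogeneous n p \<Longrightarrow> homogeneous n q \<Longrightarrow> homogeneous n (p - q)"
  using homogeneous_add[of n p "- q"] by auto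

lemma homogeneous_sum [intro]: "(\<And>x. x \<in> S \<Longrightarrow> homogeneous n (f x)) \<Longrightarrow> homogeneous n (sum f S)"
  by (induction S rule: infinite_finite_induct) auto

lemma homogeneous_power: "homogeneous 1 p \<Longrightarrow> homogeneous n (p ^ n)"
  by (induction n) (auto intro: homogeneous_mult[of 1, simplified])

lemma homogeneous_prod: "(\<And>x. x \<in> S \<Longrightarrow> homogeneous 1 (f x)) \<Longrightarrow> finite S \<Longrightarrow> homogeneous (card S) (prod f S)"
  by (induction S rule: infinite_finite_induct) (auto intro: homogeneous_mult[of 1, simplified])

text \<open>Monomials are built one variable at a time, and the degree is an argument of
  \<open>P\<close> because each variable raises it. Zero is a case of its own, being homogeneous of
  every degree.\<close>

lemma homogeneous_induct [consumes 2, case_names zero cst var add]: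
  assumes "p \<in> poly_in V" "homogeneous n p"
    and "\<And>n. P n 0"
    and "\<And>c. P 0 (cst c)"
    and "\<And>n v p. v \<in> V \<Longrightarrow> p \<in> poly_in V \<Longrightarrow> homogeneous n p \<Longrightarrow> P n p \<Longrightarrow> P (Suc n) (var v * p)"
    and "\<And>n p q. p \<in> poly_in V \<Longrightarrow> homogeneous n p \<Longrightarrow> P n p \<Longrightarrow> q \<in> poly_in V \<Longrightarrow> homogeneous n q \<Longrightarrow> P n q
       \<Longrightarrow> P n (p + q)"
  shows "P n p"
proof -
  have mono: "mdeg m = n \<Longrightarrow> Poly_Mapping.keys m \<subseteq> V \<Longrightarrow> P n (Poly_Mapping.single m c)" for n m c
  proof (induction n arbitrary: m)
    case 0
    then show ?case using assms(4)[of c] by (simp add: mdeg_eq_0_iff cst_def)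
  next
    case (Suc n)
    then have "m \<noteq> 0" by auto
    then obtain v where v: "v \<in> Poly_Mapping.keys m"
      by (metis all_not_in_conv keys_eq_empty)
    obtain m' where m': "m = Poly_Mapping.single v 1 + m'" "Poly_Mapping.keys m' \<subseteq> Poly_Mapping.keys m"
      using mono_pop[OF v] by blast
    have "mdeg m' = n" using Suc.prems(1) by (simp add: m'(1) mdeg_add)
    then have "P (Suc n) (var v * Poly_Mapping.single m' c)"
      using Suc v m'(2) by (intro assms(5) Suc.IH) (auto simp: poly_in_iff homogeneous_mdeg split: if_splits)
    then show ?case unfolding m'(1) mpoly_var_decomp .
  qed
  show ?thesis
    using assms(1,2)
  proof (induction p rule: poly_mapping_add_induct)
    case (add p q)
    then have "p \<in> poly_in V" "q \<in> poly_in V" "homogeneous n p" "homogeneous n q"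
      unfolding poly_in_iff homogeneous_mdeg by blast+
    then show ?case using add assms(6) by blast
  next
    case (single m c)
    then show ?case by (intro mono) (auto simp: poly_in_iff homogeneous_mdeg)
  qed (rule assms(3))
qed

lemma mpoly_hom_induct [consumes 1, case_names hom add]:
  assumes "p \<in> poly_in V"
    and "\<And>n p. p \<in> poly_in V \<Longrightarrow> homogeneous n p \<Longrightarrow> P p"
    and "\<And>p q. p \<in> poly_in V \<Longrightarrow> q \<in> poly_in V \<Longrightarrow> P p \<Longrightarrow> P q \<Longrightarrow> P (p + q)"
  shows "P p"
  using assms(1)
proof (induction p rule: poly_mapping_add_induct)
  case zero
  show ?case by (rule assms(2)[of _ 0]) auto
next
  case (single m c)
  then show ?case by (intro assms(2)[of _ "mdeg m"]) (auto simp: homogeneous_mdeg)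
next
  case (add p q)
  then have "p \<in> poly_in V" "q \<in> poly_in V"
    unfolding poly_in_iff by blast+
  then show ?case using add assms(3) by blast
qed

lemma mpoly_induct [consumes 1, case_names cst var add]:
  assumes "p \<in> poly_in V" "\<And>c. P (cst c)"
    and var: "\<And>v p. v \<in> V \<Longrightarrow> p \<in> poly_in V \<Longrightarrow> P p \<Longrightarrow> P (var v * p)"
    and add: "\<And>p q. p \<in> poly_in V \<Longrightarrow> q \<in> poly_in V \<Longrightarrow> P p \<Longrightarrow> P q \<Longrightarrow> P (p + q)"
  shows "P p"
  using assms(1)
proof (induction p rule: mpoly_hom_induct)
  case (hom n p)
  then show ?case
    by (induction rule: homogeneous_induct) (use assms(2)[of 0] assms(2) var add in auto)
qed (rule add)

lemma subst_cong_on: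
  assumes "p \<in> poly_in V" "\<And>v. v \<in> V \<Longrightarrow> f v = g v"
  shows "subst f p = subst g p"
  using assms(1) by (induction rule: mpoly_induct) (auto simp: subst_simps assms(2))

lemma subst_var_id: "subst var p = p"
  by (induction p rule: mpoly_induct[OF poly_in_UNIV]) (auto simp: subst_simps)

lemma subst_ident:
  assumes "p \<in> poly_in V" "\<And>v. v \<in> V \<Longrightarrow> f v = var v"
  shows "subst f p = p"
  using subst_cong_on[of p V f var] assms by (simp add: subst_var_id)

lemma subst_subst: "subst f (subst g p) = subst (\<lambda>v. subst f (g v)) p"
  by (induction p rule: mpoly_induct[OF poly_in_UNIV]) (auto simp: subst_simps)

lemma subst_poly_in:
  assumes "p \<in> poly_in V" "\<And>v. v \<in> V \<Longrightarrow> f v \<in> poly_in W"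
  shows "subst f p \<in> poly_in W"
  using assms(1) by (induction rule: mpoly_induct) (auto simp: subst_simps assms(2))

lemma subst_homogeneous:
  assumes "homogeneous n p" "p \<in> poly_in V" "\<And>v. v \<in> V \<Longrightarrow> homogeneous 1 (f v)"
  shows "homogeneous n (subst f p)"
  using assms(2,1)
  by (induction rule: homogeneous_induct)
     (auto simp: subst_simps intro!: homogeneous_mult_eq[of 1] assms(3))

section \<open>Ideals of a commutative ring\<close>

text \<open>An ideal in the type class of commutative rings. The rule has the form
  \<open>r * g + p\<close>, so an additive map kills the ideal as soon as it kills every multiple of
  every generator.\<close>

inductive_set gen_ideal :: "'r::comm_ring_1 set \<Rightarrow> 'r set" for S where
  zero [simp, intro]: "0 \<in> gen_ideal S"
| add_gen: "g \<in> S \<Longrightarrow> p \<in> gen_ideal S \<Longrightarrow> r * g + p \<in> gen_ideal S"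

lemma gen_ideal_base: "g \<in> S \<Longrightarrow> g \<in> gen_ideal S"
  using gen_ideal.add_gen[of g S 0 1] by simp

lemma gen_ideal_add [intro]: "p \<in> gen_ideal S \<Longrightarrow> q \<in> gen_ideal S \<Longrightarrow> p + q \<in> gen_ideal S"
  by (induction rule: gen_ideal.induct) (auto simp: add.assoc intro: gen_ideal.add_gen)

lemma gen_ideal_mult_left [intro]: "p \<in> gen_ideal S \<Longrightarrow> r * p \<in> gen_ideal S"
proof (induction rule: gen_ideal.induct)
  case (add_gen g p s)
  then show ?case
    using gen_ideal.add_gen[of g S "r * p" "r * s"] by (simp add: algebra_simps)
qed simp

lemma gen_ideal_mult_right [intro]: "p \<in> gen_ideal S \<Longrightarrow> p * r \<in> gen_ideal S"
  using gen_ideal_mult_left[of p S r] by (simp add: mult.commute)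

lemma gen_ideal_uminus [intro]: "p \<in> gen_ideal S \<Longrightarrow> - p \<in> gen_ideal S"
  using gen_ideal_mult_left[of p S "- 1"] by simp

lemma gen_ideal_diff [intro]: "p \<in> gen_ideal S \<Longrightarrow> q \<in> gen_ideal S \<Longrightarrow> p - q \<in> gen_ideal S"
  using gen_ideal_add[of p S "- q"] by auto

lemma gen_ideal_sum [intro]: "(\<And>x. x \<in> T \<Longrightarrow> f x \<in> gen_ideal S) \<Longrightarrow> sum f T \<in> gen_ideal S"
  by (induction T rule: infinite_finite_induct) auto

section \<open>Rank functions of matroids\<close>

definition flat_closure :: "'a matroid \<Rightarrow> 'a set \<Rightarrow> 'a set" where
  "flat_closure M S = \<Inter>{F \<in> flats M. S \<subseteq> F}"

text \<open>The least size of a set with the same closure, defined for all sets and without flags,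
  so that exchange and submodularity are available. The agreement with flag lengths is
  \<open>matroid_rank_eq\<close>.\<close>

definition rk :: "'a matroid \<Rightarrow> 'a set \<Rightarrow> nat" where
  "rk M S = (LEAST n. \<exists>T. T \<subseteq> ground M \<and> card T = n \<and> flat_closure M T = flat_closure M S)"

locale matroid =
  fixes M :: "'a matroid"
  assumes is_matroid: "is_matroid M"
begin

abbreviation "E \<equiv> ground M"
abbreviation "cl \<equiv> flat_closure M"
abbreviation "rank \<equiv> rk M"

lemma finite_ground: "finite E"
  using is_matroid by (simp add: is_matroid_def)

lemma flat_subset: "F \<in> flats M \<Longrightarrow> F \<subseteq> E"
  using is_matroid by (auto simp: is_matroid_def)

lemma finite_flats: "finite (flats M)"
  by (rule finite_subset[of _ "Pow E"]) (use flat_subset finite_ground in auto)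

lemma flat_Int: "F \<in> flats M \<Longrightarrow> G \<in> flats M \<Longrightarrow> F \<inter> G \<in> flats M"
  using is_matroid by (auto simp: is_matroid_def)

lemma ex1_cover: "F \<in> flats M \<Longrightarrow> i \<in> E - F \<Longrightarrow> \<exists>!G. covering_flat M F G \<and> i \<in> G"
  using is_matroid unfolding is_matroid_def by blast

lemma ex_cover: "F \<in> flats M \<Longrightarrow> i \<in> E - F \<Longrightarrow> \<exists>G. covering_flat M F G \<and> i \<in> G"
  by (rule ex1_implies_ex[OF ex1_cover])

lemma ground_flat: "E \<in> flats M"
proof -
  have "flats M \<noteq> {}" using is_matroid by (simp add: is_matroid_def)
  then obtain F where F: "F \<in> flats M" "\<And>G. G \<in> flats M \<Longrightarrow> F \<subseteq> G \<Longrightarrow> F = G"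
    using finite_has_maximal[OF finite_flats] by blast
  have "F = E"
  proof (rule ccontr)
    assume "F \<noteq> E"
    then obtain i where "i \<in> E - F" using flat_subset F(1) by blast
    then obtain G where "G \<in> flats M" "F \<subset> G"
      using ex_cover F(1) unfolding covering_flat_def by blast
    then show False using F(2) by blast
  qed
  then show ?thesis using F(1) by simp
qed

lemma finite_Inter_flat: "finite C \<Longrightarrow> C \<noteq> {} \<Longrightarrow> C \<subseteq> flats M \<Longrightarrow> \<Inter>C \<in> flats M"
  by (induction C rule: finite_ne_induct) (auto intro: flat_Int)

lemma cl_flat: "S \<subseteq> E \<Longrightarrow> cl S \<in> flats M"
  unfolding flat_closure_def
  by (rule finite_Inter_flat) (use finite_flats ground_flat in auto)

lemma cl_superset: "S \<subseteq> cl S"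
  by (auto simp: flat_closure_def)

lemma cl_minimal: "F \<in> flats M \<Longrightarrow> S \<subseteq> F \<Longrightarrow> cl S \<subseteq> F"
  by (auto simp: flat_closure_def)

lemma cl_ident: "F \<in> flats M \<Longrightarrow> cl F = F"
  using cl_superset cl_minimal by blast

lemma cl_mono: "S \<subseteq> T \<Longrightarrow> cl S \<subseteq> cl T"
  by (auto simp: flat_closure_def)

lemma cl_subset_ground: "S \<subseteq> E \<Longrightarrow> cl S \<subseteq> E"
  using cl_flat flat_subset by blast

lemma cl_idem [simp]: "S \<subseteq> E \<Longrightarrow> cl (cl S) = cl S"
  using cl_flat cl_ident by blast

lemma cl_le: "S \<subseteq> cl T \<Longrightarrow> T \<subseteq> E \<Longrightarrow> cl S \<subseteq> cl T"
  using cl_minimal cl_flat by blast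

lemma cl_Un_cl: "S \<subseteq> E \<Longrightarrow> T \<subseteq> E \<Longrightarrow> cl (cl S \<union> T) = cl (S \<union> T)"
proof
  assume *: "S \<subseteq> E" "T \<subseteq> E"
  have "cl S \<subseteq> cl (S \<union> T)" "T \<subseteq> cl (S \<union> T)"
    using cl_mono[of S "S \<union> T"] cl_superset[of "S \<union> T"] by auto
  then show "cl (cl S \<union> T) \<subseteq> cl (S \<union> T)" using * by (intro cl_le) auto
  show "cl (S \<union> T) \<subseteq> cl (cl S \<union> T)"
    using cl_superset[of S] by (intro cl_mono) auto
qed

lemma cl_insert_cl: "S \<subseteq> E \<Longrightarrow> i \<in> E \<Longrightarrow> cl (insert i (cl S)) = cl (insert i S)"
  using cl_Un_cl[of S "{i}"] by simp

text \<open>A cover of \<open>F\<close> through \<open>i\<close> contains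
  \<open>cl (insert i F)\<close>, so no flat can lie strictly between \<open>F\<close> and this
  closure.\<close>

lemma cl_insert_covers:
  assumes "F \<in> flats M" "i \<in> E - F" "H \<in> flats M" "F \<subset> H" "H \<subseteq> cl (insert i F)"
  shows "H = cl (insert i F)"
proof -
  obtain G where cov: "covering_flat M F G" and "i \<in> G"
    using ex_cover[OF assms(1,2)] by blast
  then have G: "G \<in> flats M" "F \<subset> G" "i \<in> G" "\<And>G'. G' \<in> flats M \<Longrightarrow> F \<subset> G' \<Longrightarrow> \<not> G' \<subset> G"
    unfolding covering_flat_def by auto
  have "cl (insert i F) \<subseteq> G"
    using G by (intro cl_minimal) auto
  then show ?thesis using G(4)[OF assms(3,4)] assms(5) by blast
qed

text \<open>\<open>cl (insert i S)\<close> is a flat strictly above \<open>cl S\<close> and inside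
  the cover generated by \<open>j\<close>; hence it is that cover and contains
  \<open>j\<close>.\<close>

lemma exchange:
  assumes "S \<subseteq> E" "i \<in> E" "j \<in> E" "i \<notin> cl S" "i \<in> cl (insert j S)"
  shows "j \<in> cl (insert i S)"
proof -
  have flat: "cl S \<in> flats M" using assms cl_flat by auto
  have j: "j \<notin> cl S"
  proof
    assume "j \<in> cl S"
    then have "cl (insert j S) \<subseteq> cl S" using assms(1) cl_superset[of S] by (intro cl_le) auto
    then show False using assms by blast
  qed
  have "cl (insert i S) = cl (insert j (cl S))"
  proof (rule cl_insert_covers)
    show "cl S \<subset> cl (insert i S)" 
      using cl_mono[of S "insert i S"] cl_superset[of "insert i S"] assms(4) by blast
    show "cl (insert i S) \<subseteq> cl (insert j (cl S))"
      using assms cl_superset[of "insert j S"] cl_le[of "insert i S" "insert j S"]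
      by (simp add: cl_insert_cl)
  qed (use assms flat j cl_flat in auto)
  then show ?thesis using cl_superset by blast
qed

section \<open>Independent sets and submodularity of the rank\<close>

definition indep :: "'a set \<Rightarrow> bool" where
  "indep I \<longleftrightarrow> I \<subseteq> E \<and> (\<forall>x\<in>I. x \<notin> cl (I - {x}))"

text \<open>Elements of \<open>I\<close> outside \<open>T\<close> are traded one at a time for
  elements of \<open>T\<close>, keeping independence and cardinality; \<open>card (I - T)\<close>
  drops with each trade.\<close>

lemma steinitz:
  assumes "indep I" "T \<subseteq> E" "I \<subseteq> cl T"
  shows "card I \<le> card T"
  using assms
proof (induction "card (I - T)" arbitrary: I rule: less_induct)
  case (less I)
  have fin: "finite I" "finite T"
    using less.prems finite_ground by (auto simp: indep_def intro: finite_subset)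
  show ?case
  proof (cases "I \<subseteq> T")
    case True
    then show ?thesis using fin by (simp add: card_mono)
  next
    case False
    then obtain x where x: "x \<in> I" "x \<notin> T" by blast
    define K where "K = I - {x}"
    have K: "K \<subseteq> E" "x \<notin> K" "I = insert x K" "x \<in> E"
      using less.prems(1) x by (auto simp: K_def indep_def)
    have xK: "x \<notin> cl K"
      using less.prems(1) x by (auto simp: K_def indep_def)
    \<comment> \<open>If all of \<open>T\<close> were in \<open>cl K\<close>, then \<open>x\<close>,
      which lies in \<open>cl T\<close>, would lie in \<open>cl K\<close>, against
      independence.\<close>
    obtain t where t: "t \<in> T" "t \<notin> cl K"
    proof -
      have "\<not> T \<subseteq> cl K"
        using cl_le[of T K] K xK less.prems(3) x by blast
      then show ?thesis using that by blast
    qed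
    have tE: "t \<in> E" using t less.prems by auto
    have "indep (insert t K)"
      unfolding indep_def
    proof (intro conjI ballI)
      show "insert t K \<subseteq> E" using K tE by auto
      fix y assume y: "y \<in> insert t K"
      show "y \<notin> cl (insert t K - {y})"
      proof (cases "y = t")
        case True
        then show ?thesis using t cl_mono[of "insert t K - {y}" K] by blast
      next
        case False
        then have yK: "y \<in> K" using y by auto
        have "y \<notin> cl (I - {y})" using less.prems(1) yK K by (auto simp: indep_def)
        then have 1: "y \<notin> cl (K - {y})" using cl_mono[of "K - {y}" "I - {y}"] K by blast
        have "y \<in> cl (insert t (K - {y})) \<Longrightarrow> t \<in> cl (insert y (K - {y}))"
          by (rule exchange[rotated 4]) (use 1 K yK tE in auto)
        moreover have "insert y (K - {y}) = K" "insert t K - {y} = insert t (K - {y})"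
          using yK False by auto
        ultimately show ?thesis using t by metis
      qed
    qed
    moreover have "insert t K - T \<subset> I - T" using t x K by auto
    then have "card (insert t K - T) < card (I - T)" using fin by (intro psubset_card_mono) auto
    moreover have "insert t K \<subseteq> cl T" using t cl_superset[of T] less.prems(3) K by auto
    ultimately have "card (insert t K) \<le> card T" using less.hyps less.prems(2) by blast
    moreover have "t \<notin> K" using t cl_superset[of K] by auto
    then have "card (insert t K) = card I" using K fin by auto
    ultimately show ?thesis by simp
  qed
qed

lemma rank_witness: "S \<subseteq> E \<Longrightarrow> \<exists>T. T \<subseteq> E \<and> card T = rank S \<and> cl T = cl S"
  unfolding rk_def by (rule LeastI_ex) auto

lemma rank_le: "T \<subseteq> E \<Longrightarrow> cl T = cl S \<Longrightarrow> rank S \<le> card T"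
  unfolding rk_def by (rule Least_le) auto

lemma rank_cong: "cl S = cl T \<Longrightarrow> rank S = rank T"
  by (simp add: rk_def)

lemma rank_cl [simp]: "S \<subseteq> E \<Longrightarrow> rank (cl S) = rank S"
  by (rule rank_cong) simp

text \<open>A set of least size with the given closure has no redundant element, since dropping one
  would keep the closure.\<close>

lemma rank_witness_indep:
  assumes "S \<subseteq> E"
  shows "\<exists>T. indep T \<and> card T = rank S \<and> cl T = cl S"
proof -
  obtain T where T: "T \<subseteq> E" "card T = rank S" "cl T = cl S"
    using rank_witness[OF assms] by blast
  have "indep T"
    unfolding indep_def
  proof (intro conjI ballI notI T(1))
    fix x assume x: "x \<in> T" "x \<in> cl (T - {x})"
    have "T \<subseteq> cl (T - {x})" using x cl_superset[of "T - {x}"] by auto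
    then have "cl (T - {x}) = cl T" using cl_le[of T "T - {x}"] T(1) cl_mono[of "T - {x}" T] by blast
    then have "rank S \<le> card (T - {x})" using T by (intro rank_le) auto
    moreover have "finite T" using T finite_ground finite_subset by blast
    ultimately show False using x T(2) card_Diff1_less[of T x] by linarith
  qed
  then show ?thesis using T by blast
qed

lemma indep_insert:
  assumes "indep I" "i \<in> E" "i \<notin> cl I"
  shows "indep (insert i I)"
  unfolding indep_def
proof (intro conjI ballI)
  show "insert i I \<subseteq> E" using assms by (auto simp: indep_def)
  have i: "i \<notin> I" using assms cl_superset by blast
  fix y assume y: "y \<in> insert i I"
  show "y \<notin> cl (insert i I - {y})"
  proof (cases "y = i")
    case True
    then show ?thesis using assms i by simp
  next
    case False
    then have yI: "y \<in> I" using y by simp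
    then have 1: "y \<notin> cl (I - {y})" using assms by (auto simp: indep_def)
    have "y \<in> cl (insert i (I - {y})) \<Longrightarrow> i \<in> cl (insert y (I - {y}))"
      by (rule exchange[rotated 4]) (use 1 assms yI in \<open>auto simp: indep_def\<close>)
    moreover have "insert y (I - {y}) = I" "insert i I - {y} = insert i (I - {y})"
      using yI False by auto
    ultimately show ?thesis using assms(3) by metis
  qed
qed

lemma rank_insert:
  assumes "S \<subseteq> E" "i \<in> E" "i \<notin> cl S"
  shows "rank (insert i S) = Suc (rank S)"
proof (rule antisym)
  obtain T where T: "indep T" "card T = rank S" "cl T = cl S"
    using rank_witness_indep[OF assms(1)] by blast
  then have TE: "T \<subseteq> E" "finite T" "i \<notin> T"
    using finite_ground finite_subset assms cl_superset[of T] by (auto simp: indep_def)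
  have cleq: "cl (insert i T) = cl (insert i S)"
    using cl_insert_cl[of T i] cl_insert_cl[of S i] T TE assms by simp
  then show "rank (insert i S) \<le> Suc (rank S)"
    using rank_le[of "insert i T" "insert i S"] TE T assms by simp
  obtain U where U: "U \<subseteq> E" "card U = rank (insert i S)" "cl U = cl (insert i S)"
    using rank_witness[of "insert i S"] assms by blast
  have "card (insert i T) \<le> card U"
    using T assms U cleq cl_superset[of "insert i T"] by (intro steinitz indep_insert) auto
  then show "Suc (rank S) \<le> rank (insert i S)"
    using TE T U by simp
qed

lemma rank_insert_cl: "S \<subseteq> E \<Longrightarrow> i \<in> cl S \<Longrightarrow> rank (insert i S) = rank S"
  using cl_le[of "insert i S" S] cl_superset[of S] cl_mono[of S "insert i S"]
  by (intro rank_cong) auto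

lemma rank_insert_le: "S \<subseteq> E \<Longrightarrow> i \<in> E \<Longrightarrow> rank (insert i S) \<le> Suc (rank S)"
  using rank_insert rank_insert_cl by (metis le_SucI order_refl)

lemma rank_insert_mono: "S \<subseteq> E \<Longrightarrow> i \<in> E \<Longrightarrow> rank S \<le> rank (insert i S)"
  using rank_insert rank_insert_cl by (metis le_SucI order_refl)

lemma rank_mono:
  assumes "S \<subseteq> T" "T \<subseteq> E"
  shows "rank S \<le> rank T"
proof -
  have "finite U \<Longrightarrow> U \<subseteq> E \<Longrightarrow> rank S \<le> rank (U \<union> S)" for U
  proof (induction rule: finite_induct)
    case (insert x F)
    then show ?case using rank_insert_mono[of "F \<union> S" x] assms by fastforce
  qed simp
  from this[of T] show ?thesis
    using assms finite_ground by (simp add: Un_absorb2 finite_subset)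
qed

lemma rank_strict_mono:
  assumes "F \<in> flats M" "F \<subseteq> S" "F \<noteq> S" "S \<subseteq> E"
  shows "rank F < rank S"
proof -
  obtain i where i: "i \<in> S - F" using assms by blast
  then have "rank (insert i F) = Suc (rank F)"
    using assms cl_ident[of F] flat_subset[of F] by (intro rank_insert) auto
  moreover have "rank (insert i F) \<le> rank S"
    using i assms by (intro rank_mono) auto
  ultimately show ?thesis by simp
qed

text \<open>\<open>U\<close> is any common subset rather than the full intersection, because in the
  application only the rank of a smaller set can be bounded from below. Starting from
  \<open>U\<close>, elements of \<open>T\<close> are added one at a time: one that raises the rank
  over the larger set also raises it over the smaller set.\<close>

lemma rank_submodular:
  assumes "S \<subseteq> E" "T \<subseteq> E" "U \<subseteq> S" "U \<subseteq> T"
  shows "rank (S \<union> T) + rank U \<le> rank S + rank T"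
proof -
  have "finite K \<Longrightarrow> K \<subseteq> E \<Longrightarrow> rank (S \<union> (U \<union> K)) + rank U \<le> rank S + rank (U \<union> K)" for K
  proof (induction rule: finite_induct)
    case empty
    then show ?case using assms by (simp add: Un_absorb2)
  next
    case (insert x K)
    have IH: "rank (S \<union> (U \<union> K)) + rank U \<le> rank S + rank (U \<union> K)"
      using insert by auto
    have x: "x \<in> E" "K \<subseteq> E" using insert by auto
    show ?case
    proof (cases "x \<in> cl (U \<union> K)")
      case True
      then have "x \<in> cl (S \<union> (U \<union> K))" using cl_mono[of "U \<union> K" "S \<union> (U \<union> K)"] by blast
      then have "rank (insert x (S \<union> (U \<union> K))) = rank (S \<union> (U \<union> K))"
        "rank (insert x (U \<union> K)) = rank (U \<union> K)"
        using True x assms by (auto intro!: rank_insert_cl)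
      then show ?thesis using IH by simp
    next
      case False
      then have "rank (insert x (U \<union> K)) = Suc (rank (U \<union> K))"
        using x assms by (intro rank_insert) auto
      moreover have "rank (insert x (S \<union> (U \<union> K))) \<le> Suc (rank (S \<union> (U \<union> K)))"
        using x assms by (intro rank_insert_le) auto
      ultimately show ?thesis using IH by simp
    qed
  qed
  from this[of T] show ?thesis
    using assms finite_ground by (simp add: Un_absorb1 finite_subset)
qed

lemma rank_empty [simp]: "rank {} = 0"
  using rank_le[of "{}" "{}"] by simp

end

section \<open>Flags of flats and the rank of a loopless matroid\<close>

locale loopless_matroid = matroid +
  assumes loopless: "loopless M"
begin

lemma empty_flat: "{} \<in> flats M"
  using loopless by (simp add: loopless_def)

lemma rank_pos: "F \<in> flats M \<Longrightarrow> F \<noteq> {} \<Longrightarrow> 0 < rank F"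
  using rank_strict_mono[OF empty_flat, of F] flat_subset[of F] by auto

text \<open>The rank maps a maximal flag bijectively onto \<open>{..<rank E}\<close>. If a rank
  \<open>n\<close> were missing, a flat could be squeezed in between the neighbours of the
  gap.\<close>

lemma maxchain_card:
  assumes "subset.maxchain (proper_flats M) C"
  shows "card C = rank E"
proof -
  have chain: "C \<subseteq> proper_flats M" "\<And>F G. F \<in> C \<Longrightarrow> G \<in> C \<Longrightarrow> F \<subseteq> G \<or> G \<subseteq> F"
    using assms unfolding subset.maxchain_def subset_chain_def by blast+
  have fl: "F \<in> flats M" "F \<subseteq> E" "F \<noteq> E" "rank F < rank E" if "F \<in> C" for F
    using that chain(1) flat_subset rank_strict_mono[of F E] unfolding proper_flats_def by auto
  have comparable_in: "F \<in> C" if "F \<in> proper_flats M" "\<And>G. G \<in> C \<Longrightarrow> F \<subseteq> G \<or> G \<subseteq> F" for F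
  proof (rule ccontr)
    assume "F \<notin> C"
    moreover have "subset.chain (proper_flats M) (insert F C)"
      unfolding subset_chain_def
    proof (intro conjI ballI)
      show "insert F C \<subseteq> proper_flats M" using that(1) chain(1) by simp
      fix G H assume "G \<in> insert F C" "H \<in> insert F C"
      then show "G \<subseteq> H \<or> H \<subseteq> G" using that(2) chain(2) by blast
    qed
    ultimately show False using assms unfolding subset.maxchain_def by blast
  qed
  have mono: "F \<subseteq> G \<longleftrightarrow> rank F \<le> rank G" if "F \<in> C" "G \<in> C" for F G
  proof
    show "F \<subseteq> G \<Longrightarrow> rank F \<le> rank G" using that fl by (simp add: rank_mono)
    assume "rank F \<le> rank G"
    then show "F \<subseteq> G"
      using chain(2)[OF that] rank_strict_mono[of G F] that fl by fastforce
  qed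
  have "bij_betw rank C {..<rank E}"
    unfolding bij_betw_def
  proof
    show "inj_on rank C" by (intro inj_onI subset_antisym) (simp_all add: mono)
    show "rank ` C = {..<rank E}"
    proof (intro equalityI subsetI)
      fix n assume n: "n \<in> {..<rank E}"
      show "n \<in> rank ` C"
      proof (rule ccontr)
        assume nC: "n \<notin> rank ` C"
        have fin: "finite C" using chain(1) finite_flats by (auto simp: proper_flats_def intro: finite_subset)
        have "E \<noteq> {}" using n by auto
        then have "{} \<in> C"
          using empty_flat by (intro comparable_in) (auto simp: proper_flats_def)
        then have "{F \<in> C. rank F < n} \<noteq> {}"
          using nC by (metis (mono_tags, lifting) empty_iff imageI mem_Collect_eq neq0_conv rank_empty)
        \<comment> \<open>\<open>A\<close> is the last member of the flag before the gap at
          \<open>n\<close>; \<open>{}\<close> belongs to the flag, so there is one.\<close>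
        then obtain A where A: "A \<in> C" "rank A < n" "\<And>F. F \<in> C \<Longrightarrow> rank F < n \<Longrightarrow> rank F \<le> rank A"
          using fin Max_in[of "rank ` {F \<in> C. rank F < n}"] Max_ge[of "rank ` {F \<in> C. rank F < n}"] by fastforce
        \<comment> \<open>\<open>D\<close> is the first member after the gap, with \<open>E\<close>
          as the default when the flag has no member beyond \<open>n\<close>.\<close>
        obtain D where D: "D \<in> flats M" "A \<subseteq> D" "n < rank D" "D = E \<or> D \<in> C"
          "\<And>F. F \<in> C \<Longrightarrow> n < rank F \<Longrightarrow> D \<subseteq> F"
        proof (cases "{F \<in> C. n < rank F} = {}")
          case True
          then show ?thesis using that[of E] fl A ground_flat n by auto
        next
          case False
          then obtain D where "D \<in> C" "n < rank D" "\<And>F. F \<in> C \<Longrightarrow> n < rank F \<Longrightarrow> rank D \<le> rank F"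
            using fin Min_in[of "rank ` {F \<in> C. n < rank F}"] Min_le[of "rank ` {F \<in> C. n < rank F}"] by fastforce
          then show ?thesis using that[of D] fl A mono by auto
        qed
        have "A \<noteq> D" using A D by auto
        then obtain i where i: "i \<in> D - A" using D by blast
        \<comment> \<open>\<open>K\<close> has rank one more than \<open>A\<close> and lies between
          \<open>A\<close> and \<open>D\<close>, so it is comparable with the whole flag and belongs
          to it. Its rank is then neither \<open>n\<close> nor at most that of \<open>A\<close>,
          which leaves no room for it.\<close>
        define K where "K = cl (insert i A)"
        have DE: "D \<subseteq> E" using D flat_subset by auto
        have K: "K \<in> flats M" "A \<subseteq> K" "K \<subseteq> D" "i \<in> K"
          unfolding K_def
          using i DE D(2) cl_superset[of "insert i A"] cl_flat[of "insert i A"] cl_minimal[OF D(1), of "insert i A"]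
          by auto
        have rK: "rank K = Suc (rank A)"
          unfolding K_def
          using i DE D(2) A(1) fl[of A] cl_ident[of A] rank_insert[of A i] rank_cl[of "insert i A"] by auto
        have "K \<in> C"
        proof (rule comparable_in)
          show "K \<in> proper_flats M"
            using K rK A n by (auto simp: proper_flats_def)
          fix G assume G: "G \<in> C"
          then have "rank G \<noteq> n" using nC by auto
          then consider "rank G < n" | "n < rank G" by linarith
          then show "K \<subseteq> G \<or> G \<subseteq> K"
          proof cases
            case 1
            then have "G \<subseteq> A" using mono[OF G A(1)] A(3)[OF G] by simp
            then show ?thesis using K(2) by blast
          next
            case 2
            then show ?thesis using D(5)[OF G] K(3) by blast
          qed
        qed
        moreover have "rank K \<noteq> n" using nC \<open>K \<in> C\<close> by auto
        ultimately show False using A(2) A(3)[of K] rK by linarith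
      qed
    qed (use fl in auto)
  qed
  then show ?thesis using bij_betw_same_card by fastforce
qed

text \<open>The description is unique only because some maximal flag exists, which the Hausdorff
  principle supplies.\<close>

lemma matroid_rank_eq: "matroid_rank M = rank E"
  unfolding matroid_rank_def
proof (rule the_equality)
  show "\<forall>C. subset.maxchain (proper_flats M) C \<longrightarrow> card C = rank E"
    using maxchain_card by blast
  fix d assume "\<forall>C. subset.maxchain (proper_flats M) C \<longrightarrow> card C = d"
  moreover obtain C where "subset.maxchain (proper_flats M) C"
    using subset.Hausdorff by blast
  ultimately show "d = rank E" using maxchain_card by blast
qed

text \<open>Adding the empty flat turns the flag into a maximal flag of all proper flats; this is
  where the shift by one in the degree of the Chow ring comes from.\<close>

lemma maxchain_nonempty_card:
  assumes "subset.maxchain (nonempty_proper_flats M) C" "E \<noteq> {}"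
  shows "card C = rank E - 1"
proof -
  have chain: "C \<subseteq> nonempty_proper_flats M" "\<And>F G. F \<in> C \<Longrightarrow> G \<in> C \<Longrightarrow> F \<subseteq> G \<or> G \<subseteq> F"
    using assms unfolding subset.maxchain_def subset_chain_def by blast+
  have "subset.maxchain (proper_flats M) (insert {} C)"
    unfolding subset.maxchain_def
  proof (intro conjI notI)
    show "subset.chain (proper_flats M) (insert {} C)"
      using chain empty_flat assms unfolding subset_chain_def nonempty_proper_flats_def proper_flats_def by auto
    assume "\<exists>S. subset.chain (proper_flats M) S \<and> insert {} C \<subset> S"
    then obtain S where S: "subset.chain (proper_flats M) S" "insert {} C \<subset> S" by blast
    then have "subset.chain (nonempty_proper_flats M) (S - {{}})"
      unfolding subset_chain_def nonempty_proper_flats_def by auto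
    moreover have "C \<subset> S - {{}}"
      using S(2) chain(1) by (auto simp: nonempty_proper_flats_def)
    ultimately show False using assms unfolding subset.maxchain_def by blast
  qed
  moreover have "finite C" "{} \<notin> C"
    using chain(1) finite_flats by (auto simp: proper_flats_def nonempty_proper_flats_def intro: finite_subset)
  ultimately show ?thesis using maxchain_card by fastforce
qed

end

section \<open>Localizations at a flat\<close>

lemma localization_ground [simp]: "ground (localization M F) = F"
  by (simp add: localization_def)

lemma localization_flats: "G \<in> flats (localization M F) \<longleftrightarrow> G \<in> flats M \<and> G \<subseteq> F"
  by (simp add: localization_def)

context loopless_matroid
begin

lemma localization_is_matroid:
  assumes "F \<in> flats M"
  shows "is_matroid (localization M F)"
  unfolding is_matroid_def
proof (intro conjI ballI)
  show "finite (ground (localization M F))"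
    using finite_subset[OF flat_subset[OF assms] finite_ground] by simp
  fix G i assume G: "G \<in> flats (localization M F)" "i \<in> ground (localization M F) - G"
  \<comment> \<open>Covers through an element of \<open>F\<close> are the same in both matroids:
    intersecting such a cover with \<open>F\<close> gives a flat strictly above \<open>G\<close>, so
    the cover already lies inside \<open>F\<close>.\<close>
  have covers: "covering_flat (localization M F) G H \<longleftrightarrow> covering_flat M G H" if "i \<in> H" for H
  proof
    assume H: "covering_flat M G H"
    have "H \<inter> F \<in> flats M" "G \<subset> H \<inter> F"
      using flat_Int assms H G that unfolding covering_flat_def by (auto simp: localization_flats)
    then have "H \<subseteq> F" using H by (auto simp: covering_flat_def)
    then show "covering_flat (localization M F) G H"
      using H by (auto simp: covering_flat_def localization_flats)
  next
    assume H: "covering_flat (localization M F) G H"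
    have "G' \<in> flats (localization M F)" if "G' \<in> flats M" "G' \<subset> H" for G'
      using H that psubset_imp_subset[OF that(2)] subset_trans[of G' H F]
      by (simp add: covering_flat_def localization_flats)
    then show "covering_flat M G H"
      using H unfolding covering_flat_def by (metis localization_flats)
  qed
  have "(covering_flat (localization M F) G H \<and> i \<in> H) = (covering_flat M G H \<and> i \<in> H)" for H
    using covers by blast
  moreover have "G \<in> flats M" "i \<in> E - G"
    using G flat_subset[OF assms] by (auto simp: localization_flats)
  note ex1_cover[OF this]
  ultimately show "\<exists>!H. covering_flat (localization M F) G H \<and> i \<in> H"
    by simp
qed (use assms in \<open>auto simp: localization_flats intro: flat_Int\<close>)

lemma localization_loopless_matroid:
  assumes "F \<in> flats M"
  shows "loopless_matroid (localization M F)"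
  using localization_is_matroid[OF assms] empty_flat
  by unfold_locales (simp_all add: loopless_def localization_flats)

lemma localization_closure:
  assumes "F \<in> flats M" "S \<subseteq> F"
  shows "flat_closure (localization M F) S = cl S"
proof
  show "cl S \<subseteq> flat_closure (localization M F) S"
    unfolding flat_closure_def localization_flats by blast
  have "cl S \<in> flats (localization M F)"
    using assms flat_subset[OF assms(1)] cl_flat[of S] cl_minimal[of F S] by (simp add: localization_flats)
  then show "flat_closure (localization M F) S \<subseteq> cl S"
    using cl_superset unfolding flat_closure_def[of "localization M F"] by blast
qed

lemma localization_rank:
  assumes "F \<in> flats M" "S \<subseteq> F"
  shows "rk (localization M F) S = rank S"
proof -
  have "(T \<subseteq> F \<and> card T = n \<and> flat_closure (localization M F) T = flat_closure (localization M F) S)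
     \<longleftrightarrow> (T \<subseteq> E \<and> card T = n \<and> cl T = cl S)" for T n
    using assms flat_subset[OF assms(1)] localization_closure cl_superset[of T] cl_minimal[OF assms]
    by auto
  then show ?thesis unfolding rk_def by simp
qed

lemma flat_rank_eq:
  assumes "F \<in> flats M"
  shows "flat_rank M F = rank F"
  unfolding flat_rank_def
  using loopless_matroid.matroid_rank_eq[OF localization_loopless_matroid[OF assms]]
  by (simp add: localization_rank[OF assms])

end

section \<open>Chow rings of intervals in the lattice of flats\<close>

definition interval_flats :: "'a matroid \<Rightarrow> 'a set \<Rightarrow> nat \<Rightarrow> 'a set set" where
  "interval_flats M B \<delta> = {G \<in> flats M. B \<subseteq> G \<and> rk M B + \<delta> \<le> rk M G}"

text \<open>The simplicial generators of the Chow ring; since the variable of \<open>E\<close>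
  stands for minus the alpha class, \<open>hvar M (ground M)\<close> is the alpha class itself.
  Arbitrary sets are allowed because \<open>insert i B\<close> need not be closed; by
  \<open>hvar_cl\<close> only the closure matters.\<close>

definition hvar :: "'a matroid \<Rightarrow> 'a set \<Rightarrow> 'a set mpoly" where
  "hvar M S = - (\<Sum>G\<in>{G \<in> flats M. S \<subseteq> G}. var G)"

text \<open>Variables outside the interval are killed instead of removed, so that every ring is a
  quotient of the same polynomial ring. The last family contains the linear relations, which
  eliminate the variable of \<open>E\<close>. In the third family \<open>hvar M (insert i B)\<close>
  plays the part of \<open>y_i\<close> when \<open>\<delta> = 0\<close>; when
  \<open>\<delta> = 1\<close> it vanishes already by the last family.\<close>

definition interval_gens :: "'a matroid \<Rightarrow> 'a set \<Rightarrow> nat \<Rightarrow> 'a set mpoly set" where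
  "interval_gens M B \<delta> =
     {var G | G. G \<notin> interval_flats M B \<delta>} \<union>
     {var F * var G | F G. F \<in> interval_flats M B \<delta> \<and> G \<in> interval_flats M B \<delta> \<and> \<not> F \<subseteq> G \<and> \<not> G \<subseteq> F} \<union>
     {var G * hvar M (insert i B) | G i. G \<in> interval_flats M B \<delta> \<and> i \<in> ground M - G} \<union>
     {hvar M F | F. F \<in> interval_flats M B \<delta> \<and> rk M F = rk M B + \<delta>}"

abbreviation interval_ideal :: "'a matroid \<Rightarrow> 'a set \<Rightarrow> nat \<Rightarrow> 'a set mpoly set" where
  "interval_ideal M B \<delta> \<equiv> gen_ideal (interval_gens M B \<delta>)"

text \<open>\<open>B_rank\<close> puts \<open>E\<close> into the interval and makes
  \<open>top_degree\<close> an honest difference. The bound \<open>\<delta> \<le> 1\<close> means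
  that one element outside \<open>B\<close> already leads into the interval.\<close>

locale flat_interval = loopless_matroid +
  fixes B :: "'a set" and \<delta> :: nat
  assumes B: "B \<in> flats M" and \<delta>: "\<delta> \<le> 1" and B_rank: "rank B + \<delta> \<le> rank E"
begin

abbreviation "P \<equiv> interval_flats M B \<delta>"
abbreviation "I \<equiv> interval_ideal M B \<delta>"
abbreviation "h \<equiv> hvar M"
abbreviation "top_degree \<equiv> rank E - rank B - \<delta>"

lemma finite_P: "finite P"
  using finite_flats by (simp add: interval_flats_def)

lemma P_flat: "G \<in> P \<Longrightarrow> G \<in> flats M"
  and P_above: "G \<in> P \<Longrightarrow> B \<subseteq> G"
  and P_rank: "G \<in> P \<Longrightarrow> rank B + \<delta> \<le> rank G"
  and P_subset: "G \<in> P \<Longrightarrow> G \<subseteq> E"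
  using flat_subset by (auto simp: interval_flats_def)

lemma B_subset: "B \<subseteq> E"
  using flat_subset B by auto

lemma P_upward: "F \<in> P \<Longrightarrow> G \<in> flats M \<Longrightarrow> F \<subseteq> G \<Longrightarrow> G \<in> P"
  using rank_mono[of F G] flat_subset[of G] by (auto simp: interval_flats_def)

lemma E_in_P: "E \<in> P"
  using B_rank ground_flat B_subset by (simp add: interval_flats_def)

lemma P_above_element:
  assumes "G \<in> flats M" "insert i B \<subseteq> G" "i \<notin> B"
  shows "G \<in> P"
proof -
  have "B \<subseteq> G" "B \<noteq> G" using assms by auto
  then have "rank B < rank G" using rank_strict_mono[OF B] flat_subset[OF assms(1)] by blast
  then show ?thesis using assms \<delta> by (simp add: interval_flats_def)
qed

lemma cl_insert_in_P: "i \<in> E - B \<Longrightarrow> cl (insert i B) \<in> P"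
  using cl_flat[of "insert i B"] cl_superset[of "insert i B"] B_subset by (intro P_above_element) auto

lemma hvar_cl: "S \<subseteq> E \<Longrightarrow> h (cl S) = h S"
proof -
  assume "S \<subseteq> E"
  then have "{G \<in> flats M. cl S \<subseteq> G} = {G \<in> flats M. S \<subseteq> G}"
    using cl_minimal cl_superset by blast
  then show ?thesis by (simp add: hvar_def)
qed

lemma hvar_split:
  assumes "S \<subseteq> F"
  shows "h F = h S + (\<Sum>H\<in>{H \<in> flats M. S \<subseteq> H \<and> \<not> F \<subseteq> H}. var H)"
proof -
  have "{G \<in> flats M. S \<subseteq> G} = {G \<in> flats M. F \<subseteq> G} \<union> {H \<in> flats M. S \<subseteq> H \<and> \<not> F \<subseteq> H}"
    using assms by auto
  then have "(\<Sum>G\<in>{G \<in> flats M. S \<subseteq> G}. var G) =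
     (\<Sum>G\<in>{G \<in> flats M. F \<subseteq> G}. var G) + (\<Sum>H\<in>{H \<in> flats M. S \<subseteq> H \<and> \<not> F \<subseteq> H}. var H)"
    using finite_flats by (subst sum.union_disjoint[symmetric]) auto
  then show ?thesis by (simp add: hvar_def)
qed

lemma gen_outside: "G \<notin> P \<Longrightarrow> var G \<in> I"
  by (rule gen_ideal_base) (unfold interval_gens_def, blast)

lemma gen_incomparable: "\<not> F \<subseteq> G \<Longrightarrow> \<not> G \<subseteq> F \<Longrightarrow> var F * var G \<in> I"
proof (cases "F \<in> P \<and> G \<in> P")
  case True
  then show "\<not> F \<subseteq> G \<Longrightarrow> \<not> G \<subseteq> F \<Longrightarrow> ?thesis"
    by (intro gen_ideal_base) (unfold interval_gens_def, blast)
next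
  case False
  then show ?thesis using gen_outside gen_ideal_mult_left gen_ideal_mult_right by blast
qed

lemma gen_element: "G \<in> P \<Longrightarrow> i \<in> E - G \<Longrightarrow> var G * h (insert i B) \<in> I"
  by (rule gen_ideal_base) (unfold interval_gens_def, blast)

lemma gen_bottom: "F \<in> P \<Longrightarrow> rank F = rank B + \<delta> \<Longrightarrow> h F \<in> I"
  by (rule gen_ideal_base) (unfold interval_gens_def, blast)

text \<open>Each factor \<open>h F\<close> replaces \<open>G\<close> by larger flats, whose intersection with \<open>F\<close> gains rank.\<close>

lemma var_times_hvar_power:
  assumes "G \<in> P" "F \<in> flats M" "B \<subseteq> F" "\<not> F \<subseteq> G" "rank F \<le> rank (F \<inter> G) + k"
  shows "var G * h F ^ k \<in> I"
  using assms
proof (induction k arbitrary: G)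
  case 0
  have "rank (F \<inter> G) < rank F"
    using 0 P_flat flat_subset by (intro rank_strict_mono flat_Int) auto
  then show ?case using 0 by simp
next
  case (Suc k)
  obtain i where i: "i \<in> F" "i \<notin> G" using Suc.prems by blast
  have iE: "i \<in> E - G" using i Suc.prems flat_subset by auto
  let ?T = "{H \<in> flats M. insert i B \<subseteq> H \<and> \<not> F \<subseteq> H}"
  \<comment> \<open>A flat \<open>H\<close> above \<open>G\<close> contains \<open>i\<close>, so it
    meets \<open>F\<close> in larger rank and the induction applies. A flat \<open>H\<close> not
    above \<open>G\<close> is incomparable with \<open>G\<close>, because \<open>i\<close> lies in
    \<open>H\<close> only.\<close>
  have "var H * (var G * h F ^ k) \<in> I" if H: "H \<in> ?T" for H
  proof (cases "G \<subseteq> H")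
    case True
    have HP: "H \<in> P" using P_upward[OF Suc.prems(1)] H True by auto
    have "rank (F \<inter> G) < rank (F \<inter> H)"
      using Suc.prems(1,2) P_flat flat_Int flat_subset[of H] H True i by (intro rank_strict_mono) auto
    then have "var H * h F ^ k \<in> I"
      using Suc.prems H by (intro Suc.IH HP) auto
    then show ?thesis
      using gen_ideal_mult_left[of "var H * h F ^ k" _ "var G"] by (simp add: mult.left_commute)
  next
    case False
    have "\<not> H \<subseteq> G" using H i by auto
    then show ?thesis
      using gen_ideal_mult_right[OF gen_incomparable[of H G], of "h F ^ k"] False by (simp add: algebra_simps)
  qed
  then have 1: "(\<Sum>H\<in>?T. var H * (var G * h F ^ k)) \<in> I"
    by (rule gen_ideal_sum)
  have 2: "(var G * h (insert i B)) * h F ^ k \<in> I"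
    by (rule gen_ideal_mult_right[OF gen_element[OF Suc.prems(1) iE]])
  have "h F = h (insert i B) + (\<Sum>H\<in>?T. var H)"
    using i Suc.prems by (intro hvar_split) auto
  then have "var G * h F ^ Suc k = (var G * h (insert i B)) * h F ^ k + (\<Sum>H\<in>?T. var H * (var G * h F ^ k))"
    by (simp add: algebra_simps sum_distrib_right sum_distrib_left)
  then show ?case using 1 2 by auto
qed

text \<open>For \<open>\<delta> = 0\<close> this is \<open>B\<close>; for
  \<open>\<delta> = 1\<close> it is the closure of \<open>B\<close> and one further element of
  \<open>F\<close>.\<close>

lemma ex_bottom_flat:
  assumes "F \<in> P"
  shows "\<exists>F0\<in>P. F0 \<subseteq> F \<and> rank F0 = rank B + \<delta>"
proof (cases "\<delta> = 0")
  case True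
  then have "B \<in> P" using B by (simp add: interval_flats_def)
  then show ?thesis using True P_above[OF assms] by auto
next
  case False
  then have \<delta>1: "\<delta> = 1" using \<delta> by auto
  have "B \<noteq> F" using P_rank[OF assms] \<delta>1 by auto
  then obtain i where i: "i \<in> F" "i \<notin> B" using P_above[OF assms] by blast
  have iE: "i \<in> E" using i P_subset[OF assms] by auto
  have "rank (cl (insert i B)) = rank B + \<delta>"
    using rank_insert[of B i] rank_cl[of "insert i B"] i iE B_subset \<delta>1 cl_ident[OF B] by auto
  moreover have "cl (insert i B) \<subseteq> F"
    using i P_above[OF assms] P_flat[OF assms] by (intro cl_minimal) auto
  ultimately show ?thesis using cl_insert_in_P[of i] i iE by auto
qed

text \<open>One factor \<open>h F\<close> is compared with \<open>h F0 = 0\<close> for a bottom flat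
  \<open>F0\<close> below \<open>F\<close>. What remains are variables of flats containing
  \<open>F0\<close> but not \<open>F\<close>, and these are killed by the other \<open>k - 1\<close>
  factors.\<close>

lemma hvar_power:
  assumes "F \<in> P" "rank F < rank B + \<delta> + k"
  shows "h F ^ k \<in> I"
proof -
  obtain k' where k: "k = Suc k'" using assms P_rank by (cases k) fastforce+
  obtain F0 where F0: "F0 \<in> P" "F0 \<subseteq> F" "rank F0 = rank B + \<delta>"
    using ex_bottom_flat[OF assms(1)] by blast
  let ?T = "{H \<in> flats M. F0 \<subseteq> H \<and> \<not> F \<subseteq> H}"
  have "var H * h F ^ k' \<in> I" if H: "H \<in> ?T" for H
  proof (rule var_times_hvar_power)
    show "H \<in> P" using H F0 P_upward by auto
    have "rank F0 \<le> rank (F \<inter> H)" using H F0 P_subset[OF assms(1)] by (intro rank_mono) auto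
    then show "rank F \<le> rank (F \<inter> H) + k'" using assms F0 k by linarith
  qed (use assms H P_flat P_above in auto)
  then have "(\<Sum>H\<in>?T. var H * h F ^ k') \<in> I" by (rule gen_ideal_sum)
  moreover have "h F0 * h F ^ k' \<in> I"
    by (rule gen_ideal_mult_right[OF gen_bottom[OF F0(1,3)]])
  moreover have "h F = h F0 + (\<Sum>H\<in>?T. var H)" using F0(2) by (rule hvar_split)
  then have "h F ^ k = h F0 * h F ^ k' + (\<Sum>H\<in>?T. var H * h F ^ k')"
    by (simp add: k algebra_simps sum_distrib_right sum_distrib_left)
  ultimately show ?thesis by auto
qed

end

section \<open>The degree functional\<close>

text \<open>Exponent vectors are read as multisets, because the Hall-Rado condition runs over
  subfamilies of the factors counted with multiplicity.\<close>

definition pm_mset :: "('v \<Rightarrow>\<^sub>0 nat) \<Rightarrow> 'v multiset" where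
  "pm_mset m = Abs_multiset (Poly_Mapping.lookup m)"

lemma count_pm_mset [simp]: "count (pm_mset m) = Poly_Mapping.lookup m"
  unfolding pm_mset_def by (rule count_Abs_multiset) simp

lemma pm_mset_add: "pm_mset (m + n) = pm_mset m + pm_mset n"
  by (rule multiset_eqI) (simp add: lookup_add)

lemma pm_mset_zero [simp]: "pm_mset 0 = {#}"
  by (rule multiset_eqI) simp

lemma pm_mset_single [simp]: "pm_mset (Poly_Mapping.single v n) = replicate_mset n v"
  by (rule multiset_eqI) (simp add: lookup_single when_def)

lemma set_pm_mset [simp]: "set_mset (pm_mset m) = Poly_Mapping.keys m"
  by (auto simp: set_mset_def in_keys_iff)

lemma size_pm_mset [simp]: "size (pm_mset m) = mdeg m"
  by (simp add: size_multiset_overloaded_eq mdeg_def)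

section \<open>The dragon Hall-Rado condition and its exchange properties\<close>

context flat_interval
begin

definition hall_rado :: "'a set multiset \<Rightarrow> bool" where
  "hall_rado N \<longleftrightarrow> (\<forall>J. J \<subseteq># N \<longrightarrow> J \<noteq> {#} \<longrightarrow> rank B + \<delta> + size J \<le> rank (B \<union> \<Union>(set_mset J)))"

text \<open>With \<open>c = \<delta> + 1\<close> this is what a further factor \<open>S\<close> needs; with \<open>c = \<delta> + 2\<close> it leaves room for two
  factors whose join is \<open>S\<close>.\<close>

definition room :: "'a set multiset \<Rightarrow> 'a set \<Rightarrow> nat \<Rightarrow> bool" where
  "room N S c \<longleftrightarrow> (\<forall>J. J \<subseteq># N \<longrightarrow> rank B + c + size J \<le> rank (B \<union> S \<union> \<Union>(set_mset J)))"

lemma subset_add_mset_cases: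
  "J \<subseteq># add_mset F N \<longleftrightarrow> J \<subseteq># N \<or> (\<exists>K. J = add_mset F K \<and> K \<subseteq># N)"
proof (cases "F \<in># J")
  case True
  then obtain K where K: "J = add_mset F K" by (metis mset_add)
  have "J \<subseteq># N \<Longrightarrow> K \<subseteq># N"
    unfolding K using mset_subset_eq_add_right[of K "{#F#}"] subset_mset.order_trans[of K "add_mset F K" N] by simp
  then show ?thesis by (auto simp: K)
next
  case False
  have "count J x \<le> count (add_mset F N) x \<longleftrightarrow> count J x \<le> count N x" for x
    using False by (cases "x = F") (simp_all add: not_in_iff)
  then have "J \<subseteq># add_mset F N \<longleftrightarrow> J \<subseteq># N"
    unfolding subseteq_mset_def by simp
  moreover have "\<not> (\<exists>K. J = add_mset F K \<and> K \<subseteq># N)" using False by force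
  ultimately show ?thesis by blast
qed

lemma all_subset_add_mset:
  "(\<forall>J. J \<subseteq># add_mset F N \<longrightarrow> Q J) \<longleftrightarrow> (\<forall>J. J \<subseteq># N \<longrightarrow> Q J) \<and> (\<forall>K. K \<subseteq># N \<longrightarrow> Q (add_mset F K))"
  using subset_add_mset_cases[of _ F N] by metis

text \<open>Subfamilies without the new factor give \<open>hall_rado N\<close>; those containing it
  have size one more, which accounts for \<open>\<delta> + 1\<close>. They are never empty, so
  \<open>room\<close> includes \<open>J = {#}\<close>.\<close>

lemma hall_rado_add: "hall_rado (add_mset F N) \<longleftrightarrow> hall_rado N \<and> room N F (\<delta> + 1)"
  unfolding hall_rado_def all_subset_add_mset by (simp add: room_def Un_assoc)

lemma room_add: "room (add_mset G N) S c \<longleftrightarrow> room N S c \<and> room N (S \<union> G) (c + 1)"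
  unfolding room_def all_subset_add_mset by (simp add: Un_assoc)

lemma Union_subset_E: "set_mset N \<subseteq> P \<Longrightarrow> J \<subseteq># N \<Longrightarrow> \<Union>(set_mset J) \<subseteq> E"
  using P_subset set_mset_mono by fastforce

lemma room_mono:
  assumes "room N S c" "S \<subseteq> T" "T \<subseteq> E" "c' \<le> c" "set_mset N \<subseteq> P"
  shows "room N T c'"
  unfolding room_def
proof (intro allI impI)
  fix J assume J: "J \<subseteq># N"
  then have "rank (B \<union> S \<union> \<Union>(set_mset J)) \<le> rank (B \<union> T \<union> \<Union>(set_mset J))"
    using assms B_subset Union_subset_E[OF assms(5) J] by (intro rank_mono) auto
  moreover have "rank B + c + size J \<le> rank (B \<union> S \<union> \<Union>(set_mset J))"
    using assms(1) J by (simp add: room_def)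
  ultimately show "rank B + c' + size J \<le> rank (B \<union> T \<union> \<Union>(set_mset J))" using assms(4) by linarith
qed

lemma room_cl:
  assumes "S \<subseteq> E" "set_mset N \<subseteq> P"
  shows "room N (cl S) c \<longleftrightarrow> room N S c"
proof -
  have "rank (B \<union> cl S \<union> \<Union>(set_mset J)) = rank (B \<union> S \<union> \<Union>(set_mset J))" if J: "J \<subseteq># N" for J
  proof (rule rank_cong)
    have "cl (cl S \<union> (B \<union> \<Union>(set_mset J))) = cl (S \<union> (B \<union> \<Union>(set_mset J)))"
      using assms B_subset Union_subset_E[OF assms(2) J] by (intro cl_Un_cl) auto
    then show "cl (B \<union> cl S \<union> \<Union>(set_mset J)) = cl (B \<union> S \<union> \<Union>(set_mset J))"
      by (simp add: Un_ac)
  qed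
  then show ?thesis by (auto simp: room_def)
qed

text \<open>Uncrossing: a subfamily \<open>K\<close> violating the condition for \<open>F\<close> is
  combined with an arbitrary \<open>J\<close> for \<open>G\<close>. Submodularity moves the estimate
  to the union of the two subfamilies, where \<open>F \<union> G\<close> has room, and to their
  intersection, where \<open>hall_rado N\<close> helps.\<close>

lemma room_or:
  assumes N: "set_mset N \<subseteq> P" "hall_rado N" and F: "F \<subseteq> E" "G \<subseteq> E"
    and FG: "room N (F \<union> G) (\<delta> + 2)" and nF: "\<not> room N F (\<delta> + 1)"
  shows "room N G (\<delta> + 1)"
  unfolding room_def
proof (intro allI impI)
  fix J assume J: "J \<subseteq># N"
  obtain K where K: "K \<subseteq># N" "rank (B \<union> F \<union> \<Union>(set_mset K)) < rank B + (\<delta> + 1) + size K"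
    using nF unfolding room_def by (auto simp: not_le)
  have JK: "J \<union># K \<subseteq># N" "J \<inter># K \<subseteq># N"
    using J K by (auto simp: subset_mset.le_infI1)
  let ?U = "B \<union> \<Union>(set_mset (J \<inter># K))"
  have "(B \<union> G \<union> \<Union>(set_mset J)) \<union> (B \<union> F \<union> \<Union>(set_mset K)) =
      B \<union> (F \<union> G) \<union> \<Union>(set_mset (J \<union># K))" by auto
  moreover have "rank ((B \<union> G \<union> \<Union>(set_mset J)) \<union> (B \<union> F \<union> \<Union>(set_mset K))) + rank ?U
     \<le> rank (B \<union> G \<union> \<Union>(set_mset J)) + rank (B \<union> F \<union> \<Union>(set_mset K))"
    using F B_subset Union_subset_E[OF N(1) J] Union_subset_E[OF N(1) K(1)]
    by (intro rank_submodular) auto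
  ultimately have "rank (B \<union> (F \<union> G) \<union> \<Union>(set_mset (J \<union># K))) + rank ?U
     \<le> rank (B \<union> G \<union> \<Union>(set_mset J)) + rank (B \<union> F \<union> \<Union>(set_mset K))"
    by (simp only:)
  moreover have "rank B + (\<delta> + 2) + size (J \<union># K) \<le> rank (B \<union> (F \<union> G) \<union> \<Union>(set_mset (J \<union># K)))"
    by (rule FG[unfolded room_def, rule_format, OF JK(1)])
  \<comment> \<open>The empty intersection is outside \<open>hall_rado\<close>, hence the bound
    without \<open>\<delta>\<close>. The final count then yields an excess of 2 over
    \<open>rank B + size J\<close>, and \<open>\<delta> + 1 \<le> 2\<close>.\<close>
  moreover have "rank B + size (J \<inter># K) \<le> rank ?U"
  proof (cases "J \<inter># K = {#}")
    case False
    show ?thesis using N(2)[unfolded hall_rado_def, rule_format, OF JK(2) False] by linarith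
  qed simp
  moreover have "size (J \<union># K) + size (J \<inter># K) = size J + size K"
  proof -
    have "J \<union># K + J \<inter># K = J + K" by (rule multiset_eqI) simp
    then show ?thesis by (metis size_union)
  qed
  ultimately show "rank B + (\<delta> + 1) + size J \<le> rank (B \<union> G \<union> \<Union>(set_mset J))"
    using K(2) \<delta> by linarith
qed

definition dhr_value :: "'a set multiset \<Rightarrow> rat" where
  "dhr_value N = (if set_mset N \<subseteq> P \<and> size N = top_degree \<and> hall_rado N then 1 else 0)"

lemma dhr_value_add2:
  "dhr_value (add_mset F (add_mset G N)) =
    (if F \<in> P \<and> G \<in> P \<and> set_mset N \<subseteq> P \<and> Suc (Suc (size N)) = top_degree \<and> hall_rado N \<and>
        room N F (\<delta> + 1) \<and> room N G (\<delta> + 1) \<and> room N (F \<union> G) (\<delta> + 2) then 1 else 0)"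
  unfolding dhr_value_def hall_rado_add room_add by (simp add: conj_ac)

text \<open>The numerical form of \<open>(h F - h H) * (h G - h H) = 0\<close>. If the four values
  are not all zero for a common reason, let \<open>f\<close> and \<open>g\<close> be the truth
  values of room for \<open>F\<close> and for \<open>G\<close>; the identity reads
  \<open>f * g + 1 = f + g\<close>, so it says that one of them holds, which is
  \<open>room_or\<close>.\<close>

lemma dhr_value_join:
  assumes "F \<in> P" "G \<in> P"
  defines "H \<equiv> cl (F \<union> G)"
  shows "dhr_value (add_mset F (add_mset G N)) + dhr_value (add_mset H (add_mset H N)) =
    dhr_value (add_mset F (add_mset H N)) + dhr_value (add_mset G (add_mset H N))"
proof (cases "set_mset N \<subseteq> P \<and> hall_rado N \<and> room N (F \<union> G) (\<delta> + 2) \<and> Suc (Suc (size N)) = top_degree")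
  case False
  have FGE: "F \<union> G \<subseteq> E" using assms P_subset by auto
  \<comment> \<open>All four pairs of factors have the same join \<open>H\<close>, so the failure of
    the condition at the join makes all four values zero at once.\<close>
  have zero: "dhr_value (add_mset X (add_mset Y N)) = 0" if XY: "cl (X \<union> Y) = cl (F \<union> G)" "X \<subseteq> E" "Y \<subseteq> E" for X Y
  proof -
    have "room N (X \<union> Y) c = room N (F \<union> G) c" if "set_mset N \<subseteq> P" for c
      using room_cl[of "X \<union> Y" N c] room_cl[of "F \<union> G" N c] XY FGE that by auto
    then have "\<not> (set_mset N \<subseteq> P \<and> hall_rado N \<and> room N (X \<union> Y) (\<delta> + 2) \<and> Suc (Suc (size N)) = top_degree)"
      using False by metis
    then show ?thesis unfolding dhr_value_add2 by presburger
  qed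
  have HE: "H \<subseteq> E" "F \<subseteq> H" "G \<subseteq> H" "cl H = H"
    unfolding H_def using cl_subset_ground[OF FGE] cl_superset[of "F \<union> G"] FGE by auto
  then have "cl (H \<union> H) = H" "cl (F \<union> H) = H" "cl (G \<union> H) = H"
    by (simp_all add: Un_absorb1)
  then show ?thesis
    using zero[of F G] zero[of H H] zero[of F H] zero[of G H] HE FGE H_def by simp
next
  case True
  have FGE: "F \<union> G \<subseteq> E" "F \<subseteq> E" "G \<subseteq> E" using assms P_subset by auto
  have HP: "H \<in> P"
    unfolding H_def
    using P_upward[OF assms(1) cl_flat[OF FGE(1)]] cl_superset[of "F \<union> G"] by auto
  have rH: "room N H c = room N (F \<union> G) c" for c
    unfolding H_def using FGE True by (intro room_cl) auto
  have rH1: "room N H (\<delta> + 1)" "room N H (\<delta> + 2)"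
    unfolding rH using True FGE by (auto intro: room_mono)
  have un: "F \<union> H = H" "G \<union> H = H"
    unfolding H_def using cl_superset[of "F \<union> G"] by auto
  have "room N F (\<delta> + 1) \<or> room N G (\<delta> + 1)"
    using room_or[of N F G] True FGE by auto
  then show ?thesis
    using True HP assms(1,2) rH1 unfolding dhr_value_add2 un by auto
qed

text \<open>The numerical form of \<open>(h F - h H) * h L = 0\<close>. Both pairs span
  \<open>insert i F\<close>, and room \<open>\<delta> + 2\<close> there leaves room
  \<open>\<delta> + 1\<close> for \<open>F\<close> because \<open>i\<close> raises the rank by at
  most one; for \<open>H\<close> it follows by monotonicity.\<close>

lemma dhr_value_element:
  assumes "F \<in> P" "i \<in> E - F"
  defines "L \<equiv> cl (insert i B)" and "H \<equiv> cl (insert i F)"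
  shows "dhr_value (add_mset F (add_mset L N)) = dhr_value (add_mset H (add_mset L N))"
proof -
  have LP: "L \<in> P" unfolding L_def using assms P_above by (intro cl_insert_in_P) auto
  have iFE: "insert i F \<subseteq> E" "insert i B \<subseteq> E" "F \<subseteq> E" using assms P_subset B_subset by auto
  have HP: "H \<in> P"
    unfolding H_def
    using P_upward[OF assms(1) cl_flat[OF iFE(1)]] cl_superset[of "insert i F"] by auto
  have LH: "L \<subseteq> H" unfolding L_def H_def using P_above[OF assms(1)] by (intro cl_mono) auto
  have iL: "i \<in> L" unfolding L_def using cl_superset[of "insert i B"] by auto
  have LE: "L \<subseteq> E" using P_subset LP by auto
  show ?thesis
  proof (cases "set_mset N \<subseteq> P")
    case True
    have 1: "room N (H \<union> L) c = room N (insert i F) c" for c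
      unfolding Un_absorb2[OF LH] unfolding H_def using iFE True by (intro room_cl) auto
    have "room N (F \<union> L) c \<longleftrightarrow> room N (insert i F) c" for c
    proof
      assume "room N (insert i F) c"
      then show "room N (F \<union> L) c"
        by (rule room_mono) (use iL iFE LE True in auto)
    next
      assume "room N (F \<union> L) c"
      then have "room N (H \<union> L) c"
        by (rule room_mono) (use LH P_subset[OF HP] cl_superset[of "insert i F"] True in \<open>auto simp: H_def\<close>)
      then show "room N (insert i F) c" using 1 by simp
    qed
    note 2 = this
    have "room N F (\<delta> + 1)" if r: "room N (insert i F) (\<delta> + 2)"
      unfolding room_def
    proof (intro allI impI)
      fix J assume J: "J \<subseteq># N"
      have "B \<union> insert i F \<union> \<Union>(set_mset J) = insert i (B \<union> F \<union> \<Union>(set_mset J))" by auto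
      then have "rank (B \<union> insert i F \<union> \<Union>(set_mset J)) \<le> Suc (rank (B \<union> F \<union> \<Union>(set_mset J)))"
        using rank_insert_le[of "B \<union> F \<union> \<Union>(set_mset J)" i] iFE B_subset Union_subset_E[OF True J] by auto
      moreover have "rank B + (\<delta> + 2) + size J \<le> rank (B \<union> insert i F \<union> \<Union>(set_mset J))"
        by (rule r[unfolded room_def, rule_format, OF J])
      ultimately show "rank B + (\<delta> + 1) + size J \<le> rank (B \<union> F \<union> \<Union>(set_mset J))" by linarith
    qed
    moreover have "room N H (\<delta> + 1)" if r: "room N (insert i F) (\<delta> + 2)"
      by (rule room_mono[OF r]) (use P_subset[OF HP] cl_superset[of "insert i F"] True in \<open>auto simp: H_def\<close>)
    ultimately show ?thesis
      using assms(1) HP LP unfolding dhr_value_add2 1 2 by auto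
  qed (simp add: dhr_value_def)
qed

text \<open>Already the empty subfamily leaves no room: \<open>F\<close> alone would need rank at
  least \<open>rank B + \<delta> + 1\<close>.\<close>

lemma dhr_value_bottom:
  assumes "F \<in> P" "rank F = rank B + \<delta>"
  shows "dhr_value (add_mset F N) = 0"
proof -
  have "\<not> room N F (\<delta> + 1)"
    using assms P_above[OF assms(1)] unfolding room_def
    by (auto intro!: exI[of _ "{#}"] simp: Un_absorb1)
  then show ?thesis by (simp add: dhr_value_def hall_rado_add)
qed

text \<open>The only monomials that are ever evaluated explicitly. A subfamily containing
  \<open>E\<close> has full rank, and any other one consists of at most \<open>a\<close> copies of
  \<open>F\<close>.\<close>

lemma dhr_value_two:
  assumes "F \<in> P" "a + (rank B + \<delta>) = rank F" "rank F + b = rank E"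
  shows "dhr_value (replicate_mset a F + replicate_mset b E) = 1"
proof -
  have "hall_rado (replicate_mset a F + replicate_mset b E)"
    unfolding hall_rado_def
  proof (intro allI impI)
    fix J assume J: "J \<subseteq># replicate_mset a F + replicate_mset b E" "J \<noteq> {#}"
    then have sJ: "size J \<le> a + b" using size_mset_mono by fastforce
    have setJ: "set_mset J \<subseteq> {F, E}"
    proof -
      have "set_mset (replicate_mset a F + replicate_mset b E) \<subseteq> {F, E}"
        by (auto split: if_splits)
      then show ?thesis using set_mset_mono[OF J(1)] by (rule subset_trans[rotated])
    qed
    show "rank B + \<delta> + size J \<le> rank (B \<union> \<Union>(set_mset J))"
    proof (cases "E \<in># J")
      case True
      then have "B \<union> \<Union>(set_mset J) = E" using setJ P_subset[OF assms(1)] B_subset by auto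
      then show ?thesis using sJ assms by simp
    next
      case False
      then have "set_mset J = {F}" using setJ J by (auto simp: set_mset_eq_empty_iff)
      then have "B \<union> \<Union>(set_mset J) = F" using P_above[OF assms(1)] by auto
      moreover have "size J \<le> a"
      proof -
        have EF: "F \<noteq> E" using False \<open>set_mset J = {F}\<close> by auto
        have "J = replicate_mset (size J) F"
          using \<open>set_mset J = {F}\<close> by (metis set_mset_subset_singletonD subset_refl)
        then have "size J = count J F" using count_replicate_mset[of "size J" F F] by simp
        also have "\<dots> \<le> count (replicate_mset a F + replicate_mset b E) F"
          by (rule mset_subset_eq_count[OF J(1)])
        also have "\<dots> = a" using EF by simp
        finally show ?thesis .
      qed
      ultimately show ?thesis using assms by simp
    qed
  qed
  then show ?thesis
    using assms E_in_P by (auto simp: dhr_value_def)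
qed

end

section \<open>Change of generators and the degree functional\<close>

declare One_nat_def [simp del]

text \<open>The system is triangular for inclusion: a minimal \<open>K\<close> occurs only in its
  own equation, so a solution on the other sets extends by choosing \<open>X K\<close>.\<close>

lemma ex_downward_mobius:
  fixes f :: "'a set \<Rightarrow> 'v mpoly"
  assumes "finite S"
  shows "\<exists>X. (\<forall>F\<in>S. (\<Sum>G\<in>{G \<in> S. F \<subseteq> G}. X G) = f F) \<and> (\<forall>F. F \<notin> S \<longrightarrow> X F = 0) \<and>
     ((\<forall>F\<in>S. homogeneous 1 (f F)) \<longrightarrow> (\<forall>F. homogeneous 1 (X F)))"
  using assms
proof (induction S rule: finite_psubset_induct)
  case (psubset S)
  show ?case
  proof (cases "S = {}")
    case False
    then obtain K where K: "K \<in> S" "\<And>G. G \<in> S \<Longrightarrow> G \<subseteq> K \<Longrightarrow> K = G"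
      using finite_has_minimal[OF psubset.hyps(1)] by blast
    define T where "T = S - {K}"
    have T: "T \<subset> S" "K \<notin> T" "S = insert K T" using K by (auto simp: T_def)
    from psubset.IH[OF T(1)] obtain X where
      "(\<forall>F\<in>T. (\<Sum>G\<in>{G \<in> T. F \<subseteq> G}. X G) = f F) \<and> (\<forall>F. F \<notin> T \<longrightarrow> X F = 0) \<and>
       ((\<forall>F\<in>T. homogeneous 1 (f F)) \<longrightarrow> (\<forall>F. homogeneous 1 (X F)))"
      by (elim exE)
    then have X: "\<And>F. F \<in> T \<Longrightarrow> (\<Sum>G\<in>{G \<in> T. F \<subseteq> G}. X G) = f F" "\<And>F. F \<notin> T \<Longrightarrow> X F = 0"
      "(\<forall>F\<in>T. homogeneous 1 (f F)) \<Longrightarrow> (\<forall>F. homogeneous 1 (X F))"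
      by simp_all
    define Y where "Y = X(K := f K - (\<Sum>G\<in>{G \<in> T. K \<subseteq> G}. X G))"
    have fin: "finite T" using psubset.hyps T by (auto intro: finite_subset)
    have eqT: "(\<Sum>G\<in>{G \<in> T. F \<subseteq> G}. Y G) = (\<Sum>G\<in>{G \<in> T. F \<subseteq> G}. X G)" for F
      using T(2) by (intro sum.cong) (auto simp: Y_def)
    have 1: "(\<Sum>G\<in>{G \<in> S. F \<subseteq> G}. Y G) = f F" if F: "F \<in> S" for F
    proof (cases "F = K")
      case True
      have "{G \<in> S. K \<subseteq> G} = insert K {G \<in> T. K \<subseteq> G}" using T(3) by auto
      then have "(\<Sum>G\<in>{G \<in> S. K \<subseteq> G}. Y G) = Y K + (\<Sum>G\<in>{G \<in> T. K \<subseteq> G}. Y G)"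
        using fin T(2) by simp
      then show ?thesis using True eqT by (simp add: Y_def)
    next
      case FK: False
      have "\<not> F \<subseteq> K" using K(2)[OF F] FK by auto
      then have "{G \<in> S. F \<subseteq> G} = {G \<in> T. F \<subseteq> G}" using T(3) by auto
      then show ?thesis using X(1)[of F] F FK T(3) eqT by auto
    qed
    have 2: "Y F = 0" if "F \<notin> S" for F
      using X(2)[of F] that T(3) K by (auto simp: Y_def)
    have 3: "homogeneous 1 (Y F)" if "\<forall>F\<in>S. homogeneous 1 (f F)" for F
      using X(3) that T(3) by (auto simp: Y_def intro!: homogeneous_diff homogeneous_sum)
    show ?thesis by (intro exI[of _ Y] conjI ballI allI impI) (simp_all add: 1 2 3)
  qed auto
qed

context flat_interval
begin

text \<open>Writes the \<open>x\<close>-variables in terms of the \<open>h\<close>-variables: below, a variable \<open>var F\<close> in the image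
  of \<open>subst mobius\<close> stands for \<open>h F\<close>.\<close>

definition mobius :: "'a set \<Rightarrow> 'a set mpoly" where
  "mobius = (SOME X. (\<forall>F\<in>P. (\<Sum>G\<in>{G \<in> P. F \<subseteq> G}. X G) = - var F) \<and> (\<forall>F. F \<notin> P \<longrightarrow> X F = 0) \<and>
     (\<forall>F. homogeneous 1 (X F)))"

lemma mobius:
  "F \<in> P \<Longrightarrow> (\<Sum>G\<in>{G \<in> P. F \<subseteq> G}. mobius G) = - var F" "F \<notin> P \<Longrightarrow> mobius F = 0" "homogeneous 1 (mobius F)"
proof -
  have hom: "\<forall>F\<in>P. homogeneous 1 (- var F)" by (auto intro: homogeneous_uminus)
  obtain X where "(\<forall>F\<in>P. (\<Sum>G\<in>{G \<in> P. F \<subseteq> G}. X G) = - var F)" "\<forall>F. F \<notin> P \<longrightarrow> X F = 0"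
     "(\<forall>F\<in>P. homogeneous 1 (- var F)) \<longrightarrow> (\<forall>F. homogeneous 1 (X F))"
    using ex_downward_mobius[OF finite_P, of "\<lambda>F. - var F"] by blast
  then have "\<exists>X. (\<forall>F\<in>P. (\<Sum>G\<in>{G \<in> P. F \<subseteq> G}. X G) = - var F) \<and> (\<forall>F. F \<notin> P \<longrightarrow> X F = 0) \<and>
     (\<forall>F. homogeneous 1 (X F))"
    using hom by blast
  from someI_ex[OF this, folded mobius_def]
  show "F \<in> P \<Longrightarrow> (\<Sum>G\<in>{G \<in> P. F \<subseteq> G}. mobius G) = - var F" "F \<notin> P \<Longrightarrow> mobius F = 0" "homogeneous 1 (mobius F)"
    by blast+
qed

lemma mobius_sum:
  assumes "F \<in> P"
  shows "(\<Sum>G\<in>{G \<in> flats M. F \<subseteq> G}. mobius G) = - var F"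
proof -
  have "{G \<in> flats M. F \<subseteq> G} = {G \<in> P. F \<subseteq> G}"
    using P_upward[OF assms] P_flat by auto
  then show ?thesis using mobius(1)[OF assms] by simp
qed

lemma subst_mobius_hvar:
  assumes "S \<subseteq> E" "cl S \<in> P"
  shows "subst mobius (h S) = var (cl S)"
proof -
  have "subst mobius (h (cl S)) = var (cl S)"
    using mobius_sum[OF assms(2)] by (simp add: hvar_def subst_simps)
  then show ?thesis using hvar_cl[OF assms(1)] by simp
qed

definition dhr_fun :: "'a set mpoly \<Rightarrow> rat" where
  "dhr_fun = lin_ext (\<lambda>c. c) (\<lambda>m. dhr_value (pm_mset m))"

lemma dhr_fun_add: "dhr_fun (p + q) = dhr_fun p + dhr_fun q"
  by (simp add: dhr_fun_def lin_ext_add)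

lemma dhr_fun_zero [simp]: "dhr_fun 0 = 0"
  by (simp add: dhr_fun_def)

lemma dhr_fun_single: "dhr_fun (Poly_Mapping.single m c) = c * dhr_value (pm_mset m)"
  by (simp add: dhr_fun_def lin_ext_single)

lemma dhr_fun_uminus: "dhr_fun (- p) = - dhr_fun p"
  using dhr_fun_add[of p "- p"] by simp

lemma dhr_fun_diff: "dhr_fun (p - q) = dhr_fun p - dhr_fun q"
  using dhr_fun_add[of p "- q"] by (simp add: dhr_fun_uminus)

lemma dhr_fun_sum: "dhr_fun (sum f S) = (\<Sum>x\<in>S. dhr_fun (f x))"
  by (induction S rule: infinite_finite_induct) (simp_all add: dhr_fun_add)

lemma dhr_fun_monomial_mult:
  "dhr_fun (Poly_Mapping.single m c * var F) = c * dhr_value (add_mset F (pm_mset m))"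
  "dhr_fun (Poly_Mapping.single m c * (var F * var G)) = c * dhr_value (add_mset F (add_mset G (pm_mset m)))"
  by (simp_all add: var_def mult_single dhr_fun_single pm_mset_add One_nat_def add_mset_commute)

lemma dhr_fun_eq_0I:
  assumes "\<And>m c. dhr_fun (Poly_Mapping.single m c * q) = 0"
  shows "dhr_fun (p * q) = 0"
  by (induction p rule: poly_mapping_add_induct) (simp_all add: assms dhr_fun_add distrib_right)

text \<open>The product \<open>(h F - h H) (h G - h H)\<close> is \<open>x F * x G\<close> plus products of incomparable variables for larger
  flats, so downward induction applies.\<close>

lemma dhr_fun_incomparable:
  assumes "F \<in> P" "G \<in> P" "\<not> F \<subseteq> G" "\<not> G \<subseteq> F"
  shows "dhr_fun (Poly_Mapping.single m c * (mobius F * mobius G)) = 0"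
  using assms
proof (induction "card (E - F) + card (E - G)" arbitrary: F G rule: less_induct)
  case less
  define H where "H = cl (F \<union> G)"
  let ?q = "Poly_Mapping.single m c"
  let ?A = "{A \<in> flats M. F \<subseteq> A \<and> \<not> G \<subseteq> A}" and ?B = "{A \<in> flats M. G \<subseteq> A \<and> \<not> F \<subseteq> A}"
  have FGE: "F \<subseteq> E" "G \<subseteq> E" using less.prems P_subset by auto
  have H: "H \<in> flats M" "F \<subseteq> H" "G \<subseteq> H"
    unfolding H_def using FGE cl_flat[of "F \<union> G"] cl_superset[of "F \<union> G"] by auto
  have HP: "H \<in> P" using P_upward[OF less.prems(1)] H by auto
  have split: "(\<Sum>A\<in>{A \<in> flats M. F \<subseteq> A \<and> \<not> G \<subseteq> A}. mobius A) = var H - var F"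
    if "F \<in> P" "G \<in> P" "cl (F \<union> G) = H" "F \<subseteq> H" "G \<subseteq> H" for F G
  proof -
    have "H \<subseteq> A \<longleftrightarrow> F \<subseteq> A \<and> G \<subseteq> A" if "A \<in> flats M" for A
      using cl_minimal[OF that, of "F \<union> G"] \<open>cl (F \<union> G) = H\<close> \<open>F \<subseteq> H\<close> \<open>G \<subseteq> H\<close> by auto
    then have "{A \<in> flats M. F \<subseteq> A} = {A \<in> flats M. H \<subseteq> A} \<union> {A \<in> flats M. F \<subseteq> A \<and> \<not> G \<subseteq> A}"
      "{A \<in> flats M. H \<subseteq> A} \<inter> {A \<in> flats M. F \<subseteq> A \<and> \<not> G \<subseteq> A} = {}" by auto
    then have "(\<Sum>A\<in>{A \<in> flats M. F \<subseteq> A}. mobius A) = (\<Sum>A\<in>{A \<in> flats M. H \<subseteq> A}. mobius A) +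
       (\<Sum>A\<in>{A \<in> flats M. F \<subseteq> A \<and> \<not> G \<subseteq> A}. mobius A)"
      using finite_flats by (simp add: sum.union_disjoint)
    then show ?thesis using mobius_sum[OF that(1)] mobius_sum[OF HP] by (simp add: algebra_simps)
  qed
  have A: "(\<Sum>A\<in>?A. mobius A) = var H - var F"
    by (rule split) (use less.prems H H_def in auto)
  have Bs: "(\<Sum>A\<in>?B. mobius A) = var H - var G"
    by (rule split) (use less.prems H H_def in \<open>auto simp: Un_commute\<close>)
  \<comment> \<open>Variables mean \<open>h\<close> here, so the expansion consists of the four
    Hall-Rado values related by \<open>dhr_value_join\<close>.\<close>
  have "?q * ((var H - var F) * (var H - var G)) =
      ?q * (var F * var G) + ?q * (var H * var H) - ?q * (var F * var H) - ?q * (var G * var H)"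
    by (simp add: algebra_simps)
  then have "dhr_fun (?q * ((var H - var F) * (var H - var G))) =
     c * (dhr_value (add_mset F (add_mset G (pm_mset m))) + dhr_value (add_mset H (add_mset H (pm_mset m)))
        - dhr_value (add_mset F (add_mset H (pm_mset m))) - dhr_value (add_mset G (add_mset H (pm_mset m))))"
    by (simp only: dhr_fun_diff dhr_fun_add dhr_fun_monomial_mult) (simp only: right_diff_distrib distrib_left)
  also have "\<dots> = 0"
    using dhr_value_join[OF less.prems(1,2), of "pm_mset m"] unfolding H_def[symmetric] by simp
  finally have "0 = dhr_fun (?q * ((\<Sum>A\<in>?A. mobius A) * (\<Sum>A\<in>?B. mobius A)))"
    by (simp add: A Bs)
  also have "\<dots> = (\<Sum>A\<in>?A. \<Sum>A'\<in>?B. dhr_fun (?q * (mobius A * mobius A')))"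
    by (subst sum_product) (simp only: sum_distrib_left dhr_fun_sum)
  also have "\<dots> = (\<Sum>A\<in>?A. if A = F then dhr_fun (?q * (mobius F * mobius G)) else 0)"
  proof (rule sum.cong[OF refl])
    fix A assume A: "A \<in> ?A"
    \<comment> \<open>Every other pair is again incomparable and consists of flats above
      \<open>F\<close> and \<open>G\<close>, at least one of them strictly larger, so the induction
      on the complements applies.\<close>
    have zero: "dhr_fun (?q * (mobius A * mobius A')) = 0" if A': "A' \<in> ?B" and ne: "A \<noteq> F \<or> A' \<noteq> G" for A'
    proof (rule less.hyps)
      show "A \<in> P" "A' \<in> P"
        using A A' P_upward[OF less.prems(1), of A] P_upward[OF less.prems(2), of A'] by auto
      then have sub: "A \<subseteq> E" "A' \<subseteq> E" using P_subset by auto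
      have "finite (E - F)" "finite (E - G)" using finite_ground by auto
      then have "card (E - A) \<le> card (E - F)" "card (E - A') \<le> card (E - G)"
         "A \<noteq> F \<Longrightarrow> card (E - A) < card (E - F)" "A' \<noteq> G \<Longrightarrow> card (E - A') < card (E - G)"
        using A A' sub by (auto intro!: card_mono psubset_card_mono)
      then show "card (E - A) + card (E - A') < card (E - F) + card (E - G)" using ne by linarith
    qed (use A A' in auto)
    show "(\<Sum>A'\<in>?B. dhr_fun (?q * (mobius A * mobius A'))) = (if A = F then dhr_fun (?q * (mobius F * mobius G)) else 0)"
    proof (cases "A = F")
      case True
      have "G \<in> ?B" using less.prems P_flat by auto
      then have "(\<Sum>A'\<in>?B. dhr_fun (?q * (mobius A * mobius A'))) = dhr_fun (?q * (mobius A * mobius G))"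
        using zero finite_flats by (subst sum.remove[of _ G]) (auto intro!: sum.neutral)
      then show ?thesis using True by simp
    next
      case False
      then show ?thesis using zero by (auto intro!: sum.neutral)
    qed
  qed
  also have "\<dots> = dhr_fun (?q * (mobius F * mobius G))"
    using less.prems P_flat finite_flats by simp
  finally show ?case by simp
qed

text \<open>The same downward induction for a single flat: \<open>h H - h F\<close> is the sum of
  the variables of the flats \<open>A\<close> containing \<open>F\<close> but not \<open>i\<close>,
  and each such \<open>A\<close> other than \<open>F\<close> is strictly larger and still misses
  \<open>i\<close>.\<close>

lemma dhr_fun_element:
  assumes "F \<in> P" "i \<in> E - F"
  shows "dhr_fun (Poly_Mapping.single m c * (mobius F * var (cl (insert i B)))) = 0"
  using assms
proof (induction "card (E - F)" arbitrary: F rule: less_induct)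
  case less
  define H where "H = cl (insert i F)"
  define L where "L = cl (insert i B)"
  let ?q = "Poly_Mapping.single m c"
  let ?A = "{A \<in> flats M. F \<subseteq> A \<and> i \<notin> A}"
  have FE: "insert i F \<subseteq> E" using less.prems P_subset by auto
  have H: "H \<in> flats M" "F \<subseteq> H" "i \<in> H"
    unfolding H_def using FE cl_flat[of "insert i F"] cl_superset[of "insert i F"] by auto
  have HP: "H \<in> P" using P_upward[OF less.prems(1)] H by auto
  have "H \<subseteq> A \<longleftrightarrow> F \<subseteq> A \<and> i \<in> A" if "A \<in> flats M" for A
    using cl_minimal[OF that, of "insert i F"] H unfolding H_def[symmetric] by auto
  then have "{A \<in> flats M. F \<subseteq> A} = {A \<in> flats M. H \<subseteq> A} \<union> ?A" "{A \<in> flats M. H \<subseteq> A} \<inter> ?A = {}"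
    by auto
  then have "(\<Sum>A\<in>{A \<in> flats M. F \<subseteq> A}. mobius A) = (\<Sum>A\<in>{A \<in> flats M. H \<subseteq> A}. mobius A) + (\<Sum>A\<in>?A. mobius A)"
    using finite_flats by (simp add: sum.union_disjoint)
  then have A: "(\<Sum>A\<in>?A. mobius A) = var H - var F"
    using mobius_sum[OF less.prems(1)] mobius_sum[OF HP] by (simp add: algebra_simps)
  have "dhr_fun (?q * ((var H - var F) * var L)) = 0"
    using dhr_value_element[OF less.prems, of "pm_mset m"]
    by (simp add: left_diff_distrib right_diff_distrib dhr_fun_diff dhr_fun_monomial_mult H_def L_def)
  then have "0 = (\<Sum>A\<in>?A. dhr_fun (?q * (mobius A * var L)))"
    unfolding A[symmetric] by (simp add: sum_distrib_left sum_distrib_right dhr_fun_sum)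
  also have "\<dots> = (\<Sum>A\<in>?A. if A = F then dhr_fun (?q * (mobius F * var L)) else 0)"
  proof (rule sum.cong[OF refl])
    fix A assume A: "A \<in> ?A"
    show "dhr_fun (?q * (mobius A * var L)) = (if A = F then dhr_fun (?q * (mobius F * var L)) else 0)"
    proof (cases "A = F")
      case False
      have AP: "A \<in> P" using A P_upward[OF less.prems(1), of A] by auto
      have "E - A \<subset> E - F" using A AP P_subset[of A] False by auto
      then have "card (E - A) < card (E - F)" using finite_ground by (intro psubset_card_mono) auto
      from less.hyps[OF this AP] show ?thesis using A less.prems False by (simp add: L_def)
    qed simp
  qed
  also have "\<dots> = dhr_fun (?q * (mobius F * var L))"
    using less.prems P_flat finite_flats by simp
  finally show ?case by (simp add: L_def)
qed

text \<open>Total on polynomials and zero on homogeneous ones outside the top degree, so that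
  orthogonality and duality can be stated without mentioning degrees.\<close>

definition deg_fun :: "'a set mpoly \<Rightarrow> rat" where
  "deg_fun p = dhr_fun (subst mobius p)"

lemma deg_fun_add: "deg_fun (p + q) = deg_fun p + deg_fun q"
  by (simp add: deg_fun_def subst_add dhr_fun_add)

lemma deg_fun_zero [simp]: "deg_fun 0 = 0"
  by (simp add: deg_fun_def)

lemma deg_fun_uminus: "deg_fun (- p) = - deg_fun p"
  by (simp add: deg_fun_def subst_uminus dhr_fun_uminus)

lemma deg_fun_diff: "deg_fun (p - q) = deg_fun p - deg_fun q"
  by (simp add: deg_fun_def subst_diff dhr_fun_diff)

lemma deg_fun_sum: "deg_fun (sum f S) = (\<Sum>x\<in>S. deg_fun (f x))"
  by (simp add: deg_fun_def subst_sum dhr_fun_sum)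

lemma deg_fun_cst_mult: "deg_fun (cst c * p) = c * deg_fun p"
proof -
  have "dhr_fun (cst c * q) = c * dhr_fun q" for q
    by (induction q rule: poly_mapping_add_induct)
       (simp_all add: distrib_left dhr_fun_add cst_def mult_single dhr_fun_single)
  then show ?thesis by (simp add: deg_fun_def subst_mult)
qed

lemma deg_fun_gen:
  assumes "g \<in> interval_gens M B \<delta>"
  shows "deg_fun (p * g) = 0"
proof -
  have mult0: "deg_fun (p * g) = 0" if "\<And>m c. dhr_fun (Poly_Mapping.single m c * subst mobius g) = 0"
    unfolding deg_fun_def subst_mult by (rule dhr_fun_eq_0I) (rule that)
  consider (outside) G where "g = var G" "G \<notin> P"
    | (incomparable) F G where "g = var F * var G" "F \<in> P" "G \<in> P" "\<not> F \<subseteq> G" "\<not> G \<subseteq> F"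
    | (element) G i where "g = var G * h (insert i B)" "G \<in> P" "i \<in> E - G"
    | (bottom) F where "g = h F" "F \<in> P" "rank F = rank B + \<delta>"
    using assms unfolding interval_gens_def by blast
  then show ?thesis
  proof cases
    case outside
    then show ?thesis by (intro mult0) (simp add: mobius(2))
  next
    case incomparable
    then show ?thesis by (intro mult0) (simp add: subst_mult dhr_fun_incomparable)
  next
    case element
    have iB: "insert i B \<subseteq> E" "i \<in> E - B" using element P_above B_subset by auto
    have "subst mobius (h (insert i B)) = var (cl (insert i B))"
      using iB cl_insert_in_P by (intro subst_mobius_hvar) auto
    then show ?thesis using element by (intro mult0) (simp add: subst_mult dhr_fun_element)
  next
    case bottom
    have "subst mobius (h F) = var F"
      using subst_mobius_hvar[of F] cl_ident[OF P_flat] bottom P_subset by auto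
    then show ?thesis using bottom by (intro mult0) (simp add: dhr_fun_monomial_mult dhr_value_bottom)
  qed
qed

lemma deg_fun_ideal: "p \<in> I \<Longrightarrow> deg_fun p = 0"
  by (induction rule: gen_ideal.induct) (simp_all add: deg_fun_add deg_fun_gen)

lemma dhr_fun_homogeneous:
  assumes "homogeneous n p" "n \<noteq> top_degree"
  shows "dhr_fun p = 0"
proof -
  have "dhr_value (pm_mset m) = 0" if "m \<in> Poly_Mapping.keys p" for m
    using that assms by (simp add: dhr_value_def homogeneous_mdeg)
  then show ?thesis unfolding dhr_fun_def lin_ext_def by simp
qed

lemma deg_fun_homogeneous:
  assumes "homogeneous n p" "n \<noteq> top_degree"
  shows "deg_fun p = 0"
  unfolding deg_fun_def
  by (rule dhr_fun_homogeneous[OF subst_homogeneous[OF assms(1), of UNIV] assms(2)]) (use mobius(3) in auto)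

lemma deg_fun_two:
  assumes "F \<in> P" "a + (rank B + \<delta>) = rank F" "rank F + b = rank E"
  shows "deg_fun (h F ^ a * h E ^ b) = 1"
proof -
  have pow: "var v ^ n = Poly_Mapping.single (Poly_Mapping.single v n) (1 :: rat)" for v :: "'a set" and n
    by (induction n) (simp_all add: var_def mult_single single_add[symmetric] One_nat_def)
  have "subst mobius (h F) = var F" "subst mobius (h E) = var E"
    using subst_mobius_hvar[of F] subst_mobius_hvar[of E] cl_ident[OF P_flat] assms(1) P_subset E_in_P by auto
  then have "subst mobius (h F ^ a * h E ^ b) = var F ^ a * var E ^ b"
    by (simp add: subst_simps)
  also have "\<dots> = Poly_Mapping.single (Poly_Mapping.single F a + Poly_Mapping.single E b) 1"
    by (simp add: pow mult_single)
  finally show ?thesis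
    using dhr_value_two[OF assms] by (simp add: deg_fun_def dhr_fun_single pm_mset_add)
qed

end

section \<open>Spanning sets, the top degree and Poincare duality\<close>

context flat_interval
begin

section \<open>Spanning by the summands\<close>

abbreviation "upper F \<equiv> interval_flats M F 1"

lemma upper_iff: "F \<in> flats M \<Longrightarrow> G \<in> upper F \<longleftrightarrow> G \<in> flats M \<and> F \<subset> G"
proof -
  assume F: "F \<in> flats M"
  have "rank F < rank G" if "G \<in> flats M" "F \<subset> G"
    using that F flat_subset[of G] by (intro rank_strict_mono) auto
  then show ?thesis unfolding interval_flats_def by fastforce
qed

lemma upper_subset_P: "F \<in> P \<Longrightarrow> upper F \<subseteq> P"
  using P_upward upper_iff[OF P_flat] by auto

lemma finite_upper: "finite (upper F)"
  using finite_flats by (simp add: interval_flats_def)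

lemma E_in_upper: "F \<in> P \<Longrightarrow> F \<noteq> E \<Longrightarrow> E \<in> upper F"
  using upper_iff[OF P_flat] P_subset ground_flat by auto

lemma rank_less_E: "F \<in> P \<Longrightarrow> F \<noteq> E \<Longrightarrow> rank F < rank E"
  using rank_strict_mono[OF P_flat] P_subset by auto

lemma sub_interval:
  assumes "F \<in> P" "F \<noteq> E"
  shows "flat_interval M F 1"
  using rank_less_E[OF assms] P_flat[OF assms(1)] by unfold_locales auto

definition usum :: "'a set \<Rightarrow> 'a set mpoly" where
  "usum F = (\<Sum>G\<in>upper F. var G)"

lemma usum_in: "usum F \<in> poly_in (upper F)"
  unfolding usum_def by (rule poly_in_sum) simp

lemma usum_hom: "homogeneous 1 (usum F)"
  unfolding usum_def by (rule homogeneous_sum) simp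

lemma hvar_usum: "F \<in> flats M \<Longrightarrow> h F = - var F - usum F"
proof -
  assume F: "F \<in> flats M"
  have "{G \<in> flats M. F \<subseteq> G} = insert F (upper F)" "F \<notin> upper F"
    using upper_iff[OF F] F by auto
  then show ?thesis using finite_upper by (simp add: hvar_def usum_def)
qed

lemma hvar_E: "h E = - var E"
proof -
  have "{G \<in> flats M. E \<subseteq> G} = {E}" using flat_subset ground_flat by auto
  then show ?thesis by (simp add: hvar_def)
qed

lemma hvar_hom: "homogeneous 1 (h F)"
  unfolding hvar_def by (intro homogeneous_uminus homogeneous_sum) simp

lemma hvar_in_upper:
  assumes "F \<in> flats M" "G \<in> upper F"
  shows "h G \<in> poly_in (upper F)"
  unfolding hvar_def
  using assms upper_iff[OF assms(1)] by (intro poly_in_uminus poly_in_sum) auto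

lemma hvar_E_in_upper: "F \<in> P \<Longrightarrow> F \<noteq> E \<Longrightarrow> h E \<in> poly_in (upper F)"
  using hvar_in_upper[OF P_flat E_in_upper] by auto

text \<open>Collects, modulo the ideal, the degree \<open>n\<close> elements of the sum of the
  summands: multiples of the power of the alpha class and the terms
  \<open>var F * h F ^ k * p\<close> with truncated exponent \<open>k\<close>. The polynomial
  \<open>p\<close> may involve the variable of \<open>E\<close>.\<close>

inductive spanned :: "nat \<Rightarrow> 'a set mpoly \<Rightarrow> bool" where
  ideal: "p \<in> I \<Longrightarrow> spanned n p"
| add: "spanned n p \<Longrightarrow> spanned n q \<Longrightarrow> spanned n (p + q)"
| top: "spanned n (cst c * h E ^ n)"
| flat: "F \<in> P \<Longrightarrow> F \<noteq> E \<Longrightarrow> k + (rank B + \<delta>) < rank F \<Longrightarrow> p \<in> poly_in (upper F) \<Longrightarrow> homogeneous j p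
    \<Longrightarrow> n = Suc (k + j) \<Longrightarrow> spanned n (var F * h F ^ k * p)"

lemma spanned_add_eq: "spanned n p \<Longrightarrow> spanned m q \<Longrightarrow> r = p + q \<Longrightarrow> n = l \<Longrightarrow> m = l \<Longrightarrow> spanned l r"
  using spanned.add by simp

text \<open>One factor \<open>h F\<close> is replaced by \<open>- var F - usum F\<close>. The first
  part lands in the summand of \<open>F\<close>; the second lowers the exponent and moves one degree
  into the polynomial above \<open>F\<close>. The borderline exponent is allowed because
  \<open>var F\<close> uses up one factor.\<close>

lemma spanned_hvar_power:
  assumes F: "F \<in> P" "F \<noteq> E"
    and IH: "\<And>n p. p \<in> poly_in (upper F) \<Longrightarrow> homogeneous n p \<Longrightarrow> spanned n p"
    and "p \<in> poly_in (upper F)" "homogeneous j p" "k + (rank B + \<delta>) \<le> rank F"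
  shows "spanned (k + j) (h F ^ k * p)"
  using assms(4-6)
proof (induction k arbitrary: p j)
  case 0
  then show ?case using IH by simp
next
  case (Suc k)
  have "spanned (Suc k + j) (var F * h F ^ k * (- p))"
    using Suc.prems F by (intro spanned.flat[where j = j]) auto
  moreover have "spanned (k + (1 + j)) (h F ^ k * (- usum F * p))"
    using Suc.prems usum_in[of F] usum_hom[of F]
    by (intro Suc.IH homogeneous_mult poly_in_mult poly_in_uminus homogeneous_uminus) auto
  moreover have "h F ^ Suc k * p = var F * h F ^ k * (- p) + h F ^ k * (- usum F * p)"
    by (simp add: hvar_usum[OF P_flat[OF F(1)]] algebra_simps)
  ultimately show ?case by (rule spanned_add_eq) simp_all
qed

text \<open>The borderline exponent lies just outside the summand. There \<open>h F ^ Suc k\<close>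
  is in the ideal, which rewrites the term into \<open>h F ^ k\<close> times a polynomial above
  \<open>F\<close>.\<close>

lemma spanned_flat_power:
  assumes F: "F \<in> P" "F \<noteq> E"
    and IH: "\<And>n p. p \<in> poly_in (upper F) \<Longrightarrow> homogeneous n p \<Longrightarrow> spanned n p"
    and p: "p \<in> poly_in (upper F)" "homogeneous j p" and k: "k + (rank B + \<delta>) \<le> rank F"
  shows "spanned (Suc (k + j)) (var F * h F ^ k * p)"
proof (cases "k + (rank B + \<delta>) < rank F")
  case True
  then show ?thesis using F p by (intro spanned.flat) auto
next
  case False
  have "h F ^ Suc k \<in> I" using False F by (intro hvar_power) auto
  then have "spanned (Suc (k + j)) (h F ^ Suc k * (- p))"
    by (intro spanned.ideal gen_ideal_mult_right)
  moreover have "spanned (k + (1 + j)) (h F ^ k * (- usum F * p))"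
    using p usum_in[of F] usum_hom[of F]
    by (intro spanned_hvar_power[OF F IH] homogeneous_mult poly_in_mult poly_in_uminus homogeneous_uminus k) auto
  moreover have "var F * h F ^ k * p = h F ^ Suc k * (- p) + h F ^ k * (- usum F * p)"
    by (simp add: hvar_usum[OF P_flat[OF F(1)]] algebra_simps)
  ultimately show ?thesis by (rule spanned_add_eq) simp_all
qed

text \<open>The sum of the summands is stable under multiplication by \<open>var v\<close>. On the
  term of \<open>F\<close>, a flat above \<open>F\<close> is absorbed into \<open>p\<close>, an
  incomparable one gives zero, and \<open>v = F\<close> uses the formula for the square of
  \<open>var F\<close>. For \<open>v\<close> below \<open>F\<close> the whole term is a polynomial
  above \<open>v\<close>, so one is back at the spanning terms of \<open>v\<close>.\<close>

lemma spanned_var: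
  assumes V: "v \<in> P"
    and IH: "\<And>n p. v \<noteq> E \<Longrightarrow> p \<in> poly_in (upper v) \<Longrightarrow> homogeneous n p \<Longrightarrow> spanned n p"
    and "spanned n q"
  shows "spanned (Suc n) (var v * q)"
  using assms(3)
proof (induction rule: spanned.induct)
  case (ideal p n)
  then show ?case by (intro spanned.ideal gen_ideal_mult_left)
next
  case (add n p q)
  then show ?case by (simp add: distrib_left spanned.add)
next
  case (top n c)
  show ?case
  proof (cases "v = E")
    case True
    have "var v * (cst c * h E ^ n) = cst (- c) * h E ^ Suc n"
      by (simp add: True hvar_E algebra_simps)
    then show ?thesis using spanned.top[of "Suc n" "- c"] by (simp only:)
  next
    case False
    have "spanned (Suc (0 + n)) (var v * h v ^ 0 * (cst c * h E ^ n))"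
      using V False P_rank[OF V]
      by (intro spanned_flat_power[OF V False IH] poly_in_mult poly_in_power hvar_E_in_upper
          homogeneous_cst_mult homogeneous_power hvar_hom) auto
    then show ?thesis by simp
  qed
next
  case (flat F k p j n)
  consider "v = F" | "v \<subset> F" | "F \<subset> v" | "\<not> v \<subseteq> F" "\<not> F \<subseteq> v" by blast
  then show ?case
  proof cases
    case 1
    have 2: "spanned (Suc (Suc k + j)) (var F * h F ^ Suc k * (- p))"
      using flat IH 1 by (intro spanned_flat_power) auto
    have 3: "spanned (Suc n) (var F * h F ^ k * (- usum F * p))"
      using flat usum_in[of F] usum_hom[of F]
      by (intro spanned.flat[where j = "1 + j"] poly_in_mult poly_in_uminus homogeneous_mult homogeneous_uminus) auto
    have "var v * (var F * h F ^ k * p) = var F * h F ^ Suc k * (- p) + var F * h F ^ k * (- usum F * p)"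
      unfolding 1 by (simp add: hvar_usum[OF P_flat[OF flat(1)]] algebra_simps)
    from 2 3 this show ?thesis by (rule spanned_add_eq) (simp_all add: flat(6))
  next
    case 2
    have vE: "v \<noteq> E" using 2 P_subset[OF flat(1)] by auto
    have Fv: "F \<in> upper v" "upper F \<subseteq> upper v"
      using 2 upper_iff[OF P_flat[OF V]] upper_iff[OF P_flat[OF flat(1)]] P_flat[OF flat(1)] by auto
    have "homogeneous (1 + k + j) (var F * h F ^ k * p)"
      using flat by (intro homogeneous_mult homogeneous_power hvar_hom) auto
    moreover have "var F * h F ^ k * p \<in> poly_in (upper v)"
      using Fv flat poly_in_mono[OF Fv(2)] hvar_in_upper[OF P_flat[OF V] Fv(1)]
      by (intro poly_in_mult poly_in_power) auto
    ultimately have "spanned (Suc (0 + (1 + k + j))) (var v * h v ^ 0 * (var F * h F ^ k * p))"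
      using P_rank[OF V] by (intro spanned_flat_power[OF V vE IH[OF vE]]) auto
    then show ?thesis using flat(6) by (simp add: One_nat_def)
  next
    case 3
    have "v \<in> upper F" using 3 upper_iff[OF P_flat[OF flat(1)]] P_flat[OF V] by auto
    then have "spanned (Suc n) (var F * h F ^ k * (var v * p))"
      using flat by (intro spanned.flat[where j = "1 + j"] poly_in_mult homogeneous_mult) auto
    then show ?thesis by (simp add: algebra_simps)
  next
    case 4
    have "var v * var F * (h F ^ k * p) \<in> I"
      by (rule gen_ideal_mult_right[OF gen_incomparable[OF 4]])
    then show ?thesis by (intro spanned.ideal) (simp add: algebra_simps)
  qed
qed

lemma spanned_cst: "spanned 0 (cst c)"
  using spanned.top[of 0 c] by simp

text \<open>Induction on upward closed sets of flats: the step for \<open>v\<close> needs the claim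
  only for polynomials above \<open>v\<close>, and these flats form a smaller such set.\<close>

lemma spanned_upset:
  assumes "finite V" "V \<subseteq> P" "\<And>F. F \<in> V \<Longrightarrow> upper F \<subseteq> V" "p \<in> poly_in V" "homogeneous n p"
  shows "spanned n p"
  using assms
proof (induction V arbitrary: p n rule: finite_psubset_induct)
  case (psubset V)
  show ?case
    using psubset.prems(3,4)
  proof (induction rule: homogeneous_induct)
    case (var n v p)
    have "spanned m q" if "q \<in> poly_in (upper v)" "homogeneous m q" for m q
    proof (rule psubset.IH[OF _ _ _ that])
      have vP: "v \<in> P" using var psubset.prems(1) by auto
      have "v \<notin> upper v" using upper_iff[OF P_flat[OF vP]] by auto
      then show "upper v \<subset> V" using psubset.prems(2) var(1) by blast
      show "upper v \<subseteq> P" by (rule upper_subset_P[OF vP])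
      show "upper F \<subseteq> upper v" if "F \<in> upper v" for F
        using that upper_iff[OF P_flat[OF vP]] upper_iff[of F] by auto
    qed
    then show ?case using var psubset.prems(1) by (intro spanned_var) auto
  qed (auto intro: spanned_cst spanned.ideal spanned.add)
qed

lemma spanned_all:
  assumes "homogeneous n p"
  shows "spanned n p"
  using poly_in_UNIV assms
proof (induction rule: homogeneous_induct)
  case (var n v p)
  show ?case
  proof (cases "v \<in> P")
    case True
    have up: "upper F \<subseteq> upper v" if "F \<in> upper v" for F
      using that upper_iff[OF P_flat[OF True]] upper_iff[of F] by auto
    have "spanned m q" if "q \<in> poly_in (upper v)" "homogeneous m q" for m q
      by (rule spanned_upset[OF finite_upper upper_subset_P[OF True] up that])
    then show ?thesis using True var by (intro spanned_var) auto
  next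
    case False
    then show ?thesis by (intro spanned.ideal gen_ideal_mult_right gen_outside)
  qed
qed (auto intro: spanned_cst spanned.ideal spanned.add)

text \<open>The ideal of the contraction contains all variables outside \<open>upper F\<close>. They
  have to be set to zero before a multiplication by \<open>var F\<close> can map this ideal into
  \<open>I\<close>.\<close>

definition restrict_upper :: "'a set \<Rightarrow> 'a set mpoly \<Rightarrow> 'a set mpoly" where
  "restrict_upper F = subst (\<lambda>G. if G \<in> upper F then var G else 0)"

lemma restrict_upper_ident: "p \<in> poly_in (upper F) \<Longrightarrow> restrict_upper F p = p"
  unfolding restrict_upper_def by (rule subst_ident) auto

lemma restrict_upper_in: "restrict_upper F p \<in> poly_in (upper F)"
  unfolding restrict_upper_def by (rule subst_poly_in[OF poly_in_UNIV]) auto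

lemma restrict_upper_cong: "p - restrict_upper F p \<in> interval_ideal M F 1"
proof (induction p rule: mpoly_induct[OF poly_in_UNIV])
  case (1 c)
  then show ?case by (simp add: restrict_upper_def)
next
  case (2 v p)
  have "var v - restrict_upper F (var v) \<in> interval_ideal M F 1"
    by (auto simp: restrict_upper_def interval_gens_def intro!: gen_ideal_base)
  then have "(var v - restrict_upper F (var v)) * p + restrict_upper F (var v) * (p - restrict_upper F p)
      \<in> interval_ideal M F 1"
    using 2 by (intro gen_ideal_add gen_ideal_mult_left gen_ideal_mult_right)
  then show ?case by (simp add: restrict_upper_def subst_mult algebra_simps)
next
  case (3 p q)
  then have "(p - restrict_upper F p) + (q - restrict_upper F q) \<in> interval_ideal M F 1"
    by (intro gen_ideal_add)
  then show ?case by (simp add: restrict_upper_def subst_add algebra_simps)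
qed

text \<open>The two \<open>h\<close>-classes for \<open>B\<close> and for \<open>F\<close> differ by
  flats that contain \<open>i\<close> but not \<open>F\<close>; these are incomparable with
  \<open>F\<close>, which misses \<open>i\<close>.\<close>

lemma var_times_element:
  assumes "F \<in> P" "i \<in> E - F"
  shows "var F * h (insert i F) \<in> I"
proof -
  have sub: "insert i B \<subseteq> insert i F" using P_above[OF assms(1)] by auto
  let ?T = "{H \<in> flats M. insert i B \<subseteq> H \<and> \<not> insert i F \<subseteq> H}"
  have "var F * var H \<in> I" if "H \<in> ?T" for H
    using that assms by (intro gen_incomparable) auto
  then have "(\<Sum>H\<in>?T. var F * var H) \<in> I" by (rule gen_ideal_sum)
  then have "var F * h (insert i B) + (\<Sum>H\<in>?T. var F * var H) \<in> I"
    using gen_element[OF assms] by (intro gen_ideal_add)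
  then show ?thesis unfolding hvar_split[OF sub] by (simp add: distrib_left sum_distrib_left)
qed

text \<open>Multiplication by \<open>var F\<close> is a well-defined map from the Chow ring of the
  contraction. Both kinds of relations involving \<open>h\<close> there are multiples of some
  \<open>h (insert i F)\<close>, which \<open>var F\<close> kills.\<close>

lemma push_ideal:
  assumes F: "F \<in> P" "F \<noteq> E" and p: "p \<in> interval_ideal M F 1"
  shows "var F * restrict_upper F p \<in> I"
  using p
proof (induction rule: gen_ideal.induct)
  case zero
  then show ?case by (simp add: restrict_upper_def)
next
  case (add_gen g p r)
  have Ff: "F \<in> flats M" using F P_flat by auto
  have rh: "restrict_upper F (h S) = h S" if "F \<subset> S" for S
    using that upper_iff[OF Ff] unfolding hvar_def
    by (intro restrict_upper_ident poly_in_uminus poly_in_sum) auto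
  have rv: "restrict_upper F (var G) = var G" if "G \<in> upper F" for G
    using that by (intro restrict_upper_ident) auto
  consider (outside) G where "g = var G" "G \<notin> upper F"
    | (incomparable) G H where "g = var G * var H" "G \<in> upper F" "H \<in> upper F" "\<not> G \<subseteq> H" "\<not> H \<subseteq> G"
    | (element) G i where "g = var G * h (insert i F)" "G \<in> upper F" "i \<in> E - G"
    | (bottom) G where "g = h G" "G \<in> upper F" "rank G = rank F + 1"
    using add_gen(1) unfolding interval_gens_def by blast
  then have "var F * restrict_upper F g \<in> I"
  proof cases
    case outside
    then show ?thesis by (simp add: restrict_upper_def)
  next
    case incomparable
    have "restrict_upper F g = var G * var H"
      using incomparable rv by (simp add: restrict_upper_def subst_mult)
    then show ?thesis using incomparable by (simp add: gen_ideal_mult_left gen_incomparable)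
  next
    case element
    have i: "i \<in> E - F" using element upper_iff[OF Ff] by auto
    have "F \<subset> insert i F" using i by auto
    then have "restrict_upper F g = var G * h (insert i F)"
      using element(1) rv[OF element(2)] rh[of "insert i F"] by (simp add: restrict_upper_def subst_mult)
    then show ?thesis using gen_ideal_mult_left[OF var_times_element[OF F(1) i], of "var G"]
      by (simp add: algebra_simps)
  next
    case bottom
    have GF: "G \<in> flats M" "F \<subset> G" "G \<subseteq> E" using bottom upper_iff[OF Ff] flat_subset by auto
    then obtain i where i: "i \<in> G - F" by blast
    have iE: "i \<in> E - F" using i GF by auto
    have "insert i F \<subseteq> E" using iE P_subset[OF F(1)] by auto
    note iFE = this
    \<comment> \<open>A flat of rank one above \<open>F\<close> is generated over \<open>F\<close>
      by any one of its further elements.\<close>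
    have "cl (insert i F) = G"
    proof (rule ccontr)
      assume "cl (insert i F) \<noteq> G"
      moreover have "cl (insert i F) \<subseteq> G" using GF i by (intro cl_minimal) auto
      ultimately have "rank (cl (insert i F)) < rank G"
        using GF cl_flat[OF iFE] by (intro rank_strict_mono) auto
      moreover have "rank (cl (insert i F)) = Suc (rank F)"
        using rank_insert[of F i] iE iFE cl_ident[OF Ff] by auto
      ultimately show False using bottom by simp
    qed
    then have "h G = h (insert i F)" using hvar_cl[OF iFE] by simp
    then show ?thesis using bottom rh[OF GF(2)] var_times_element[OF F(1) iE] by simp
  qed
  from gen_ideal_add[OF gen_ideal_mult_left[OF this, of "restrict_upper F r"] add_gen.IH]
  show ?case by (simp add: restrict_upper_def subst_add subst_mult algebra_simps)
qed

lemma push_ideal_in: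
  assumes "F \<in> P" "F \<noteq> E" "p \<in> interval_ideal M F 1" "p \<in> poly_in (upper F)"
  shows "var F * p \<in> I"
  using push_ideal[OF assms(1-3)] restrict_upper_ident[OF assms(4)] by simp

section \<open>The top degree and the vanishing above it\<close>

lemma deg_fun_hvar_E: "deg_fun (h E ^ n) = (if n = top_degree then 1 else 0)"
proof (cases "n = top_degree")
  case True
  then show ?thesis using deg_fun_two[of E top_degree 0] E_in_P B_rank by simp
next
  case False
  then show ?thesis using deg_fun_homogeneous[OF homogeneous_power[OF hvar_hom]] by simp
qed

text \<open>The hypothesis \<open>van\<close> is vanishing for the contractions, to be supplied by
  induction. It makes every spanning term except the power of \<open>h E\<close> disappear.\<close>

lemma top_cong_aux:
  assumes van: "\<And>F n p. F \<in> P \<Longrightarrow> F \<noteq> E \<Longrightarrow> rank B + \<delta> < rank F \<Longrightarrow> homogeneous n p \<Longrightarrow>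
      n > rank E - rank F - 1 \<Longrightarrow> p \<in> interval_ideal M F 1"
    and "homogeneous n p" "top_degree \<le> n"
  shows "\<exists>c. p - cst c * h E ^ n \<in> I"
  using spanned_all[OF assms(2)] assms(3)
proof (induction rule: spanned.induct)
  case (ideal p n)
  then show ?case by (intro exI[of _ 0]) simp
next
  case (add n p q)
  then obtain a b where "p - cst a * h E ^ n \<in> I" "q - cst b * h E ^ n \<in> I" by auto
  then have "(p - cst a * h E ^ n) + (q - cst b * h E ^ n) \<in> I" by (rule gen_ideal_add)
  then show ?case by (intro exI[of _ "a + b"]) (simp add: algebra_simps)
next
  case (top n c)
  then show ?case by (intro exI[of _ c]) simp
next
  case (flat F k p j n)
  have "p \<in> interval_ideal M F 1"
  proof (rule van)
    \<comment> \<open>The term has degree \<open>Suc (k + j)\<close>, at least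
      \<open>top_degree\<close>, while \<open>k\<close> is less than
      \<open>rank F - rank B - \<delta>\<close>; so \<open>j\<close> is at least
      \<open>rank E - rank F\<close>.\<close>
    show "rank E - rank F - 1 < j"
      using flat rank_less_E[OF flat(1,2)] by linarith
  qed (use flat in auto)
  then have "var F * p \<in> I" using flat by (intro push_ideal_in) auto
  then have "var F * p * h F ^ k \<in> I" by (rule gen_ideal_mult_right)
  then show ?case by (intro exI[of _ 0]) (simp add: algebra_simps)
qed

lemma vanish_aux:
  assumes van: "\<And>F n p. F \<in> P \<Longrightarrow> F \<noteq> E \<Longrightarrow> rank B + \<delta> < rank F \<Longrightarrow> homogeneous n p \<Longrightarrow>
      n > rank E - rank F - 1 \<Longrightarrow> p \<in> interval_ideal M F 1"
    and "homogeneous n p" "top_degree < n"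
  shows "p \<in> I"
proof -
  obtain c where "p - cst c * h E ^ n \<in> I"
    using top_cong_aux[of n p, OF _ assms(2)] van assms(3) by (meson less_imp_le_nat)
  moreover have "cst c * h E ^ n \<in> I"
    using assms(3) by (intro gen_ideal_mult_left hvar_power E_in_P) linarith
  ultimately have "(p - cst c * h E ^ n) + cst c * h E ^ n \<in> I" by (rule gen_ideal_add)
  then show ?thesis by simp
qed

end

text \<open>The induction is on the corank of \<open>B\<close>. It stays at
  \<open>\<delta> = 1\<close>, which is the value for the contraction by a flat of any
  interval.\<close>

lemma contraction_vanish:
  fixes M :: "'a matroid" and p :: "'a set mpoly"
  assumes "flat_interval M B 1" "homogeneous n p" "rk M (ground M) - rk M B - 1 < n"
  shows "p \<in> interval_ideal M B 1"
  using assms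
proof (induction "rk M (ground M) - rk M B" arbitrary: B n p rule: less_induct)
  case less
  interpret flat_interval M B 1 by (rule less.prems(1))
  show ?case
  proof (rule vanish_aux[OF _ less.prems(2,3)])
    fix F n and p :: "'a set mpoly" assume F: "F \<in> P" "F \<noteq> E" "rank B + 1 < rank F" and p: "homogeneous n p" "n > rank E - rank F - 1"
    show "p \<in> interval_ideal M F 1"
    proof (rule less.hyps[OF _ sub_interval[OF F(1,2)] p])
      show "rank E - rank F < rank E - rank B"
        using F(3) rank_less_E[OF F(1,2)] by linarith
    qed
  qed
qed

section \<open>Degrees of elements of a single summand\<close>

context flat_interval
begin

lemma upper_vanish:
  assumes "F \<in> P" "F \<noteq> E" "rank B + \<delta> < rank F" "homogeneous n p" "n > rank E - rank F - 1"
  shows "p \<in> interval_ideal M F 1"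
  by (rule contraction_vanish[OF sub_interval[OF assms(1,2)] assms(4,5)])

text \<open>The top degree is spanned by one power of \<open>h E\<close>, and applying
  \<open>deg_fun\<close>, which is 1 on it, identifies the coefficient. This is what makes the top
  degree one-dimensional.\<close>

lemma top_cong:
  assumes "homogeneous top_degree p"
  shows "p - cst (deg_fun p) * h E ^ top_degree \<in> I"
proof -
  have "\<exists>c. p - cst c * h E ^ top_degree \<in> I"
    by (rule top_cong_aux[OF _ assms order_refl]) (rule upper_vanish)
  then obtain c where c: "p - cst c * h E ^ top_degree \<in> I" by (elim exE)
  have "deg_fun p - c = 0"
    using deg_fun_ideal[OF c] by (simp add: deg_fun_diff deg_fun_cst_mult deg_fun_hvar_E)
  then show ?thesis using c by simp
qed

lemma deg_fun_flat_less:
  assumes F: "F \<in> P" "F \<noteq> E" "k + (rank B + \<delta>) < rank F" and p: "p \<in> poly_in (upper F)"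
  shows "deg_fun (var F * h F ^ k * p) = 0"
  using p
proof (induction rule: mpoly_hom_induct)
  case (hom j p)
  show ?case
  proof (cases "1 + k + j = top_degree")
    case True
    have "p \<in> interval_ideal M F 1"
      using hom F True rank_less_E[OF F(1,2)] by (intro contraction_vanish[OF sub_interval]) auto
    then have "var F * p \<in> I" using hom F by (intro push_ideal_in) auto
    then have "var F * p * h F ^ k \<in> I" by (rule gen_ideal_mult_right)
    then show ?thesis using deg_fun_ideal by (simp add: algebra_simps)
  next
    case False
    have "homogeneous (1 + k + j) (var F * h F ^ k * p)"
      using hom by (intro homogeneous_mult homogeneous_power hvar_hom) auto
    then show ?thesis using deg_fun_homogeneous False by blast
  qed
qed (simp add: distrib_left deg_fun_add)

text \<open>By \<open>top_cong\<close> for the contraction it suffices to take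
  \<open>p = h E ^ j\<close> in the top degree of the contraction, where both sides should be
  1.\<close>

lemma deg_fun_flat_eq:
  assumes F: "F \<in> P" "F \<noteq> E" "k + (rank B + \<delta>) = rank F" and p: "p \<in> poly_in (upper F)"
  shows "deg_fun (var F * h F ^ k * p) = flat_interval.deg_fun M F 1 p"
  using p
proof (induction rule: mpoly_hom_induct)
  case (hom j p)
  interpret Q: flat_interval M F 1 by (rule sub_interval[OF F(1,2)])
  have r: "rank F < rank E" by (rule rank_less_E[OF F(1,2)])
  show ?case
  proof (cases "j = rank E - rank F - 1")
    case False
    have "homogeneous (1 + k + j) (var F * h F ^ k * p)"
      using hom by (intro homogeneous_mult homogeneous_power hvar_hom) auto
    moreover have "1 + k + j \<noteq> top_degree" using False F r by linarith
    ultimately have "deg_fun (var F * h F ^ k * p) = 0" using deg_fun_homogeneous by blast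
    then show ?thesis using Q.deg_fun_homogeneous[OF hom(2) False] by simp
  next
    case True
    let ?c = "Q.deg_fun p"
    have "p - cst ?c * h E ^ j \<in> interval_ideal M F 1"
      using Q.top_cong[of p] hom(2) unfolding True .
    then have "var F * (p - cst ?c * h E ^ j) \<in> I"
      using hom(1) hvar_E_in_upper[OF F(1,2)]
      by (intro push_ideal_in[OF F(1,2)] poly_in_diff poly_in_mult poly_in_power) auto
    then have "var F * (p - cst ?c * h E ^ j) * h F ^ k \<in> I" by (rule gen_ideal_mult_right)
    moreover have "var F * (p - cst ?c * h E ^ j) * h F ^ k =
       var F * h F ^ k * p - cst ?c * (var F * h F ^ k * h E ^ j)" by (simp add: algebra_simps)
    ultimately have 1: "deg_fun (var F * h F ^ k * p) = ?c * deg_fun (var F * h F ^ k * h E ^ j)"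
      using deg_fun_ideal[of "var F * (p - cst ?c * h E ^ j) * h F ^ k"]
      by (simp add: deg_fun_diff deg_fun_cst_mult)
    \<comment> \<open>Expanding one factor \<open>h F\<close> in this element of the ideal relates
      the wanted degree to the terms of the flats strictly above \<open>F\<close>; only
      \<open>E\<close> among them contributes.\<close>
    have "h F ^ Suc k * h E ^ j \<in> I"
      using F by (intro gen_ideal_mult_right hvar_power) auto
    then have "0 = deg_fun (h F ^ Suc k * h E ^ j)" using deg_fun_ideal by simp
    also have "h F ^ Suc k * h E ^ j = - (var F * h F ^ k * h E ^ j) - (\<Sum>G\<in>upper F. var G * h F ^ k * h E ^ j)"
      by (simp add: hvar_usum[OF P_flat[OF F(1)]] usum_def algebra_simps sum_distrib_left sum_distrib_right)
    also have "deg_fun \<dots> = - deg_fun (var F * h F ^ k * h E ^ j) - (\<Sum>G\<in>upper F. deg_fun (var G * h F ^ k * h E ^ j))"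
      by (simp add: deg_fun_diff deg_fun_uminus deg_fun_sum)
    also have "(\<Sum>G\<in>upper F. deg_fun (var G * h F ^ k * h E ^ j)) = (\<Sum>G\<in>upper F. if G = E then - 1 else 0)"
    proof (rule sum.cong[OF refl])
      fix G assume G: "G \<in> upper F"
      show "deg_fun (var G * h F ^ k * h E ^ j) = (if G = E then - 1 else 0)"
      proof (cases "G = E")
        case True
        have "var E * h F ^ k * h E ^ j = - (h F ^ k * h E ^ Suc j)"
          by (simp add: hvar_E)
        moreover have "deg_fun (h F ^ k * h E ^ Suc j) = 1"
          using F r \<open>j = rank E - rank F - 1\<close> by (intro deg_fun_two) auto
        ultimately show ?thesis using True by (simp add: deg_fun_uminus)
      next
        case False
        have GP: "G \<in> P" using G upper_subset_P[OF F(1)] by auto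
        have "rank F < rank G" using G upper_iff[OF P_flat[OF F(1)]] P_subset[OF GP] P_flat[OF F(1)]
          by (intro rank_strict_mono) auto
        \<comment> \<open>\<open>G\<close> has rank at least \<open>rank F + 1\<close>, so the
          \<open>j = rank E - rank F - 1\<close> factors \<open>h E\<close> suffice to exhaust
          \<open>E\<close> over \<open>G\<close>.\<close>
        then have "var G * h E ^ j \<in> I"
          using False GP P_subset[OF GP] ground_flat B_subset \<open>j = rank E - rank F - 1\<close>
          by (intro var_times_hvar_power) (auto simp: Int_absorb1)
        then have "var G * h E ^ j * h F ^ k \<in> I" by (rule gen_ideal_mult_right)
        then show ?thesis using deg_fun_ideal False by (simp add: algebra_simps)
      qed
    qed
    also have "\<dots> = - 1" using E_in_upper[OF F(1,2)] finite_upper by simp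
    finally show ?thesis using 1 by simp
  qed
next
  case (add p q)
  interpret Q: flat_interval M F 1 by (rule sub_interval[OF F(1,2)])
  show ?case using add by (simp add: distrib_left deg_fun_add Q.deg_fun_add)
qed

text \<open>The top degree of the localization at \<open>F\<close>, so that
  \<open>k < mult_bound F\<close> is the truncation in the definition of \<open>J\<close>. It is
  zero for the bottom flats, which have no summand.\<close>

definition mult_bound :: "'a set \<Rightarrow> nat" where
  "mult_bound F = rank F - (rank B + \<delta>)"

abbreviation "inner_flats \<equiv> P - {E}"

definition total :: "(nat \<Rightarrow> rat) \<Rightarrow> ('a set \<Rightarrow> nat \<Rightarrow> 'a set mpoly) \<Rightarrow> 'a set mpoly" where
  "total c f = (\<Sum>j\<le>top_degree. cst (c j) * h E ^ j) +
     (\<Sum>F\<in>inner_flats. \<Sum>k<mult_bound F. var F * h F ^ k * f F k)"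

definition coeffs_in :: "('a set \<Rightarrow> nat \<Rightarrow> 'a set mpoly) \<Rightarrow> bool" where
  "coeffs_in f \<longleftrightarrow> (\<forall>F\<in>inner_flats. \<forall>k. f F k \<in> poly_in (upper F))"

lemma coeffs_inD: "coeffs_in f \<Longrightarrow> F \<in> inner_flats \<Longrightarrow> f F k \<in> poly_in (upper F)"
  by (simp add: coeffs_in_def)

lemma total_add: "total (\<lambda>j. a j + b j) (\<lambda>F k. f F k + g F k) = total a f + total b g"
  by (simp add: total_def distrib_left distrib_right sum.distrib)

lemma mult_bound_less: "k < mult_bound F \<longleftrightarrow> k + (rank B + \<delta>) < rank F"
  by (auto simp: mult_bound_def)

lemma ex_total_hom: "spanned n p \<Longrightarrow> \<exists>c f. coeffs_in f \<and> p - total c f \<in> I"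
proof (induction rule: spanned.induct)
  case (ideal p n)
  have "total (\<lambda>_. 0) (\<lambda>_ _. 0) = 0" by (simp add: total_def)
  then show ?case using ideal by (intro exI[of _ "\<lambda>_. 0"] exI[of _ "\<lambda>_ _. 0"]) (simp add: coeffs_in_def)
next
  case (add n p q)
  from add.IH obtain a f b g where *: "coeffs_in f" "p - total a f \<in> I" "coeffs_in g" "q - total b g \<in> I"
    by (elim exE conjE)
  have "(p - total a f) + (q - total b g) \<in> I" using *(2,4) by (rule gen_ideal_add)
  moreover have "coeffs_in (\<lambda>F k. f F k + g F k)"
    unfolding coeffs_in_def using coeffs_inD[OF *(1)] coeffs_inD[OF *(3)] by (intro ballI allI poly_in_add)
  ultimately show ?case
    by (intro exI[of _ "\<lambda>j. a j + b j"] exI[of _ "\<lambda>F k. f F k + g F k"]) (simp add: total_add algebra_simps)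
next
  case (top n c)
  show ?case
  proof (cases "n \<le> top_degree")
    case True
    have "(\<Sum>j\<le>top_degree. cst (if j = n then c else 0) * h E ^ j) = (\<Sum>j\<le>top_degree. if j = n then cst c * h E ^ n else 0)"
      by (intro sum.cong) auto
    also have "\<dots> = cst c * h E ^ n" using True by simp
    finally have "total (\<lambda>j. if j = n then c else 0) (\<lambda>_ _. 0) = cst c * h E ^ n"
      by (simp add: total_def)
    then show ?thesis
      by (intro exI[of _ "\<lambda>j. if j = n then c else 0"] exI[of _ "\<lambda>_ _. 0"]) (simp add: coeffs_in_def)
  next
    case False
    have "cst c * h E ^ n \<in> I"
      using False by (intro gen_ideal_mult_left hvar_power E_in_P) linarith
    moreover have "total (\<lambda>_. 0) (\<lambda>_ _. 0) = 0" by (simp add: total_def)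
    ultimately show ?thesis by (intro exI[of _ "\<lambda>_. 0"] exI[of _ "\<lambda>_ _. 0"]) (simp add: coeffs_in_def)
  qed
next
  case (flat F k p j n)
  define f where "f = (\<lambda>G l. if G = F \<and> l = k then p else 0)"
  have k: "k < mult_bound F" using flat by (simp add: mult_bound_less)
  have "(\<Sum>G\<in>inner_flats. \<Sum>l<mult_bound G. var G * h G ^ l * f G l) =
     (\<Sum>G\<in>inner_flats. if G = F then var F * h F ^ k * p else 0)"
  proof (rule sum.cong[OF refl])
    fix G
    show "(\<Sum>l<mult_bound G. var G * h G ^ l * f G l) = (if G = F then var F * h F ^ k * p else 0)"
    proof (cases "G = F")
      case True
      have "(\<Sum>l<mult_bound F. var F * h F ^ l * f F l) = (\<Sum>l<mult_bound F. if l = k then var F * h F ^ k * p else 0)"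
        by (intro sum.cong) (auto simp: f_def)
      then show ?thesis using k True by simp
    qed (simp add: f_def)
  qed
  also have "\<dots> = var F * h F ^ k * p" using flat finite_P by simp
  finally have "total (\<lambda>_. 0) f = var F * h F ^ k * p" by (simp add: total_def)
  moreover have "coeffs_in f" using flat by (simp add: coeffs_in_def f_def)
  ultimately show ?case by (intro exI[of _ "\<lambda>_. 0"] exI[of _ f]) simp
qed

lemma ex_total: "\<exists>c f. coeffs_in f \<and> p - total c f \<in> I"
proof (induction p rule: mpoly_hom_induct[OF poly_in_UNIV])
  case (1 n p)
  then show ?case using ex_total_hom[OF spanned_all] by simp
next
  case (2 p q)
  then obtain a f b g where *: "coeffs_in f" "p - total a f \<in> I" "coeffs_in g" "q - total b g \<in> I"
    by (elim exE conjE)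
  have "(p - total a f) + (q - total b g) \<in> I" using *(2,4) by (rule gen_ideal_add)
  moreover have "coeffs_in (\<lambda>F k. f F k + g F k)"
    unfolding coeffs_in_def using coeffs_inD[OF *(1)] coeffs_inD[OF *(3)] by (intro ballI allI poly_in_add)
  ultimately show ?case
    by (intro exI[of _ "\<lambda>j. a j + b j"] exI[of _ "\<lambda>F k. f F k + g F k"]) (simp add: total_add algebra_simps)
qed

lemma inner_props:
  assumes "F \<in> inner_flats"
  shows "F \<in> P" "F \<noteq> E" "h E \<in> poly_in (upper F)"
  using assms hvar_E_in_upper by auto

lemma flat_orthogonal_top:
  assumes "F \<in> inner_flats" "k < mult_bound F" "p \<in> poly_in (upper F)"
  shows "deg_fun (var F * h F ^ k * p * h E ^ j) = 0"
proof -
  have "deg_fun (var F * h F ^ k * (p * h E ^ j)) = 0"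
    using assms inner_props[OF assms(1)]
    by (intro deg_fun_flat_less poly_in_mult poly_in_power) (simp_all add: mult_bound_less)
  then show ?thesis by (simp add: mult.assoc)
qed

text \<open>For \<open>F\<close> below \<open>G\<close> the whole second factor is a polynomial
  above \<open>F\<close> and can be absorbed into \<open>p\<close>; the exponent of
  \<open>h F\<close> stays too small to give a nonzero degree.\<close>

lemma flat_orthogonal_flat:
  assumes F: "F \<in> inner_flats" "k < mult_bound F" "p \<in> poly_in (upper F)"
    and G: "G \<in> inner_flats" "l < mult_bound G" "q \<in> poly_in (upper G)"
    and "F \<noteq> G"
  shows "deg_fun ((var F * h F ^ k * p) * (var G * h G ^ l * q)) = 0"
proof -
  have key: "deg_fun ((var F * h F ^ k * p) * (var G * h G ^ l * q)) = 0"
    if F: "F \<in> inner_flats" "k < mult_bound F" "p \<in> poly_in (upper F)"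
      and G: "G \<in> inner_flats" "l < mult_bound G" "q \<in> poly_in (upper G)"
      and "F \<subset> G" for F G k l p q
  proof -
    have Ff: "F \<in> flats M" "G \<in> flats M" using F G P_flat by auto
    have "G \<in> upper F" "upper G \<subseteq> upper F"
      using that upper_iff[OF Ff(1)] upper_iff[OF Ff(2)] Ff by auto
    then have "p * (var G * h G ^ l * q) \<in> poly_in (upper F)"
      using F(3) poly_in_mono[OF \<open>upper G \<subseteq> upper F\<close> G(3)] hvar_in_upper[OF Ff(1)]
      by (intro poly_in_mult poly_in_power poly_in_var) auto
    then have "deg_fun (var F * h F ^ k * (p * (var G * h G ^ l * q))) = 0"
      using F inner_props[OF F(1)] by (intro deg_fun_flat_less) (simp_all add: mult_bound_less)
    then show ?thesis by (simp add: mult.assoc)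
  qed
  consider "F \<subset> G" | "G \<subset> F" | "\<not> F \<subseteq> G" "\<not> G \<subseteq> F" using \<open>F \<noteq> G\<close> by blast
  then show ?thesis
  proof cases
    case 1
    then show ?thesis by (rule key[OF F G])
  next
    case 2
    have "deg_fun ((var G * h G ^ l * q) * (var F * h F ^ k * p)) = 0" by (rule key[OF G F 2])
    then show ?thesis by (simp only: mult.commute)
  next
    case 3
    have "var F * var G * (h F ^ k * p * h G ^ l * q) \<in> I"
      by (rule gen_ideal_mult_right[OF gen_incomparable[OF 3]])
    moreover have "(var F * h F ^ k * p) * (var G * h G ^ l * q) = var F * var G * (h F ^ k * p * h G ^ l * q)"
      by (simp add: algebra_simps)
    ultimately have "(var F * h F ^ k * p) * (var G * h G ^ l * q) \<in> I" by (simp only:)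
    then show ?thesis by (rule deg_fun_ideal)
  qed
qed

text \<open>\<open>PD\<close> is duality for the contractions, to be supplied by induction. Pairing
  with elements of one summand isolates its component. The coefficient of \<open>h E ^ j\<close> is
  detected by the complementary power, and the coefficients at \<open>F\<close> are obtained from
  the largest exponent downwards.\<close>

lemma total_coeffs:
  assumes f: "coeffs_in f"
    and orth: "\<And>t. deg_fun (total c f * t) = 0"
    and PD: "\<And>F p. F \<in> inner_flats \<Longrightarrow> rank B + \<delta> < rank F \<Longrightarrow>
        (\<And>q. flat_interval.deg_fun M F 1 (p * q) = 0) \<Longrightarrow> p \<in> interval_ideal M F 1"
  shows "j \<le> top_degree \<Longrightarrow> c j = 0"
    and "F \<in> inner_flats \<Longrightarrow> k < mult_bound F \<Longrightarrow> f F k \<in> interval_ideal M F 1"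
proof -
  assume j: "j \<le> top_degree"
  have "0 = deg_fun (total c f * h E ^ (top_degree - j))" using orth by simp
  also have "total c f * h E ^ (top_degree - j) = (\<Sum>i\<le>top_degree. cst (c i) * h E ^ (i + (top_degree - j))) +
     (\<Sum>F\<in>inner_flats. \<Sum>k<mult_bound F. var F * h F ^ k * f F k * h E ^ (top_degree - j))"
    by (simp add: total_def distrib_right sum_distrib_right power_add mult.assoc)
  also have "deg_fun \<dots> = (\<Sum>i\<le>top_degree. c i * deg_fun (h E ^ (i + (top_degree - j)))) +
     (\<Sum>F\<in>inner_flats. \<Sum>k<mult_bound F. deg_fun (var F * h F ^ k * f F k * h E ^ (top_degree - j)))"
    by (simp only: deg_fun_add deg_fun_sum deg_fun_cst_mult)
  also have "(\<Sum>F\<in>inner_flats. \<Sum>k<mult_bound F. deg_fun (var F * h F ^ k * f F k * h E ^ (top_degree - j))) = 0"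
    by (intro sum.neutral ballI flat_orthogonal_top coeffs_inD[OF f]) simp_all
  also have "(\<Sum>i\<le>top_degree. c i * deg_fun (h E ^ (i + (top_degree - j)))) = (\<Sum>i\<le>top_degree. if i = j then c j else 0)"
    using j by (intro sum.cong) (auto simp: deg_fun_hvar_E)
  also have "\<dots> = c j" using j by simp
  finally show "c j = 0" by simp
next
  assume F: "F \<in> inner_flats" and k: "k < mult_bound F"
  let ?N = "mult_bound F"
  note FP = inner_props[OF F]
  interpret Q: flat_interval M F 1 by (rule sub_interval[OF FP(1,2)])
  have main: "deg_fun (\<Sum>k<?N. (var F * h F ^ k * f F k) * (var F * h F ^ l * q)) = 0"
    if l: "l < ?N" and q: "q \<in> poly_in (upper F)" for l q
  proof -
    let ?t = "var F * h F ^ l * q"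
    have "0 = deg_fun (total c f * ?t)" using orth by simp
    also have "total c f * ?t = (\<Sum>i\<le>top_degree. cst (c i) * (?t * h E ^ i)) +
       (\<Sum>G\<in>inner_flats. \<Sum>k<mult_bound G. (var G * h G ^ k * f G k) * ?t)"
      by (simp add: total_def distrib_right sum_distrib_right) (simp add: algebra_simps)
    also have "deg_fun \<dots> = (\<Sum>i\<le>top_degree. c i * deg_fun (?t * h E ^ i)) +
       (\<Sum>G\<in>inner_flats. \<Sum>k<mult_bound G. deg_fun ((var G * h G ^ k * f G k) * ?t))"
      by (simp only: deg_fun_add deg_fun_sum deg_fun_cst_mult)
    also have "(\<Sum>i\<le>top_degree. c i * deg_fun (?t * h E ^ i)) = 0"
      using flat_orthogonal_top[OF F l q] by simp
    also have "(\<Sum>G\<in>inner_flats. \<Sum>k<mult_bound G. deg_fun ((var G * h G ^ k * f G k) * ?t)) =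
       (\<Sum>G\<in>inner_flats. if G = F then \<Sum>k<?N. deg_fun ((var F * h F ^ k * f F k) * ?t) else 0)"
    proof (rule sum.cong[OF refl])
      fix G assume G: "G \<in> inner_flats"
      show "(\<Sum>k<mult_bound G. deg_fun ((var G * h G ^ k * f G k) * ?t)) =
        (if G = F then \<Sum>k<?N. deg_fun ((var F * h F ^ k * f F k) * ?t) else 0)"
      proof (cases "G = F")
        case False
        have "(\<Sum>k<mult_bound G. deg_fun ((var G * h G ^ k * f G k) * ?t)) = 0"
          by (intro sum.neutral ballI flat_orthogonal_flat[OF G _ coeffs_inD[OF f G] F l q False]) simp
        then show ?thesis using False by simp
      qed simp
    qed
    also have "\<dots> = (\<Sum>k<?N. deg_fun ((var F * h F ^ k * f F k) * ?t))"
      using F finite_P by simp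
    finally show ?thesis by (simp add: deg_fun_sum)
  qed
  \<comment> \<open>The exponent \<open>k0 = ?N - 1 - m\<close> is tested against
    \<open>var F * h F ^ m * q\<close>: the two exponents of \<open>h F\<close> and the one gained
    from the square of \<open>var F\<close> add up to exactly \<open>?N\<close>.\<close>
  have claim: "m < ?N \<Longrightarrow> f F (?N - 1 - m) \<in> interval_ideal M F 1" for m
  proof (induction m rule: less_induct)
    case (less m)
    define k0 where "k0 = ?N - 1 - m"
    have k0: "k0 < ?N" "k0 + m + 1 = ?N" using less.prems by (auto simp: k0_def)
    have FN: "rank B + \<delta> < rank F" "?N + (rank B + \<delta>) = rank F"
      using k0 by (auto simp: mult_bound_def)
    have "Q.deg_fun (f F k0 * q) = 0" if q: "q \<in> poly_in (upper F)" for q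
    proof -
      \<comment> \<open>After the square of \<open>var F\<close> is expanded, exponents
        \<open>k < k0\<close> stay below \<open>?N\<close> and give degree zero. At
        \<open>k0\<close> the first part reaches \<open>?N\<close> and becomes a degree in the
        contraction. For \<open>k > k0\<close> the coefficient is already in the ideal.\<close>
      have term_eq: "deg_fun ((var F * h F ^ k * f F k) * (var F * h F ^ m * q)) =
          (if k = k0 then - Q.deg_fun (f F k0 * q) else 0)" if k: "k < ?N" for k
      proof -
        have fq: "f F k * q \<in> poly_in (upper F)" using coeffs_inD[OF f F] q by (rule poly_in_mult)
        have ufq: "usum F * (f F k * q) \<in> poly_in (upper F)" using usum_in fq by (rule poly_in_mult)
        have "(var F * h F ^ k * f F k) * (var F * h F ^ m * q) =
           var F * (var F * h F ^ (k + m) * (f F k * q))" by (simp add: algebra_simps power_add)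
        also have "\<dots> = - (var F * h F ^ (k + m + 1) * (f F k * q)) - var F * h F ^ (k + m) * (usum F * (f F k * q))"
        proof -
          have v: "var F = - h F - usum F" by (simp add: hvar_usum[OF P_flat[OF FP(1)]])
          show ?thesis by (subst (2) v) (simp add: algebra_simps One_nat_def)
        qed
        finally have e: "deg_fun ((var F * h F ^ k * f F k) * (var F * h F ^ m * q)) =
           - deg_fun (var F * h F ^ (k + m + 1) * (f F k * q)) - deg_fun (var F * h F ^ (k + m) * (usum F * (f F k * q)))"
          by (simp only: deg_fun_diff deg_fun_uminus)
        consider "k < k0" | "k = k0" | "k > k0" by linarith
        then show ?thesis
        proof cases
          case 1
          have "deg_fun (var F * h F ^ (k + m + 1) * (f F k * q)) = 0"
            using 1 k0 FN by (intro deg_fun_flat_less[OF FP(1,2) _ fq]) linarith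
          moreover have "deg_fun (var F * h F ^ (k + m) * (usum F * (f F k * q))) = 0"
            using 1 k0 FN by (intro deg_fun_flat_less[OF FP(1,2) _ ufq]) linarith
          ultimately show ?thesis using e 1 by simp
        next
          case 2
          have "deg_fun (var F * h F ^ (k + m + 1) * (f F k * q)) = Q.deg_fun (f F k * q)"
            using 2 k0 FN by (intro deg_fun_flat_eq[OF FP(1,2) _ fq]) linarith
          moreover have "deg_fun (var F * h F ^ (k + m) * (usum F * (f F k * q))) = 0"
            using 2 k0 FN by (intro deg_fun_flat_less[OF FP(1,2) _ ufq]) linarith
          ultimately show ?thesis using e 2 by simp
        next
          case 3
          have "f F (?N - 1 - (?N - 1 - k)) \<in> interval_ideal M F 1"
            using 3 k k0 by (intro less.IH) linarith+
          moreover have "?N - 1 - (?N - 1 - k) = k" using k by linarith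
          ultimately have "var F * f F k \<in> I"
            by (intro push_ideal_in[OF FP(1,2) _ coeffs_inD[OF f F]]) simp
          then have "var F * f F k * (h F ^ k * (var F * h F ^ m * q)) \<in> I" by (rule gen_ideal_mult_right)
          moreover have "var F * f F k * (h F ^ k * (var F * h F ^ m * q)) =
             (var F * h F ^ k * f F k) * (var F * h F ^ m * q)" by (simp add: algebra_simps)
          ultimately show ?thesis using deg_fun_ideal 3 by simp
        qed
      qed
      have "0 = (\<Sum>k<?N. deg_fun ((var F * h F ^ k * f F k) * (var F * h F ^ m * q)))"
        using main[OF less.prems q] by (simp add: deg_fun_sum)
      also have "\<dots> = (\<Sum>k<?N. if k = k0 then - Q.deg_fun (f F k0 * q) else 0)"
        using term_eq by (intro sum.cong) auto
      also have "\<dots> = - Q.deg_fun (f F k0 * q)" using k0 by simp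
      finally show ?thesis by simp
    qed
    note restricted = this
    \<comment> \<open>Duality has to be tested against all polynomials, and an arbitrary
      \<open>q\<close> is congruent to its restriction to the variables above
      \<open>F\<close>.\<close>
    have "Q.deg_fun (f F k0 * q) = 0" for q
    proof -
      have "f F k0 * (q - restrict_upper F q) \<in> interval_ideal M F 1"
        by (intro gen_ideal_mult_left restrict_upper_cong)
      then have "Q.deg_fun (f F k0 * q - f F k0 * restrict_upper F q) = 0"
        using Q.deg_fun_ideal by (simp add: right_diff_distrib)
      then show ?thesis using restricted[OF restrict_upper_in] by (simp add: Q.deg_fun_diff)
    qed
    then show ?case using PD[OF F FN(1)] by (simp add: k0_def)
  qed
  from claim[of "?N - 1 - k"] show "f F k \<in> interval_ideal M F 1"
  proof -
    have "?N - 1 - (?N - 1 - k) = k" "?N - 1 - k < ?N" using k by linarith+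
    then show ?thesis using claim[of "?N - 1 - k"] by simp
  qed
qed

lemma summand_in_ideal:
  assumes "F \<in> inner_flats" "p \<in> interval_ideal M F 1" "p \<in> poly_in (upper F)"
  shows "var F * h F ^ k * p \<in> I"
proof -
  have "var F * p * h F ^ k \<in> I"
    using assms inner_props[OF assms(1)] by (intro gen_ideal_mult_right push_ideal_in) auto
  then show ?thesis by (simp add: algebra_simps)
qed

lemma nondegenerate_aux:
  assumes PD: "\<And>F p. F \<in> inner_flats \<Longrightarrow> rank B + \<delta> < rank F \<Longrightarrow>
        (\<And>q. flat_interval.deg_fun M F 1 (p * q) = 0) \<Longrightarrow> p \<in> interval_ideal M F 1"
    and p: "\<And>q. deg_fun (p * q) = 0"
  shows "p \<in> I"
proof -
  obtain c f where cf: "coeffs_in f" "p - total c f \<in> I" using ex_total by blast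
  have "deg_fun (total c f * t) = 0" for t
  proof -
    have "(p - total c f) * t \<in> I" using cf(2) by (rule gen_ideal_mult_right)
    then have "deg_fun (p * t - total c f * t) = 0" using deg_fun_ideal by (simp add: left_diff_distrib)
    then show ?thesis using p by (simp add: deg_fun_diff)
  qed
  note orth = this
  have c0: "c j = 0" if "j \<le> top_degree" for j
    by (rule total_coeffs(1)[OF cf(1) orth _ that]) (rule PD)
  have f0: "f F k \<in> interval_ideal M F 1" if "F \<in> inner_flats" "k < mult_bound F" for F k
    by (rule total_coeffs(2)[OF cf(1) orth _ that]) (rule PD)
  have "(\<Sum>F\<in>inner_flats. \<Sum>k<mult_bound F. var F * h F ^ k * f F k) \<in> I"
    by (intro gen_ideal_sum summand_in_ideal f0 coeffs_inD[OF cf(1)]) simp_all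
  moreover have "(\<Sum>j\<le>top_degree. cst (c j) * h E ^ j) = 0"
  proof (intro sum.neutral ballI)
    fix j :: nat assume "j \<in> {..top_degree}"
    then have "j \<le> top_degree" by (rule atMost_iff[THEN iffD1])
    then have "c j = 0" by (rule c0)
    then show "cst (c j) * h E ^ j = 0" by simp
  qed
  ultimately have "total c f \<in> I" by (simp add: total_def)
  then have "(p - total c f) + total c f \<in> I" using cf(2) by (intro gen_ideal_add)
  then show ?thesis by simp
qed

end

text \<open>Poincare duality for the contractions, by induction on the corank. A polynomial is
  written as a sum over the summands, and by the induction hypothesis each component that pairs to
  zero vanishes.\<close>

lemma contraction_nondegenerate:
  fixes M :: "'a matroid" and p :: "'a set mpoly"
  assumes "flat_interval M B 1" "\<And>q. flat_interval.deg_fun M B 1 (p * q) = 0"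
  shows "p \<in> interval_ideal M B 1"
  using assms
proof (induction "rk M (ground M) - rk M B" arbitrary: B p rule: less_induct)
  case less
  interpret flat_interval M B 1 by (rule less.prems(1))
  show ?case
  proof (rule nondegenerate_aux[OF _ less.prems(2)])
    fix F and p :: "'a set mpoly"
    assume F: "F \<in> inner_flats" "rank B + 1 < rank F" and p: "\<And>q. flat_interval.deg_fun M F 1 (p * q) = 0"
    note FP = inner_props[OF F(1)]
    show "p \<in> interval_ideal M F 1"
    proof (rule less.hyps[OF _ sub_interval[OF FP(1,2)] p])
      show "rank E - rank F < rank E - rank B"
        using F(2) rank_less_E[OF FP(1,2)] by linarith
    qed
  qed
qed

section \<open>Directness of the sum and degrees of flags\<close>

context flat_interval
begin

lemma upper_nondegenerate:
  assumes "F \<in> inner_flats" "\<And>q. flat_interval.deg_fun M F 1 (p * q) = 0"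
  shows "p \<in> interval_ideal M F 1"
  by (rule contraction_nondegenerate[OF sub_interval[OF inner_props(1,2)[OF assms(1)]] assms(2)])

text \<open>Directness: an element of the ideal pairs to zero with everything, so its components
  vanish by duality in the contractions.\<close>

lemma total_in_ideal:
  assumes f: "coeffs_in f" and t: "total c f \<in> I"
  shows "j \<le> top_degree \<Longrightarrow> c j = 0"
    and "F \<in> inner_flats \<Longrightarrow> k < mult_bound F \<Longrightarrow> var F * h F ^ k * f F k \<in> I"
proof -
  have "deg_fun (total c f * q) = 0" for q
    by (rule deg_fun_ideal[OF gen_ideal_mult_right[OF t]])
  note coeffs = total_coeffs[OF f this upper_nondegenerate]
  show "j \<le> top_degree \<Longrightarrow> c j = 0" by (rule coeffs(1))
  show "F \<in> inner_flats \<Longrightarrow> k < mult_bound F \<Longrightarrow> var F * h F ^ k * f F k \<in> I"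
    by (intro summand_in_ideal coeffs(2) coeffs_inD[OF f])
qed

lemma chain_rank_bound:
  assumes "finite C" "C \<subseteq> flats M" "\<And>F G. F \<in> C \<Longrightarrow> G \<in> C \<Longrightarrow> F \<subseteq> G \<or> G \<subseteq> F"
    "\<And>F. F \<in> C \<Longrightarrow> r \<le> rank F \<and> rank F < s"
  shows "card C \<le> s - r"
proof -
  have "inj_on rank C"
  proof (rule inj_onI, rule ccontr)
    fix F G assume FG: "F \<in> C" "G \<in> C" "rank F = rank G" "F \<noteq> G"
    then have "F \<in> flats M" "G \<in> flats M" using assms(2) by auto
    then show False
      using assms(3)[OF FG(1,2)] FG(3,4) rank_strict_mono[of F G] rank_strict_mono[of G F] flat_subset by fastforce
  qed
  then have "card C = card (rank ` C)" by (simp add: card_image)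
  also have "\<dots> \<le> card {r..<s}" using assms(4) by (intro card_mono) auto
  finally show ?thesis by simp
qed

text \<open>Counting ranks shows that a flag of full length starts with a bottom flat. For such a
  flat the exponent \<open>k = 0\<close> is the borderline one, so \<open>deg_fun_flat_eq\<close>
  strips off its variable and passes to the contraction.\<close>

lemma deg_fun_flag_step:
  assumes C: "C \<subseteq> inner_flats" "\<And>F G. F \<in> C \<Longrightarrow> G \<in> C \<Longrightarrow> F \<subseteq> G \<or> G \<subseteq> F" "card C = top_degree" "C \<noteq> {}"
  shows "\<exists>F\<in>C. F \<in> inner_flats \<and> C - {F} \<subseteq> upper F - {E} \<and> card (C - {F}) = rank E - rank F - 1 \<and>
     rank F = rank B + \<delta> \<and> deg_fun (\<Prod>G\<in>C. var G) = flat_interval.deg_fun M F 1 (\<Prod>G\<in>C - {F}. var G)"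
proof -
  have fin: "finite C" using C(1) finite_P finite_subset by blast
  obtain F where F: "F \<in> C" "\<And>G. G \<in> C \<Longrightarrow> G \<subseteq> F \<Longrightarrow> F = G"
    using finite_has_minimal[OF fin C(4)] by blast
  have min: "F \<subseteq> G" if "G \<in> C" for G using C(2)[OF F(1) that] F(2)[OF that] by auto
  have Fi: "F \<in> inner_flats" using F C(1) by auto
  note FP = inner_props[OF Fi]
  have rank: "rank G < rank E" "G \<in> flats M" "G \<subseteq> E" "rank F \<le> rank G" if "G \<in> C" for G
  proof -
    have G: "G \<in> P" "G \<noteq> E" using that C(1) by auto
    show "rank G < rank E" "G \<in> flats M" "G \<subseteq> E"
      using rank_less_E[OF G] P_flat[OF G(1)] P_subset[OF G(1)] by auto
    then show "rank F \<le> rank G" using min[OF that] by (intro rank_mono)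
  qed
  have "card C \<le> rank E - rank F"
    using rank C(2) by (intro chain_rank_bound[OF fin]) auto
  then have r: "rank F = rank B + \<delta>"
    using C(3) P_rank[OF FP(1)] rank(1)[OF F(1)] by linarith
  have up: "C - {F} \<subseteq> upper F - {E}"
  proof
    fix G assume G: "G \<in> C - {F}"
    then show "G \<in> upper F - {E}"
      using C(1) min[of G] rank(2)[of G] upper_iff[OF P_flat[OF FP(1)]] by auto
  qed
  have "(\<Prod>G\<in>C. var G) = var F * h F ^ 0 * (\<Prod>G\<in>C - {F}. var G)"
    using prod.remove[OF fin F(1), of var] by simp
  also have "deg_fun \<dots> = flat_interval.deg_fun M F 1 (\<Prod>G\<in>C - {F}. var G)"
    using r up by (intro deg_fun_flat_eq FP poly_in_prod poly_in_var) auto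
  finally have "deg_fun (\<Prod>G\<in>C. var G) = flat_interval.deg_fun M F 1 (\<Prod>G\<in>C - {F}. var G)" .
  moreover have "card (C - {F}) = rank E - rank F - 1"
    using fin F(1) C(3) r by (simp add: One_nat_def)
  ultimately show ?thesis using F(1) Fi up r by blast
qed

end

lemma contraction_deg_flag:
  fixes M :: "'a matroid"
  assumes "flat_interval M B 1" "C \<subseteq> interval_flats M B 1 - {ground M}"
    "\<And>F G. F \<in> C \<Longrightarrow> G \<in> C \<Longrightarrow> F \<subseteq> G \<or> G \<subseteq> F" "card C = rk M (ground M) - rk M B - 1"
  shows "flat_interval.deg_fun M B 1 (\<Prod>G\<in>C. var G) = 1"
  using assms
proof (induction "card C" arbitrary: B C)
  case 0
  interpret flat_interval M B 1 by (rule 0(2))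
  have "finite C" by (rule finite_subset[OF 0(3)]) (use finite_P in simp)
  then have "C = {}" using 0(1) by simp
  then show ?case using 0(1,5) deg_fun_hvar_E[of 0] by simp
next
  case (Suc n)
  interpret flat_interval M B 1 by (rule Suc.prems(1))
  have ne: "C \<noteq> {}" using Suc(2) by auto
  obtain F where F: "F \<in> C" "F \<in> inner_flats" "C - {F} \<subseteq> upper F - {E}" "card (C - {F}) = rank E - rank F - 1"
    "deg_fun (\<Prod>G\<in>C. var G) = flat_interval.deg_fun M F 1 (\<Prod>G\<in>C - {F}. var G)"
    using deg_fun_flag_step[OF Suc.prems(2,3,4) ne] by blast
  have "n = card (C - {F})" using Suc(2) F(1) by (simp add: card_Diff_singleton One_nat_def)
  then have "flat_interval.deg_fun M F 1 (\<Prod>G\<in>C - {F}. var G) = 1"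
    using Suc.prems(3) F by (intro Suc.hyps(1) sub_interval) auto
  then show ?case using F(5) by simp
qed

context flat_interval
begin

lemma deg_fun_flag:
  assumes C: "C \<subseteq> inner_flats" "\<And>F G. F \<in> C \<Longrightarrow> G \<in> C \<Longrightarrow> F \<subseteq> G \<or> G \<subseteq> F" "card C = top_degree"
  shows "deg_fun (\<Prod>G\<in>C. var G) = 1"
proof (cases "C = {}")
  case True
  then show ?thesis using C(3) deg_fun_hvar_E[of 0] by simp
next
  case False
  obtain F where F: "F \<in> C" "F \<in> inner_flats" "C - {F} \<subseteq> upper F - {E}" "card (C - {F}) = rank E - rank F - 1"
    "deg_fun (\<Prod>G\<in>C. var G) = flat_interval.deg_fun M F 1 (\<Prod>G\<in>C - {F}. var G)"
    using deg_fun_flag_step[OF C False] by blast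
  have "flat_interval.deg_fun M F 1 (\<Prod>G\<in>C - {F}. var G) = 1"
    using C(2) F by (intro contraction_deg_flag sub_interval) auto
  then show ?thesis using F(5) by simp
qed

end

section \<open>Presentations of rational vector spaces\<close>

definition scl :: "rat \<Rightarrow> ('k \<Rightarrow>\<^sub>0 rat) \<Rightarrow> 'k \<Rightarrow>\<^sub>0 rat" where
  "scl c = Poly_Mapping.map ((*) c)"

lemma lookup_scl [simp]: "Poly_Mapping.lookup (scl c p) k = c * Poly_Mapping.lookup p k"
  by (simp add: scl_def Poly_Mapping.map.rep_eq when_def)

lemma scl_simps [simp]: "scl c 0 = 0" "scl 0 p = 0" "scl 1 p = p" "scl (- 1) p = - p"
  "scl c (p + q) = scl c p + scl c q" "scl c (p - q) = scl c p - scl c q" "scl c (scl d p) = scl (c * d) p"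
  "scl c (Poly_Mapping.single k d) = Poly_Mapping.single k (c * d)"
  by (auto intro!: poly_mapping_eqI simp: lookup_add lookup_minus lookup_single when_def algebra_simps)

lemma scl_cst: "scl c p = cst c * p"
  by (simp add: scl_def smult_conv)

text \<open>A vector space known only through a surjection \<open>\<Phi>\<close> from a space
  \<open>D\<close> of finitely supported functions. Equality of images is congruence modulo
  \<open>J\<close>, so computations with cosets turn into computations with representatives.\<close>

locale presentation =
  fixes R :: "(rat, 'b) module" and \<Phi> :: "('k \<Rightarrow>\<^sub>0 rat) \<Rightarrow> 'b" and D J :: "('k \<Rightarrow>\<^sub>0 rat) set"
  assumes D_zero: "0 \<in> D" and D_add: "x \<in> D \<Longrightarrow> y \<in> D \<Longrightarrow> x + y \<in> D" and D_scl: "x \<in> D \<Longrightarrow> scl c x \<in> D"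
    and carrier_eq: "carrier R = \<Phi> ` D"
    and Phi_add: "x \<in> D \<Longrightarrow> y \<in> D \<Longrightarrow> \<Phi> x \<oplus>\<^bsub>R\<^esub> \<Phi> y = \<Phi> (x + y)"
    and Phi_zero: "\<zero>\<^bsub>R\<^esub> = \<Phi> 0"
    and Phi_scl: "x \<in> D \<Longrightarrow> c \<odot>\<^bsub>R\<^esub> \<Phi> x = \<Phi> (scl c x)"
    and Phi_eq_iff: "x \<in> D \<Longrightarrow> y \<in> D \<Longrightarrow> \<Phi> x = \<Phi> y \<longleftrightarrow> x - y \<in> J"
begin

lemma D_uminus: "x \<in> D \<Longrightarrow> - x \<in> D"
  using D_scl[of x "- 1"] by simp

lemma D_diff: "x \<in> D \<Longrightarrow> y \<in> D \<Longrightarrow> x - y \<in> D"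
  using D_add[OF _ D_uminus, of x y] by simp

lemma D_sum: "(\<And>i. i \<in> K \<Longrightarrow> g i \<in> D) \<Longrightarrow> sum g K \<in> D"
  by (induction K rule: infinite_finite_induct) (auto intro: D_zero D_add)

lemma Phi_closed: "x \<in> D \<Longrightarrow> \<Phi> x \<in> carrier R"
  by (simp add: carrier_eq)

lemma carrierE: "a \<in> carrier R \<Longrightarrow> (\<And>x. x \<in> D \<Longrightarrow> a = \<Phi> x \<Longrightarrow> thesis) \<Longrightarrow> thesis"
  by (auto simp: carrier_eq)

lemma abelian_group: "abelian_group R"
proof (rule abelian_groupI)
  fix a b c assume a: "a \<in> carrier R" and b: "b \<in> carrier R" and c: "c \<in> carrier R"
  obtain x y z where xyz: "x \<in> D" "y \<in> D" "z \<in> D" "a = \<Phi> x" "b = \<Phi> y" "c = \<Phi> z"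
    using a b c by (auto simp: carrier_eq)
  show "(a \<oplus>\<^bsub>R\<^esub> b) \<oplus>\<^bsub>R\<^esub> c = a \<oplus>\<^bsub>R\<^esub> (b \<oplus>\<^bsub>R\<^esub> c)"
    using xyz by (simp add: Phi_add D_add add.assoc)
next
  fix a b assume a: "a \<in> carrier R" and b: "b \<in> carrier R"
  obtain x y where xy: "x \<in> D" "y \<in> D" "a = \<Phi> x" "b = \<Phi> y"
    using a b by (auto simp: carrier_eq)
  show "a \<oplus>\<^bsub>R\<^esub> b \<in> carrier R" using xy by (simp add: Phi_add D_add Phi_closed)
  show "a \<oplus>\<^bsub>R\<^esub> b = b \<oplus>\<^bsub>R\<^esub> a" using xy by (simp add: Phi_add add.commute)
next
  show "\<zero>\<^bsub>R\<^esub> \<in> carrier R" using D_zero by (simp add: Phi_zero Phi_closed)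
  fix a assume "a \<in> carrier R"
  then obtain x where x: "x \<in> D" "a = \<Phi> x" by (auto simp: carrier_eq)
  show "\<zero>\<^bsub>R\<^esub> \<oplus>\<^bsub>R\<^esub> a = a" using x D_zero by (simp add: Phi_zero Phi_add)
  show "\<exists>b\<in>carrier R. b \<oplus>\<^bsub>R\<^esub> a = \<zero>\<^bsub>R\<^esub>"
    using x D_uminus[OF x(1)] by (intro bexI[of _ "\<Phi> (- x)"]) (simp_all add: Phi_zero Phi_add Phi_closed)
qed

lemma a_inv_eq: "x \<in> D \<Longrightarrow> \<ominus>\<^bsub>R\<^esub> \<Phi> x = \<Phi> (- x)"
  using abelian_group.minus_equality[OF abelian_group, of "\<Phi> (- x)" "\<Phi> x"]
  by (simp add: Phi_add D_uminus Phi_zero Phi_closed)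

lemma add_inv_smult: "a \<in> carrier R \<Longrightarrow> \<ominus>\<^bsub>R\<^esub> a = (- 1) \<odot>\<^bsub>R\<^esub> a"
  by (auto simp: carrier_eq a_inv_eq Phi_scl)

lemma submodule_iff:
  "submodule H QQ R \<longleftrightarrow> H \<subseteq> carrier R \<and> \<zero>\<^bsub>R\<^esub> \<in> H \<and> (\<forall>a\<in>H. \<forall>b\<in>H. a \<oplus>\<^bsub>R\<^esub> b \<in> H) \<and>
     (\<forall>c. \<forall>a\<in>H. c \<odot>\<^bsub>R\<^esub> a \<in> H)"
proof
  assume H: "submodule H QQ R"
  interpret submodule H QQ R by (rule H)
  show "H \<subseteq> carrier R \<and> \<zero>\<^bsub>R\<^esub> \<in> H \<and> (\<forall>a\<in>H. \<forall>b\<in>H. a \<oplus>\<^bsub>R\<^esub> b \<in> H) \<and> (\<forall>c. \<forall>a\<in>H. c \<odot>\<^bsub>R\<^esub> a \<in> H)"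
    using subset m_closed one_closed smult_closed by (auto simp: QQ_def)
next
  assume H: "H \<subseteq> carrier R \<and> \<zero>\<^bsub>R\<^esub> \<in> H \<and> (\<forall>a\<in>H. \<forall>b\<in>H. a \<oplus>\<^bsub>R\<^esub> b \<in> H) \<and> (\<forall>c. \<forall>a\<in>H. c \<odot>\<^bsub>R\<^esub> a \<in> H)"
  have "inv\<^bsub>add_monoid R\<^esub> a \<in> H" if "a \<in> H" for a
    using H that add_inv_smult[of a] by (auto simp: a_inv_def)
  then show "submodule H QQ R"
    using H by (intro submodule.intro subgroup.intro submodule_axioms.intro) auto
qed

lemma lin_span_superset: "X \<subseteq> lin_span R X"
  unfolding lin_span_def by (rule hull_subset)

lemma lin_span_minimal: "submodule H QQ R \<Longrightarrow> X \<subseteq> H \<Longrightarrow> lin_span R X \<subseteq> H"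
  unfolding lin_span_def by (rule hull_minimal)

lemma carrier_submodule: "submodule (carrier R) QQ R"
  unfolding submodule_iff
  by (auto simp: carrier_eq Phi_add Phi_scl Phi_zero D_add D_scl D_zero)

lemma lin_span_submodule:
  assumes "X \<subseteq> carrier R"
  shows "submodule (lin_span R X) QQ R"
proof -
  have 1: "lin_span R X \<subseteq> carrier R"
    using lin_span_minimal[OF carrier_submodule assms] .
  have 2: "submodule S QQ R \<Longrightarrow> \<zero>\<^bsub>R\<^esub> \<in> S" "submodule S QQ R \<Longrightarrow> a \<in> S \<Longrightarrow> b \<in> S \<Longrightarrow> a \<oplus>\<^bsub>R\<^esub> b \<in> S"
    "submodule S QQ R \<Longrightarrow> a \<in> S \<Longrightarrow> c \<odot>\<^bsub>R\<^esub> a \<in> S" for S a b c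
    by (simp_all add: submodule_iff)
  show ?thesis
    unfolding submodule_iff
  proof (intro conjI ballI allI 1)
    show "\<zero>\<^bsub>R\<^esub> \<in> lin_span R X" unfolding lin_span_def hull_def using 2(1) by simp
    fix a assume a: "a \<in> lin_span R X"
    show "c \<odot>\<^bsub>R\<^esub> a \<in> lin_span R X" for c
      using a 2(3) unfolding lin_span_def hull_def by simp
    fix b assume "b \<in> lin_span R X"
    then show "a \<oplus>\<^bsub>R\<^esub> b \<in> lin_span R X"
      using a 2(2) unfolding lin_span_def hull_def by simp
  qed
qed

lemma finsum_Phi:
  assumes "finite K" "\<And>i. i \<in> K \<Longrightarrow> g i \<in> D"
  shows "finsum R (\<lambda>i. \<Phi> (g i)) K = \<Phi> (sum g K)"
proof -
  interpret abelian_group R by (rule abelian_group)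
  show ?thesis using assms
  proof (induction K rule: finite_induct)
    case (insert i K)
    then have "finsum R (\<lambda>i. \<Phi> (g i)) (insert i K) = \<Phi> (g i) \<oplus>\<^bsub>R\<^esub> finsum R (\<lambda>i. \<Phi> (g i)) K"
      by (intro finsum_insert) (auto simp: Phi_closed)
    then show ?case using insert D_sum[of K g] by (simp add: Phi_add)
  qed (simp add: Phi_zero)
qed

end

lemma linear_mapsD:
  assumes "f \<in> linear_maps A B"
  shows "a \<in> carrier A \<Longrightarrow> f a \<in> carrier B"
    "a \<in> carrier A \<Longrightarrow> b \<in> carrier A \<Longrightarrow> f (a \<oplus>\<^bsub>A\<^esub> b) = f a \<oplus>\<^bsub>B\<^esub> f b"
    "a \<in> carrier A \<Longrightarrow> f (c \<odot>\<^bsub>A\<^esub> a) = c \<odot>\<^bsub>B\<^esub> f a"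
  using assms by (auto simp: linear_maps_def hom_def)

lemma linear_image_lin_span:
  assumes A: "presentation A \<Phi>A DA JA" and B: "presentation B \<Phi>B DB JB"
    and f: "f \<in> linear_maps A B" and X: "X \<subseteq> carrier A"
  shows "f ` lin_span A X = lin_span B (f ` X)"
proof -
  interpret A: presentation A \<Phi>A DA JA by (rule A)
  interpret B: presentation B \<Phi>B DB JB by (rule B)
  note fD = linear_mapsD[OF f]
  have fX: "f ` X \<subseteq> carrier B" using fD(1) X by auto
  have spA: "submodule (lin_span A X) QQ A" and spB: "submodule (lin_span B (f ` X)) QQ B"
    using A.lin_span_submodule[OF X] B.lin_span_submodule[OF fX] by auto
  have z: "f \<zero>\<^bsub>A\<^esub> = \<zero>\<^bsub>B\<^esub>"
  proof -
    have 0: "\<zero>\<^bsub>A\<^esub> \<in> carrier A" using A.carrier_submodule by (simp add: A.submodule_iff)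
    then obtain y where y: "y \<in> DB" "f \<zero>\<^bsub>A\<^esub> = \<Phi>B y" using fD(1) B.carrierE by blast
    have "f (0 \<odot>\<^bsub>A\<^esub> \<zero>\<^bsub>A\<^esub>) = 0 \<odot>\<^bsub>B\<^esub> f \<zero>\<^bsub>A\<^esub>" using fD(3) 0 by blast
    then show ?thesis by (simp add: A.Phi_zero A.Phi_scl[OF A.D_zero] y(2)[unfolded A.Phi_zero] B.Phi_scl[OF y(1)] B.Phi_zero)
  qed
  show ?thesis
  proof
    have "submodule {x \<in> carrier A. f x \<in> lin_span B (f ` X)} QQ A"
      using spB A.carrier_submodule z unfolding A.submodule_iff B.submodule_iff by (auto simp: fD)
    then have "lin_span A X \<subseteq> {x \<in> carrier A. f x \<in> lin_span B (f ` X)}"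
      using X B.lin_span_superset[of "f ` X"] by (intro A.lin_span_minimal) auto
    then show "f ` lin_span A X \<subseteq> lin_span B (f ` X)" by auto
    have sub: "lin_span A X \<subseteq> carrier A" using spA by (simp add: A.submodule_iff)
    have "submodule (f ` lin_span A X) QQ B"
      unfolding B.submodule_iff
    proof (intro conjI ballI allI)
      show "f ` lin_span A X \<subseteq> carrier B" using sub fD(1) by auto
      show "\<zero>\<^bsub>B\<^esub> \<in> f ` lin_span A X" using spA z[symmetric] unfolding A.submodule_iff by blast
      fix a assume "a \<in> f ` lin_span A X"
      then obtain x where x: "x \<in> lin_span A X" "a = f x" by blast
      have xc: "x \<in> carrier A" using x sub by auto
      show "c \<odot>\<^bsub>B\<^esub> a \<in> f ` lin_span A X" for c
        using spA x fD(3)[OF xc, of c, symmetric] unfolding A.submodule_iff by auto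
      fix b assume "b \<in> f ` lin_span A X"
      then obtain y where y: "y \<in> lin_span A X" "b = f y" by blast
      have yc: "y \<in> carrier A" using y sub by auto
      show "a \<oplus>\<^bsub>B\<^esub> b \<in> f ` lin_span A X"
        using spA x y fD(2)[OF xc yc, symmetric] unfolding A.submodule_iff by auto
    qed
    then show "lin_span B (f ` X) \<subseteq> f ` lin_span A X"
      using A.lin_span_superset[of X] by (intro B.lin_span_minimal) auto
  qed
qed

section \<open>Coset quotients of spaces of finitely supported functions\<close>

locale pm_module =
  fixes A :: "(rat, 'k \<Rightarrow>\<^sub>0 rat) module"
  assumes A_zero: "\<zero>\<^bsub>A\<^esub> = 0" and A_add: "add A = (+)" and A_smult: "smult A = scl"
    and A_closed: "0 \<in> carrier A" "x \<in> carrier A \<Longrightarrow> y \<in> carrier A \<Longrightarrow> x + y \<in> carrier A"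
      "x \<in> carrier A \<Longrightarrow> scl c x \<in> carrier A"
begin

lemma self_presentation: "presentation A (\<lambda>x. x) (carrier A) {0}"
  by unfold_locales (auto simp: A_zero A_add A_smult A_closed)

lemma submodule_iff:
  "submodule H QQ A \<longleftrightarrow> H \<subseteq> carrier A \<and> 0 \<in> H \<and> (\<forall>a\<in>H. \<forall>b\<in>H. a + b \<in> H) \<and> (\<forall>c. \<forall>a\<in>H. scl c a \<in> H)"
  using presentation.submodule_iff[OF self_presentation, of H] by (simp add: A_zero A_add A_smult)

lemma coset_eq: "J +>\<^bsub>A\<^esub> x = {j + x | j. j \<in> J}"
  by (auto simp: a_r_coset_def r_coset_def A_add)

context
  fixes J assumes J: "submodule J QQ A"
begin

lemma J_closed: "0 \<in> J" "x \<in> J \<Longrightarrow> y \<in> J \<Longrightarrow> x + y \<in> J" "x \<in> J \<Longrightarrow> scl c x \<in> J" "x \<in> J \<Longrightarrow> - x \<in> J"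
  "x \<in> J \<Longrightarrow> y \<in> J \<Longrightarrow> x - y \<in> J"
proof -
  show *: "0 \<in> J" "x \<in> J \<Longrightarrow> y \<in> J \<Longrightarrow> x + y \<in> J" "x \<in> J \<Longrightarrow> scl c x \<in> J" for x y c
    using J by (auto simp: submodule_iff)
  show m: "x \<in> J \<Longrightarrow> - x \<in> J" for x using *(3)[of x "- 1"] by simp
  show "x \<in> J \<Longrightarrow> y \<in> J \<Longrightarrow> x - y \<in> J" using *(2)[OF _ m, of x y] by simp
qed

lemma coset_mem_iff: "z \<in> J +>\<^bsub>A\<^esub> x \<longleftrightarrow> z - x \<in> J"
proof
  assume "z - x \<in> J"
  moreover have "z = (z - x) + x" by simp
  ultimately show "z \<in> J +>\<^bsub>A\<^esub> x" unfolding coset_eq by blast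
qed (auto simp: coset_eq)

lemma coset_eq_iff: "J +>\<^bsub>A\<^esub> x = J +>\<^bsub>A\<^esub> y \<longleftrightarrow> x - y \<in> J"
proof
  assume "J +>\<^bsub>A\<^esub> x = J +>\<^bsub>A\<^esub> y"
  moreover have "x \<in> J +>\<^bsub>A\<^esub> x" by (simp add: coset_mem_iff J_closed)
  ultimately show "x - y \<in> J" by (simp add: coset_mem_iff)
next
  assume *: "x - y \<in> J"
  have "z - x \<in> J \<longleftrightarrow> z - y \<in> J" for z
    using J_closed(2)[OF _ *, of "z - x"] J_closed(5)[OF _ *, of "z - y"] by auto
  then show "J +>\<^bsub>A\<^esub> x = J +>\<^bsub>A\<^esub> y" by (auto simp: coset_mem_iff)
qed

lemma quot_presentation: "presentation (quot_module A J) (\<lambda>x. J +>\<^bsub>A\<^esub> x) (carrier A) J"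
proof
  show "carrier (quot_module A J) = (\<lambda>x. J +>\<^bsub>A\<^esub> x) ` carrier A"
    by (auto simp: quot_module_def FactRing_def A_RCOSETS_def RCOSETS_def a_r_coset_def)
  show "\<zero>\<^bsub>quot_module A J\<^esub> = J +>\<^bsub>A\<^esub> 0"
    by (auto simp: quot_module_def FactRing_def coset_eq)
  fix x y c assume x: "x \<in> carrier A"
  show "c \<odot>\<^bsub>quot_module A J\<^esub> (J +>\<^bsub>A\<^esub> x) = J +>\<^bsub>A\<^esub> scl c x"
  proof -
    \<comment> \<open>The union in the scalar multiplication of the quotient runs over all
      representatives; they all give the same coset.\<close>
    have "J +>\<^bsub>A\<^esub> (c \<odot>\<^bsub>A\<^esub> a) = J +>\<^bsub>A\<^esub> scl c x" if "a \<in> J +>\<^bsub>A\<^esub> x" for a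
      using J_closed(3)[of "a - x" c] that by (simp add: coset_mem_iff coset_eq_iff A_smult)
    moreover have "x \<in> J +>\<^bsub>A\<^esub> x" by (simp add: coset_mem_iff J_closed)
    ultimately show ?thesis unfolding quot_module_def by auto
  qed
  assume "y \<in> carrier A"
  show "(J +>\<^bsub>A\<^esub> x) \<oplus>\<^bsub>quot_module A J\<^esub> (J +>\<^bsub>A\<^esub> y) = J +>\<^bsub>A\<^esub> (x + y)"
  proof -
    have "(J +>\<^bsub>A\<^esub> x) \<oplus>\<^bsub>quot_module A J\<^esub> (J +>\<^bsub>A\<^esub> y) = {a + b | a b. a \<in> J +>\<^bsub>A\<^esub> x \<and> b \<in> J +>\<^bsub>A\<^esub> y}"
      by (auto simp: quot_module_def FactRing_def set_add_def set_mult_def A_add)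
    also have "\<dots> = J +>\<^bsub>A\<^esub> (x + y)"
    proof (intro equalityI subsetI)
      fix z assume "z \<in> {a + b | a b. a \<in> J +>\<^bsub>A\<^esub> x \<and> b \<in> J +>\<^bsub>A\<^esub> y}"
      then obtain a b where ab: "z = a + b" "a - x \<in> J" "b - y \<in> J" by (auto simp: coset_mem_iff)
      have "z - (x + y) = (a - x) + (b - y)" by (simp add: ab(1))
      then show "z \<in> J +>\<^bsub>A\<^esub> (x + y)" using J_closed(2)[OF ab(2,3)] by (simp only: coset_mem_iff)
    next
      fix z assume "z \<in> J +>\<^bsub>A\<^esub> (x + y)"
      then have "z = (z - y) + y" "z - y - x \<in> J" "y - y \<in> J"
        by (simp_all add: coset_mem_iff J_closed algebra_simps)
      then show "z \<in> {a + b | a b. a \<in> J +>\<^bsub>A\<^esub> x \<and> b \<in> J +>\<^bsub>A\<^esub> y}"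
        unfolding mem_Collect_eq coset_mem_iff by blast
    qed
    finally show ?thesis .
  qed
qed (auto simp: A_closed coset_eq_iff)

end

end

lemma free_module_pm: "pm_module (free_module S)"
proof
  show "x \<in> carrier (free_module S) \<Longrightarrow> y \<in> carrier (free_module S) \<Longrightarrow> x + y \<in> carrier (free_module S)" for x y
    using Poly_Mapping.keys_add[of x y] by (auto simp: free_module_def)
  show "x \<in> carrier (free_module S) \<Longrightarrow> scl c x \<in> carrier (free_module S)" for x c
    by (auto simp: free_module_def in_keys_iff subset_iff)
qed (simp_all add: free_module_def scl_def fun_eq_iff)

lemma poly_algebra_pm: "pm_module (poly_algebra V)"
proof
  show "x \<in> carrier (poly_algebra V) \<Longrightarrow> y \<in> carrier (poly_algebra V) \<Longrightarrow> x + y \<in> carrier (poly_algebra V)" for x y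
    using poly_in_add[of x V y] by (simp add: poly_in_def)
  show "x \<in> carrier (poly_algebra V) \<Longrightarrow> scl c x \<in> carrier (poly_algebra V)" for x c
    using poly_in_mult[OF poly_in_cst, of x V c] by (simp add: poly_in_def scl_cst)
qed (simp_all add: poly_algebra_def scl_def fun_eq_iff)

section \<open>Maps out of tensor products\<close>

locale tensor_setup =
  A: presentation A \<Phi>A DA JA + B: presentation B \<Phi>B DB JB
  for A :: "(rat, 'b) module" and \<Phi>A :: "('k \<Rightarrow>\<^sub>0 rat) \<Rightarrow> 'b" and DA JA
    and B :: "(rat, 'c) module" and \<Phi>B :: "('l \<Rightarrow>\<^sub>0 rat) \<Rightarrow> 'c" and DB JB
begin

abbreviation "T \<equiv> tensor_product A B"
abbreviation "Free \<equiv> free_module (carrier A \<times> carrier B)"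
abbreviation "Rel \<equiv> tensor_relations A B"
abbreviation "pure a b \<equiv> pure_tensor A B a b"

sublocale F: pm_module Free by (rule free_module_pm)

lemma free_carrier: "z \<in> carrier Free \<longleftrightarrow> Poly_Mapping.keys z \<subseteq> carrier A \<times> carrier B"
  by (simp add: free_module_def)

lemma single_carrier: "a \<in> carrier A \<Longrightarrow> b \<in> carrier B \<Longrightarrow> Poly_Mapping.single (a, b) c \<in> carrier Free"
  by (simp add: free_carrier)

lemma A_ops: "a \<in> carrier A \<Longrightarrow> a' \<in> carrier A \<Longrightarrow> a \<oplus>\<^bsub>A\<^esub> a' \<in> carrier A" "a \<in> carrier A \<Longrightarrow> c \<odot>\<^bsub>A\<^esub> a \<in> carrier A"
  using A.carrier_submodule unfolding A.submodule_iff by auto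

lemma B_ops: "a \<in> carrier B \<Longrightarrow> a' \<in> carrier B \<Longrightarrow> a \<oplus>\<^bsub>B\<^esub> a' \<in> carrier B" "a \<in> carrier B \<Longrightarrow> c \<odot>\<^bsub>B\<^esub> a \<in> carrier B"
  using B.carrier_submodule unfolding B.submodule_iff by auto

lemma free_diff: "x \<in> carrier Free \<Longrightarrow> y \<in> carrier Free \<Longrightarrow> x - y \<in> carrier Free"
  by (rule presentation.D_diff[OF F.self_presentation])

lemma bilinear_relations_sub: "bilinear_relations A B \<subseteq> carrier Free"
  unfolding bilinear_relations_def
  by (auto intro!: free_diff single_carrier A_ops B_ops)

lemma Rel_submodule: "submodule Rel QQ Free"
  unfolding tensor_relations_def
  by (rule presentation.lin_span_submodule[OF F.self_presentation bilinear_relations_sub])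

lemma Rel_base: "z \<in> bilinear_relations A B \<Longrightarrow> z \<in> Rel"
  unfolding tensor_relations_def using presentation.lin_span_superset[OF F.self_presentation] by blast

abbreviation "cls z \<equiv> Rel +>\<^bsub>Free\<^esub> z"

sublocale T: presentation T cls "carrier Free" Rel
  unfolding tensor_product_def by (rule F.quot_presentation[OF Rel_submodule])

lemma pure_cls: "pure a b = cls (Poly_Mapping.single (a, b) 1)"
  by (simp add: pure_tensor_def)

lemma pure_closed: "a \<in> carrier A \<Longrightarrow> b \<in> carrier B \<Longrightarrow> pure a b \<in> carrier T"
  unfolding pure_cls by (intro T.Phi_closed single_carrier)

lemma pure_add_left:
  assumes "a \<in> carrier A" "a' \<in> carrier A" "b \<in> carrier B"
  shows "pure (a \<oplus>\<^bsub>A\<^esub> a') b = pure a b \<oplus>\<^bsub>T\<^esub> pure a' b"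
proof -
  have "Poly_Mapping.single (a \<oplus>\<^bsub>A\<^esub> a', b) 1 - Poly_Mapping.single (a, b) 1 - Poly_Mapping.single (a', b) 1 \<in> Rel"
    using assms by (intro Rel_base) (unfold bilinear_relations_def, blast)
  then show ?thesis
    using assms by (simp add: pure_cls T.Phi_add single_carrier F.A_closed A_ops T.Phi_eq_iff algebra_simps)
qed

lemma pure_add_right:
  assumes "a \<in> carrier A" "b \<in> carrier B" "b' \<in> carrier B"
  shows "pure a (b \<oplus>\<^bsub>B\<^esub> b') = pure a b \<oplus>\<^bsub>T\<^esub> pure a b'"
proof -
  have "Poly_Mapping.single (a, b \<oplus>\<^bsub>B\<^esub> b') 1 - Poly_Mapping.single (a, b) 1 - Poly_Mapping.single (a, b') 1 \<in> Rel"
    using assms by (intro Rel_base) (unfold bilinear_relations_def, blast)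
  then show ?thesis
    using assms by (simp add: pure_cls T.Phi_add single_carrier F.A_closed B_ops T.Phi_eq_iff algebra_simps)
qed

lemma pure_smult_left:
  assumes "a \<in> carrier A" "b \<in> carrier B"
  shows "pure (c \<odot>\<^bsub>A\<^esub> a) b = c \<odot>\<^bsub>T\<^esub> pure a b"
proof -
  have "Poly_Mapping.single (c \<odot>\<^bsub>A\<^esub> a, b) 1 - Poly_Mapping.single (a, b) c \<in> Rel"
    using assms by (intro Rel_base) (unfold bilinear_relations_def, blast)
  then show ?thesis
    using assms by (simp add: pure_cls T.Phi_scl single_carrier A_ops T.Phi_eq_iff)
qed

lemma pure_smult_right:
  assumes "a \<in> carrier A" "b \<in> carrier B"
  shows "pure a (c \<odot>\<^bsub>B\<^esub> b) = c \<odot>\<^bsub>T\<^esub> pure a b"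
proof -
  have "Poly_Mapping.single (a, c \<odot>\<^bsub>B\<^esub> b) 1 - Poly_Mapping.single (a, b) c \<in> Rel"
    using assms by (intro Rel_base) (unfold bilinear_relations_def, blast)
  then show ?thesis
    using assms by (simp add: pure_cls T.Phi_scl single_carrier B_ops T.Phi_eq_iff)
qed

text \<open>Linear maps are compared on pure tensors only, because every element of the tensor
  product is the class of a finite combination of pairs.\<close>

lemma linear_map_eqI:
  assumes f: "f \<in> linear_maps T R" "f \<in> extensional (carrier T)"
    and g: "g \<in> linear_maps T R" "g \<in> extensional (carrier T)"
    and R: "presentation R \<Phi> D J"
    and pure: "\<And>p q. p \<in> DA \<Longrightarrow> q \<in> DB \<Longrightarrow> f (pure (\<Phi>A p) (\<Phi>B q)) = g (pure (\<Phi>A p) (\<Phi>B q))"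
  shows "f = g"
proof (rule extensionalityI[OF f(2) g(2)])
  fix x assume "x \<in> carrier T"
  then obtain z where z: "z \<in> carrier Free" "x = cls z" by (rule T.carrierE)
  \<comment> \<open>The empty combination has to be a pure tensor as well for the hypothesis to
    cover it.\<close>
  have zero: "cls 0 = pure (\<Phi>A 0) (\<Phi>B 0)"
  proof -
    have "pure (0 \<odot>\<^bsub>A\<^esub> \<Phi>A 0) (\<Phi>B 0) = 0 \<odot>\<^bsub>T\<^esub> pure (\<Phi>A 0) (\<Phi>B 0)"
      by (intro pure_smult_left A.Phi_closed B.Phi_closed A.D_zero B.D_zero)
    moreover have "Poly_Mapping.single (\<Phi>A 0, \<Phi>B 0) (1 :: rat) \<in> carrier Free"
      by (intro single_carrier A.Phi_closed B.Phi_closed A.D_zero B.D_zero)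
    ultimately show ?thesis
      by (simp add: A.Phi_scl A.D_zero pure_cls T.Phi_scl)
  qed
  have "f (cls z) = g (cls z)"
    using z(1)
  proof (induction z rule: poly_mapping_add_induct)
    case zero
    then show ?case using pure[OF A.D_zero B.D_zero] \<open>cls 0 = pure (\<Phi>A 0) (\<Phi>B 0)\<close> by simp
  next
    case (single k c)
    obtain a b where k: "k = (a, b)" by (cases k)
    have ab: "a \<in> carrier A" "b \<in> carrier B" using single k by (auto simp: free_carrier)
    obtain p q where pq: "p \<in> DA" "q \<in> DB" "a = \<Phi>A p" "b = \<Phi>B q"
      using ab A.carrierE B.carrierE by metis
    have "cls (Poly_Mapping.single (a, b) c) = c \<odot>\<^bsub>T\<^esub> pure a b"
      using ab by (simp add: pure_cls T.Phi_scl single_carrier)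
    then show ?case
      using pure[OF pq(1,2)] pq ab linear_mapsD(3)[OF f(1)] linear_mapsD(3)[OF g(1)] pure_closed k by simp
  next
    case (add p q)
    then have "p \<in> carrier Free" "q \<in> carrier Free" by (auto simp: free_carrier)
    then show ?case
      using add linear_mapsD(2)[OF f(1)] linear_mapsD(2)[OF g(1)] by (simp add: T.Phi_add[symmetric] T.Phi_closed)
  qed
  then show "f x = g x" using z by simp
qed

text \<open>The universal property of the tensor product for a bilinear \<open>\<beta>\<close> given
  on representatives: it descends because either kernel is sent into \<open>J\<close>.\<close>

lemma ex_linear_map:
  fixes \<beta> :: "('k \<Rightarrow>\<^sub>0 rat) \<Rightarrow> ('l \<Rightarrow>\<^sub>0 rat) \<Rightarrow> 'v mpoly"
  assumes R: "presentation R \<Phi> UNIV J"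
    and add: "\<And>p p' q. \<beta> (p + p') q = \<beta> p q + \<beta> p' q" "\<And>p q q'. \<beta> p (q + q') = \<beta> p q + \<beta> p q'"
    and scl: "\<And>c p q. \<beta> (scl c p) q = scl c (\<beta> p q)" "\<And>c p q. \<beta> p (scl c q) = scl c (\<beta> p q)"
    and J: "\<And>p q. p \<in> DA \<Longrightarrow> p \<in> JA \<Longrightarrow> q \<in> DB \<Longrightarrow> \<beta> p q \<in> J" "\<And>p q. p \<in> DA \<Longrightarrow> q \<in> DB \<Longrightarrow> q \<in> JB \<Longrightarrow> \<beta> p q \<in> J"
  shows "\<exists>f. f \<in> linear_maps T R \<and> f \<in> extensional (carrier T) \<and>
    (\<forall>p\<in>DA. \<forall>q\<in>DB. f (pure (\<Phi>A p) (\<Phi>B q)) = \<Phi> (\<beta> p q))"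
proof -
  interpret R: presentation R \<Phi> UNIV J by (rule R)
  define rA where "rA a = (SOME p. p \<in> DA \<and> \<Phi>A p = a)" for a
  define rB where "rB b = (SOME q. q \<in> DB \<and> \<Phi>B q = b)" for b
  have rA: "rA (\<Phi>A p) \<in> DA" "\<Phi>A (rA (\<Phi>A p)) = \<Phi>A p" if "p \<in> DA" for p
    using someI[of "\<lambda>p'. p' \<in> DA \<and> \<Phi>A p' = \<Phi>A p" p] that unfolding rA_def by auto
  have rB: "rB (\<Phi>B q) \<in> DB" "\<Phi>B (rB (\<Phi>B q)) = \<Phi>B q" if "q \<in> DB" for q
    using someI[of "\<lambda>p'. p' \<in> DB \<and> \<Phi>B p' = \<Phi>B q" q] that unfolding rB_def by auto
  define g where "g k = \<beta> (rA (fst k)) (rB (snd k))" for k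
  have diff: "\<beta> (p - p') q = \<beta> p q - \<beta> p' q" "\<beta> p (q - q') = \<beta> p q - \<beta> p q'" for p p' q q'
  proof -
    show "\<beta> (p - p') q = \<beta> p q - \<beta> p' q" using add(1)[of "p - p'" p' q] by (simp add: eq_diff_eq)
    show "\<beta> p (q - q') = \<beta> p q - \<beta> p q'" using add(2)[of p "q - q'" q'] by (simp add: eq_diff_eq)
  qed
  have g: "\<Phi> (g (\<Phi>A p, \<Phi>B q)) = \<Phi> (\<beta> p q)" if "p \<in> DA" "q \<in> DB" for p q
  proof -
    have "rA (\<Phi>A p) - p \<in> JA" "rA (\<Phi>A p) - p \<in> DA" using rA that A.Phi_eq_iff A.D_diff by auto
    then have "\<beta> (rA (\<Phi>A p) - p) (rB (\<Phi>B q)) \<in> J" using rB that by (intro J(1)) auto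
    then have 1: "\<Phi> (\<beta> (rA (\<Phi>A p)) (rB (\<Phi>B q))) = \<Phi> (\<beta> p (rB (\<Phi>B q)))"
      by (simp add: diff R.Phi_eq_iff)
    have "rB (\<Phi>B q) - q \<in> JB" "rB (\<Phi>B q) - q \<in> DB" using rB that B.Phi_eq_iff B.D_diff by auto
    then have "\<beta> p (rB (\<Phi>B q) - q) \<in> J" using that by (intro J(2)) auto
    then have 2: "\<Phi> (\<beta> p (rB (\<Phi>B q))) = \<Phi> (\<beta> p q)" by (simp add: diff R.Phi_eq_iff)
    show ?thesis using 1 2 by (simp add: g_def)
  qed
  \<comment> \<open>The linear extension to the free space. Since \<open>g\<close> uses chosen
    representatives, it agrees with \<open>\<beta>\<close> only modulo \<open>J\<close>, and each
    tensor relation has to be checked up to that error.\<close>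
  define L where "L = lin_ext cst g"
  have L_add: "L (x + y) = L x + L y" for x y by (simp add: L_def lin_ext_add)
  have L_single: "L (Poly_Mapping.single k c) = scl c (g k)" for k c by (simp add: L_def lin_ext_single scl_cst)
  have L_zero: "L 0 = 0" by (simp add: L_def)
  have L_scl: "L (scl c x) = scl c (L x)" for c x
    by (induction x rule: poly_mapping_add_induct) (simp_all add: L_zero L_single L_add)
  have L_diff: "L (x - y) = L x - L y" for x y using L_add[of "x - y" y] by simp
  have R0: "\<Phi> x = \<Phi> 0 \<longleftrightarrow> x \<in> J" for x by (simp add: R.Phi_eq_iff)
  have Jc: "x \<in> J \<Longrightarrow> y \<in> J \<Longrightarrow> x + y \<in> J" "x \<in> J \<Longrightarrow> scl c x \<in> J" "0 \<in> J" for x y c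
    using R.Phi_add[of x y] R.Phi_add[of 0 0] R.Phi_scl[of x c] R.Phi_scl[of 0 c] R0[of x] R0[of y] R0[of "x + y"]
      R0[of "scl c x"] R0[of 0] by auto
  have diffJ: "x - y \<in> J" if "\<Phi> x = \<Phi> y" for x y using that by (simp add: R.Phi_eq_iff)
  have gJ: "g (\<Phi>A p, \<Phi>B q) - \<beta> p q \<in> J" if "p \<in> DA" "q \<in> DB" for p q
    using diffJ[OF g[OF that]] .
  have "submodule {z \<in> carrier Free. L z \<in> J} QQ Free"
    unfolding F.submodule_iff using Jc by (auto simp: L_zero L_add L_scl F.A_closed)
  moreover have "bilinear_relations A B \<subseteq> {z \<in> carrier Free. L z \<in> J}"
  proof
    fix z assume z: "z \<in> bilinear_relations A B"
    have key: "L z \<in> J" if "\<Phi> (L z) = \<Phi> 0" using that R0 by simp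
    have gadd: "\<Phi> (g k) = \<Phi> x \<Longrightarrow> \<Phi> (g k') = \<Phi> x' \<Longrightarrow> \<Phi> (g k'') = \<Phi> x'' \<Longrightarrow> \<Phi> (x - x' - x'') = \<Phi> 0 \<Longrightarrow>
       \<Phi> (g k - g k' - g k'') = \<Phi> 0" for k k' k'' x x' x''
    proof -
      assume "\<Phi> (g k) = \<Phi> x" "\<Phi> (g k') = \<Phi> x'" "\<Phi> (g k'') = \<Phi> x''" "\<Phi> (x - x' - x'') = \<Phi> 0"
      then have *: "g k - x \<in> J" "g k' - x' \<in> J" "g k'' - x'' \<in> J" "x - x' - x'' \<in> J"
        by (auto intro: diffJ simp: R0)
      have "(g k - x) + scl (- 1) (g k' - x') + scl (- 1) (g k'' - x'') + (x - x' - x'') \<in> J"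
        using * by (intro Jc)
      then show ?thesis by (simp add: R0 algebra_simps)
    qed
    have gscl: "\<Phi> (g k) = \<Phi> (scl c x) \<Longrightarrow> \<Phi> (g k') = \<Phi> x \<Longrightarrow> \<Phi> (g k - scl c (g k')) = \<Phi> 0" for k k' x c
    proof -
      assume "\<Phi> (g k) = \<Phi> (scl c x)" "\<Phi> (g k') = \<Phi> x"
      then have *: "g k - scl c x \<in> J" "g k' - x \<in> J" by (auto intro: diffJ)
      have "(g k - scl c x) + scl (- c) (g k' - x) \<in> J" using * by (intro Jc)
      moreover have "scl (- c) y = - scl c y" for y :: "'v mpoly" by (simp add: scl_cst)
      ultimately show ?thesis by (simp add: R0 algebra_simps)
    qed
    have "\<Phi> (L z) = \<Phi> 0"
      using z unfolding bilinear_relations_def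
    proof (elim UnE CollectE exE conjE)
      fix a a' b assume *: "z = Poly_Mapping.single (a \<oplus>\<^bsub>A\<^esub> a', b) 1 - Poly_Mapping.single (a, b) 1 - Poly_Mapping.single (a', b) 1"
        "a \<in> carrier A" "a' \<in> carrier A" "b \<in> carrier B"
      obtain p p' q where "p \<in> DA" "p' \<in> DA" "q \<in> DB" "a = \<Phi>A p" "a' = \<Phi>A p'" "b = \<Phi>B q"
        using * A.carrierE B.carrierE by metis
      then show ?thesis
        unfolding *(1) L_diff L_single using g
        by (simp add: A.Phi_add) (intro gadd[of _ "\<beta> (p + p') q" _ "\<beta> p q" _ "\<beta> p' q"], auto simp: A.D_add add)
    next
      fix a b b' assume *: "z = Poly_Mapping.single (a, b \<oplus>\<^bsub>B\<^esub> b') 1 - Poly_Mapping.single (a, b) 1 - Poly_Mapping.single (a, b') 1"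
        "a \<in> carrier A" "b \<in> carrier B" "b' \<in> carrier B"
      obtain p q' q where "p \<in> DA" "q' \<in> DB" "q \<in> DB" "a = \<Phi>A p" "b' = \<Phi>B q'" "b = \<Phi>B q"
        using * A.carrierE B.carrierE by metis
      then show ?thesis
        unfolding *(1) L_diff L_single using g
        by (simp add: B.Phi_add) (intro gadd[of _ "\<beta> p (q + q')" _ "\<beta> p q" _ "\<beta> p q'"], auto simp: B.D_add add)
    next
      fix c a b assume *: "z = Poly_Mapping.single (c \<odot>\<^bsub>A\<^esub> a, b) 1 - Poly_Mapping.single (a, b) c" "a \<in> carrier A" "b \<in> carrier B"
      obtain p q where "p \<in> DA" "q \<in> DB" "a = \<Phi>A p" "b = \<Phi>B q"
        using * A.carrierE B.carrierE by metis
      then show ?thesis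
        unfolding *(1) L_diff L_single using g
        by (simp add: A.Phi_scl) (intro gscl[of _ _ "\<beta> p q"], auto simp: A.D_scl scl)
    next
      fix c a b assume *: "z = Poly_Mapping.single (a, c \<odot>\<^bsub>B\<^esub> b) 1 - Poly_Mapping.single (a, b) c" "a \<in> carrier A" "b \<in> carrier B"
      obtain p q where "p \<in> DA" "q \<in> DB" "a = \<Phi>A p" "b = \<Phi>B q"
        using * A.carrierE B.carrierE by metis
      then show ?thesis
        unfolding *(1) L_diff L_single using g
        by (simp add: B.Phi_scl) (intro gscl[of _ _ "\<beta> p q"], auto simp: B.D_scl scl)
    qed
    then show "z \<in> {z \<in> carrier Free. L z \<in> J}" using key z bilinear_relations_sub by auto
  qed
  ultimately have "lin_span Free (bilinear_relations A B) \<subseteq> {z \<in> carrier Free. L z \<in> J}"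
    by (rule presentation.lin_span_minimal[OF F.self_presentation])
  then have RelJ: "z \<in> Rel \<Longrightarrow> L z \<in> J" for z unfolding tensor_relations_def by auto
  define f where "f x = (if x \<in> carrier T then \<Phi> (L (SOME z. z \<in> carrier Free \<and> cls z = x)) else undefined)" for x
  have fcls: "f (cls z) = \<Phi> (L z)" if z: "z \<in> carrier Free" for z
  proof -
    define z' where "z' = (SOME z'. z' \<in> carrier Free \<and> cls z' = cls z)"
    have z': "z' \<in> carrier Free" "cls z' = cls z"
      using someI[of "\<lambda>z'. z' \<in> carrier Free \<and> cls z' = cls z" z] z unfolding z'_def by auto
    then have "L (z' - z) \<in> J" using RelJ T.Phi_eq_iff z by auto
    then have "\<Phi> (L z') = \<Phi> (L z)" by (simp add: L_diff R.Phi_eq_iff)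
    then show ?thesis using T.Phi_closed[OF z] by (simp add: f_def z'_def)
  qed
  have lin: "f \<in> linear_maps T R"
    unfolding linear_maps_def hom_def
  proof (intro CollectI conjI Pi_I ballI allI)
    fix x assume "x \<in> carrier (add_monoid T)"
    then obtain z where z: "z \<in> carrier Free" "x = cls z" using T.carrierE by auto
    then show "f x \<in> carrier (add_monoid R)" by (simp add: fcls R.Phi_closed)
    fix y assume "y \<in> carrier (add_monoid T)"
    then obtain w where w: "w \<in> carrier Free" "y = cls w" using T.carrierE by auto
    show "f (x \<otimes>\<^bsub>add_monoid T\<^esub> y) = f x \<otimes>\<^bsub>add_monoid R\<^esub> f y"
      using z w by (simp add: T.Phi_add fcls F.A_closed R.Phi_add L_add)
  next
    fix c x assume "x \<in> carrier T"
    then obtain z where z: "z \<in> carrier Free" "x = cls z" using T.carrierE by auto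
    then show "f (c \<odot>\<^bsub>T\<^esub> x) = c \<odot>\<^bsub>R\<^esub> f x"
      by (simp add: T.Phi_scl fcls F.A_closed R.Phi_scl L_scl)
  qed
  have pure: "f (pure (\<Phi>A p) (\<Phi>B q)) = \<Phi> (\<beta> p q)" if "p \<in> DA" "q \<in> DB" for p q
    unfolding pure_cls using that g by (simp add: fcls single_carrier A.Phi_closed B.Phi_closed L_single)
  show ?thesis
    using lin pure by (intro exI[of _ f]) (simp add: extensional_def f_def)
qed

text \<open>Generators of the second factor suffice: for fixed \<open>a\<close>, the elements
  \<open>b\<close> with \<open>f (pure a b)\<close> in the given span form a subspace.\<close>

lemma image_tensor_subspace:
  assumes R: "presentation R \<Phi> D J" and f: "f \<in> linear_maps T R" and Y: "Y \<subseteq> carrier B"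
  shows "f ` tensor_subspace A B (carrier A) (lin_span B Y) = lin_span R {f (pure a y) | a y. a \<in> carrier A \<and> y \<in> Y}"
proof -
  interpret R: presentation R \<Phi> D J by (rule R)
  note fD = linear_mapsD[OF f]
  let ?X = "{pure a b | a b. a \<in> carrier A \<and> b \<in> lin_span B Y}"
  let ?S = "lin_span R {f (pure a y) | a y. a \<in> carrier A \<and> y \<in> Y}"
  have spY: "submodule (lin_span B Y) QQ B" by (rule B.lin_span_submodule[OF Y])
  then have sub: "lin_span B Y \<subseteq> carrier B" by (simp add: B.submodule_iff)
  have X: "?X \<subseteq> carrier T" using sub pure_closed by auto
  have gen: "{f (pure a y) | a y. a \<in> carrier A \<and> y \<in> Y} \<subseteq> carrier R"
    using Y pure_closed fD(1) by auto
  have spS: "submodule ?S QQ R" by (rule R.lin_span_submodule[OF gen])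
  have "f ` tensor_subspace A B (carrier A) (lin_span B Y) = lin_span R (f ` ?X)"
    unfolding tensor_subspace_def by (rule linear_image_lin_span[OF T.presentation_axioms R f X])
  also have "\<dots> = ?S"
  proof
    have "f (pure a b) \<in> ?S" if a: "a \<in> carrier A" and b: "b \<in> lin_span B Y" for a b
    proof -
      have "submodule {b \<in> carrier B. f (pure a b) \<in> ?S} QQ B"
        unfolding B.submodule_iff
      proof (intro conjI ballI allI)
        have z: "\<zero>\<^bsub>B\<^esub> \<in> carrier B" using B.carrier_submodule by (simp add: B.submodule_iff)
        have "\<zero>\<^bsub>B\<^esub> = 0 \<odot>\<^bsub>B\<^esub> \<zero>\<^bsub>B\<^esub>" by (simp add: B.Phi_zero B.Phi_scl B.D_zero)
        then have "f (pure a \<zero>\<^bsub>B\<^esub>) = 0 \<odot>\<^bsub>R\<^esub> f (pure a \<zero>\<^bsub>B\<^esub>)"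
          using pure_smult_right[OF a z, of 0] fD(3)[OF pure_closed[OF a z], of 0] by simp
        moreover have "0 \<odot>\<^bsub>R\<^esub> r = \<zero>\<^bsub>R\<^esub>" if "r \<in> carrier R" for r
          using that by (auto simp: R.carrier_eq R.Phi_scl R.Phi_zero)
        ultimately have "f (pure a \<zero>\<^bsub>B\<^esub>) = \<zero>\<^bsub>R\<^esub>" using fD(1) pure_closed[OF a z] by metis
        then show "\<zero>\<^bsub>B\<^esub> \<in> {b \<in> carrier B. f (pure a b) \<in> ?S}"
          using z spS by (simp add: R.submodule_iff)
        fix b assume b: "b \<in> {b \<in> carrier B. f (pure a b) \<in> ?S}"
        show "c \<odot>\<^bsub>B\<^esub> b \<in> {b \<in> carrier B. f (pure a b) \<in> ?S}" for c
          using b a spS B_ops by (simp add: pure_smult_right fD(3) pure_closed R.submodule_iff)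
        fix b' assume b': "b' \<in> {b \<in> carrier B. f (pure a b) \<in> ?S}"
        show "b \<oplus>\<^bsub>B\<^esub> b' \<in> {b \<in> carrier B. f (pure a b) \<in> ?S}"
          using b b' a spS B_ops by (simp add: pure_add_right fD(2) pure_closed R.submodule_iff)
      qed simp
      moreover have "Y \<subseteq> {b \<in> carrier B. f (pure a b) \<in> ?S}"
        using Y a R.lin_span_superset[of "{f (pure a y) | a y. a \<in> carrier A \<and> y \<in> Y}"] by auto
      ultimately show ?thesis using b B.lin_span_minimal by blast
    qed
    then show "lin_span R (f ` ?X) \<subseteq> ?S" by (intro R.lin_span_minimal[OF spS]) auto
    have fX: "f ` ?X \<subseteq> carrier R" using X fD(1) by auto
    have "{f (pure a y) | a y. a \<in> carrier A \<and> y \<in> Y} \<subseteq> f ` ?X"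
      using B.lin_span_superset[of Y] by blast
    then show "?S \<subseteq> lin_span R (f ` ?X)"
      using R.lin_span_superset[of "f ` ?X"]
      by (intro R.lin_span_minimal R.lin_span_submodule[OF fX]) (rule subset_trans)
  qed
  finally show ?thesis .
qed

end

section \<open>The decomposition for a presented Chow ring\<close>

text \<open>Common ground of the two Chow rings: an algebra presented by the ideal of the interval
  with \<open>B = {}\<close>. It is instantiated with \<open>\<delta> = 1\<close> for the Chow ring
  and \<open>\<delta> = 0\<close> for the augmented one, so the decomposition and the orthogonality
  are proved once.\<close>

locale chow_presentation =
  flat_interval M "{}" \<delta> for M :: "'a matroid" and \<delta> +
  fixes R :: "(rat, 'b) module" and \<Phi> :: "'a set mpoly \<Rightarrow> 'b"
  assumes pres: "presentation R \<Phi> UNIV I"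
    and Phi_mult: "\<Phi> p \<otimes>\<^bsub>R\<^esub> \<Phi> q = \<Phi> (p * q)" and Phi_one: "\<one>\<^bsub>R\<^esub> = \<Phi> 1"
begin

sublocale R: presentation R \<Phi> UNIV I by (rule pres)

lemma Phi_ops: "\<Phi> x \<oplus>\<^bsub>R\<^esub> \<Phi> y = \<Phi> (x + y)" "c \<odot>\<^bsub>R\<^esub> \<Phi> x = \<Phi> (cst c * x)"
  "\<Phi> x \<in> carrier R" "\<Phi> x = \<Phi> y \<longleftrightarrow> x - y \<in> I" "carrier R = range \<Phi>"
  by (simp_all add: R.Phi_add R.Phi_scl R.Phi_closed R.Phi_eq_iff R.carrier_eq scl_cst rangeI)

text \<open>Flats with \<open>mult_bound F = 0\<close> are left out, since they carry no term. What
  remains are the flats of rank at least two for \<open>\<delta> = 1\<close> and the nonempty ones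
  for \<open>\<delta> = 0\<close>, always proper.\<close>

definition idx :: "'a set option set" where
  "idx = insert None (Some ` {F \<in> inner_flats. 0 < mult_bound F})"

fun summand_polys :: "'a set option \<Rightarrow> 'a set mpoly set" where
  "summand_polys None = {\<Sum>j\<le>top_degree. cst (c j) * h E ^ j | c. True}"
| "summand_polys (Some F) =
     {\<Sum>k<mult_bound F. var F * h F ^ k * f k | f. \<forall>k. f k \<in> poly_in (upper F)}"

lemma summand_polys_zero: "0 \<in> summand_polys i"
proof (cases i)
  case None
  then show ?thesis by (auto intro!: exI[of _ "\<lambda>_. 0"])
next
  case (Some F)
  then show ?thesis by (auto intro!: exI[of _ "\<lambda>_. 0"])
qed

lemma summand_polys_add: "s \<in> summand_polys i \<Longrightarrow> t \<in> summand_polys i \<Longrightarrow> s + t \<in> summand_polys i"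
proof (cases i)
  case None
  assume "s \<in> summand_polys i" "t \<in> summand_polys i"
  then obtain c d where "s = (\<Sum>j\<le>top_degree. cst (c j) * h E ^ j)" "t = (\<Sum>j\<le>top_degree. cst (d j) * h E ^ j)"
    unfolding None by auto
  then have "s + t = (\<Sum>j\<le>top_degree. cst (c j + d j) * h E ^ j)"
    by (simp add: sum.distrib distrib_right)
  then show ?thesis unfolding None summand_polys.simps by (intro CollectI exI[of _ "\<lambda>j. c j + d j"] conjI TrueI)
next
  case (Some F)
  assume "s \<in> summand_polys i" "t \<in> summand_polys i"
  then obtain f g where fg: "s = (\<Sum>k<mult_bound F. var F * h F ^ k * f k)" "\<forall>k. f k \<in> poly_in (upper F)"
    "t = (\<Sum>k<mult_bound F. var F * h F ^ k * g k)" "\<forall>k. g k \<in> poly_in (upper F)"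
    unfolding Some by auto
  then have "s + t = (\<Sum>k<mult_bound F. var F * h F ^ k * (f k + g k))"
    by (simp add: sum.distrib distrib_left)
  moreover have "\<forall>k. f k + g k \<in> poly_in (upper F)" using fg by (intro allI poly_in_add) auto
  ultimately show ?thesis unfolding Some summand_polys.simps by (intro CollectI exI[of _ "\<lambda>k. f k + g k"] conjI)
qed

lemma summand_polys_cst_mult: "s \<in> summand_polys i \<Longrightarrow> cst c * s \<in> summand_polys i"
proof (cases i)
  case None
  assume "s \<in> summand_polys i"
  then obtain d where "s = (\<Sum>j\<le>top_degree. cst (d j) * h E ^ j)" unfolding None by auto
  then have "cst c * s = (\<Sum>j\<le>top_degree. cst (c * d j) * h E ^ j)"
    by (simp add: sum_distrib_left mult.assoc)
  then show ?thesis unfolding None summand_polys.simps by (intro CollectI exI[of _ "\<lambda>j. c * d j"] conjI TrueI)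
next
  case (Some F)
  assume "s \<in> summand_polys i"
  then obtain f where f: "s = (\<Sum>k<mult_bound F. var F * h F ^ k * f k)" "\<forall>k. f k \<in> poly_in (upper F)"
    unfolding Some by auto
  then have "cst c * s = (\<Sum>k<mult_bound F. var F * h F ^ k * (cst c * f k))"
    by (simp add: sum_distrib_left algebra_simps)
  moreover have "\<forall>k. cst c * f k \<in> poly_in (upper F)" using f by (intro allI poly_in_mult) auto
  ultimately show ?thesis unfolding Some summand_polys.simps by (intro CollectI exI[of _ "\<lambda>k. cst c * f k"] conjI)
qed

lemma summand_submodule: "submodule (\<Phi> ` summand_polys i) QQ R"
  unfolding R.submodule_iff
  by (auto simp: Phi_ops(1-3) R.Phi_zero summand_polys_zero summand_polys_add summand_polys_cst_mult)

lemma power_in_summand: "\<Phi> (h E ^ n) \<in> \<Phi> ` summand_polys None"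
proof (cases "n \<le> top_degree")
  case True
  have "(\<Sum>j\<le>top_degree. cst (if j = n then 1 else 0) * h E ^ j) = (\<Sum>j\<le>top_degree. if j = n then h E ^ n else 0)"
    by (intro sum.cong) auto
  also have "\<dots> = h E ^ n" using True by simp
  finally have "h E ^ n = (\<Sum>j\<le>top_degree. cst (if j = n then 1 else 0) * h E ^ j)" by simp
  then have "h E ^ n \<in> summand_polys None"
    unfolding summand_polys.simps by (intro CollectI exI[of _ "\<lambda>j. if j = n then 1 else 0"] conjI TrueI)
  then show ?thesis by (rule imageI)
next
  case False
  have "h E ^ n \<in> I" using False by (intro hvar_power E_in_P) linarith
  then have "\<Phi> (h E ^ n) = \<Phi> 0" by (simp add: Phi_ops)
  then show ?thesis using summand_polys_zero[of None] by auto
qed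

lemma submodule_Phi_sum:
  assumes "submodule S QQ R" "\<And>x. x \<in> K \<Longrightarrow> \<Phi> (g x) \<in> S"
  shows "\<Phi> (sum g K) \<in> S"
  using assms(2)
proof (induction K rule: infinite_finite_induct)
  case (insert x K)
  then have "\<Phi> (g x) \<oplus>\<^bsub>R\<^esub> \<Phi> (sum g K) \<in> S" using assms(1) unfolding R.submodule_iff by auto
  then show ?case using insert by (simp add: Phi_ops)
qed (use assms(1) in \<open>auto simp: R.submodule_iff R.Phi_zero\<close>)

lemma submodule_Phi_cst:
  assumes "submodule S QQ R" "\<Phi> p \<in> S"
  shows "\<Phi> (cst c * p) \<in> S"
  using assms unfolding R.submodule_iff Phi_ops(2)[symmetric] by auto

lemma top_summand_mult:
  assumes "s \<in> summand_polys None" "t \<in> summand_polys None"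
  shows "\<Phi> (s * t) \<in> \<Phi> ` summand_polys None"
proof -
  obtain c d where "s = (\<Sum>j\<le>top_degree. cst (c j) * h E ^ j)" "t = (\<Sum>j\<le>top_degree. cst (d j) * h E ^ j)"
    using assms by auto
  then have "s * t = (\<Sum>i\<le>top_degree. \<Sum>j\<le>top_degree. cst (c i * d j) * h E ^ (i + j))"
    by (simp add: sum_product power_add algebra_simps)
  then show ?thesis
    by (simp only:) (intro submodule_Phi_sum summand_submodule submodule_Phi_cst power_in_summand)
qed

text \<open>The powers of the alpha class beyond the top degree vanish, so finitely many powers
  already span a subspace closed under products.\<close>

lemma generated_subalgebra_top: "generated_subalgebra R {\<Phi> (h E)} = \<Phi> ` summand_polys None"
  unfolding generated_subalgebra_def
proof (rule hull_unique)
  show "{\<Phi> (h E)} \<subseteq> \<Phi> ` summand_polys None" using power_in_summand[of 1] by simp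
  have sub: "submodule (\<Phi> ` summand_polys None) QQ R" by (rule summand_submodule)
  have "submonoid (\<Phi> ` summand_polys None) R"
  proof
    show "\<Phi> ` summand_polys None \<subseteq> carrier R" by (auto simp: Phi_ops)
    show "\<one>\<^bsub>R\<^esub> \<in> \<Phi> ` summand_polys None" using power_in_summand[of 0] by (simp add: Phi_one)
    show "x \<otimes>\<^bsub>R\<^esub> y \<in> \<Phi> ` summand_polys None" if "x \<in> \<Phi> ` summand_polys None" "y \<in> \<Phi> ` summand_polys None" for x y
    proof -
      from that(1) obtain s where s: "x = \<Phi> s" "s \<in> summand_polys None" by (rule imageE)
      from that(2) obtain t where t: "y = \<Phi> t" "t \<in> summand_polys None" by (rule imageE)
      show ?thesis unfolding s t Phi_mult by (rule top_summand_mult[OF s(2) t(2)])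
    qed
  qed
  then show "subring (\<Phi> ` summand_polys None) R \<and> submodule (\<Phi> ` summand_polys None) QQ R"
    using sub submodule.axioms(1)[OF sub] by (auto intro: subring.intro)
  fix S assume S: "{\<Phi> (h E)} \<subseteq> S" "subring S R \<and> submodule S QQ R"
  interpret S: subring S R using S by simp
  have pow: "\<Phi> (h E ^ n) \<in> S" for n
  proof (induction n)
    case 0
    then show ?case using S.submonoid_axioms submonoid.one_closed[of S R] by (simp add: Phi_one)
  next
    case (Suc n)
    have "\<Phi> (h E) \<otimes>\<^bsub>R\<^esub> \<Phi> (h E ^ n) \<in> S"
      using S(1) Suc by (intro submonoid.m_closed[OF S.submonoid_axioms]) auto
    then show ?case by (simp add: Phi_mult)
  qed
  show "\<Phi> ` summand_polys None \<subseteq> S"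
  proof
    fix x assume "x \<in> \<Phi> ` summand_polys None"
    then obtain c where "x = \<Phi> (\<Sum>j\<le>top_degree. cst (c j) * h E ^ j)" by auto
    then show "x \<in> S" using S(2) by (simp only:) (intro submodule_Phi_sum submodule_Phi_cst pow, auto)
  qed
qed

lemma lin_span_flat:
  assumes "F \<in> inner_flats"
  shows "lin_span R {\<Phi> (var F * h F ^ k * p) | k p. k < mult_bound F \<and> p \<in> poly_in (upper F)} = \<Phi> ` summand_polys (Some F)"
    (is "lin_span R ?X = _")
proof
  have X: "?X \<subseteq> carrier R" by (auto simp: Phi_ops)
  show "lin_span R ?X \<subseteq> \<Phi> ` summand_polys (Some F)"
  proof (intro R.lin_span_minimal summand_submodule subsetI)
    fix x assume "x \<in> ?X"
    then obtain k p where kp: "x = \<Phi> (var F * h F ^ k * p)" "k < mult_bound F" "p \<in> poly_in (upper F)" by auto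
    have "(\<Sum>l<mult_bound F. var F * h F ^ l * (if l = k then p else 0)) =
       (\<Sum>l<mult_bound F. if l = k then var F * h F ^ k * p else 0)" by (intro sum.cong) auto
    also have "\<dots> = var F * h F ^ k * p" using kp by simp
    finally have "var F * h F ^ k * p = (\<Sum>l<mult_bound F. var F * h F ^ l * (if l = k then p else 0))" by simp
    then have "var F * h F ^ k * p \<in> summand_polys (Some F)"
      unfolding summand_polys.simps using kp(3)
      by (intro CollectI exI[of _ "\<lambda>l. if l = k then p else 0"] conjI) auto
    then show "x \<in> \<Phi> ` summand_polys (Some F)" using kp(1) by auto
  qed
  show "\<Phi> ` summand_polys (Some F) \<subseteq> lin_span R ?X"
  proof
    fix x assume "x \<in> \<Phi> ` summand_polys (Some F)"
    then obtain f where f: "x = \<Phi> (\<Sum>k<mult_bound F. var F * h F ^ k * f k)" "\<forall>k. f k \<in> poly_in (upper F)" by auto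
    have "\<Phi> (var F * h F ^ k * f k) \<in> lin_span R ?X" if "k < mult_bound F" for k
      using that f(2) by (intro subsetD[OF R.lin_span_superset]) auto
    then show "x \<in> lin_span R ?X" unfolding f(1) by (intro submodule_Phi_sum R.lin_span_submodule X) auto
  qed
qed

text \<open>\<open>h E\<close> involves only the variable of \<open>E\<close>, which lies above
  every \<open>F\<close>, so it is absorbed into the coefficient. This is why the summands are
  modules over the subalgebra of the alpha class.\<close>

lemma summand_hE_mult:
  assumes "s \<in> summand_polys i" "i \<in> idx"
  shows "\<Phi> (h E ^ n * s) \<in> \<Phi> ` summand_polys i"
proof (cases i)
  case None
  obtain t where t: "t \<in> summand_polys None" "\<Phi> (h E ^ n) = \<Phi> t" using power_in_summand[of n] by auto
  have "\<Phi> (h E ^ n * s) = \<Phi> (t * s)" using t(2) by (simp add: Phi_mult[symmetric])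
  then show ?thesis using top_summand_mult[OF t(1)] assms(1) None by simp
next
  case (Some F)
  have F: "F \<in> inner_flats" using assms(2) Some by (auto simp: idx_def)
  obtain f where f: "s = (\<Sum>k<mult_bound F. var F * h F ^ k * f k)" "\<forall>k. f k \<in> poly_in (upper F)"
    using assms(1) Some by auto
  have "h E ^ n * s = (\<Sum>k<mult_bound F. var F * h F ^ k * (h E ^ n * f k))"
    by (simp add: f(1) sum_distrib_left algebra_simps)
  moreover have "\<forall>k. h E ^ n * f k \<in> poly_in (upper F)"
    using f(2) inner_props(3)[OF F] by (intro allI poly_in_mult poly_in_power) auto
  ultimately have "h E ^ n * s \<in> summand_polys (Some F)"
    unfolding summand_polys.simps by (intro CollectI exI[of _ "\<lambda>k. h E ^ n * f k"] conjI)
  then show ?thesis unfolding Some by (rule imageI)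
qed

lemma finite_idx: "finite idx"
  using finite_P by (simp add: idx_def)

lemma sum_idx: "(\<Sum>i\<in>idx. g i) = g None + (\<Sum>F\<in>{F \<in> inner_flats. 0 < mult_bound F}. g (Some F))"
proof -
  have "(\<Sum>i\<in>Some ` {F \<in> inner_flats. 0 < mult_bound F}. g i) = (\<Sum>F\<in>{F \<in> inner_flats. 0 < mult_bound F}. g (Some F))"
    by (subst sum.reindex) (auto simp: o_def)
  then show ?thesis using finite_P by (simp add: idx_def)
qed

lemma sum_summands_zero:
  assumes s: "\<And>i. i \<in> idx \<Longrightarrow> s i \<in> summand_polys i" and I: "(\<Sum>i\<in>idx. s i) \<in> I" and i: "i \<in> idx"
  shows "s i \<in> I"
proof -
  have "s None \<in> summand_polys None" by (rule s) (simp add: idx_def)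
  then obtain c where c: "s None = (\<Sum>j\<le>top_degree. cst (c j) * h E ^ j)" by auto
  \<comment> \<open>Coefficients are chosen for all flats at once, in order to recognize the sum as
    one \<open>total\<close>.\<close>
  have "\<forall>F. \<exists>f. F \<in> inner_flats \<longrightarrow> 0 < mult_bound F \<longrightarrow>
     s (Some F) = (\<Sum>k<mult_bound F. var F * h F ^ k * f k) \<and> (\<forall>k. f k \<in> poly_in (upper F))"
  proof
    fix F
    show "\<exists>f. F \<in> inner_flats \<longrightarrow> 0 < mult_bound F \<longrightarrow>
       s (Some F) = (\<Sum>k<mult_bound F. var F * h F ^ k * f k) \<and> (\<forall>k. f k \<in> poly_in (upper F))"
    proof (cases "F \<in> inner_flats \<and> 0 < mult_bound F")
      case True
      then have "s (Some F) \<in> summand_polys (Some F)" by (intro s) (simp add: idx_def)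
      then show ?thesis by auto
    qed auto
  qed
  from choice[OF this] obtain g where g': "\<forall>F. F \<in> inner_flats \<longrightarrow> 0 < mult_bound F \<longrightarrow>
     s (Some F) = (\<Sum>k<mult_bound F. var F * h F ^ k * g F k) \<and> (\<forall>k. g F k \<in> poly_in (upper F))" ..
  then have g: "s (Some F) = (\<Sum>k<mult_bound F. var F * h F ^ k * g F k) \<and> (\<forall>k. g F k \<in> poly_in (upper F))"
    if "F \<in> inner_flats" "0 < mult_bound F" for F
    using that by simp
  define f where "f F k = (if 0 < mult_bound F then g F k else 0)" for F k
  have cf: "coeffs_in f" using g by (simp add: coeffs_in_def f_def)
  have sF: "s (Some F) = (\<Sum>k<mult_bound F. var F * h F ^ k * f F k)" if "F \<in> inner_flats" "0 < mult_bound F" for F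
    using g[OF that] that by (simp add: f_def)
  have "(\<Sum>i\<in>idx. s i) = total c f"
  proof -
    have "(\<Sum>F\<in>{F \<in> inner_flats. 0 < mult_bound F}. s (Some F)) =
       (\<Sum>F\<in>{F \<in> inner_flats. 0 < mult_bound F}. \<Sum>k<mult_bound F. var F * h F ^ k * f F k)"
      by (intro sum.cong) (auto simp: sF)
    also have "\<dots> = (\<Sum>F\<in>inner_flats. \<Sum>k<mult_bound F. var F * h F ^ k * f F k)"
    proof (rule sum.mono_neutral_left)
      show "\<forall>F\<in>inner_flats - {F \<in> inner_flats. 0 < mult_bound F}.
         (\<Sum>k<mult_bound F. var F * h F ^ k * f F k) = 0"
      proof
        fix F assume "F \<in> inner_flats - {F \<in> inner_flats. 0 < mult_bound F}"
        then have "\<not> 0 < mult_bound F" by (auto simp only: Diff_iff mem_Collect_eq)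
        then have "mult_bound F = 0" by simp
        then show "(\<Sum>k<mult_bound F. var F * h F ^ k * f F k) = 0" by simp
      qed
    qed (use finite_P in auto)
    finally show ?thesis by (simp add: sum_idx c total_def)
  qed
  then have tot: "total c f \<in> I" using I by simp
  show ?thesis
  proof (cases i)
    case None
    have "s None = 0" unfolding c
    proof (intro sum.neutral ballI)
      fix j :: nat assume "j \<in> {..top_degree}"
      then have "j \<le> top_degree" by (rule atMost_iff[THEN iffD1])
      then have "c j = 0" by (rule total_in_ideal(1)[OF cf tot])
      then show "cst (c j) * h E ^ j = 0" by simp
    qed
    then show ?thesis using None by simp
  next
    case (Some F)
    then have F: "F \<in> inner_flats" "0 < mult_bound F" using i by (auto simp: idx_def)
    show ?thesis unfolding Some sF[OF F]
      by (intro gen_ideal_sum total_in_ideal(2)[OF cf tot] F) simp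
  qed
qed

lemma ex_summands: "\<exists>s. (\<forall>i\<in>idx. s i \<in> summand_polys i) \<and> p - (\<Sum>i\<in>idx. s i) \<in> I"
proof -
  obtain c f where cf: "coeffs_in f" "p - total c f \<in> I" using ex_total[of p] by (elim exE conjE)
  define s where "s i = (case i of None \<Rightarrow> \<Sum>j\<le>top_degree. cst (c j) * h E ^ j
     | Some F \<Rightarrow> \<Sum>k<mult_bound F. var F * h F ^ k * f F k)" for i
  have "s i \<in> summand_polys i" if i: "i \<in> idx" for i
  proof (cases i)
    case None
    then show ?thesis by (auto simp: s_def)
  next
    case (Some F)
    then have "F \<in> inner_flats" using i by (auto simp: idx_def)
    then show ?thesis
      using Some coeffs_inD[OF cf(1)] unfolding Some s_def by (auto intro!: exI[of _ "f F"])
  qed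
  moreover have "(\<Sum>i\<in>idx. s i) = total c f"
  proof -
    have "(\<Sum>F\<in>{F \<in> inner_flats. 0 < mult_bound F}. \<Sum>k<mult_bound F. var F * h F ^ k * f F k) =
       (\<Sum>F\<in>inner_flats. \<Sum>k<mult_bound F. var F * h F ^ k * f F k)"
    proof (rule sum.mono_neutral_left)
      show "\<forall>F\<in>inner_flats - {F \<in> inner_flats. 0 < mult_bound F}.
         (\<Sum>k<mult_bound F. var F * h F ^ k * f F k) = 0"
      proof
        fix F assume "F \<in> inner_flats - {F \<in> inner_flats. 0 < mult_bound F}"
        then have "\<not> 0 < mult_bound F" by (auto simp only: Diff_iff mem_Collect_eq)
        then have "mult_bound F = 0" by simp
        then show "(\<Sum>k<mult_bound F. var F * h F ^ k * f F k) = 0" by simp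
      qed
    qed (use finite_P in auto)
    then show ?thesis by (simp add: sum_idx s_def total_def)
  qed
  ultimately show ?thesis using cf(2) by (intro exI[of _ s]) simp
qed

lemma decomposition:
  "module_decomposition (generated_subalgebra R {\<Phi> (h E)}) R idx (\<lambda>i. \<Phi> ` summand_polys i)"
  unfolding module_decomposition_def generated_subalgebra_top
proof (intro conjI ballI)
  fix i assume i: "i \<in> idx"
  have sub: "submodule (\<Phi> ` summand_polys i) QQ R" by (rule summand_submodule)
  interpret S: subgroup "\<Phi> ` summand_polys i" "add_monoid R" by (rule submodule.axioms(1)[OF sub])
  show "submodule (\<Phi> ` summand_polys i) (R\<lparr>carrier := \<Phi> ` summand_polys None\<rparr>) (regular_module R)"
  proof (intro submodule.intro subgroup.intro submodule_axioms.intro)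
    show "\<Phi> ` summand_polys i \<subseteq> carrier (add_monoid (regular_module R))"
      using S.subset by (simp add: regular_module_def)
    show "x \<otimes>\<^bsub>add_monoid (regular_module R)\<^esub> y \<in> \<Phi> ` summand_polys i"
      if "x \<in> \<Phi> ` summand_polys i" "y \<in> \<Phi> ` summand_polys i" for x y
      using S.m_closed[OF that] by (simp add: regular_module_def)
    show "\<one>\<^bsub>add_monoid (regular_module R)\<^esub> \<in> \<Phi> ` summand_polys i"
      using S.one_closed by (simp add: regular_module_def)
    show "inv\<^bsub>add_monoid (regular_module R)\<^esub> x \<in> \<Phi> ` summand_polys i"
      if "x \<in> \<Phi> ` summand_polys i" for x
      using S.m_inv_closed[OF that] by (simp add: regular_module_def m_inv_def)
    fix a x assume "a \<in> carrier (R\<lparr>carrier := \<Phi> ` summand_polys None\<rparr>)" "x \<in> \<Phi> ` summand_polys i"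
    then obtain s t where st: "a = \<Phi> s" "s \<in> summand_polys None" "x = \<Phi> t" "t \<in> summand_polys i" by auto
    obtain c where "s = (\<Sum>j\<le>top_degree. cst (c j) * h E ^ j)" using st(2) by auto
    then have "s * t = (\<Sum>j\<le>top_degree. cst (c j) * (h E ^ j * t))"
      by (simp add: sum_distrib_right mult.assoc)
    then have "\<Phi> (s * t) \<in> \<Phi> ` summand_polys i"
      by (simp only:) (intro submodule_Phi_sum[OF sub] submodule_Phi_cst[OF sub] summand_hE_mult[OF st(4) i])
    then show "a \<odot>\<^bsub>regular_module R\<^esub> x \<in> \<Phi> ` summand_polys i"
      using st by (simp add: regular_module_def Phi_mult)
  qed
next
  fix a assume "a \<in> carrier R"
  then obtain p where p: "a = \<Phi> p" by (auto simp: Phi_ops)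
  obtain s where s: "\<forall>i\<in>idx. s i \<in> summand_polys i" "p - (\<Sum>i\<in>idx. s i) \<in> I"
    using ex_summands[of p] by (elim exE conjE)
  interpret abelian_group R by (rule R.abelian_group)
  have fin: "finsum R f idx = \<Phi> (\<Sum>i\<in>idx. t i)" if "\<And>i. i \<in> idx \<Longrightarrow> f i = \<Phi> (t i)" for f t
  proof -
    have "finsum R f idx = finsum R (\<lambda>i. \<Phi> (t i)) idx"
      using that by (intro finsum_cong') (auto simp: Phi_ops)
    then show ?thesis using R.finsum_Phi[OF finite_idx] by simp
  qed
  show "\<exists>!f. f \<in> Pi\<^sub>E idx (\<lambda>i. \<Phi> ` summand_polys i) \<and> finsum R f idx = a"
  proof (rule ex1I[of _ "restrict (\<lambda>i. \<Phi> (s i)) idx"])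
    have "finsum R (restrict (\<lambda>i. \<Phi> (s i)) idx) idx = \<Phi> (\<Sum>i\<in>idx. s i)" by (rule fin) simp
    also have "\<dots> = a"
    proof -
      have "\<Phi> p = \<Phi> (\<Sum>i\<in>idx. s i)" using s(2) by (simp only: Phi_ops(4))
      then show ?thesis using p by simp
    qed
    finally show "restrict (\<lambda>i. \<Phi> (s i)) idx \<in> Pi\<^sub>E idx (\<lambda>i. \<Phi> ` summand_polys i) \<and>
       finsum R (restrict (\<lambda>i. \<Phi> (s i)) idx) idx = a"
      using s(1) by (auto intro!: restrict_PiE)
  next
    fix f assume f: "f \<in> Pi\<^sub>E idx (\<lambda>i. \<Phi> ` summand_polys i) \<and> finsum R f idx = a"
    then have "\<forall>i\<in>idx. \<exists>t. t \<in> summand_polys i \<and> f i = \<Phi> t" by (auto simp: PiE_def Pi_def)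
    from bchoice[OF this] obtain t where t: "\<forall>i\<in>idx. t i \<in> summand_polys i \<and> f i = \<Phi> (t i)" ..
    have ft: "finsum R f idx = \<Phi> (\<Sum>i\<in>idx. t i)" using t by (intro fin) simp
    have "\<Phi> (\<Sum>i\<in>idx. t i) = \<Phi> p" using f p unfolding ft[symmetric] by simp
    then have "(\<Sum>i\<in>idx. t i) - p \<in> I" by (simp only: Phi_ops(4))
    \<comment> \<open>Two representations of the same element differ by a family of summand elements
      whose sum is in the ideal; by directness each difference is then in the ideal.\<close>
    then have "((\<Sum>i\<in>idx. t i) - p) + (p - (\<Sum>i\<in>idx. s i)) \<in> I" using s(2) by (intro gen_ideal_add)
    then have "(\<Sum>i\<in>idx. t i + cst (- 1) * s i) \<in> I" by (simp add: sum_subtractf)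
    then have "t i + cst (- 1) * s i \<in> I" if "i \<in> idx" for i
      using t s(1) that
      by (intro sum_summands_zero[of "\<lambda>i. t i + cst (- 1) * s i"] summand_polys_add summand_polys_cst_mult) auto
    then have "f i = \<Phi> (s i)" if "i \<in> idx" for i using that t R.Phi_eq_iff by simp
    then show "f = restrict (\<lambda>i. \<Phi> (s i)) idx"
      using f by (intro extensionalityI[of _ idx]) (auto simp: PiE_def)
  qed
qed

lemma summands_orthogonal:
  assumes "i \<in> idx" "j \<in> idx" "i \<noteq> j" "s \<in> summand_polys i" "t \<in> summand_polys j"
  shows "deg_fun (s * t) = 0"
proof -
  have top: "deg_fun (s * t) = 0" if F: "F \<in> inner_flats" and s: "s \<in> summand_polys (Some F)" and t: "t \<in> summand_polys None" for F s t
  proof -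
    obtain f where f: "s = (\<Sum>k<mult_bound F. var F * h F ^ k * f k)" "\<forall>k. f k \<in> poly_in (upper F)"
      using s by auto
    obtain c where c: "t = (\<Sum>j\<le>top_degree. cst (c j) * h E ^ j)" using t by auto
    have "s * t = (\<Sum>k<mult_bound F. \<Sum>j\<le>top_degree. cst (c j) * (var F * h F ^ k * f k * h E ^ j))"
      unfolding f(1) c sum_product by (intro sum.cong) (simp_all add: algebra_simps)
    then have "deg_fun (s * t) = (\<Sum>k<mult_bound F. \<Sum>j\<le>top_degree. c j * deg_fun (var F * h F ^ k * f k * h E ^ j))"
      by (simp only: deg_fun_sum deg_fun_cst_mult)
    also have "\<dots> = 0"
      using flat_orthogonal_top[OF F] f(2) by (intro sum.neutral ballI) auto
    finally show ?thesis .
  qed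
  show ?thesis
  proof (cases i)
    case None
    then obtain G where G: "j = Some G" using assms(3) by (cases j) auto
    have "deg_fun (t * s) = 0" using top[of G t s] assms None G by (auto simp: idx_def)
    then show ?thesis by (simp add: mult.commute)
  next
    case (Some F)
    note iF = this
    show ?thesis
    proof (cases j)
      case None
      then show ?thesis using top[of F s t] assms iF by (auto simp: idx_def)
    next
      case (Some G)
      have FG: "F \<in> inner_flats" "G \<in> inner_flats" "F \<noteq> G" using assms iF Some by (auto simp: idx_def)
      obtain f where f: "s = (\<Sum>k<mult_bound F. var F * h F ^ k * f k)" "\<forall>k. f k \<in> poly_in (upper F)"
        using assms iF by auto
      obtain g where g: "t = (\<Sum>k<mult_bound G. var G * h G ^ k * g k)" "\<forall>k. g k \<in> poly_in (upper G)"
        using assms Some by auto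
      have "deg_fun (s * t) = (\<Sum>k<mult_bound F. \<Sum>l<mult_bound G. deg_fun ((var F * h F ^ k * f k) * (var G * h G ^ l * g l)))"
        unfolding f(1) g(1) sum_product deg_fun_sum ..
      also have "\<dots> = 0"
        using f(2) g(2) FG by (intro sum.neutral ballI flat_orthogonal_flat) auto
      finally show ?thesis .
    qed
  qed
qed

section \<open>The degree map, orthogonality and truncated powers of the alpha class\<close>

definition degree_part :: "nat \<Rightarrow> 'b set" where
  "degree_part k = \<Phi> ` {p. homogeneous k p}"

text \<open>\<open>mc\<close> and \<open>X\<close> abstract the maximal flags and their classes, so
  that this covers both definitions of the degree map. Uniqueness holds because the top degree is
  spanned by the class of any one flag, and such a flag exists.\<close>

lemma deg_characterization:
  assumes chains: "\<And>C. mc C \<Longrightarrow> X C = \<Phi> (\<Prod>F\<in>C. var F) \<and> C \<subseteq> inner_flats \<and> card C = top_degree \<and>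
      (\<forall>F\<in>C. \<forall>G\<in>C. F \<subseteq> G \<or> G \<subseteq> F)" and ex: "\<exists>C. mc C"
    and p: "homogeneous top_degree p"
  shows "(THE f. f \<in> extensional (degree_part top_degree) \<and>
     f \<in> linear_maps (R\<lparr>carrier := degree_part top_degree\<rparr>) QQ \<and>
     bij_betw f (degree_part top_degree) UNIV \<and> (\<forall>C. mc C \<longrightarrow> f (X C) = 1)) (\<Phi> p) = deg_fun p"
proof -
  let ?D = "degree_part top_degree"
  define d where "d x = (if x \<in> ?D then deg_fun (SOME p. \<Phi> p = x) else undefined)" for x
  have dPhi: "d (\<Phi> p) = deg_fun p" if "homogeneous top_degree p" for p
  proof -
    have "\<Phi> (SOME q. \<Phi> q = \<Phi> p) = \<Phi> p" by (rule someI) (rule refl)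
    then have "deg_fun (SOME q. \<Phi> q = \<Phi> p) = deg_fun p"
      using deg_fun_ideal[of "(SOME q. \<Phi> q = \<Phi> p) - p"] by (simp add: Phi_ops deg_fun_diff)
    then show ?thesis using that by (auto simp: d_def degree_part_def)
  qed
  have top: "\<Phi> p = deg_fun p \<odot>\<^bsub>R\<^esub> \<Phi> (h E ^ top_degree)" if "homogeneous top_degree p" for p
    using top_cong[OF that] R.Phi_eq_iff by (simp add: Phi_ops(2))
  have flag: "deg_fun (\<Prod>F\<in>C. var F) = 1" "homogeneous top_degree (\<Prod>F\<in>C. var F)" "X C = \<Phi> (\<Prod>F\<in>C. var F)"
    if "mc C" for C
  proof -
    note C = chains[OF that]
    have "finite C" using C finite_P finite_subset[of C P] by auto
    have "homogeneous (card C) (\<Prod>F\<in>C. var F)" using \<open>finite C\<close> by (intro homogeneous_prod) auto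
    then show "homogeneous top_degree (\<Prod>F\<in>C. var F)" using C by metis
    show "deg_fun (\<Prod>F\<in>C. var F) = 1"
    proof (rule deg_fun_flag)
      show "C \<subseteq> inner_flats" "card C = top_degree" using C by (metis, metis)
      show "F \<in> C \<Longrightarrow> G \<in> C \<Longrightarrow> F \<subseteq> G \<or> G \<subseteq> F" for F G using C by metis
    qed
    show "X C = \<Phi> (\<Prod>F\<in>C. var F)" using C by metis
  qed
  have hE: "homogeneous top_degree (h E ^ top_degree)" by (rule homogeneous_power[OF hvar_hom])
  let ?Q = "\<lambda>f. f \<in> extensional ?D \<and> f \<in> linear_maps (R\<lparr>carrier := ?D\<rparr>) QQ \<and>
     bij_betw f ?D UNIV \<and> (\<forall>C. mc C \<longrightarrow> f (X C) = 1)"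
  have Qd: "?Q d"
  proof (intro conjI allI impI)
    show "d \<in> extensional ?D" by (simp add: extensional_def d_def)
    show "d \<in> linear_maps (R\<lparr>carrier := ?D\<rparr>) QQ"
      unfolding linear_maps_def hom_def
    proof (intro CollectI conjI Pi_I ballI allI)
      show "d x \<in> carrier (add_monoid QQ)" for x by (simp add: QQ_def)
      fix x y assume "x \<in> carrier (add_monoid (R\<lparr>carrier := ?D\<rparr>))" "y \<in> carrier (add_monoid (R\<lparr>carrier := ?D\<rparr>))"
      then obtain p q where "x = \<Phi> p" "homogeneous top_degree p" "y = \<Phi> q" "homogeneous top_degree q"
        by (auto simp: degree_part_def)
      then show "d (x \<otimes>\<^bsub>add_monoid (R\<lparr>carrier := ?D\<rparr>)\<^esub> y) = d x \<otimes>\<^bsub>add_monoid QQ\<^esub> d y"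
        by (simp add: Phi_ops(1) dPhi homogeneous_add deg_fun_add QQ_def)
    next
      fix c x assume "x \<in> carrier (R\<lparr>carrier := ?D\<rparr>)"
      then obtain p where "x = \<Phi> p" "homogeneous top_degree p" by (auto simp: degree_part_def)
      then show "d (c \<odot>\<^bsub>R\<lparr>carrier := ?D\<rparr>\<^esub> x) = c \<odot>\<^bsub>QQ\<^esub> d x"
        by (simp add: Phi_ops(2) dPhi homogeneous_cst_mult deg_fun_cst_mult QQ_def)
    qed
    show "bij_betw d ?D UNIV"
      unfolding bij_betw_def
    proof
      show "inj_on d ?D"
      proof (rule inj_onI)
        fix x y assume xy: "x \<in> ?D" "y \<in> ?D" "d x = d y"
        then obtain p q where pq: "x = \<Phi> p" "homogeneous top_degree p" "y = \<Phi> q" "homogeneous top_degree q"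
          by (auto simp: degree_part_def)
        then have "deg_fun p = deg_fun q" using xy(3) dPhi by simp
        then show "x = y" using top[OF pq(2)] top[OF pq(4)] pq(1,3) by simp
      qed
      show "d ` ?D = UNIV"
      proof (intro equalityI subsetI)
        fix c :: rat
        have "homogeneous top_degree (cst c * h E ^ top_degree)" using hE by (rule homogeneous_cst_mult)
        moreover have "deg_fun (cst c * h E ^ top_degree) = c" by (simp add: deg_fun_cst_mult deg_fun_hvar_E)
        ultimately show "c \<in> d ` ?D"
          using dPhi by (intro image_eqI[of _ _ "\<Phi> (cst c * h E ^ top_degree)"]) (auto simp: degree_part_def)
      qed simp
    qed
    show "d (X C) = 1" if "mc C" for C
      using dPhi[OF flag(2)[OF that]] flag(1)[OF that] flag(3)[OF that] by simp
  qed
  have "f = d" if Q: "?Q f" for f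
  proof (rule extensionalityI[of f ?D])
    show "f \<in> extensional ?D" "d \<in> extensional ?D" using Q Qd by auto
    have lin: "f \<in> linear_maps (R\<lparr>carrier := ?D\<rparr>) QQ" and one: "\<forall>C. mc C \<longrightarrow> f (X C) = 1" using Q by auto
    obtain C where C: "mc C" using ex ..
    have "\<Phi> (h E ^ top_degree) = X C"
      using top[OF flag(2)[OF C]] flag(1,3)[OF C] by (simp add: Phi_ops(2))
    then have f1: "f (\<Phi> (h E ^ top_degree)) = 1" using one C by simp
    fix x assume "x \<in> ?D"
    then obtain p where p: "x = \<Phi> p" "homogeneous top_degree p" by (auto simp: degree_part_def)
    have "\<Phi> (h E ^ top_degree) \<in> carrier (R\<lparr>carrier := ?D\<rparr>)" using hE by (auto simp: degree_part_def)
    from linear_mapsD(3)[OF lin this, of "deg_fun p"]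
    have "f (deg_fun p \<odot>\<^bsub>R\<^esub> \<Phi> (h E ^ top_degree)) = deg_fun p"
      unfolding f1 by (simp add: QQ_def)
    then have "f x = deg_fun p" unfolding p(1) top[OF p(2)] .
    moreover have "d x = deg_fun p" unfolding p(1) by (rule dPhi[OF p(2)])
    ultimately show "f x = d x" by simp
  qed
  then have "(THE f. ?Q f) = d" using Qd by (intro the_equality)
  then show ?thesis using dPhi[OF p] by simp
qed

lemma orthogonal:
  assumes ij: "i \<in> idx" "j \<in> idx" "i \<noteq> j"
    and \<eta>: "\<eta> \<in> \<Phi> ` summand_polys i \<inter> degree_part k" and \<xi>: "\<xi> \<in> \<Phi> ` summand_polys j \<inter> degree_part l"
    and kl: "k + l = top_degree"
    and dg: "\<And>p. homogeneous top_degree p \<Longrightarrow> dg (\<Phi> p) = deg_fun p"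
  shows "dg (\<eta> \<otimes>\<^bsub>R\<^esub> \<xi>) = 0"
proof -
  \<comment> \<open>A homogeneous element of a summand has two representatives, a homogeneous one
    and one of the form defining the summand. They need not coincide, but \<open>deg_fun\<close>
    does not see the difference.\<close>
  obtain s p where s: "\<eta> = \<Phi> s" "s \<in> summand_polys i" "\<eta> = \<Phi> p" "homogeneous k p"
    using \<eta> unfolding degree_part_def by blast
  obtain t q where t: "\<xi> = \<Phi> t" "t \<in> summand_polys j" "\<xi> = \<Phi> q" "homogeneous l q"
    using \<xi> unfolding degree_part_def by blast
  have "homogeneous top_degree (p * q)" using homogeneous_mult[OF s(4) t(4)] kl by simp
  then have "dg (\<Phi> (p * q)) = deg_fun (p * q)" by (rule dg)
  moreover have "\<Phi> (p * q) = \<Phi> (s * t)" using s(1,3) t(1,3) by (simp only: Phi_mult[symmetric])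
  then have "deg_fun (p * q) = deg_fun (s * t)"
    using deg_fun_ideal[of "p * q - s * t"] by (simp add: Phi_ops deg_fun_diff)
  moreover have "deg_fun (s * t) = 0" by (rule summands_orthogonal[OF ij s(2) t(2)])
  moreover have "\<eta> \<otimes>\<^bsub>R\<^esub> \<xi> = \<Phi> (p * q)" unfolding s(3) t(3) by (rule Phi_mult)
  ultimately show ?thesis by simp
qed

text \<open>The definition of \<open>J\<close> intersects the subalgebra with the degree parts. A
  homogeneous class of degree \<open>k\<close> in the subalgebra is a multiple of the
  \<open>k\<close>-th power: every other coefficient is detected by pairing with a complementary
  power.\<close>

lemma truncated_span:
  "lin_span R (\<Union>k. if k = top_degree then {\<zero>\<^bsub>R\<^esub>} else generated_subalgebra R {\<Phi> (h E)} \<inter> degree_part k) =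
   lin_span R {\<Phi> (h E ^ k) | k. k < top_degree}"
  (is "lin_span R ?X = lin_span R ?Y")
proof
  have Y: "?Y \<subseteq> carrier R" by (auto simp: Phi_ops)
  have spY: "submodule (lin_span R ?Y) QQ R" by (rule R.lin_span_submodule[OF Y])
  have X: "?X \<subseteq> carrier R"
    by (auto simp: Phi_ops degree_part_def R.Phi_zero split: if_splits)
  show "lin_span R ?X \<subseteq> lin_span R ?Y"
  proof (intro R.lin_span_minimal[OF spY] subsetI)
    fix x assume "x \<in> ?X"
    then obtain k where k: "x \<in> (if k = top_degree then {\<zero>\<^bsub>R\<^esub>} else generated_subalgebra R {\<Phi> (h E)} \<inter> degree_part k)"
      by (elim UN_E)
    have zero: "\<zero>\<^bsub>R\<^esub> \<in> lin_span R ?Y" using spY unfolding R.submodule_iff by auto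
    show "x \<in> lin_span R ?Y"
    proof (cases "k = top_degree")
      case True
      then have "x = \<zero>\<^bsub>R\<^esub>" using k unfolding True by simp
      then show ?thesis using zero by simp
    next
      case False
      then have "x \<in> generated_subalgebra R {\<Phi> (h E)} \<inter> degree_part k" using k by (simp only: if_False)
      then have "x \<in> \<Phi> ` summand_polys None" "x \<in> degree_part k"
        unfolding generated_subalgebra_top by (rule IntD1, rule IntD2)
      then obtain s p where sp: "x = \<Phi> s" "s \<in> summand_polys None" "x = \<Phi> p" "homogeneous k p"
        unfolding degree_part_def by blast
      obtain c where "s = (\<Sum>j\<le>top_degree. cst (c j) * h E ^ j)" using sp(2) by auto
      then have cp: "x = \<Phi> (\<Sum>j\<le>top_degree. cst (c j) * h E ^ j)" "x = \<Phi> p" "homogeneous k p"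
        using sp by simp_all
      have c0: "c j = 0" if j: "j \<le> top_degree" "j \<noteq> k" for j
      proof -
        have "deg_fun (p * h E ^ (top_degree - j)) = 0"
        proof (rule deg_fun_homogeneous)
          show "homogeneous (k + (top_degree - j)) (p * h E ^ (top_degree - j))"
            by (intro homogeneous_mult cp(3) homogeneous_power hvar_hom)
          show "k + (top_degree - j) \<noteq> top_degree" using j by linarith
        qed
        moreover have "p - (\<Sum>j\<le>top_degree. cst (c j) * h E ^ j) \<in> I" using cp Phi_ops(4) by simp
        then have "(p - (\<Sum>j\<le>top_degree. cst (c j) * h E ^ j)) * h E ^ (top_degree - j) \<in> I" by (rule gen_ideal_mult_right)
        then have "deg_fun (p * h E ^ (top_degree - j)) = deg_fun ((\<Sum>i\<le>top_degree. cst (c i) * h E ^ i) * h E ^ (top_degree - j))"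
          using deg_fun_ideal[of "(p - (\<Sum>j\<le>top_degree. cst (c j) * h E ^ j)) * h E ^ (top_degree - j)"]
          by (simp only: left_diff_distrib deg_fun_diff right_minus_eq simp_thms)
        moreover have "(\<Sum>i\<le>top_degree. cst (c i) * h E ^ i) * h E ^ (top_degree - j) =
           (\<Sum>i\<le>top_degree. cst (c i) * h E ^ (i + (top_degree - j)))"
          by (simp add: sum_distrib_right power_add mult.assoc)
        then have "deg_fun ((\<Sum>i\<le>top_degree. cst (c i) * h E ^ i) * h E ^ (top_degree - j)) =
           (\<Sum>i\<le>top_degree. c i * deg_fun (h E ^ (i + (top_degree - j))))"
          by (simp only: deg_fun_sum deg_fun_cst_mult)
        moreover have "\<dots> = (\<Sum>i\<le>top_degree. if i = j then c j else 0)"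
          using j by (intro sum.cong) (auto simp: deg_fun_hvar_E)
        moreover have "\<dots> = c j" using j by simp
        ultimately show ?thesis by simp
      qed
      have "\<Phi> (cst (c j) * h E ^ j) \<in> lin_span R ?Y" if "j \<in> {..top_degree}" for j
      proof (cases "j = k")
        case True
        have "j \<le> top_degree" using that by (rule atMost_iff[THEN iffD1])
        then have "j < top_degree" using True False by linarith
        then have "\<Phi> (h E ^ j) \<in> lin_span R ?Y" by (intro subsetD[OF R.lin_span_superset]) auto
        then show ?thesis by (rule submodule_Phi_cst[OF spY])
      next
        case False
        have "j \<le> top_degree" using that by (rule atMost_iff[THEN iffD1])
        then have "c j = 0" using False by (rule c0)
        then show ?thesis using zero by (simp add: R.Phi_zero)
      qed
      then show ?thesis unfolding cp(1) by (rule submodule_Phi_sum[OF spY])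
    qed
  qed
  show "lin_span R ?Y \<subseteq> lin_span R ?X"
  proof (intro R.lin_span_minimal R.lin_span_submodule X subsetI)
    fix x assume "x \<in> ?Y"
    then obtain k where k: "x = \<Phi> (h E ^ k)" "k < top_degree" by auto
    have "homogeneous k (h E ^ k)" by (rule homogeneous_power[OF hvar_hom])
    then have "x \<in> generated_subalgebra R {\<Phi> (h E)} \<inter> degree_part k"
      using power_in_summand[of k] unfolding generated_subalgebra_top degree_part_def k(1) by auto
    then have "x \<in> ?X" using k(2) by (intro UN_I[of k]) auto
    then show "x \<in> lin_span R ?X" by (rule subsetD[OF R.lin_span_superset])
  qed
qed

end

section \<open>Quotients of polynomial algebras\<close>

definition poly_ideal :: "'v set \<Rightarrow> 'v mpoly set \<Rightarrow> bool" where
  "poly_ideal V J \<longleftrightarrow> J \<subseteq> poly_in V \<and> 0 \<in> J \<and> (\<forall>a\<in>J. \<forall>b\<in>J. a + b \<in> J) \<and> (\<forall>a\<in>J. \<forall>r\<in>poly_in V. r * a \<in> J)"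

lemma poly_algebra_simps: "carrier (poly_algebra V) = poly_in V" "mult (poly_algebra V) = (*)" "one (poly_algebra V) = 1"
  "zero (poly_algebra V) = 0" "add (poly_algebra V) = (+)"
  by (simp_all add: poly_in_def poly_algebra_def)

lemma poly_algebra_ring: "ring (poly_algebra V)"
proof (rule ringI)
  show "abelian_group (poly_algebra V)"
    by (rule presentation.abelian_group[OF pm_module.self_presentation[OF poly_algebra_pm]])
  show "Group.monoid (poly_algebra V)"
    by unfold_locales (auto simp: poly_algebra_simps mult.assoc)
qed (simp_all add: poly_algebra_simps algebra_simps)

lemma poly_ideal_iff: "ideal J (poly_algebra V) \<longleftrightarrow> poly_ideal V J"
proof
  assume "ideal J (poly_algebra V)"
  then interpret ideal J "poly_algebra V" .
  show "poly_ideal V J"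
    unfolding poly_ideal_def
    using a_subset additive_subgroup.a_closed[OF is_additive_subgroup] additive_subgroup.zero_closed[OF is_additive_subgroup] I_l_closed
    by (auto simp: poly_algebra_simps)
next
  assume J: "poly_ideal V J"
  interpret R: ring "poly_algebra V" by (rule poly_algebra_ring)
  have "scl c a \<in> J" if "a \<in> J" for c a
    using J that by (simp add: poly_ideal_def scl_cst)
  then have "submodule J QQ (poly_algebra V)"
    using J unfolding pm_module.submodule_iff[OF poly_algebra_pm] by (simp add: poly_ideal_def poly_algebra_simps)
  then have "subgroup J (add_monoid (poly_algebra V))" by (rule submodule.axioms(1))
  then show "ideal J (poly_algebra V)"
    using J by (intro idealI R.ring_axioms) (auto simp: poly_ideal_def poly_algebra_simps mult.commute)
qed

lemma Idl_poly_ideal: "S \<subseteq> poly_in V \<Longrightarrow> poly_ideal V (Idl\<^bsub>poly_algebra V\<^esub> S)"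
  using ring.genideal_ideal[OF poly_algebra_ring, of S V] by (simp add: poly_ideal_iff poly_algebra_simps)

lemma Idl_superset: "S \<subseteq> poly_in V \<Longrightarrow> S \<subseteq> Idl\<^bsub>poly_algebra V\<^esub> S"
  using ring.genideal_self[OF poly_algebra_ring, of S V] by (simp add: poly_algebra_simps)

lemma Idl_minimal: "poly_ideal V K \<Longrightarrow> S \<subseteq> K \<Longrightarrow> Idl\<^bsub>poly_algebra V\<^esub> S \<subseteq> K"
  using ring.genideal_minimal[OF poly_algebra_ring, of K V S] by (simp add: poly_ideal_iff)

lemma poly_ideal_gen_ideal: "poly_ideal UNIV (gen_ideal S)"
  unfolding poly_ideal_def by (auto intro: gen_ideal_mult_left)

lemma poly_ideal_submodule:
  assumes "poly_ideal V J"
  shows "submodule J QQ (poly_algebra V)"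
proof -
  have "scl c a \<in> J" if "a \<in> J" for c a
    using assms that by (simp add: poly_ideal_def scl_cst)
  then show ?thesis
    using assms unfolding pm_module.submodule_iff[OF poly_algebra_pm] by (simp add: poly_ideal_def poly_algebra_simps)
qed

lemma poly_ideal_closed:
  assumes "poly_ideal V J"
  shows "a \<in> J \<Longrightarrow> b \<in> J \<Longrightarrow> a + b \<in> J" "a \<in> J \<Longrightarrow> r \<in> poly_in V \<Longrightarrow> r * a \<in> J" "a \<in> J \<Longrightarrow> - a \<in> J"
    "a \<in> J \<Longrightarrow> b \<in> J \<Longrightarrow> a - b \<in> J" "0 \<in> J" "a \<in> J \<Longrightarrow> a \<in> poly_in V"
proof -
  show *: "a \<in> J \<Longrightarrow> b \<in> J \<Longrightarrow> a + b \<in> J" "a \<in> J \<Longrightarrow> r \<in> poly_in V \<Longrightarrow> r * a \<in> J" "0 \<in> J" "a \<in> J \<Longrightarrow> a \<in> poly_in V"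
    for a b r using assms by (auto simp: poly_ideal_def)
  show m: "a \<in> J \<Longrightarrow> - a \<in> J" for a using *(2)[OF _ poly_in_cst, of a "- 1"] by simp
  show "a \<in> J \<Longrightarrow> b \<in> J \<Longrightarrow> a - b \<in> J" using *(1)[of a "- b"] m by simp
qed

lemma quot_algebra_presentation:
  assumes "poly_ideal V J"
  shows "presentation (quot_module (poly_algebra V) J) (\<lambda>p. J +>\<^bsub>poly_algebra V\<^esub> p) (poly_in V) J"
  using pm_module.quot_presentation[OF poly_algebra_pm poly_ideal_submodule[OF assms]]
  by (simp add: poly_algebra_simps)

lemma quot_algebra_mult:
  assumes J: "poly_ideal V J" and p: "p \<in> poly_in V" and q: "q \<in> poly_in V"
  shows "(J +>\<^bsub>poly_algebra V\<^esub> p) \<otimes>\<^bsub>quot_module (poly_algebra V) J\<^esub> (J +>\<^bsub>poly_algebra V\<^esub> q) = J +>\<^bsub>poly_algebra V\<^esub> (p * q)"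
proof -
  note cos = pm_module.coset_mem_iff[OF poly_algebra_pm poly_ideal_submodule[OF J]]
    pm_module.coset_eq_iff[OF poly_algebra_pm poly_ideal_submodule[OF J]]
  note Jc = poly_ideal_closed[OF J]
  have "J +>\<^bsub>poly_algebra V\<^esub> (a * b) = J +>\<^bsub>poly_algebra V\<^esub> (p * q)"
    if "a \<in> J +>\<^bsub>poly_algebra V\<^esub> p" "b \<in> J +>\<^bsub>poly_algebra V\<^esub> q" for a b
  proof -
    have ab: "a - p \<in> J" "b - q \<in> J" using that by (simp_all add: cos)
    have b: "b \<in> poly_in V" using poly_in_add[OF Jc(6)[OF ab(2)] q] by simp
    have "b * (a - p) + p * (b - q) \<in> J" using ab b p by (intro Jc(1) Jc(2))
    then show ?thesis by (simp add: cos algebra_simps)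
  qed
  note const = this
  have mem: "p \<in> J +>\<^bsub>poly_algebra V\<^esub> p" "q \<in> J +>\<^bsub>poly_algebra V\<^esub> q" using Jc by (simp_all add: cos)
  have "(\<Union>a\<in>J +>\<^bsub>poly_algebra V\<^esub> p. \<Union>b\<in>J +>\<^bsub>poly_algebra V\<^esub> q. J +>\<^bsub>poly_algebra V\<^esub> (a * b)) = J +>\<^bsub>poly_algebra V\<^esub> (p * q)"
  proof
    show "(\<Union>a\<in>J +>\<^bsub>poly_algebra V\<^esub> p. \<Union>b\<in>J +>\<^bsub>poly_algebra V\<^esub> q. J +>\<^bsub>poly_algebra V\<^esub> (a * b)) \<subseteq> J +>\<^bsub>poly_algebra V\<^esub> (p * q)"
      by (intro UN_least) (simp only: const subset_refl)
    show "J +>\<^bsub>poly_algebra V\<^esub> (p * q) \<subseteq> (\<Union>a\<in>J +>\<^bsub>poly_algebra V\<^esub> p. \<Union>b\<in>J +>\<^bsub>poly_algebra V\<^esub> q. J +>\<^bsub>poly_algebra V\<^esub> (a * b))"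
      by (rule subset_trans[OF UN_upper[OF mem(2)] UN_upper[OF mem(1)]])
  qed
  then show ?thesis
    by (simp only: quot_module_def FactRing_def rcoset_mult_def poly_algebra_simps monoid.simps)
qed

lemma quot_algebra_one: "\<one>\<^bsub>quot_module (poly_algebra V) J\<^esub> = J +>\<^bsub>poly_algebra V\<^esub> 1"
  by (simp add: quot_module_def FactRing_def poly_algebra_simps)

lemma poly_ideal_subst_cong:
  assumes K: "poly_ideal V K" and f: "\<And>v. v \<in> V \<Longrightarrow> f v \<in> poly_in V" "\<And>v. v \<in> V \<Longrightarrow> var v - f v \<in> K" and p: "p \<in> poly_in V"
  shows "p - subst f p \<in> K"
  using p
proof (induction rule: mpoly_induct)
  case (cst c)
  then show ?case using poly_ideal_closed[OF K] by simp
next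
  case (var v p)
  note Kc = poly_ideal_closed[OF K]
  have "p * (var v - f v) + f v * (p - subst f p) \<in> K"
    using var f by (intro Kc(1) Kc(2)) auto
  then show ?case by (simp add: subst_mult algebra_simps)
next
  case (add p q)
  then have "(p - subst f p) + (q - subst f q) \<in> K" using poly_ideal_closed[OF K] by blast
  then show ?case by (simp add: subst_add algebra_simps)
qed

lemma poly_ideal_subst_preimage:
  assumes K: "poly_ideal V K" and f: "\<And>v. v \<in> W \<Longrightarrow> f v \<in> poly_in V"
  shows "poly_ideal W {p \<in> poly_in W. subst f p \<in> K}"
  unfolding poly_ideal_def
  using poly_ideal_closed[OF K] subst_poly_in[of _ W f V] f by (auto simp: subst_add subst_mult)

lemma gen_ideal_minimal:
  assumes K: "poly_ideal UNIV K" and S: "S \<subseteq> K"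
  shows "gen_ideal S \<subseteq> K"
proof
  fix p assume "p \<in> gen_ideal S"
  then show "p \<in> K"
    by (induction rule: gen_ideal.induct) (use S poly_ideal_closed[OF K] in auto)
qed

text \<open>A change of variables. The substitutions \<open>f\<close> and \<open>g\<close> respect
  the generators and are inverse to each other modulo the ideals, so the quotient of the polynomial
  algebra in \<open>V\<close> is presented by all polynomials modulo
  \<open>gen_ideal G\<close>.\<close>

lemma subst_presentation:
  fixes f :: "'v \<Rightarrow> 'w mpoly" and g :: "'w \<Rightarrow> 'v mpoly"
  assumes S: "S \<subseteq> poly_in V"
    and f: "\<And>v. f v \<in> poly_in V"
    and gens: "\<And>x. x \<in> G \<Longrightarrow> subst f x \<in> Idl\<^bsub>poly_algebra V\<^esub> S"
      "\<And>x. x \<in> S \<Longrightarrow> subst g x \<in> gen_ideal G"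
    and fg: "\<And>v. var v - subst g (f v) \<in> gen_ideal G" "\<And>w. w \<in> V \<Longrightarrow> var w - subst f (g w) \<in> Idl\<^bsub>poly_algebra V\<^esub> S"
  defines "J \<equiv> Idl\<^bsub>poly_algebra V\<^esub> S"
  defines "R \<equiv> quot_module (poly_algebra V) J" and "\<Phi> \<equiv> \<lambda>p. J +>\<^bsub>poly_algebra V\<^esub> subst f p"
  shows "presentation R \<Phi> UNIV (gen_ideal G)" "\<Phi> p \<otimes>\<^bsub>R\<^esub> \<Phi> q = \<Phi> (p * q)" "\<one>\<^bsub>R\<^esub> = \<Phi> 1"
    "r \<in> poly_in V \<Longrightarrow> \<Phi> (subst g r) = J +>\<^bsub>poly_algebra V\<^esub> r"
proof -
  have J: "poly_ideal V J" unfolding J_def by (rule Idl_poly_ideal[OF S])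
  note Jc = poly_ideal_closed[OF J]
  interpret Q: presentation R "\<lambda>p. J +>\<^bsub>poly_algebra V\<^esub> p" "poly_in V" J
    unfolding R_def by (rule quot_algebra_presentation[OF J])
  have fV: "subst f p \<in> poly_in V" for p by (rule subst_poly_in[OF poly_in_UNIV]) (rule f)
  have 1: "subst f p \<in> J" if "p \<in> gen_ideal G" for p
  proof -
    have "gen_ideal G \<subseteq> {p \<in> poly_in UNIV. subst f p \<in> J}"
      by (intro gen_ideal_minimal poly_ideal_subst_preimage[OF J]) (use f gens(1) in \<open>auto simp: J_def\<close>)
    then show ?thesis using that by auto
  qed
  have 2: "subst g p \<in> gen_ideal G" if "p \<in> J" for p
  proof -
    have "poly_ideal V {p \<in> poly_in V. subst g p \<in> gen_ideal G}"
      by (rule poly_ideal_subst_preimage[OF poly_ideal_gen_ideal]) simp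
    then have "J \<subseteq> {p \<in> poly_in V. subst g p \<in> gen_ideal G}"
      unfolding J_def by (rule Idl_minimal) (use S gens(2) in auto)
    then show ?thesis using that by auto
  qed
  have 3: "p - subst g (subst f p) \<in> gen_ideal G" for p
    unfolding subst_subst
    by (rule poly_ideal_subst_cong[OF poly_ideal_gen_ideal]) (use fg(1) in auto)
  have 4: "r - subst f (subst g r) \<in> J" if "r \<in> poly_in V" for r
    unfolding subst_subst
    by (rule poly_ideal_subst_cong[OF J]) (use fg(2) that fV in \<open>auto simp: J_def\<close>)
  show surj: "\<Phi> (subst g r) = J +>\<^bsub>poly_algebra V\<^esub> r" if "r \<in> poly_in V" for r
  proof -
    have "J +>\<^bsub>poly_algebra V\<^esub> r = J +>\<^bsub>poly_algebra V\<^esub> subst f (subst g r)"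
      using Q.Phi_eq_iff[OF that fV] 4[OF that] by blast
    then show ?thesis by (simp add: \<Phi>_def)
  qed
  have ker: "\<Phi> x = \<Phi> y \<longleftrightarrow> x - y \<in> gen_ideal G" for x y
  proof -
    have "\<Phi> x = \<Phi> y \<longleftrightarrow> subst f (x - y) \<in> J"
      unfolding \<Phi>_def subst_diff by (rule Q.Phi_eq_iff[OF fV fV])
    also have "\<dots> \<longleftrightarrow> x - y \<in> gen_ideal G"
    proof
      assume "subst f (x - y) \<in> J"
      then have "subst g (subst f (x - y)) + ((x - y) - subst g (subst f (x - y))) \<in> gen_ideal G"
        using 2 3 by (intro gen_ideal_add)
      then show "x - y \<in> gen_ideal G" by simp
    qed (rule 1)
    finally show ?thesis .
  qed
  show "presentation R \<Phi> UNIV (gen_ideal G)"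
  proof
    show "carrier R = range \<Phi>"
    proof
      show "range \<Phi> \<subseteq> carrier R" using fV by (auto simp: \<Phi>_def Q.carrier_eq)
      show "carrier R \<subseteq> range \<Phi>" using surj unfolding Q.carrier_eq by (metis image_subsetI rangeI)
    qed
    show "c \<odot>\<^bsub>R\<^esub> \<Phi> x = \<Phi> (scl c x)" for c x
      using Q.Phi_scl[OF fV] by (simp add: \<Phi>_def scl_cst subst_mult)
  qed (use Q.Phi_add[OF fV fV] Q.Phi_zero ker in \<open>auto simp: \<Phi>_def subst_add\<close>)
  show "\<Phi> p \<otimes>\<^bsub>R\<^esub> \<Phi> q = \<Phi> (p * q)"
    unfolding \<Phi>_def R_def subst_mult by (rule quot_algebra_mult[OF J fV fV])
  show "\<one>\<^bsub>R\<^esub> = \<Phi> 1"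
    unfolding \<Phi>_def R_def by (simp add: quot_algebra_one)
qed

section \<open>Chow rings of contractions and pushforwards\<close>

lemma chow_gens_in_poly: "{(\<Sum>F\<in>{F \<in> nonempty_proper_flats M. i \<in> F}. var F) -
       (\<Sum>F\<in>{F \<in> nonempty_proper_flats M. j \<in> F}. var F)
         | i j. i \<in> ground M \<and> j \<in> ground M \<and> i \<noteq> j} \<union>
      {var F * var G
         | F G. F \<in> nonempty_proper_flats M \<and> G \<in> nonempty_proper_flats M \<and>
                \<not> F \<subseteq> G \<and> \<not> G \<subseteq> F} \<subseteq> poly_in (nonempty_proper_flats M)"
proof -
  have "(\<Sum>F\<in>{F \<in> nonempty_proper_flats M. i \<in> F}. var F) \<in> poly_in (nonempty_proper_flats M)" for i
    by (rule poly_in_sum) simp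
  then show ?thesis by (auto intro!: poly_in_diff poly_in_mult)
qed

lemma chow_poly_ideal: "poly_ideal (nonempty_proper_flats M) (chow_ideal M)"
  unfolding chow_ideal_def chow_poly_def by (rule Idl_poly_ideal[OF chow_gens_in_poly])

lemma chow_class_presentation: "presentation (chow M) (chow_class M) (poly_in (nonempty_proper_flats M)) (chow_ideal M)"
  unfolding chow_def chow_class_def[abs_def] chow_poly_def
  by (rule quot_algebra_presentation[OF chow_poly_ideal])

lemma chow_ideal_minimal:
  assumes K: "poly_ideal (nonempty_proper_flats M) K"
    and lin: "\<And>i j. i \<in> ground M \<Longrightarrow> j \<in> ground M \<Longrightarrow> i \<noteq> j \<Longrightarrow> (\<Sum>F\<in>{F \<in> nonempty_proper_flats M. i \<in> F}. var F) -
       (\<Sum>F\<in>{F \<in> nonempty_proper_flats M. j \<in> F}. var F) \<in> K"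
    and quad: "\<And>F G. F \<in> nonempty_proper_flats M \<Longrightarrow> G \<in> nonempty_proper_flats M \<Longrightarrow> \<not> F \<subseteq> G \<Longrightarrow> \<not> G \<subseteq> F \<Longrightarrow>
       var F * var G \<in> K"
  shows "chow_ideal M \<subseteq> K"
  unfolding chow_ideal_def chow_poly_def
  by (rule Idl_minimal[OF K]) (use lin quad in blast)

section \<open>From the variables of the contraction to flats of the matroid\<close>

context flat_interval
begin

text \<open>The relation \<open>h F = 0\<close> of a bottom flat expresses the variable of
  \<open>E\<close> by the others, which are the honest variables of the Chow rings.\<close>

lemma eliminate_top: "\<exists>q\<in>poly_in inner_flats. p - q \<in> I"
proof -
  obtain F where F: "F \<in> P" "rank F = rank B + \<delta>" using ex_bottom_flat[OF E_in_P] by blast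
  define e where "e = - (\<Sum>G\<in>{G \<in> flats M. F \<subseteq> G \<and> G \<noteq> E}. var G)"
  define f where "f G = (if G = E then e else if G \<in> P then var G else 0)" for G
  have sub: "{G \<in> flats M. F \<subseteq> G \<and> G \<noteq> E} \<subseteq> inner_flats" using P_upward[OF F(1)] by auto
  have e: "e \<in> poly_in inner_flats"
    unfolding e_def using sub by (intro poly_in_uminus poly_in_sum poly_in_var) auto
  have f: "f v \<in> poly_in inner_flats" for v using e by (auto simp: f_def)
  have "{G \<in> flats M. F \<subseteq> G} = insert E {G \<in> flats M. F \<subseteq> G \<and> G \<noteq> E}"
    using P_subset[OF F(1)] ground_flat by auto
  then have "var E - e = - h F" using finite_flats by (simp add: hvar_def e_def)
  then have "var v - f v \<in> I" for v
    using gen_bottom[OF F] gen_outside by (auto simp: f_def intro: gen_ideal_uminus)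
  then have "p - subst f p \<in> I"
    by (intro poly_ideal_subst_cong[OF poly_ideal_gen_ideal]) auto
  moreover have "subst f p \<in> poly_in inner_flats" by (rule subst_poly_in[OF poly_in_UNIV]) (rule f)
  ultimately show ?thesis by blast
qed

definition expand :: "'a set \<Rightarrow> 'a set mpoly \<Rightarrow> 'a set mpoly" where
  "expand F = subst (\<lambda>G. var (G \<union> F))"

lemma contraction_flats:
  assumes "F \<in> inner_flats"
  shows "nonempty_proper_flats (contraction M F) = (\<lambda>G. G - F) ` (upper F - {E})"
proof -
  have F: "F \<in> flats M" "F \<subset> E" using assms P_flat P_subset by auto
  show ?thesis
  proof (intro equalityI subsetI)
    fix K assume "K \<in> nonempty_proper_flats (contraction M F)"
    then obtain G where G: "K = G - F" "G \<in> flats M" "F \<subseteq> G" "K \<noteq> E - F" "K \<noteq> {}"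
      by (auto simp: nonempty_proper_flats_def proper_flats_def contraction_def)
    then have "G \<in> upper F - {E}" using upper_iff[OF F(1)] by auto
    then show "K \<in> (\<lambda>G. G - F) ` (upper F - {E})" using G(1) by auto
  next
    fix K assume "K \<in> (\<lambda>G. G - F) ` (upper F - {E})"
    then obtain G where G: "K = G - F" "G \<in> upper F" "G \<noteq> E" by auto
    then have "G \<in> flats M" "F \<subset> G" "G \<subseteq> E" using upper_iff[OF F(1)] flat_subset by auto
    then show "K \<in> nonempty_proper_flats (contraction M F)"
      using G F by (auto simp: nonempty_proper_flats_def proper_flats_def contraction_def)
  qed
qed

lemma expand_in:
  assumes "F \<in> inner_flats" "p \<in> poly_in (nonempty_proper_flats (contraction M F))"
  shows "expand F p \<in> poly_in (upper F - {E})"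
  unfolding expand_def
proof (rule subst_poly_in[OF assms(2)])
  fix v assume "v \<in> nonempty_proper_flats (contraction M F)"
  then obtain G where G: "v = G - F" "G \<in> upper F - {E}" using contraction_flats[OF assms(1)] by auto
  then have "v \<union> F = G" using upper_iff[OF P_flat] assms(1) by auto
  then show "var (v \<union> F) \<in> poly_in (upper F - {E})" using G by auto
qed

lemma expand_onto:
  assumes "F \<in> inner_flats" "q \<in> poly_in (upper F - {E})"
  shows "\<exists>p\<in>poly_in (nonempty_proper_flats (contraction M F)). expand F p = q"
proof (intro bexI)
  have up: "G - F \<union> F = G" if "G \<in> upper F - {E}" for G using that upper_iff[OF P_flat] assms(1) by auto
  show "expand F (subst (\<lambda>G. var (G - F)) q) = q"
    unfolding expand_def subst_subst by (rule subst_ident[OF assms(2)]) (simp only: subst_var up)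
  show "subst (\<lambda>G. var (G - F)) q \<in> poly_in (nonempty_proper_flats (contraction M F))"
    by (rule subst_poly_in[OF assms(2)]) (auto simp: contraction_flats[OF assms(1)])
qed

text \<open>Well-definedness of the pushforward in the factor of the contraction. A linear relation
  there becomes a difference of two classes \<open>h (insert i F)\<close>, each of which is killed
  by \<open>var F\<close>.\<close>

lemma expand_ideal:
  assumes F: "F \<in> inner_flats" and p: "p \<in> chow_ideal (contraction M F)"
  shows "var F * expand F p \<in> I"
proof -
  let ?N = "contraction M F"
  let ?K = "{p \<in> poly_in (nonempty_proper_flats ?N). var F * expand F p \<in> I}"
  have Ff: "F \<in> flats M" "F \<in> P" "F \<noteq> E" using F P_flat by auto
  have "poly_ideal (nonempty_proper_flats ?N) ?K"
    unfolding poly_ideal_def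
  proof (intro conjI ballI)
    fix a r assume "a \<in> ?K" "r \<in> poly_in (nonempty_proper_flats ?N)"
    then show "r * a \<in> ?K"
      using gen_ideal_mult_left[of "var F * expand F a" _ "expand F r"]
      by (simp add: expand_def subst_mult poly_in_mult mult.left_commute)
  qed (auto simp: expand_def subst_add distrib_left)
  moreover have "(\<Sum>G\<in>{G \<in> nonempty_proper_flats ?N. i \<in> G}. var G) - (\<Sum>G\<in>{G \<in> nonempty_proper_flats ?N. j \<in> G}. var G) \<in> ?K"
    if ij: "i \<in> ground ?N" "j \<in> ground ?N" for i j
  proof -
    have sum: "expand F (\<Sum>G\<in>{G \<in> nonempty_proper_flats ?N. i \<in> G}. var G) = - h (insert i F) - var E" if i: "i \<in> E - F" for i
    proof -
      have "{G \<in> nonempty_proper_flats ?N. i \<in> G} = (\<lambda>G. G - F) ` {G \<in> upper F - {E}. i \<in> G}"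
        using i by (auto simp: contraction_flats[OF F])
      moreover have inj: "inj_on (\<lambda>G. G - F) {G \<in> upper F - {E}. i \<in> G}"
      proof (rule inj_onI)
        fix G H assume GH: "G \<in> {G \<in> upper F - {E}. i \<in> G}" "H \<in> {G \<in> upper F - {E}. i \<in> G}" "G - F = H - F"
        then have "F \<subseteq> G" "F \<subseteq> H" using upper_iff[OF Ff(1)] by auto
        then show "G = H" using GH(3) by blast
      qed
      ultimately have "expand F (\<Sum>G\<in>{G \<in> nonempty_proper_flats ?N. i \<in> G}. var G) =
         (\<Sum>G\<in>{G \<in> upper F - {E}. i \<in> G}. var (G - F \<union> F))"
        by (simp add: expand_def subst_sum sum.reindex)
      also have "\<dots> = (\<Sum>G\<in>{G \<in> upper F - {E}. i \<in> G}. var G)"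
      proof (rule sum.cong[OF refl])
        fix G assume "G \<in> {G \<in> upper F - {E}. i \<in> G}"
        then have "G - F \<union> F = G" using upper_iff[OF Ff(1)] by auto
        then show "var (G - F \<union> F) = var G" by simp
      qed
      also have "\<dots> = - h (insert i F) - var E"
      proof -
        have "{G \<in> flats M. insert i F \<subseteq> G} = insert E {G \<in> upper F - {E}. i \<in> G}"
          using i upper_iff[OF Ff(1)] ground_flat P_subset[OF Ff(2)] by auto
        then show ?thesis using finite_upper by (simp add: hvar_def)
      qed
      finally show ?thesis .
    qed
    have ij: "i \<in> E - F" "j \<in> E - F" using ij by (auto simp: contraction_def)
    have "expand F ((\<Sum>G\<in>{G \<in> nonempty_proper_flats ?N. i \<in> G}. var G) - (\<Sum>G\<in>{G \<in> nonempty_proper_flats ?N. j \<in> G}. var G)) =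
       h (insert j F) - h (insert i F)"
      using sum[OF ij(1)] sum[OF ij(2)] by (simp add: expand_def subst_diff)
    moreover have "var F * h (insert j F) - var F * h (insert i F) \<in> I"
      by (intro gen_ideal_diff var_times_element Ff ij)
    ultimately have "var F * expand F ((\<Sum>G\<in>{G \<in> nonempty_proper_flats ?N. i \<in> G}. var G) - (\<Sum>G\<in>{G \<in> nonempty_proper_flats ?N. j \<in> G}. var G)) \<in> I"
      by (simp add: right_diff_distrib)
    moreover have "(\<Sum>G\<in>{G \<in> nonempty_proper_flats ?N. i \<in> G}. var G) - (\<Sum>G\<in>{G \<in> nonempty_proper_flats ?N. j \<in> G}. var G)
        \<in> poly_in (nonempty_proper_flats ?N)"
      by (intro poly_in_diff poly_in_sum poly_in_var) auto
    ultimately show ?thesis by blast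
  qed
  moreover have "var G * var H \<in> ?K"
    if GH: "G \<in> nonempty_proper_flats ?N" "H \<in> nonempty_proper_flats ?N" "\<not> G \<subseteq> H" "\<not> H \<subseteq> G" for G H
  proof -
    have disj: "G \<inter> F = {}" "H \<inter> F = {}" using GH by (auto simp: contraction_flats[OF F])
    have "\<not> G \<union> F \<subseteq> H \<union> F" "\<not> H \<union> F \<subseteq> G \<union> F" using GH(3,4) disj by auto
    then have "var (G \<union> F) * var (H \<union> F) \<in> I" by (rule gen_incomparable)
    then have "var F * (var (G \<union> F) * var (H \<union> F)) \<in> I" by (rule gen_ideal_mult_left)
    then show ?thesis using GH by (simp add: expand_def subst_mult poly_in_mult)
  qed
  ultimately have "chow_ideal ?N \<subseteq> ?K" by (rule chow_ideal_minimal)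
  then show ?thesis using p by blast
qed

end

text \<open>The localization carries the same \<open>\<delta>\<close> as the matroid itself, so the
  two rings are of the same kind; the contraction contributes its ordinary Chow ring in both
  cases.\<close>

locale pushforward =
  chow_presentation M \<delta> R \<Phi> + L: chow_presentation "localization M F" \<delta> R' \<Phi>'
  for M :: "'a matroid" and \<delta> and R :: "(rat, 'b) module" and \<Phi> and F and R' :: "(rat, 'c) module" and \<Phi>' +
  assumes F: "F \<in> inner_flats"
begin

lemma F_facts: "F \<in> P" "F \<noteq> E" "F \<in> flats M" "F \<subseteq> E"
  using F P_flat P_subset by auto

lemma local_flats: "G \<in> interval_flats (localization M F) {} \<delta> \<longleftrightarrow> G \<in> P \<and> G \<subseteq> F"
  using localization_rank[OF F_facts(3)] by (auto simp: interval_flats_def localization_flats)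

text \<open>The variable of the top flat \<open>F\<close> of the localization is minus its alpha class, which \<open>x\<^sub>F\<close> turns into \<open>h F\<close>.\<close>

definition extend_var :: "'a set \<Rightarrow> 'a set mpoly" where
  "extend_var G = (if G \<in> P \<and> G \<subset> F then var G else if G = F then - h F else 0)"

definition extend :: "'a set mpoly \<Rightarrow> 'a set mpoly" where
  "extend = subst extend_var"

text \<open>The flats above \<open>S\<close> are of three kinds. Those strictly inside
  \<open>F\<close> keep their variables, those above \<open>F\<close> add up to the image of the
  variable of \<open>F\<close>, and the others are incomparable with \<open>F\<close> and are killed
  by \<open>var F\<close>.\<close>

lemma extend_hvar:
  assumes "S \<subseteq> F" and P: "\<And>G. G \<in> flats M \<Longrightarrow> S \<subseteq> G \<Longrightarrow> G \<in> P"
  shows "var F * extend (hvar (localization M F) S) - var F * h S \<in> I"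
proof -
  let ?U = "{G \<in> flats M. S \<subseteq> G \<and> G \<subset> F}" and ?W = "{G \<in> flats M. S \<subseteq> G \<and> \<not> G \<subset> F \<and> \<not> F \<subseteq> G}"
  have fin: "finite ?U" "finite ?W" "finite {G \<in> flats M. F \<subseteq> G}" using finite_flats by auto
  have "{G \<in> flats (localization M F). S \<subseteq> G} = insert F ?U"
    using assms F_facts by (auto simp: localization_flats)
  then have "extend (hvar (localization M F) S) = - (- h F + (\<Sum>G\<in>?U. extend_var G))"
    using fin by (simp add: extend_def hvar_def[of "localization M F"] subst_simps extend_var_def)
  also have "(\<Sum>G\<in>?U. extend_var G) = (\<Sum>G\<in>?U. var G)"
    using P by (intro sum.cong) (auto simp: extend_var_def)
  finally have 1: "extend (hvar (localization M F) S) = h F - (\<Sum>G\<in>?U. var G)" by simp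
  have "{G \<in> flats M. S \<subseteq> G} = {G \<in> flats M. F \<subseteq> G} \<union> (?U \<union> ?W)"
    using assms by auto
  moreover have "{G \<in> flats M. F \<subseteq> G} \<inter> (?U \<union> ?W) = {}" "?U \<inter> ?W = {}" by auto
  ultimately have "(\<Sum>G\<in>{G \<in> flats M. S \<subseteq> G}. var G) =
     (\<Sum>G\<in>{G \<in> flats M. F \<subseteq> G}. var G) + ((\<Sum>G\<in>?U. var G) + (\<Sum>G\<in>?W. var G))"
    using fin by (simp add: sum.union_disjoint)
  then have 2: "h S = h F - (\<Sum>G\<in>?U. var G) - (\<Sum>G\<in>?W. var G)" by (simp add: hvar_def)
  have "var F * extend (hvar (localization M F) S) - var F * h S = var F * (\<Sum>G\<in>?W. var G)"
    unfolding 1 2 by (simp only: right_diff_distrib) simp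
  also have "\<dots> = (\<Sum>G\<in>?W. var F * var G)" by (rule sum_distrib_left)
  also have "\<dots> \<in> I"
    by (intro gen_ideal_sum gen_incomparable) auto
  finally show ?thesis .
qed

lemma extend_ideal:
  assumes "q \<in> interval_ideal (localization M F) {} \<delta>"
  shows "var F * extend q \<in> I"
  using assms
proof (induction rule: gen_ideal.induct)
  case zero
  then show ?case by (simp add: extend_def)
next
  case (add_gen g p r)
  have hI: "var F * extend (hvar (localization M F) S) \<in> I \<longleftrightarrow> var F * h S \<in> I" if "S \<subseteq> F"
    "\<And>G. G \<in> flats M \<Longrightarrow> S \<subseteq> G \<Longrightarrow> G \<in> P" for S
  proof -
    note * = extend_hvar[OF that]
    show ?thesis
    proof
      assume "var F * extend (hvar (localization M F) S) \<in> I"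
      from gen_ideal_diff[OF this *] show "var F * h S \<in> I" by simp
    next
      assume "var F * h S \<in> I"
      from gen_ideal_add[OF * this] show "var F * extend (hvar (localization M F) S) \<in> I" by simp
    qed
  qed
  let ?PL = "interval_flats (localization M F) {} \<delta>"
  consider (outside) G where "g = var G" "G \<notin> ?PL"
    | (incomparable) G H where "g = var G * var H" "G \<in> ?PL" "H \<in> ?PL" "\<not> G \<subseteq> H" "\<not> H \<subseteq> G"
    | (element) G i where "g = var G * hvar (localization M F) (insert i {})" "G \<in> ?PL" "i \<in> ground (localization M F) - G"
    | (bottom) G where "g = hvar (localization M F) G" "G \<in> ?PL"
        "rk (localization M F) G = rk (localization M F) {} + \<delta>"
    using add_gen(1) unfolding interval_gens_def by blast
  then have "var F * extend g \<in> I"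
  proof cases
    case outside
    then have "extend_var G = 0" using F_facts by (auto simp: extend_var_def local_flats)
    then show ?thesis using outside by (simp add: extend_def)
  next
    case incomparable
    then have "G \<noteq> F" "H \<noteq> F" by (auto simp: local_flats)
    then have "extend g = var G * var H"
      using incomparable by (simp add: extend_def subst_mult extend_var_def psubset_eq local_flats)
    then show ?thesis using gen_ideal_mult_left[OF gen_incomparable[of G H]] incomparable by simp
  next
    case element
    have GF: "G \<subset> F" "G \<in> P" using element by (auto simp: local_flats)
    then have e: "extend g = var G * extend (hvar (localization M F) {i})"
      using element by (simp add: extend_def subst_mult extend_var_def)
    have "i \<in> E - G" using element F_facts by auto
    then have 1: "var G * h {i} \<in> I" using gen_element[OF GF(2), of i] by simp
    have "var F * extend (hvar (localization M F) {i}) - var F * h {i} \<in> I"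
    proof (rule extend_hvar)
      show "{i} \<subseteq> F" using element by auto
      fix H assume "H \<in> flats M" "{i} \<subseteq> H"
      then show "H \<in> P" by (intro P_above_element[of _ i]) auto
    qed
    from gen_ideal_add[OF gen_ideal_mult_left[OF this, of "var G"] gen_ideal_mult_left[OF 1, of "var F"]]
    show ?thesis unfolding e by (simp add: algebra_simps)
  next
    case bottom
    have G: "G \<in> P" "G \<subseteq> F" using bottom by (simp_all add: local_flats)
    have "rank G = rank {} + \<delta>" using bottom(3) G(2) by (simp add: localization_rank[OF F_facts(3)])
    then have "var F * h G \<in> I" by (intro gen_ideal_mult_left gen_bottom G(1))
    then show ?thesis unfolding bottom(1) using P_upward[OF G(1)] G(2) by (subst hI)
  qed
  from gen_ideal_add[OF gen_ideal_mult_left[OF this, of "extend r"] add_gen.IH]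
  show ?case by (simp add: extend_def subst_add subst_mult algebra_simps)
qed

abbreviation "N \<equiv> contraction M F"
abbreviation "DN \<equiv> poly_in (nonempty_proper_flats N)"

definition push :: "'a set mpoly \<Rightarrow> 'a set mpoly \<Rightarrow> 'a set mpoly" where
  "push p q = var F * expand F p * extend q"

sublocale TS: tensor_setup "chow N" "chow_class N" DN "chow_ideal N" R' \<Phi>' UNIV "interval_ideal (localization M F) {} \<delta>"
  by (intro tensor_setup.intro chow_class_presentation L.pres)

lemma ex_push: "\<exists>f. f \<in> linear_maps TS.T R \<and> f \<in> extensional (carrier TS.T) \<and>
    (\<forall>p\<in>DN. \<forall>q\<in>UNIV. f (TS.pure (chow_class N p) (\<Phi>' q)) = \<Phi> (push p q))"
proof (rule TS.ex_linear_map[OF pres])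
  fix p p' q q' c
  show "push (p + p') q = push p q + push p' q" "push p (q + q') = push p q + push p q'"
    "push (scl c p) q = scl c (push p q)" "push p (scl c q) = scl c (push p q)"
    by (simp_all add: push_def expand_def extend_def subst_add subst_mult scl_cst algebra_simps)
  show "push p q \<in> I" if "p \<in> DN" "p \<in> chow_ideal N"
    unfolding push_def by (rule gen_ideal_mult_right[OF expand_ideal[OF F that(2)]])
  show "push p q \<in> I" if "p \<in> DN" "q \<in> interval_ideal (localization M F) {} \<delta>"
    using gen_ideal_mult_left[OF extend_ideal[OF that(2)], of "expand F p"]
    by (simp add: push_def algebra_simps)
qed

lemma expand_monomial:
  assumes "set_mset K \<subseteq> {G \<in> proper_flats M. F \<subset> G}"
  shows "expand F (\<Prod>G\<in>#K. var (G - F)) = (\<Prod>G\<in>#K. var G)"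
  using assms
proof (induction K)
  case empty
  then show ?case by (simp add: expand_def)
next
  case (add G K)
  then have "G - F \<union> F = G" by auto
  then show ?case using add by (simp add: expand_def subst_mult del: Un_Diff_cancel2)
qed

lemma contraction_monomial:
  assumes "set_mset K \<subseteq> {G \<in> proper_flats M. F \<subset> G}"
  shows "(\<Prod>G\<in>#K. var (G - F)) \<in> DN"
  using assms
proof (induction K)
  case empty
  then show ?case by simp
next
  case (add G K)
  then have "G \<in> upper F - {E}" using upper_iff[OF F_facts(3)] by (simp add: proper_flats_def)
  then have "var (G - F) \<in> DN" by (simp add: contraction_flats[OF F])
  then show ?case using add by (simp add: poly_in_mult)
qed

lemma extend_monomial:
  assumes "set_mset K \<subseteq> {G \<in> inner_flats. G \<subset> F}"
  shows "extend (\<Prod>G\<in>#K. var G) = (\<Prod>G\<in>#K. var G)"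
  using assms by (induction K) (simp_all add: extend_def subst_mult extend_var_def)

text \<open>The formula defining a pushforward fixes its values only on monomials in proper flats.
  The variable of \<open>F\<close> in the second factor is eliminated first; then monomials span in
  both factors.\<close>

lemma linear_maps_monomials:
  assumes f: "f \<in> linear_maps TS.T R" and g: "g \<in> linear_maps TS.T R"
    and mono: "\<And>K K'. set_mset K \<subseteq> {G \<in> proper_flats M. F \<subset> G} \<Longrightarrow> set_mset K' \<subseteq> {G \<in> inner_flats. G \<subset> F} \<Longrightarrow>
      f (TS.pure (chow_class N (\<Prod>G\<in>#K. var (G - F))) (\<Phi>' (\<Prod>G\<in>#K'. var G))) =
      g (TS.pure (chow_class N (\<Prod>G\<in>#K. var (G - F))) (\<Phi>' (\<Prod>G\<in>#K'. var G)))"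
    and p: "p \<in> DN"
  shows "f (TS.pure (chow_class N p) (\<Phi>' q)) = g (TS.pure (chow_class N p) (\<Phi>' q))"
proof -
  note fD = linear_mapsD[OF f] and gD = linear_mapsD[OF g]
  have cN: "chow_class N p \<in> carrier (chow N)" if "p \<in> DN" for p using that by (rule TS.A.Phi_closed)
  have cL: "\<Phi>' q \<in> carrier R'" for q by (rule L.Phi_ops(3))
  have mono_span: "Q q" if q: "q \<in> poly_in V" and Qm: "\<And>K. set_mset K \<subseteq> V \<Longrightarrow> Q (\<Prod>G\<in>#K. var G)"
    and Qadd: "\<And>p q. p \<in> poly_in V \<Longrightarrow> q \<in> poly_in V \<Longrightarrow> Q p \<Longrightarrow> Q q \<Longrightarrow> Q (p + q)"
    and Qscl: "\<And>c p. p \<in> poly_in V \<Longrightarrow> Q p \<Longrightarrow> Q (scl c p)" for V :: "'a set set" and Q q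
  proof -
    \<comment> \<open>The claim is strengthened by an arbitrary monomial factor, so that in the
      variable step \<open>v\<close> can be moved into that factor.\<close>
    have "\<forall>K. set_mset K \<subseteq> V \<longrightarrow> Q (q * (\<Prod>G\<in>#K. var G))"
      using q
    proof (induction rule: mpoly_induct)
      case (cst c)
      have in_V: "(\<Prod>G\<in>#K. var G) \<in> poly_in V" if "set_mset K \<subseteq> V" for K
        using that by (induction K) (auto intro!: poly_in_mult)
      show ?case
      proof (intro allI impI)
        fix K assume K: "set_mset K \<subseteq> V"
        have "Q (scl c (\<Prod>G\<in>#K. var G))" by (rule Qscl[OF in_V[OF K] Qm[OF K]])
        then show "Q (cst c * (\<Prod>G\<in>#K. var G))" by (simp add: scl_cst)
      qed
    next
      case (var v p)
      show ?case
      proof (intro allI impI)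
        fix K assume K: "set_mset K \<subseteq> V"
        have "Q (p * (\<Prod>G\<in>#add_mset v K. var G))" using var K by (intro var.IH[rule_format]) auto
        then show "Q (var v * p * (\<Prod>G\<in>#K. var G))" by (simp add: algebra_simps)
      qed
    next
      case (add p q)
      have in_V: "(\<Prod>G\<in>#K. var G) \<in> poly_in V" if "set_mset K \<subseteq> V" for K
        using that by (induction K) (auto intro!: poly_in_mult)
      show ?case
      proof (intro allI impI)
        fix K assume K: "set_mset K \<subseteq> V"
        have "Q (p * (\<Prod>G\<in>#K. var G) + q * (\<Prod>G\<in>#K. var G))"
          using add K in_V[OF K] by (intro Qadd poly_in_mult) auto
        then show "Q ((p + q) * (\<Prod>G\<in>#K. var G))" by (simp add: distrib_right)
      qed
    qed
    then have "Q (q * (\<Prod>G\<in>#{#}. var G))" by (rule allE[of _ "{#}"]) simp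
    then show ?thesis by simp
  qed
  obtain q' where q': "q' \<in> poly_in L.inner_flats" "q - q' \<in> interval_ideal (localization M F) {} \<delta>"
    using L.eliminate_top[of q] by blast
  have inner: "L.inner_flats = {G \<in> inner_flats. G \<subset> F}"
    using local_flats P_subset[OF F_facts(1)] F_facts by auto
  have "\<Phi>' q = \<Phi>' q'" using q'(2) by (simp only: L.Phi_ops(4))
  moreover have "f (TS.pure (chow_class N p) (\<Phi>' q')) = g (TS.pure (chow_class N p) (\<Phi>' q'))"
    using q'(1) unfolding inner
  proof (rule mono_span)
    fix K' assume K': "set_mset K' \<subseteq> {G \<in> inner_flats. G \<subset> F}"
    show "f (TS.pure (chow_class N p) (\<Phi>' (\<Prod>G\<in>#K'. var G))) = g (TS.pure (chow_class N p) (\<Phi>' (\<Prod>G\<in>#K'. var G)))"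
      using p
    proof (rule mono_span)
      fix K assume K: "set_mset K \<subseteq> nonempty_proper_flats N"
      define K2 where "K2 = image_mset (\<lambda>G. G \<union> F) K"
      have "image_mset (\<lambda>G. (G \<union> F) - F) K = image_mset (\<lambda>G. G) K"
        using K by (intro image_mset_cong) (auto simp: contraction_flats[OF F])
      then have eq: "(\<Prod>G\<in>#K2. var (G - F)) = (\<Prod>G\<in>#K. var G)"
      proof -
        assume *: "image_mset (\<lambda>G. (G \<union> F) - F) K = image_mset (\<lambda>G. G) K"
        have "image_mset (\<lambda>G. var (G - F)) K2 = image_mset var (image_mset (\<lambda>G. (G \<union> F) - F) K)"
          by (simp add: K2_def image_mset.compositionality o_def)
        also have "\<dots> = image_mset var K" unfolding * by simp
        finally show ?thesis by simp
      qed
      have "set_mset K2 \<subseteq> {G \<in> proper_flats M. F \<subset> G}"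
      proof
        fix H assume "H \<in> set_mset K2"
        then obtain G where G: "G \<in> set_mset K" "H = G \<union> F" by (auto simp: K2_def)
        then obtain G' where G': "G = G' - F" "G' \<in> upper F - {E}" using K contraction_flats[OF F] by auto
        then have "H = G'" using G upper_iff[OF F_facts(3)] by auto
        then show "H \<in> {G \<in> proper_flats M. F \<subset> G}" using G' upper_iff[OF F_facts(3)] by (auto simp: proper_flats_def)
      qed
      from mono[OF this K'] show "f (TS.pure (chow_class N (\<Prod>G\<in>#K. var G)) (\<Phi>' (\<Prod>G\<in>#K'. var G))) =
          g (TS.pure (chow_class N (\<Prod>G\<in>#K. var G)) (\<Phi>' (\<Prod>G\<in>#K'. var G)))"
        unfolding eq .
    next
      fix p1 p2 assume "p1 \<in> DN" "p2 \<in> DN"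
        "f (TS.pure (chow_class N p1) (\<Phi>' (\<Prod>G\<in>#K'. var G))) = g (TS.pure (chow_class N p1) (\<Phi>' (\<Prod>G\<in>#K'. var G)))"
        "f (TS.pure (chow_class N p2) (\<Phi>' (\<Prod>G\<in>#K'. var G))) = g (TS.pure (chow_class N p2) (\<Phi>' (\<Prod>G\<in>#K'. var G)))"
      then show "f (TS.pure (chow_class N (p1 + p2)) (\<Phi>' (\<Prod>G\<in>#K'. var G))) = g (TS.pure (chow_class N (p1 + p2)) (\<Phi>' (\<Prod>G\<in>#K'. var G)))"
        using cN cL by (simp add: TS.A.Phi_add[symmetric] TS.pure_add_left fD(2) gD(2) TS.pure_closed)
    next
      fix c p1 assume "p1 \<in> DN"
        "f (TS.pure (chow_class N p1) (\<Phi>' (\<Prod>G\<in>#K'. var G))) = g (TS.pure (chow_class N p1) (\<Phi>' (\<Prod>G\<in>#K'. var G)))"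
      then show "f (TS.pure (chow_class N (scl c p1)) (\<Phi>' (\<Prod>G\<in>#K'. var G))) = g (TS.pure (chow_class N (scl c p1)) (\<Phi>' (\<Prod>G\<in>#K'. var G)))"
        using cN cL by (simp add: TS.A.Phi_scl[symmetric] TS.pure_smult_left fD(3) gD(3) TS.pure_closed)
    qed
  next
    fix q1 q2 assume "f (TS.pure (chow_class N p) (\<Phi>' q1)) = g (TS.pure (chow_class N p) (\<Phi>' q1))"
      "f (TS.pure (chow_class N p) (\<Phi>' q2)) = g (TS.pure (chow_class N p) (\<Phi>' q2))"
    then show "f (TS.pure (chow_class N p) (\<Phi>' (q1 + q2))) = g (TS.pure (chow_class N p) (\<Phi>' (q1 + q2)))"
      using cN[OF p] cL by (simp add: L.Phi_ops(1)[symmetric] TS.pure_add_right fD(2) gD(2) TS.pure_closed)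
  next
    fix c q1 assume "f (TS.pure (chow_class N p) (\<Phi>' q1)) = g (TS.pure (chow_class N p) (\<Phi>' q1))"
    then show "f (TS.pure (chow_class N p) (\<Phi>' (scl c q1))) = g (TS.pure (chow_class N p) (\<Phi>' (scl c q1)))"
      using cN[OF p] cL by (simp add: L.R.Phi_scl[OF UNIV_I, symmetric] TS.pure_smult_right fD(3) gD(3) TS.pure_closed)
  qed
  ultimately show ?thesis by simp
qed

text \<open>\<open>X\<close> and \<open>Y\<close> stand for the classes as they are written in the
  two definitions of the pushforward, which differ in their variables. The definite description is
  thereby identified with the map induced by \<open>push\<close>.\<close>

lemma pushforward_characterization:
  assumes Y: "\<And>K'. set_mset K' \<subseteq> {G \<in> inner_flats. G \<subset> F} \<Longrightarrow> Y K' = \<Phi>' (\<Prod>G\<in>#K'. var G)"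
    and X: "\<And>K K'. set_mset K \<subseteq> {G \<in> proper_flats M. F \<subset> G} \<Longrightarrow> set_mset K' \<subseteq> {G \<in> inner_flats. G \<subset> F} \<Longrightarrow>
       X K K' = \<Phi> (var F * (\<Prod>G\<in>#K. var G) * (\<Prod>G\<in>#K'. var G))"
  defines "f \<equiv> (THE f. f \<in> extensional (carrier TS.T) \<and> f \<in> linear_maps TS.T R \<and>
    (\<forall>K K'. set_mset K \<subseteq> {G \<in> proper_flats M. F \<subset> G} \<and> set_mset K' \<subseteq> {G \<in> inner_flats. G \<subset> F} \<longrightarrow>
      f (TS.pure (chow_class N (\<Prod>G\<in>#K. var (G - F))) (Y K')) = X K K'))"
  shows "f \<in> linear_maps TS.T R" "p \<in> DN \<Longrightarrow> f (TS.pure (chow_class N p) (\<Phi>' q)) = \<Phi> (push p q)"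
proof -
  obtain g where g: "g \<in> linear_maps TS.T R" "g \<in> extensional (carrier TS.T)"
    "\<And>p q. p \<in> DN \<Longrightarrow> g (TS.pure (chow_class N p) (\<Phi>' q)) = \<Phi> (push p q)"
    using ex_push by auto
  have gm: "g (TS.pure (chow_class N (\<Prod>G\<in>#K. var (G - F))) (\<Phi>' (\<Prod>G\<in>#K'. var G))) = X K K'"
    if "set_mset K \<subseteq> {G \<in> proper_flats M. F \<subset> G}" "set_mset K' \<subseteq> {G \<in> inner_flats. G \<subset> F}" for K K'
    unfolding g(3)[OF contraction_monomial[OF that(1)]] X[OF that] push_def
      expand_monomial[OF that(1)] extend_monomial[OF that(2)] ..
  have "f = g"
    unfolding f_def
  proof (rule the_equality)
    show "g \<in> extensional (carrier TS.T) \<and> g \<in> linear_maps TS.T R \<and>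
      (\<forall>K K'. set_mset K \<subseteq> {G \<in> proper_flats M. F \<subset> G} \<and> set_mset K' \<subseteq> {G \<in> inner_flats. G \<subset> F} \<longrightarrow>
        g (TS.pure (chow_class N (\<Prod>G\<in>#K. var (G - F))) (Y K')) = X K K')"
    proof (intro conjI allI impI g)
      fix K K' assume K: "set_mset K \<subseteq> {G \<in> proper_flats M. F \<subset> G} \<and> set_mset K' \<subseteq> {G \<in> inner_flats. G \<subset> F}"
      show "g (TS.pure (chow_class N (\<Prod>G\<in>#K. var (G - F))) (Y K')) = X K K'"
        unfolding Y[OF conjunct2[OF K]] by (rule gm[OF conjunct1[OF K] conjunct2[OF K]])
    qed
  next
    fix f' assume f': "f' \<in> extensional (carrier TS.T) \<and> f' \<in> linear_maps TS.T R \<and>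
      (\<forall>K K'. set_mset K \<subseteq> {G \<in> proper_flats M. F \<subset> G} \<and> set_mset K' \<subseteq> {G \<in> inner_flats. G \<subset> F} \<longrightarrow>
        f' (TS.pure (chow_class N (\<Prod>G\<in>#K. var (G - F))) (Y K')) = X K K')"
    then have f1: "f' \<in> extensional (carrier TS.T)" "f' \<in> linear_maps TS.T R" by simp_all
    have f2: "f' (TS.pure (chow_class N (\<Prod>G\<in>#K. var (G - F))) (\<Phi>' (\<Prod>G\<in>#K'. var G))) =
        g (TS.pure (chow_class N (\<Prod>G\<in>#K. var (G - F))) (\<Phi>' (\<Prod>G\<in>#K'. var G)))"
      if K: "set_mset K \<subseteq> {G \<in> proper_flats M. F \<subset> G}" "set_mset K' \<subseteq> {G \<in> inner_flats. G \<subset> F}" for K K'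
      using f'[THEN conjunct2, THEN conjunct2, rule_format, OF conjI[OF K]] unfolding gm[OF K] Y[OF K(2)] .
    show "f' = g"
      by (rule TS.linear_map_eqI[OF f1(2,1) g(1,2) pres]) (rule linear_maps_monomials[OF f1(2) g(1) f2])
  qed
  then show "f \<in> linear_maps TS.T R" "p \<in> DN \<Longrightarrow> f (TS.pure (chow_class N p) (\<Phi>' q)) = \<Phi> (push p q)"
    using g by simp_all
qed

lemma local_top_degree: "rk (localization M F) F - rk (localization M F) {} - \<delta> = mult_bound F"
  using localization_rank[OF F_facts(3), of F] localization_rank[OF F_facts(3), of "{}"]
  by (simp add: mult_bound_def)

lemma local_alpha: "extend (hvar (localization M F) F ^ k) = h F ^ k"
proof -
  have "hvar (localization M F) F = - var F" using L.hvar_E by simp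
  then show ?thesis by (simp add: extend_def subst_simps extend_var_def)
qed

text \<open>The image of the truncated powers of the alpha class of the localization gives the
  exponents of \<open>h F\<close>; the factor of the contraction gives the polynomials above
  \<open>F\<close>.\<close>

lemma pushforward_image:
  assumes f: "f \<in> linear_maps TS.T R" "\<And>p q. p \<in> DN \<Longrightarrow> f (TS.pure (chow_class N p) (\<Phi>' q)) = \<Phi> (push p q)"
  shows "f ` tensor_subspace (chow N) R' (carrier (chow N)) (lin_span R' {\<Phi>' (hvar (localization M F) F ^ k) | k. k < mult_bound F}) =
    \<Phi> ` summand_polys (Some F)"
proof -
  let ?Y = "{\<Phi>' (hvar (localization M F) F ^ k) | k. k < mult_bound F}"
  have "f ` tensor_subspace (chow N) R' (carrier (chow N)) (lin_span R' ?Y) =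
     lin_span R {f (TS.pure a y) | a y. a \<in> carrier (chow N) \<and> y \<in> ?Y}"
    by (rule TS.image_tensor_subspace[OF pres f(1)]) (auto simp: L.Phi_ops(3))
  also have "{f (TS.pure a y) | a y. a \<in> carrier (chow N) \<and> y \<in> ?Y} =
     {\<Phi> (var F * h F ^ k * p) | k p. k < mult_bound F \<and> p \<in> poly_in (upper F)}"
  proof (intro equalityI subsetI)
    fix x assume "x \<in> {f (TS.pure a y) | a y. a \<in> carrier (chow N) \<and> y \<in> ?Y}"
    then obtain a k where ak: "x = f (TS.pure a (\<Phi>' (hvar (localization M F) F ^ k)))" "a \<in> carrier (chow N)" "k < mult_bound F" by auto
    obtain p where p: "p \<in> DN" "a = chow_class N p" using ak(2) by (rule TS.A.carrierE)
    have "x = \<Phi> (push p (hvar (localization M F) F ^ k))" unfolding ak(1) p(2) by (rule f(2)[OF p(1)])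
    also have "push p (hvar (localization M F) F ^ k) = var F * h F ^ k * expand F p"
      by (simp add: push_def local_alpha algebra_simps)
    finally show "x \<in> {\<Phi> (var F * h F ^ k * p) | k p. k < mult_bound F \<and> p \<in> poly_in (upper F)}"
      using ak(3) poly_in_mono[OF _ expand_in[OF F p(1)], of "upper F"] by auto
  next
    fix x assume "x \<in> {\<Phi> (var F * h F ^ k * p) | k p. k < mult_bound F \<and> p \<in> poly_in (upper F)}"
    then obtain k q where kq: "x = \<Phi> (var F * h F ^ k * q)" "k < mult_bound F" "q \<in> poly_in (upper F)" by auto
    interpret Q: flat_interval M F 1 by (rule sub_interval[OF F_facts(1,2)])
    \<comment> \<open>A coefficient above \<open>F\<close> may involve the variable of
      \<open>E\<close>, which is not a variable of the contraction. It is eliminated modulo the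
      ideal of the contraction, which \<open>var F\<close> kills.\<close>
    obtain q' where q': "q' \<in> poly_in (upper F - {E})" "q - q' \<in> interval_ideal M F 1"
      using Q.eliminate_top[of q] by blast
    have "q' \<in> poly_in (upper F)" by (rule poly_in_mono[OF _ q'(1)]) auto
    then have "var F * (q - q') \<in> I"
      using kq(3) by (intro push_ideal_in[OF F_facts(1,2) q'(2)] poly_in_diff)
    then have "var F * (q - q') * h F ^ k \<in> I" by (rule gen_ideal_mult_right)
    then have "var F * h F ^ k * q - var F * h F ^ k * q' \<in> I" by (simp add: algebra_simps)
    then have x: "x = \<Phi> (var F * h F ^ k * q')" unfolding kq(1) Phi_ops(4) .
    obtain p where p: "p \<in> DN" "expand F p = q'" using expand_onto[OF F q'(1)] by blast
    have "push p (hvar (localization M F) F ^ k) = var F * h F ^ k * q'"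
      by (simp add: push_def local_alpha p(2) algebra_simps)
    then have "x = f (TS.pure (chow_class N p) (\<Phi>' (hvar (localization M F) F ^ k)))"
      using x f(2)[OF p(1)] by simp
    then show "x \<in> {f (TS.pure a y) | a y. a \<in> carrier (chow N) \<and> y \<in> ?Y}"
      using kq(2) TS.A.Phi_closed[OF p(1)] by blast
  qed
  also have "lin_span R {\<Phi> (var F * h F ^ k * p) | k p. k < mult_bound F \<and> p \<in> poly_in (upper F)} = \<Phi> ` summand_polys (Some F)"
    by (rule lin_span_flat[OF F])
  finally show ?thesis .
qed

end

section \<open>Transport of decompositions and of gradings\<close>

lemma module_decomposition_cong:
  assumes "module_decomposition H A K S" "\<And>i. i \<in> K \<Longrightarrow> S i = S' i"
  shows "module_decomposition H A K S'"
  using assms PiE_cong[of K S S'] unfolding module_decomposition_def by simp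

lemma degree_part_subst:
  assumes f: "\<And>v. f v \<in> poly_in V" "\<And>v. homogeneous 1 (f v)" and g: "\<And>w. w \<in> V \<Longrightarrow> homogeneous 1 (g w)"
    and fg: "\<And>r. r \<in> poly_in V \<Longrightarrow> cls (subst f (subst g r)) = cls r"
  shows "(\<lambda>p. cls (subst f p)) ` {p. homogeneous k p} = cls ` {p \<in> poly_in V. homogeneous k p}"
proof (intro equalityI subsetI)
  fix x assume "x \<in> (\<lambda>p. cls (subst f p)) ` {p. homogeneous k p}"
  then obtain p where p: "x = cls (subst f p)" "homogeneous k p" by auto
  have "subst f p \<in> poly_in V" by (rule subst_poly_in[OF poly_in_UNIV]) (rule f)
  moreover have "homogeneous k (subst f p)" by (rule subst_homogeneous[OF p(2) poly_in_UNIV]) (rule f)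
  ultimately show "x \<in> cls ` {p \<in> poly_in V. homogeneous k p}" using p(1) by auto
next
  fix x assume "x \<in> cls ` {p \<in> poly_in V. homogeneous k p}"
  then obtain p where p: "x = cls p" "p \<in> poly_in V" "homogeneous k p" by auto
  have "homogeneous k (subst g p)" by (rule subst_homogeneous[OF p(3,2)]) (rule g)
  then show "x \<in> (\<lambda>p. cls (subst f p)) ` {p. homogeneous k p}"
    using fg[OF p(2)] p(1) by (intro image_eqI[of _ _ "subst g p"]) auto
qed

section \<open>The Chow ring\<close>

text \<open>The variable of the ground set goes to minus the alpha class, with the same chosen
  element as in \<open>chow_alpha\<close>; so the class of \<open>h E\<close> is
  \<open>chow_alpha M\<close> without further congruences.\<close>

definition chow_var :: "'a matroid \<Rightarrow> 'a set \<Rightarrow> 'a set mpoly" where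
  "chow_var M G = (if G \<in> nonempty_proper_flats M then var G
     else if G = ground M then - (\<Sum>F\<in>{F \<in> nonempty_proper_flats M. (SOME i. i \<in> ground M) \<in> F}. var F) else 0)"

definition chow_map :: "'a matroid \<Rightarrow> 'a set mpoly \<Rightarrow> 'a set mpoly set" where
  "chow_map M p = chow_class M (subst (chow_var M) p)"

lemma chow_var_in: "chow_var M G \<in> poly_in (nonempty_proper_flats M)"
  by (auto simp: chow_var_def intro!: poly_in_uminus poly_in_sum)

lemma chow_var_hom: "homogeneous 1 (chow_var M G)"
  by (auto simp: chow_var_def intro!: homogeneous_uminus homogeneous_sum)

locale nonempty_loopless_matroid = loopless_matroid +
  assumes nonempty: "E \<noteq> {}"
begin

sublocale flat_interval M "{}" 1
  using rank_pos[OF ground_flat nonempty] empty_flat by unfold_locales (auto simp: Suc_le_eq One_nat_def)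

lemma inner_flats_eq: "inner_flats = nonempty_proper_flats M"
proof -
  have "G \<in> P \<longleftrightarrow> G \<in> flats M \<and> G \<noteq> {}" for G
    using upper_iff[OF empty_flat, of G] by auto
  then show ?thesis by (auto simp: nonempty_proper_flats_def proper_flats_def)
qed

lemma P_eq: "G \<in> P \<longleftrightarrow> G \<in> nonempty_proper_flats M \<or> G = E"
  using inner_flats_eq E_in_P by blast

abbreviation "alpha_at i \<equiv> (\<Sum>F\<in>{F \<in> nonempty_proper_flats M. i \<in> F}. var F)"

lemma hvar_element: "i \<in> E \<Longrightarrow> h {i} = - alpha_at i - var E"
proof -
  assume i: "i \<in> E"
  have "{G \<in> flats M. {i} \<subseteq> G} = insert E {F \<in> nonempty_proper_flats M. i \<in> F}"
    using i ground_flat by (auto simp: nonempty_proper_flats_def proper_flats_def)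
  moreover have "E \<notin> {F \<in> nonempty_proper_flats M. i \<in> F}" "finite {F \<in> nonempty_proper_flats M. i \<in> F}"
    using finite_flats by (auto simp: nonempty_proper_flats_def proper_flats_def)
  ultimately show ?thesis by (simp add: hvar_def)
qed

lemma hvar_element_ideal:
  assumes i: "i \<in> E"
  shows "h {i} \<in> I"
proof -
  have i': "i \<in> E - {}" "{i} \<subseteq> E" using i by auto
  have "rank (cl {i}) = rank {} + 1"
    using rank_insert[of "{}" i] rank_cl[OF i'(2)] i cl_ident[OF empty_flat] by (simp add: One_nat_def)
  then have "h (cl {i}) \<in> I" using cl_insert_in_P[OF i'(1)] by (intro gen_bottom) auto
  then show ?thesis using hvar_cl[OF i'(2)] by simp
qed

lemma subst_alpha_at: "subst (chow_var M) (alpha_at i) = alpha_at i"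
  by (rule subst_ident[of _ "nonempty_proper_flats M"]) (auto simp: chow_var_def intro!: poly_in_sum)

lemma E_not_proper: "E \<notin> nonempty_proper_flats M"
  by (simp add: nonempty_proper_flats_def proper_flats_def)

lemma subst_hvar_element:
  assumes "i \<in> E"
  shows "subst (chow_var M) (h {i}) = alpha_at (SOME i. i \<in> E) - alpha_at i"
  using E_not_proper
  by (simp add: hvar_element[OF assms] subst_diff subst_uminus subst_alpha_at) (simp add: chow_var_def)

lemma some_in: "(SOME i. i \<in> E) \<in> E"
  using nonempty by (simp add: some_in_eq)

lemma chow_ideal_linear:
  assumes "i \<in> E" "j \<in> E"
  shows "alpha_at i - alpha_at j \<in> chow_ideal M"
proof (cases "i = j")
  case True
  then show ?thesis using poly_ideal_closed(5)[OF chow_poly_ideal] by simp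
next
  case False
  then show ?thesis
    using assms unfolding chow_ideal_def chow_poly_def
    by (intro subsetD[OF Idl_superset[OF chow_gens_in_poly]]) blast
qed

lemma chow_ideal_incomparable:
  assumes "F \<in> nonempty_proper_flats M" "G \<in> nonempty_proper_flats M" "\<not> F \<subseteq> G" "\<not> G \<subseteq> F"
  shows "var F * var G \<in> chow_ideal M"
  using assms unfolding chow_ideal_def chow_poly_def
  by (intro subsetD[OF Idl_superset[OF chow_gens_in_poly]]) blast

text \<open>Every \<open>h {i}\<close> becomes a difference of two sums from the linear relations. A
  flat of rank one is the closure of any of its elements, so the bottom relations are of this kind
  too.\<close>

lemma chow_var_gens:
  assumes "x \<in> interval_gens M {} 1"
  shows "subst (chow_var M) x \<in> chow_ideal M"
proof -
  note Jc = poly_ideal_closed[OF chow_poly_ideal[of M]]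
  have hJ: "subst (chow_var M) (h {i}) \<in> chow_ideal M" if "i \<in> E" for i
    unfolding subst_hvar_element[OF that] by (rule chow_ideal_linear[OF some_in that])
  consider (outside) G where "x = var G" "G \<notin> P"
    | (incomparable) F G where "x = var F * var G" "F \<in> P" "G \<in> P" "\<not> F \<subseteq> G" "\<not> G \<subseteq> F"
    | (element) G i where "x = var G * h (insert i {})" "G \<in> P" "i \<in> E - G"
    | (bottom) F where "x = h F" "F \<in> P" "rank F = rank {} + 1"
    using assms unfolding interval_gens_def by blast
  then show ?thesis
  proof cases
    case outside
    then show ?thesis using Jc(5) by (simp add: P_eq chow_var_def)
  next
    case incomparable
    have "F \<noteq> E" "G \<noteq> E" using incomparable P_subset by auto
    then have "F \<in> nonempty_proper_flats M" "G \<in> nonempty_proper_flats M" using incomparable by (simp_all add: P_eq)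
    then show ?thesis using incomparable by (simp add: subst_mult chow_var_def chow_ideal_incomparable)
  next
    case element
    then show ?thesis using Jc(2)[OF hJ[of i] chow_var_in[of M G]] by (simp add: subst_mult)
  next
    case bottom
    have "F \<noteq> {}" using bottom by auto
    then obtain i where i: "i \<in> F" by blast
    have iE: "i \<in> E" "{i} \<subseteq> E" using i P_subset[OF bottom(2)] by auto
    have "cl {i} = F"
    proof (rule ccontr)
      assume ne: "cl {i} \<noteq> F"
      have "cl {i} \<subseteq> F" using P_flat[OF bottom(2)] i by (intro cl_minimal) auto
      then have "rank (cl {i}) < rank F"
        using ne cl_flat[OF iE(2)] P_subset[OF bottom(2)] by (intro rank_strict_mono) auto
      moreover have "rank (cl {i}) = 1"
        using rank_insert[of "{}" i] rank_cl[OF iE(2)] iE cl_ident[OF empty_flat] by (simp add: One_nat_def)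
      ultimately show False using bottom(3) by simp
    qed
    then have "h F = h {i}" using hvar_cl[OF iE(2)] by simp
    then show ?thesis using hJ[OF iE(1)] bottom by simp
  qed
qed

lemma chow_presentation_facts:
  "presentation (chow M) (chow_map M) UNIV I" "chow_map M p \<otimes>\<^bsub>chow M\<^esub> chow_map M q = chow_map M (p * q)"
  "\<one>\<^bsub>chow M\<^esub> = chow_map M 1" "r \<in> poly_in (nonempty_proper_flats M) \<Longrightarrow> chow_map M r = chow_class M r"
proof -
  have gens2: "subst var x \<in> I" if "x \<in> {alpha_at i - alpha_at j | i j. i \<in> E \<and> j \<in> E \<and> i \<noteq> j} \<union>
      {var F * var G | F G. F \<in> nonempty_proper_flats M \<and> G \<in> nonempty_proper_flats M \<and> \<not> F \<subseteq> G \<and> \<not> G \<subseteq> F}" for x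
    using that
  proof (elim UnE CollectE exE conjE)
    fix i j assume ij: "x = alpha_at i - alpha_at j" "i \<in> E" "j \<in> E"
    have "h {j} - h {i} \<in> I" using ij by (intro gen_ideal_diff hvar_element_ideal)
    then show ?thesis using ij by (simp add: subst_var_id hvar_element)
  next
    fix F G assume "x = var F * var G" "\<not> F \<subseteq> G" "\<not> G \<subseteq> F"
    then show ?thesis using gen_incomparable by (simp add: subst_var_id)
  qed
  \<comment> \<open>On the variable of \<open>E\<close> this is minus the relation
    \<open>h {i} = 0\<close> for the chosen \<open>i\<close>.\<close>
  have fg: "var v - subst var (chow_var M v) \<in> I" for v
  proof -
    have "h {SOME i. i \<in> E} \<in> I" by (rule hvar_element_ideal[OF some_in])
    from gen_ideal_uminus[OF this] have "v = E \<Longrightarrow> var v - chow_var M v \<in> I"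
      using E_not_proper by (simp add: hvar_element[OF some_in] chow_var_def)
    then show ?thesis
      using gen_outside[of v] by (auto simp: subst_var_id chow_var_def P_eq)
  qed
  have gf: "var w - subst (chow_var M) (var w) \<in> Idl\<^bsub>poly_algebra (nonempty_proper_flats M)\<^esub> ({alpha_at i - alpha_at j | i j. i \<in> E \<and> j \<in> E \<and> i \<noteq> j} \<union>
      {var F * var G | F G. F \<in> nonempty_proper_flats M \<and> G \<in> nonempty_proper_flats M \<and> \<not> F \<subseteq> G \<and> \<not> G \<subseteq> F})"
    if "w \<in> nonempty_proper_flats M" for w
    using that poly_ideal_closed(5)[OF chow_poly_ideal[of M, unfolded chow_ideal_def chow_poly_def]] by (simp add: chow_var_def)
  note facts = subst_presentation[OF chow_gens_in_poly[of M] chow_var_in chow_var_gens[unfolded chow_ideal_def chow_poly_def] gens2 fg gf,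
      folded chow_poly_def, folded chow_ideal_def, folded chow_def chow_class_def chow_map_def]
  show "presentation (chow M) (chow_map M) UNIV I" by (rule facts(1))
  show "chow_map M p \<otimes>\<^bsub>chow M\<^esub> chow_map M q = chow_map M (p * q)" using facts(2) .
  show "\<one>\<^bsub>chow M\<^esub> = chow_map M 1" using facts(3) .
  show "r \<in> poly_in (nonempty_proper_flats M) \<Longrightarrow> chow_map M r = chow_class M r"
    unfolding chow_map_def by (subst subst_ident) (auto simp: chow_var_def)
qed

sublocale chow_presentation M 1 "chow M" "chow_map M"
  by (intro chow_presentation.intro chow_presentation_axioms.intro flat_interval_axioms chow_presentation_facts(1-3))

lemma chow_alpha_eq: "chow_alpha M = chow_map M (h E)"
  using E_not_proper by (simp add: hvar_E chow_alpha_def chow_map_def subst_uminus) (simp add: chow_var_def)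

lemma chow_H_eq: "chow_H M = generated_subalgebra (chow M) {chow_map M (h E)}"
  by (simp add: chow_H_def chow_alpha_eq)

lemma chow_degree_part_eq: "chow_degree_part M k = degree_part k"
proof -
  have "(\<lambda>p. chow_class M (subst (chow_var M) p)) ` {p. homogeneous k p} =
      chow_class M ` {p \<in> poly_in (nonempty_proper_flats M). homogeneous k p}"
    using chow_presentation_facts(4)
    by (intro degree_part_subst[where g = var] chow_var_in chow_var_hom) (auto simp: subst_var_id chow_map_def)
  note eq = this
  have "(\<lambda>p. chow_class M (subst (chow_var M) p)) = chow_map M"
    by (rule ext) (simp only: chow_map_def)
  then show ?thesis
    unfolding degree_part_def chow_degree_part_def chow_poly_def poly_algebra_simps eq[symmetric] by (simp only:)
qed

lemma rank_top: "matroid_rank M - 1 = top_degree"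
  by (simp add: matroid_rank_eq)

lemma chow_deg_eq:
  assumes "homogeneous top_degree p"
  shows "chow_deg M (chow_map M p) = deg_fun p"
  unfolding chow_deg_def chow_degree_part_eq rank_top
proof (rule deg_characterization[OF _ _ assms])
  fix C assume C: "subset.maxchain (nonempty_proper_flats M) C"
  then have sub: "C \<subseteq> nonempty_proper_flats M" "\<forall>F\<in>C. \<forall>G\<in>C. F \<subseteq> G \<or> G \<subseteq> F"
    unfolding subset.maxchain_def subset_chain_def by simp_all
  have "(\<Prod>F\<in>C. var F) \<in> poly_in (nonempty_proper_flats M)" using sub by (intro poly_in_prod poly_in_var) auto
  then show "chow_class M (\<Prod>F\<in>C. var F) = chow_map M (\<Prod>F\<in>C. var F) \<and> C \<subseteq> inner_flats \<and> card C = top_degree \<and>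
      (\<forall>F\<in>C. \<forall>G\<in>C. F \<subseteq> G \<or> G \<subseteq> F)"
    using sub maxchain_nonempty_card[OF C nonempty] chow_presentation_facts(4) inner_flats_eq by simp
next
  show "\<exists>C. subset.maxchain (nonempty_proper_flats M) C" using subset.Hausdorff by blast
qed

lemma idx_eq: "insert None (Some ` flats_uC M) = idx"
proof -
  have "flats_uC M = {F \<in> inner_flats. 0 < mult_bound F}"
  proof (intro equalityI subsetI)
    fix F assume "F \<in> flats_uC M"
    then have F: "F \<in> flats M" "F \<noteq> E" "2 \<le> rank F" by (auto simp: flats_uC_def proper_flats_def flat_rank_eq)
    then have "F \<noteq> {}" by auto
    then show "F \<in> {F \<in> inner_flats. 0 < mult_bound F}"
      using F unfolding inner_flats_eq by (simp add: nonempty_proper_flats_def proper_flats_def mult_bound_def)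
  next
    fix F assume "F \<in> {F \<in> inner_flats. 0 < mult_bound F}"
    then show "F \<in> flats_uC M"
      unfolding inner_flats_eq by (auto simp: nonempty_proper_flats_def flats_uC_def proper_flats_def flat_rank_eq mult_bound_def)
  qed
  then show ?thesis by (simp add: idx_def)
qed

lemma chow_J_eq: "chow_J M = lin_span (chow M) {chow_map M (h E ^ k) | k. k < top_degree}"
proof -
  \<comment> \<open>The truncation is stated with \<open>k + 1\<close>; it matches the top degree
    because a nonempty ground set has positive rank.\<close>
  have "k + 1 = matroid_rank M \<longleftrightarrow> k = top_degree" for k
    using rank_pos[OF ground_flat nonempty] by (auto simp: matroid_rank_eq)
  then have "chow_J_part M k = (if k = top_degree then {\<zero>\<^bsub>chow M\<^esub>} else generated_subalgebra (chow M) {chow_map M (h E)} \<inter> degree_part k)" for k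
    unfolding chow_J_part_def chow_H_eq chow_degree_part_eq by (simp only:)
  then have "chow_J_part M = (\<lambda>k. if k = top_degree then {\<zero>\<^bsub>chow M\<^esub>} else generated_subalgebra (chow M) {chow_map M (h E)} \<inter> degree_part k)"
    by (rule ext)
  then show ?thesis
    unfolding chow_J_def using truncated_span by (simp only:)
qed

lemma chow_summand_eq:
  assumes "i \<in> idx"
  shows "chow_summand M i = chow_map M ` summand_polys i"
proof (cases i)
  case None
  then show ?thesis using generated_subalgebra_top by (simp only: chow_summand.simps chow_H_eq)
next
  case (Some F)
  then have F: "F \<in> inner_flats" using assms by (auto simp: idx_def)
  have Ff: "F \<in> flats M" "F \<noteq> {}" using F unfolding inner_flats_eq by (auto simp: nonempty_proper_flats_def proper_flats_def)
  \<comment> \<open>\<open>F\<close> is nonempty, so the localization is again in the case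
    \<open>\<delta> = 1\<close>.\<close>
  interpret L: nonempty_loopless_matroid "localization M F"
    using localization_loopless_matroid[OF Ff(1)] Ff(2)
    by (simp add: nonempty_loopless_matroid_def nonempty_loopless_matroid_axioms_def)
  interpret pushforward M 1 "chow M" "chow_map M" F "chow (localization M F)" "chow_map (localization M F)"
    by (intro pushforward.intro pushforward_axioms.intro chow_presentation_axioms L.chow_presentation_axioms F)
  have cond: "{G \<in> nonempty_proper_flats M. G \<subset> F} = {G \<in> inner_flats. G \<subset> F}" by (simp only: inner_flats_eq)
  have Y: "chow_class (localization M F) (\<Prod>G\<in>#K'. var G) = chow_map (localization M F) (\<Prod>G\<in>#K'. var G)"
    if K': "set_mset K' \<subseteq> {G \<in> inner_flats. G \<subset> F}" for K'
  proof -
    have "(\<Prod>G\<in>#K'. var G) \<in> poly_in (nonempty_proper_flats (localization M F))"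
      using K'
    proof (induction K')
      case (add G K)
      then have "G \<in> nonempty_proper_flats M" "G \<subset> F" unfolding inner_flats_eq by auto
      then have "G \<in> nonempty_proper_flats (localization M F)"
        by (auto simp: nonempty_proper_flats_def proper_flats_def localization_flats)
      then show ?case using add by (simp add: poly_in_mult)
    qed simp
    then show ?thesis by (simp add: L.chow_presentation_facts(4))
  qed
  have mset_in: "(\<Prod>G\<in>#K. var G) \<in> poly_in (nonempty_proper_flats M)" if "set_mset K \<subseteq> nonempty_proper_flats M" for K
    using that by (induction K) (auto intro!: poly_in_mult)
  have X: "chow_class M (var F * (\<Prod>G\<in>#K. var G) * (\<Prod>G\<in>#K'. var G)) = chow_map M (var F * (\<Prod>G\<in>#K. var G) * (\<Prod>G\<in>#K'. var G))"
    if K: "set_mset K \<subseteq> {G \<in> proper_flats M. F \<subset> G}" "set_mset K' \<subseteq> {G \<in> inner_flats. G \<subset> F}" for K K'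
  proof -
    have "set_mset K \<subseteq> nonempty_proper_flats M" using K(1) by (auto simp: nonempty_proper_flats_def)
    moreover have "set_mset K' \<subseteq> nonempty_proper_flats M" using K(2) unfolding inner_flats_eq by auto
    moreover have "F \<in> nonempty_proper_flats M" using F unfolding inner_flats_eq .
    ultimately have "var F * (\<Prod>G\<in>#K. var G) * (\<Prod>G\<in>#K'. var G) \<in> poly_in (nonempty_proper_flats M)"
      using mset_in by (intro poly_in_mult) auto
    then show ?thesis by (simp add: chow_presentation_facts(4))
  qed
  note pf = pushforward_characterization[where Y = "\<lambda>K'. chow_class (localization M F) (\<Prod>G\<in>#K'. var G)" and
      X = "\<lambda>K K'. chow_class M (var F * (\<Prod>G\<in>#K. var G) * (\<Prod>G\<in>#K'. var G))", OF Y X]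
  have psi: "chow_psi M F = (THE f. f \<in> extensional (carrier TS.T) \<and> f \<in> linear_maps TS.T (chow M) \<and>
    (\<forall>K K'. set_mset K \<subseteq> {G \<in> proper_flats M. F \<subset> G} \<and> set_mset K' \<subseteq> {G \<in> inner_flats. G \<subset> F} \<longrightarrow>
      f (TS.pure (chow_class N (\<Prod>G\<in>#K. var (G - F))) (chow_class (localization M F) (\<Prod>G\<in>#K'. var G))) =
      chow_class M (var F * (\<Prod>G\<in>#K. var G) * (\<Prod>G\<in>#K'. var G))))"
    unfolding chow_psi_def Let_def cond ..
  have J: "chow_J (localization M F) = lin_span (chow (localization M F)) {chow_map (localization M F) (hvar (localization M F) F ^ k) | k. k < mult_bound F}"
    using L.chow_J_eq unfolding localization_ground local_top_degree .
  show ?thesis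
    unfolding Some chow_summand.simps J
    by (rule pushforward_image) (use pf in \<open>simp_all only: psi\<close>)
qed

lemma chow_decomposition:
  "module_decomposition (chow_H M) (chow M) (insert None (Some ` flats_uC M)) (chow_summand M)"
  "i \<in> insert None (Some ` flats_uC M) \<Longrightarrow> j \<in> insert None (Some ` flats_uC M) \<Longrightarrow> i \<noteq> j \<Longrightarrow>
    chow_orthogonal M (chow_summand M i) (chow_summand M j)"
proof -
  show "module_decomposition (chow_H M) (chow M) (insert None (Some ` flats_uC M)) (chow_summand M)"
    unfolding idx_eq chow_H_eq
  proof (rule module_decomposition_cong[OF decomposition])
    show "chow_map M ` summand_polys i = chow_summand M i" if "i \<in> idx" for i
      by (rule chow_summand_eq[OF that, symmetric])
  qed
  assume ij: "i \<in> insert None (Some ` flats_uC M)" "j \<in> insert None (Some ` flats_uC M)" "i \<noteq> j"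
  then have ij': "i \<in> idx" "j \<in> idx" unfolding idx_eq by simp_all
  show "chow_orthogonal M (chow_summand M i) (chow_summand M j)"
    unfolding chow_orthogonal_def chow_summand_eq[OF ij'(1)] chow_summand_eq[OF ij'(2)] chow_degree_part_eq rank_top
  proof (intro allI impI ballI)
    fix k \<eta> \<xi>
    assume k: "k \<le> top_degree" and m: "\<eta> \<in> chow_map M ` summand_polys i \<inter> degree_part k"
      "\<xi> \<in> chow_map M ` summand_polys j \<inter> degree_part (top_degree - k)"
    show "chow_deg M (\<eta> \<otimes>\<^bsub>chow M\<^esub> \<xi>) = 0"
      by (rule orthogonal[OF ij' ij(3) m _ chow_deg_eq]) (use k in simp_all)
  qed
qed

end

section \<open>The augmented Chow ring\<close>

definition aug_var :: "'a matroid \<Rightarrow> 'a set \<Rightarrow> 'a aug_var mpoly" where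
  "aug_var M G = (if G \<in> proper_flats M then var (XVar G)
     else if G = ground M then - (\<Sum>F\<in>proper_flats M. var (XVar F)) else 0)"

text \<open>\<open>y_i\<close> is the sum of the variables of the flats missing \<open>i\<close>.
  Modulo the relation \<open>h {} = 0\<close> this equals minus the sum over the flats containing
  \<open>i\<close>, which is \<open>hvar M {i}\<close>.\<close>

fun aug_back :: "'a matroid \<Rightarrow> 'a aug_var \<Rightarrow> 'a set mpoly" where
  "aug_back M (XVar G) = var G"
| "aug_back M (YVar i) = hvar M {i}"

definition aug_map :: "'a matroid \<Rightarrow> 'a set mpoly \<Rightarrow> 'a aug_var mpoly set" where
  "aug_map M p = aug_chow_class M (subst (aug_var M) p)"

definition aug_vars :: "'a matroid \<Rightarrow> 'a aug_var set" where
  "aug_vars M = YVar ` ground M \<union> XVar ` proper_flats M"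

definition aug_gens :: "'a matroid \<Rightarrow> 'a aug_var mpoly set" where
  "aug_gens M = {var (YVar i) - (\<Sum>F\<in>{F \<in> proper_flats M. i \<notin> F}. var (XVar F)) | i. i \<in> ground M} \<union>
      {var (XVar F) * var (XVar G)
         | F G. F \<in> proper_flats M \<and> G \<in> proper_flats M \<and> \<not> F \<subseteq> G \<and> \<not> G \<subseteq> F} \<union>
      {var (YVar i) * var (XVar F) | i F. i \<in> ground M \<and> F \<in> proper_flats M \<and> i \<notin> F}"

lemma aug_chow_poly_eq: "aug_chow_poly M = poly_algebra (aug_vars M)"
  by (simp add: aug_chow_poly_def aug_vars_def)

lemma aug_chow_ideal_eq: "aug_chow_ideal M = Idl\<^bsub>aug_chow_poly M\<^esub> (aug_gens M)"
  by (simp add: aug_chow_ideal_def aug_gens_def)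

lemma aug_gens_in_poly: "aug_gens M \<subseteq> poly_in (aug_vars M)"
proof -
  have "(\<Sum>F\<in>{F \<in> proper_flats M. i \<notin> F}. var (XVar F)) \<in> poly_in (aug_vars M)" for i
    by (rule poly_in_sum) (auto simp: aug_vars_def)
  then show ?thesis by (auto simp: aug_gens_def aug_vars_def intro!: poly_in_diff poly_in_mult)
qed

lemma aug_poly_ideal: "poly_ideal (aug_vars M) (aug_chow_ideal M)"
  unfolding aug_chow_ideal_eq aug_chow_poly_eq by (rule Idl_poly_ideal[OF aug_gens_in_poly])

lemma aug_ideal_gen: "x \<in> aug_gens M \<Longrightarrow> x \<in> aug_chow_ideal M"
  unfolding aug_chow_ideal_eq aug_chow_poly_eq by (rule subsetD[OF Idl_superset[OF aug_gens_in_poly]])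

lemma aug_var_in: "aug_var M G \<in> poly_in (aug_vars M)"
  by (auto simp: aug_var_def aug_vars_def intro!: poly_in_uminus poly_in_sum)

lemma aug_var_hom: "homogeneous 1 (aug_var M G)"
  by (auto simp: aug_var_def intro!: homogeneous_uminus homogeneous_sum)

locale augmented_matroid = loopless_matroid
begin

sublocale flat_interval M "{}" 0
  using empty_flat by unfold_locales auto

lemma P_eq: "P = flats M"
  by (auto simp: interval_flats_def)

lemma inner_flats_eq: "inner_flats = proper_flats M"
  by (simp add: P_eq proper_flats_def)

lemma E_not_proper: "E \<notin> proper_flats M"
  by (simp add: proper_flats_def)

lemma finite_proper: "finite (proper_flats M)"
  using finite_flats by (simp add: proper_flats_def)

lemma flats_split: "flats M = insert E (proper_flats M)"
  using ground_flat by (auto simp: proper_flats_def)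

lemma hvar_empty: "h {} = - (\<Sum>F\<in>proper_flats M. var F) - var E"
proof -
  have eq: "{G \<in> flats M. {} \<subseteq> G} = insert E (proper_flats M)" using flats_split by auto
  show ?thesis unfolding hvar_def eq using finite_proper E_not_proper by simp
qed

lemma hvar_element: "i \<in> E \<Longrightarrow> h {i} = - (\<Sum>F\<in>{F \<in> proper_flats M. i \<in> F}. var F) - var E"
proof -
  assume i: "i \<in> E"
  have "{G \<in> flats M. {i} \<subseteq> G} = insert E {F \<in> proper_flats M. i \<in> F}" using i flats_split by auto
  moreover have "E \<notin> {F \<in> proper_flats M. i \<in> F}" "finite {F \<in> proper_flats M. i \<in> F}"
    using finite_proper E_not_proper by auto
  ultimately show ?thesis by (simp add: hvar_def)
qed

lemma proper_split: "(\<Sum>F\<in>proper_flats M. g F) = (\<Sum>F\<in>{F \<in> proper_flats M. i \<in> F}. g F) + (\<Sum>F\<in>{F \<in> proper_flats M. i \<notin> F}. g F)"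
  for g :: "'a set \<Rightarrow> 'v mpoly"
proof -
  have "proper_flats M = {F \<in> proper_flats M. i \<in> F} \<union> {F \<in> proper_flats M. i \<notin> F}" by auto
  moreover have "{F \<in> proper_flats M. i \<in> F} \<inter> {F \<in> proper_flats M. i \<notin> F} = {}" by auto
  ultimately show ?thesis using finite_proper by (metis (no_types, lifting) finite_Un sum.union_disjoint)
qed

lemma hvar_empty_ideal: "h {} \<in> I"
  using empty_flat by (intro gen_bottom) (simp_all add: P_eq)

lemma subst_var_E: "aug_var M E = - (\<Sum>F\<in>proper_flats M. var (XVar F))"
  using E_not_proper by (simp add: aug_var_def)

lemma subst_sum_proper:
  assumes "S \<subseteq> proper_flats M"
  shows "subst (aug_var M) (\<Sum>F\<in>S. var F) = (\<Sum>F\<in>S. var (XVar F))"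
  unfolding subst_sum subst_var using assms by (intro sum.cong) (auto simp: aug_var_def)

lemma subst_hvar_empty: "subst (aug_var M) (h {}) = 0"
  by (simp add: hvar_empty subst_diff subst_uminus subst_sum_proper subst_var_E)

lemma subst_hvar_element:
  assumes "i \<in> E"
  shows "subst (aug_var M) (h {i}) = (\<Sum>F\<in>{F \<in> proper_flats M. i \<notin> F}. var (XVar F))"
proof -
  have "subst (aug_var M) (\<Sum>F\<in>{F \<in> proper_flats M. i \<in> F}. var F) = (\<Sum>F\<in>{F \<in> proper_flats M. i \<in> F}. var (XVar F))"
    by (rule subst_sum_proper) auto
  then show ?thesis
    using proper_split[of "\<lambda>F. var (XVar F)" i]
    by (simp add: hvar_element[OF assms] subst_diff subst_uminus subst_var_E)
qed

lemma aug_var_gens: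
  assumes "x \<in> interval_gens M {} 0"
  shows "subst (aug_var M) x \<in> aug_chow_ideal M"
proof -
  note Jc = poly_ideal_closed[OF aug_poly_ideal[of M]]
  consider (outside) G where "x = var G" "G \<notin> P"
    | (incomparable) F G where "x = var F * var G" "F \<in> P" "G \<in> P" "\<not> F \<subseteq> G" "\<not> G \<subseteq> F"
    | (element) G i where "x = var G * h (insert i {})" "G \<in> P" "i \<in> E - G"
    | (bottom) F where "x = h F" "F \<in> P" "rank F = rank {} + 0"
    using assms unfolding interval_gens_def by blast
  then show ?thesis
  proof cases
    case outside
    then have "G \<notin> proper_flats M" "G \<noteq> E" using flats_split by (auto simp: P_eq)
    then show ?thesis using Jc(5) outside by (simp add: aug_var_def)
  next
    case incomparable
    have "F \<noteq> E" "G \<noteq> E" using incomparable P_subset by auto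
    then have FG: "F \<in> proper_flats M" "G \<in> proper_flats M" using incomparable by (simp_all add: P_eq proper_flats_def)
    then have "var (XVar F) * var (XVar G) \<in> aug_chow_ideal M"
      using incomparable by (intro aug_ideal_gen) (unfold aug_gens_def, blast)
    then show ?thesis using incomparable FG by (simp add: subst_mult aug_var_def)
  next
    case element
    then have G: "G \<in> proper_flats M" and i: "i \<in> E" "i \<notin> G" by (auto simp: P_eq proper_flats_def)
    have 1: "var (YVar i) - (\<Sum>F\<in>{F \<in> proper_flats M. i \<notin> F}. var (XVar F)) \<in> aug_chow_ideal M"
      using i by (intro aug_ideal_gen) (unfold aug_gens_def, blast)
    have 2: "var (YVar i) * var (XVar G) \<in> aug_chow_ideal M"
      using i G by (intro aug_ideal_gen) (unfold aug_gens_def, blast)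
    have "var (XVar G) \<in> poly_in (aug_vars M)" using G by (simp add: aug_vars_def)
    \<comment> \<open>The linear relation replaces \<open>y_i\<close> in the monomial relation
      \<open>y_i * x_G = 0\<close>; what results is the image of
      \<open>var G * h {i}\<close>.\<close>
    from Jc(4)[OF 2 Jc(2)[OF 1 this]]
    have "var (XVar G) * (\<Sum>F\<in>{F \<in> proper_flats M. i \<notin> F}. var (XVar F)) \<in> aug_chow_ideal M"
      by (simp add: right_diff_distrib mult.commute)
    then show ?thesis using element G subst_hvar_element[OF i(1)] by (simp add: subst_mult) (simp add: aug_var_def)
  next
    case bottom
    have "F = {}" using rank_pos[OF P_flat[OF bottom(2)]] bottom(3) by auto
    then show ?thesis using bottom subst_hvar_empty Jc(5) by simp
  qed
qed

lemma aug_back_gens: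
  assumes "x \<in> aug_gens M"
  shows "subst (aug_back M) x \<in> I"
  using assms unfolding aug_gens_def
proof (elim UnE CollectE exE conjE)
  fix i assume i: "x = var (YVar i) - (\<Sum>F\<in>{F \<in> proper_flats M. i \<notin> F}. var (XVar F))" "i \<in> E"
  \<comment> \<open>Flats containing \<open>i\<close> come from \<open>h {i}\<close>, flats missing
    \<open>i\<close> from the subtracted sum, so together they make up \<open>h {}\<close>.\<close>
  have "subst (aug_back M) x = h {}"
    using proper_split[of var i] by (simp add: i(1) subst_diff subst_sum hvar_element[OF i(2)] hvar_empty)
  then show ?thesis using hvar_empty_ideal by simp
next
  fix F G assume "x = var (XVar F) * var (XVar G)" "\<not> F \<subseteq> G" "\<not> G \<subseteq> F"
  then show ?thesis using gen_incomparable by (simp add: subst_mult)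
next
  fix i F assume iF: "x = var (YVar i) * var (XVar F)" "i \<in> E" "F \<in> proper_flats M" "i \<notin> F"
  have "var F * h (insert i {}) \<in> I" using iF by (intro gen_element) (auto simp: P_eq proper_flats_def)
  then show ?thesis using iF by (simp add: subst_mult mult.commute)
qed

lemma aug_presentation_facts:
  "presentation (aug_chow M) (aug_map M) UNIV I" "aug_map M p \<otimes>\<^bsub>aug_chow M\<^esub> aug_map M q = aug_map M (p * q)"
  "\<one>\<^bsub>aug_chow M\<^esub> = aug_map M 1" "r \<in> poly_in (aug_vars M) \<Longrightarrow> aug_map M (subst (aug_back M) r) = aug_chow_class M r"
proof -
  have fg: "var v - subst (aug_back M) (aug_var M v) \<in> I" for v
  proof (cases "v = E")
    case True
    have "subst (aug_back M) (aug_var M E) = - (\<Sum>F\<in>proper_flats M. var F)"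
      by (simp add: subst_var_E subst_uminus subst_sum)
    then show ?thesis using gen_ideal_uminus[OF hvar_empty_ideal] by (simp add: True hvar_empty)
  next
    case False
    then show ?thesis using gen_outside[of v] by (auto simp: aug_var_def P_eq proper_flats_def)
  qed
  have gf: "var w - subst (aug_var M) (aug_back M w) \<in> Idl\<^bsub>poly_algebra (aug_vars M)\<^esub> (aug_gens M)" if w: "w \<in> aug_vars M" for w
  proof (cases w)
    case (YVar i)
    then have i: "i \<in> E" using w by (auto simp: aug_vars_def)
    have "var (YVar i) - (\<Sum>F\<in>{F \<in> proper_flats M. i \<notin> F}. var (XVar F)) \<in> aug_chow_ideal M"
      using i by (intro aug_ideal_gen) (unfold aug_gens_def, blast)
    then show ?thesis
      using subst_hvar_element[OF i] YVar by (simp add: aug_chow_ideal_eq aug_chow_poly_eq)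
  next
    case (XVar G)
    then have "G \<in> proper_flats M" using w by (auto simp: aug_vars_def)
    then show ?thesis
      using XVar poly_ideal_closed(5)[OF aug_poly_ideal[of M, unfolded aug_chow_ideal_eq aug_chow_poly_eq]] by (simp add: aug_var_def)
  qed
  note facts = subst_presentation[OF aug_gens_in_poly aug_var_in aug_var_gens[unfolded aug_chow_ideal_eq aug_chow_poly_eq] aug_back_gens fg gf,
      folded aug_chow_poly_eq, folded aug_chow_ideal_eq, folded aug_chow_def aug_chow_class_def aug_map_def]
  show "presentation (aug_chow M) (aug_map M) UNIV I" by (rule facts(1))
  show "aug_map M p \<otimes>\<^bsub>aug_chow M\<^esub> aug_map M q = aug_map M (p * q)" using facts(2) .
  show "\<one>\<^bsub>aug_chow M\<^esub> = aug_map M 1" using facts(3) .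
  show "r \<in> poly_in (aug_vars M) \<Longrightarrow> aug_map M (subst (aug_back M) r) = aug_chow_class M r" using facts(4) .
qed

sublocale chow_presentation M 0 "aug_chow M" "aug_map M"
  by (intro chow_presentation.intro chow_presentation_axioms.intro flat_interval_axioms aug_presentation_facts(1-3))

lemma aug_chow_alpha_eq: "aug_chow_alpha M = aug_map M (h E)"
  by (simp add: hvar_E aug_chow_alpha_def aug_map_def subst_uminus subst_var_E)

lemma aug_chow_H_eq: "aug_chow_H M = generated_subalgebra (aug_chow M) {aug_map M (h E)}"
  by (simp add: aug_chow_H_def aug_chow_alpha_eq)

lemma aug_chow_degree_part_eq: "aug_chow_degree_part M k = degree_part k"
proof -
  have "(\<lambda>p. aug_chow_class M (subst (aug_var M) p)) ` {p. homogeneous k p} =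
      aug_chow_class M ` {p \<in> poly_in (aug_vars M). homogeneous k p}"
  proof (rule degree_part_subst[where g = "aug_back M", OF aug_var_in aug_var_hom])
    show "homogeneous 1 (aug_back M w)" for w by (cases w) (auto simp: hvar_hom)
    show "aug_chow_class M (subst (aug_var M) (subst (aug_back M) r)) = aug_chow_class M r" if "r \<in> poly_in (aug_vars M)" for r
      using aug_presentation_facts(4)[OF that] by (simp add: aug_map_def)
  qed
  note eq = this
  have "(\<lambda>p. aug_chow_class M (subst (aug_var M) p)) = aug_map M"
    by (rule ext) (simp only: aug_map_def)
  then show ?thesis
    unfolding degree_part_def aug_chow_degree_part_def aug_chow_poly_eq poly_algebra_simps eq[symmetric] by (simp only:)
qed

lemma rank_top: "matroid_rank M = top_degree"
  by (simp add: matroid_rank_eq)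

lemma aug_map_prod:
  assumes "S \<subseteq> proper_flats M"
  shows "subst (aug_var M) (\<Prod>F\<in>S. var F) = (\<Prod>F\<in>S. var (XVar F))"
  unfolding subst_prod subst_var using assms by (intro prod.cong) (auto simp: aug_var_def)

lemma aug_map_prod_mset:
  assumes "set_mset K \<subseteq> proper_flats M"
  shows "subst (aug_var M) (\<Prod>F\<in>#K. var F) = (\<Prod>F\<in>#K. var (XVar F))"
  using assms by (induction K) (simp_all add: subst_mult aug_var_def)

lemma aug_chow_deg_eq:
  assumes "homogeneous top_degree p"
  shows "aug_chow_deg M (aug_map M p) = deg_fun p"
  unfolding aug_chow_deg_def aug_chow_degree_part_eq rank_top
proof (rule deg_characterization[OF _ _ assms])
  fix C assume C: "subset.maxchain (proper_flats M) C"
  then have sub: "C \<subseteq> proper_flats M" "\<forall>F\<in>C. \<forall>G\<in>C. F \<subseteq> G \<or> G \<subseteq> F"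
    unfolding subset.maxchain_def subset_chain_def by simp_all
  then show "aug_chow_class M (\<Prod>F\<in>C. var (XVar F)) = aug_map M (\<Prod>F\<in>C. var F) \<and> C \<subseteq> inner_flats \<and> card C = top_degree \<and>
      (\<forall>F\<in>C. \<forall>G\<in>C. F \<subseteq> G \<or> G \<subseteq> F)"
    using maxchain_card[OF C] inner_flats_eq by (simp add: aug_map_def aug_map_prod)
next
  show "\<exists>C. subset.maxchain (proper_flats M) C" using subset.Hausdorff by blast
qed

lemma idx_eq: "insert None (Some ` flats_C M) = idx"
proof -
  have "flats_C M = {F \<in> inner_flats. 0 < mult_bound F}"
  proof (intro equalityI subsetI)
    fix F assume "F \<in> flats_C M"
    then have F: "F \<in> proper_flats M" "F \<in> flats M" "F \<noteq> {}"
      by (auto simp: flats_C_def nonempty_proper_flats_def proper_flats_def)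
    then show "F \<in> {F \<in> inner_flats. 0 < mult_bound F}"
      using rank_pos[OF F(2,3)] unfolding inner_flats_eq by (simp add: mult_bound_def)
  next
    fix F assume "F \<in> {F \<in> inner_flats. 0 < mult_bound F}"
    then show "F \<in> flats_C M"
      unfolding inner_flats_eq by (auto simp: nonempty_proper_flats_def flats_C_def mult_bound_def)
  qed
  then show ?thesis by (simp add: idx_def)
qed

lemma aug_chow_J_eq: "aug_chow_J M = lin_span (aug_chow M) {aug_map M (h E ^ k) | k. k < top_degree}"
proof -
  have "aug_chow_J_part M k = (if k = top_degree then {\<zero>\<^bsub>aug_chow M\<^esub>} else generated_subalgebra (aug_chow M) {aug_map M (h E)} \<inter> degree_part k)" for k
    unfolding aug_chow_J_part_def aug_chow_H_eq aug_chow_degree_part_eq rank_top ..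
  then have "aug_chow_J_part M = (\<lambda>k. if k = top_degree then {\<zero>\<^bsub>aug_chow M\<^esub>} else generated_subalgebra (aug_chow M) {aug_map M (h E)} \<inter> degree_part k)"
    by (rule ext)
  then show ?thesis
    unfolding aug_chow_J_def using truncated_span by (simp only:)
qed

lemma aug_chow_summand_eq:
  assumes "i \<in> idx"
  shows "aug_chow_summand M i = aug_map M ` summand_polys i"
proof (cases i)
  case None
  then show ?thesis using generated_subalgebra_top by (simp only: aug_chow_summand.simps aug_chow_H_eq)
next
  case (Some F)
  then have F: "F \<in> inner_flats" using assms by (auto simp: idx_def)
  have Ff: "F \<in> flats M" using F unfolding inner_flats_eq by (auto simp: proper_flats_def)
  interpret L: augmented_matroid "localization M F"
    using localization_loopless_matroid[OF Ff(1)] by (simp add: augmented_matroid_def)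
  interpret pushforward M 0 "aug_chow M" "aug_map M" F "aug_chow (localization M F)" "aug_map (localization M F)"
    by (intro pushforward.intro pushforward_axioms.intro chow_presentation_axioms L.chow_presentation_axioms F)
  have cond: "{G \<in> proper_flats M. G \<subset> F} = {G \<in> inner_flats. G \<subset> F}" by (simp only: inner_flats_eq)
  have Y: "aug_chow_class (localization M F) (\<Prod>G\<in>#K'. var (XVar G)) = aug_map (localization M F) (\<Prod>G\<in>#K'. var G)"
    if K': "set_mset K' \<subseteq> {G \<in> inner_flats. G \<subset> F}" for K'
  proof -
    have "set_mset K' \<subseteq> proper_flats (localization M F)"
      using K' unfolding inner_flats_eq by (auto simp: proper_flats_def localization_flats)
    then show ?thesis by (simp add: aug_map_def L.aug_map_prod_mset)
  qed
  have X: "aug_chow_class M (var (XVar F) * (\<Prod>G\<in>#K. var (XVar G)) * (\<Prod>G\<in>#K'. var (XVar G))) =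
      aug_map M (var F * (\<Prod>G\<in>#K. var G) * (\<Prod>G\<in>#K'. var G))"
    if K: "set_mset K \<subseteq> {G \<in> proper_flats M. F \<subset> G}" "set_mset K' \<subseteq> {G \<in> inner_flats. G \<subset> F}" for K K'
  proof -
    have "set_mset K \<subseteq> proper_flats M" using K(1) by auto
    moreover have "set_mset K' \<subseteq> proper_flats M" using K(2) unfolding inner_flats_eq by auto
    moreover have "F \<in> proper_flats M" using F unfolding inner_flats_eq .
    ultimately show ?thesis
      by (simp add: aug_map_def subst_mult aug_map_prod_mset) (simp add: aug_var_def)
  qed
  note pf = pushforward_characterization[where Y = "\<lambda>K'. aug_chow_class (localization M F) (\<Prod>G\<in>#K'. var (XVar G))" and
      X = "\<lambda>K K'. aug_chow_class M (var (XVar F) * (\<Prod>G\<in>#K. var (XVar G)) * (\<Prod>G\<in>#K'. var (XVar G)))", OF Y X]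
  have psi: "aug_chow_psi M F = (THE f. f \<in> extensional (carrier TS.T) \<and> f \<in> linear_maps TS.T (aug_chow M) \<and>
    (\<forall>K K'. set_mset K \<subseteq> {G \<in> proper_flats M. F \<subset> G} \<and> set_mset K' \<subseteq> {G \<in> inner_flats. G \<subset> F} \<longrightarrow>
      f (TS.pure (chow_class N (\<Prod>G\<in>#K. var (G - F))) (aug_chow_class (localization M F) (\<Prod>G\<in>#K'. var (XVar G)))) =
      aug_chow_class M (var (XVar F) * (\<Prod>G\<in>#K. var (XVar G)) * (\<Prod>G\<in>#K'. var (XVar G)))))"
    unfolding aug_chow_psi_def Let_def cond ..
  have J: "aug_chow_J (localization M F) = lin_span (aug_chow (localization M F)) {aug_map (localization M F) (hvar (localization M F) F ^ k) | k. k < mult_bound F}"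
    using L.aug_chow_J_eq unfolding localization_ground local_top_degree .
  show ?thesis
    unfolding Some aug_chow_summand.simps J
    by (rule pushforward_image) (use pf in \<open>simp_all only: psi\<close>)
qed

lemma aug_chow_decomposition:
  "module_decomposition (aug_chow_H M) (aug_chow M) (insert None (Some ` flats_C M)) (aug_chow_summand M)"
  "i \<in> insert None (Some ` flats_C M) \<Longrightarrow> j \<in> insert None (Some ` flats_C M) \<Longrightarrow> i \<noteq> j \<Longrightarrow>
    aug_chow_orthogonal M (aug_chow_summand M i) (aug_chow_summand M j)"
proof -
  show "module_decomposition (aug_chow_H M) (aug_chow M) (insert None (Some ` flats_C M)) (aug_chow_summand M)"
    unfolding idx_eq aug_chow_H_eq
  proof (rule module_decomposition_cong[OF decomposition])
    show "aug_map M ` summand_polys i = aug_chow_summand M i" if "i \<in> idx" for i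
      by (rule aug_chow_summand_eq[OF that, symmetric])
  qed
  assume ij: "i \<in> insert None (Some ` flats_C M)" "j \<in> insert None (Some ` flats_C M)" "i \<noteq> j"
  then have ij': "i \<in> idx" "j \<in> idx" unfolding idx_eq by simp_all
  show "aug_chow_orthogonal M (aug_chow_summand M i) (aug_chow_summand M j)"
    unfolding aug_chow_orthogonal_def aug_chow_summand_eq[OF ij'(1)] aug_chow_summand_eq[OF ij'(2)] aug_chow_degree_part_eq rank_top
  proof (intro allI impI ballI)
    fix k \<eta> \<xi>
    assume k: "k \<le> top_degree" and m: "\<eta> \<in> aug_map M ` summand_polys i \<inter> degree_part k"
      "\<xi> \<in> aug_map M ` summand_polys j \<inter> degree_part (top_degree - k)"
    show "aug_chow_deg M (\<eta> \<otimes>\<^bsub>aug_chow M\<^esub> \<xi>) = 0"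
      by (rule orthogonal[OF ij' ij(3) m _ aug_chow_deg_eq]) (use k in simp_all)
  qed
qed

end

theorem theorem1p4:
  fixes M :: "'a matroid"
  assumes "is_matroid M" and "loopless M"
  shows "(ground M \<noteq> {} \<longrightarrow>
            module_decomposition (chow_H M) (chow M) (insert None (Some ` flats_uC M)) (chow_summand M) \<and>
            (\<forall>i\<in>insert None (Some ` flats_uC M). \<forall>j\<in>insert None (Some ` flats_uC M).
               i \<noteq> j \<longrightarrow> chow_orthogonal M (chow_summand M i) (chow_summand M j))) \<and>
         (module_decomposition (aug_chow_H M) (aug_chow M) (insert None (Some ` flats_C M)) (aug_chow_summand M) \<and>
            (\<forall>i\<in>insert None (Some ` flats_C M). \<forall>j\<in>insert None (Some ` flats_C M).
               i \<noteq> j \<longrightarrow> aug_chow_orthogonal M (aug_chow_summand M i) (aug_chow_summand M j)))"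
proof (intro conjI impI ballI)
  have M: "loopless_matroid M" using assms by unfold_locales
  interpret A: augmented_matroid M using M by (simp add: augmented_matroid_def)
  show "module_decomposition (aug_chow_H M) (aug_chow M) (insert None (Some ` flats_C M)) (aug_chow_summand M)"
    by (rule A.aug_chow_decomposition)
  show "aug_chow_orthogonal M (aug_chow_summand M i) (aug_chow_summand M j)"
    if "i \<in> insert None (Some ` flats_C M)" "j \<in> insert None (Some ` flats_C M)" "i \<noteq> j" for i j
    by (rule A.aug_chow_decomposition(2)[OF that])
  assume ne: "ground M \<noteq> {}"
  have C: "nonempty_loopless_matroid M"
    using M ne by (simp add: nonempty_loopless_matroid_def nonempty_loopless_matroid_axioms_def)
  show "module_decomposition (chow_H M) (chow M) (insert None (Some ` flats_uC M)) (chow_summand M)"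
    by (rule nonempty_loopless_matroid.chow_decomposition(1)[OF C])
  show "chow_orthogonal M (chow_summand M i) (chow_summand M j)"
    if "i \<in> insert None (Some ` flats_uC M)" "j \<in> insert None (Some ` flats_uC M)" "i \<noteq> j" for i j
    by (rule nonempty_loopless_matroid.chow_decomposition(2)[OF C that])
qed

end
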